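(* Let $\mathcal X=[0,1]^d$ and $M>0$. Let $(\mathcal Q,\mathcal G_n(\cdot))$ be either $\big(\mathcal P^2_{\chi^2}(M,\mathcal X),\mathcal G_n^{\mathsf R}(\cdot)\big)$ or $\big(\mathcal P^2_{\chi^2,\mathsf B}(M,\mathcal X),\mathcal G_n^{\mathsf S}(\cdot)\big)$. Then the estimator $\hat\chi^2_{\mathcal G_n(M)}(X^n,Y^n)$ is minimax rate-optimal over $\mathcal Q$, with risk of order $n^{-1/2}$: there are constants $0<c\le C<\infty$ depending only on $M,d$ such that $$\sup_{(\mu,\nu)\in\mathcal Q}\mathbb E\Big[\big|\hat\chi^2_{\mathcal G_n(M)}(X^n,Y^n)-\chi^2(\mu\|\nu)\big|\Big]\le C\,n^{-1/2}\quad\text{for all }n,$$ while for all sufficiently large $n$ $$\inf_{\hat{\mathsf D}}\ \sup_{(\mu,\nu)\in\mathcal Q}\mathbb E\Big[\big|\hat{\mathsf D}(X^n,Y^n)-\chi^2(\mu\|\nu)\big|\Big]\ge c\,n^{-1/2},$$ the infimum being over all estimators (measurable functions of $(X^n,Y^n)$). Moreover, the estimator $\hat\chi^2_{\mathcal G_n(\log n)}(X^n,Y^n)$, which does not use $M$, satisfies $$\sup_{(\mu,\nu)\in\mathcal Q}\mathbb E\big[|\hat\chi^2_{\mathcal G_n(\log n)}(X^n,Y^n)-\chi^2(\mu\|\nu)|\big]=\tilde O(n^{-1/2})$$ as $n\to\infty$, where $\tilde O$ hides factors polynomial in $\log n$.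
   Context: $\chi^2(\mu\|\nu)=\mathbb E_\nu[(\frac{d\mu}{d\nu}-1)^2]$ if $\mu\ll\nu$ and $\infty$ otherwise. $\mathcal P^2_{\chi^2}(\mathcal X)$ is the set of pairs of Borel probability measures on $\mathcal X$ with $\mu\ll\nu$ and $\chi^2(\mu\|\nu)<\infty$; $f_{\chi^2}=2(\frac{d\mu}{d\nu}-1)$ (pointwise conditions refer to a suitable version). $\mathcal P^2_{\chi^2}(M,\mathcal X)=\{(\mu,\nu)\in\mathcal P^2_{\chi^2}(\mathcal X):c^\star_{\mathsf{KB}}(f_{\chi^2},\mathcal X)\vee\chi^2(\mu\|\nu)\le M\}$ and $\mathcal P^2_{\chi^2,\mathsf B}(M,\mathcal X)=\{(\mu,\nu)\in\mathcal P^2_{\chi^2}(\mathcal X):c^\star_{\mathsf{B}}(f_{\chi^2},\mathcal X)\vee\chi^2(\mu\|\nu)\le M\}$. Coefficients: $\|\mathcal X\|:=\sup_{x\in\mathcal X}\|x\|_\infty$. For $\tilde f:\mathbb R^d\to\mathbb R$ with a Fourier representation $\tilde f(x)=\int_{\mathbb R^d}e^{i\omega\cdot x}F(d\omega)$, $F$ a complex Borel measure with magnitude $|F|$, let $S_m(\tilde f)=\int_{\mathbb R^d}\|\omega\|_1^m|F|(d\omega)$. For $f:\mathcal X\to\mathbb R$: $c^\star_{\mathsf{KB}}(f,\mathcal X)$ is the infimum of $c\ge0$ such that some such $\tilde f$ satisfies $\tilde f|_{\mathcal X}=f$, $\|\mathcal X\|S_2(\tilde f)\le c$, $|\tilde f(0)|\le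 c$, $\|\nabla\tilde f(0)\|_1\le c$; $c^\star_{\mathsf B}(f,\mathcal X)$ is the infimum of $c\ge 0$ such that some such $\tilde f$ satisfies $\tilde f|_{\mathcal X}=f$, $\|\mathcal X\|S_1(\tilde f)\le c$, $|\tilde f(0)|\le c$. Neural networks: $\mathcal G_k(a_1,a_2,a_3,a_4,\phi)$ is the set of $g(x)=\sum_{i=1}^k\beta_i\phi(w_i\cdot x+b_i)+w_0\cdot x+b_0$ on $\mathbb R^d$ with $\|w_i\|_1\vee|b_i|\le a_1$, $|\beta_i|\le a_2$ ($1\le i\le k$), $|b_0|\le a_3$, $\|w_0\|_1\le a_4$. $\phi_{\mathsf S}(z)=(1+e^{-z})^{-1}$, $\phi_{\mathsf R}(z)=\max\{z,0\}$, $\mathcal G_k^{\mathsf R}(a)=\mathcal G_k(1,2k^{-1}a,a,a,\phi_{\mathsf R})$, $\mathcal G_k^{\mathsf S}(a)=\mathcal G_k(k^{1/2}\log k,2k^{-1}a,a,0,\phi_{\mathsf S})$. Estimator: $\hat\chi^2_{\mathcal G}(X^n,Y^n)=\sup_{g\in\mathcal G}\frac1n\sum_{i=1}^n\big[g(X_i)-g(Y_i)-\tfrac14g(Y_i)^2\big]$, where $X^n$ is i.i.d. from $\mu$ and $Y^n$ i.i.d. from $\nu$ (independent samples). *)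

theory Defs
  imports "HOL-Probability.Probability"
begin

definition borel_prob_measures :: "'a::topological_space set \<Rightarrow> 'a measure set" where
  "borel_prob_measures X = {\<mu>. sets \<mu> = sets (restrict_space borel X) \<and> prob_space \<mu>}"

(* absolutely_continuous \<nu> \<mu> says that \<mu> is absolutely continuous with respect to \<nu>,
   and RN_deriv \<nu> \<mu> is the density of \<mu> with respect to \<nu>. *)
definition chi2_div :: "'a measure \<Rightarrow> 'a measure \<Rightarrow> ennreal" where
  "chi2_div \<mu> \<nu> =
     (if absolutely_continuous \<nu> \<mu>
      then \<integral>\<^sup>+x. ennreal ((enn2real (RN_deriv \<nu> \<mu> x) - 1)\<^sup>2) \<partial>\<nu>
      else \<infinity>)"

definition chi2_pairs :: "'a::topological_space set \<Rightarrow> ('a measure \<times> 'a measure) set" where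
  "chi2_pairs X =
     {(\<mu>, \<nu>). \<mu> \<in> borel_prob_measures X \<and> \<nu> \<in> borel_prob_measures X \<and>
        absolutely_continuous \<nu> \<mu> \<and> chi2_div \<mu> \<nu> < \<infinity>}"

text \<open>All real-valued versions of the function \<open>2 (d\<mu>/d\<nu> - 1)\<close>, which is determined only
  \<open>\<nu>\<close>-almost everywhere.\<close>

definition chi2_potentials :: "'a measure \<Rightarrow> 'a measure \<Rightarrow> ('a \<Rightarrow> real) set" where
  "chi2_potentials \<mu> \<nu> =
     {f \<in> borel_measurable \<nu>. AE x in \<nu>. f x = 2 * (enn2real (RN_deriv \<nu> \<mu> x) - 1)}"

definition complex_borel_measure :: "('a::topological_space set \<Rightarrow> complex) \<Rightarrow> bool" where
  "complex_borel_measure F \<longleftrightarrow>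
     (\<forall>A::nat \<Rightarrow> 'a set. range A \<subseteq> sets borel \<longrightarrow> disjoint_family A \<longrightarrow>
        (\<lambda>i. F (A i)) sums F (\<Union>i. A i))"

text \<open>The total variation measure \<open>|F|\<close>: the supremum over countable Borel partitions.\<close>

definition total_variation :: "('a::topological_space set \<Rightarrow> complex) \<Rightarrow> 'a measure" where
  "total_variation F =
     measure_of UNIV (sets borel)
       (\<lambda>A. \<Squnion>P \<in> {P :: nat \<Rightarrow> 'a set. range P \<subseteq> sets borel \<and> disjoint_family P \<and> (\<Union>i. P i) = A}.
          \<Sum>i. ennreal (cmod (F (P i))))"

text \<open>Integration against a complex measure is defined through its polar decomposition
  \<open>dF = h d|F|\<close> with \<open>|h| = 1\<close>: the integral of \<open>g\<close> is that of \<open>g h\<close> against \<open>|F|\<close>.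
  Every complex Borel measure has such an \<open>h\<close>, unique up to \<open>|F|\<close>-null sets.\<close>

definition polar_density :: "('a::topological_space set \<Rightarrow> complex) \<Rightarrow> ('a \<Rightarrow> complex) \<Rightarrow> bool" where
  "polar_density F h \<longleftrightarrow>
     integrable (total_variation F) h \<and> (\<forall>\<omega>. cmod (h \<omega>) = 1) \<and>
     (\<forall>A \<in> sets borel. F A = (LINT \<omega>:A|total_variation F. h \<omega>))"

definition fourier_representation ::
    "('a::real_inner \<Rightarrow> real) \<Rightarrow> ('a set \<Rightarrow> complex) \<Rightarrow> bool" where
  "fourier_representation f F \<longleftrightarrow>
     complex_borel_measure F \<and>
     (\<exists>h. polar_density F h \<and>
        (\<forall>x. complex_of_real (f x) =
           (LINT \<omega>|total_variation F. exp (\<i> * complex_of_real (\<omega> \<bullet> x)) * h \<omega>)))"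

definition l1norm :: "real^'d \<Rightarrow> real" where
  "l1norm x = (\<Sum>i\<in>UNIV. \<bar>x $ i\<bar>)"

definition sup_radius :: "(real^'d) set \<Rightarrow> ennreal" where
  "sup_radius X = (\<Squnion>x\<in>X. ennreal (infnorm x))"

definition spectral_moment :: "nat \<Rightarrow> ((real^'d) set \<Rightarrow> complex) \<Rightarrow> ennreal" where
  "spectral_moment m F = (\<integral>\<^sup>+\<omega>. ennreal (l1norm \<omega> ^ m) \<partial>total_variation F)"

definition KB_coeff :: "(real^'d \<Rightarrow> real) \<Rightarrow> (real^'d) set \<Rightarrow> ennreal" where
  "KB_coeff f X =
     Inf {ennreal c |c. 0 \<le> c \<and>
       (\<exists>f' F D. fourier_representation f' F \<and> (\<forall>x\<in>X. f' x = f x) \<and>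
          sup_radius X * spectral_moment 2 F \<le> ennreal c \<and>
          \<bar>f' 0\<bar> \<le> c \<and>
          GDERIV f' 0 :> D \<and> l1norm D \<le> c)}"

definition B_coeff :: "(real^'d \<Rightarrow> real) \<Rightarrow> (real^'d) set \<Rightarrow> ennreal" where
  "B_coeff f X =
     Inf {ennreal c |c. 0 \<le> c \<and>
       (\<exists>f' F. fourier_representation f' F \<and> (\<forall>x\<in>X. f' x = f x) \<and>
          sup_radius X * spectral_moment 1 F \<le> ennreal c \<and>
          \<bar>f' 0\<bar> \<le> c)}"

definition chi2_KB_class ::
    "real \<Rightarrow> (real^'d) set \<Rightarrow> ((real^'d) measure \<times> (real^'d) measure) set" where
  "chi2_KB_class M X =
     {(\<mu>, \<nu>) \<in> chi2_pairs X.
        \<exists>f \<in> chi2_potentials \<mu> \<nu>. max (KB_coeff f X) (chi2_div \<mu> \<nu>) \<le> ennreal M}"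

definition chi2_B_class ::
    "real \<Rightarrow> (real^'d) set \<Rightarrow> ((real^'d) measure \<times> (real^'d) measure) set" where
  "chi2_B_class M X =
     {(\<mu>, \<nu>) \<in> chi2_pairs X.
        \<exists>f \<in> chi2_potentials \<mu> \<nu>. max (B_coeff f X) (chi2_div \<mu> \<nu>) \<le> ennreal M}"

definition nn_class ::
    "nat \<Rightarrow> real \<Rightarrow> real \<Rightarrow> real \<Rightarrow> real \<Rightarrow> (real \<Rightarrow> real) \<Rightarrow> (real^'d \<Rightarrow> real) set" where
  "nn_class k a1 a2 a3 a4 \<phi> =
     {g. \<exists>(\<beta> :: nat \<Rightarrow> real) (w :: nat \<Rightarrow> real^'d) (b :: nat \<Rightarrow> real) w0 b0.
        (\<forall>i\<in>{1..k}. max (l1norm (w i)) \<bar>b i\<bar> \<le> a1 \<and> \<bar>\<beta> i\<bar> \<le> a2) \<and>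
        \<bar>b0\<bar> \<le> a3 \<and> l1norm w0 \<le> a4 \<and>
        g = (\<lambda>x. (\<Sum>i=1..k. \<beta> i * \<phi> (w i \<bullet> x + b i)) + w0 \<bullet> x + b0)}"

definition sigmoid :: "real \<Rightarrow> real" where
  "sigmoid z = inverse (1 + exp (- z))"

definition relu :: "real \<Rightarrow> real" where
  "relu z = max z 0"

definition relu_nets :: "nat \<Rightarrow> real \<Rightarrow> (real^'d \<Rightarrow> real) set" where
  "relu_nets k a = nn_class k 1 (2 / real k * a) a a relu"

definition sigmoid_nets :: "nat \<Rightarrow> real \<Rightarrow> (real^'d \<Rightarrow> real) set" where
  "sigmoid_nets k a = nn_class k (sqrt (real k) * ln (real k)) (2 / real k * a) a 0 sigmoid"

text \<open>A pair of samples of size \<open>n\<close> is a pair of functions on the index set \<open>{..<n}\<close>.\<close>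

definition estimators ::
    "nat \<Rightarrow> 'a::topological_space set \<Rightarrow> ((nat \<Rightarrow> 'a) \<times> (nat \<Rightarrow> 'a) \<Rightarrow> real) set" where
  "estimators n X =
     borel_measurable
       ((\<Pi>\<^sub>M i\<in>{..<n}. restrict_space borel X) \<Otimes>\<^sub>M (\<Pi>\<^sub>M i\<in>{..<n}. restrict_space borel X))"

definition sample_law ::
    "nat \<Rightarrow> 'a measure \<Rightarrow> 'a measure \<Rightarrow> ((nat \<Rightarrow> 'a) \<times> (nat \<Rightarrow> 'a)) measure" where
  "sample_law n \<mu> \<nu> = (\<Pi>\<^sub>M i\<in>{..<n}. \<mu>) \<Otimes>\<^sub>M (\<Pi>\<^sub>M i\<in>{..<n}. \<nu>)"

text \<open>The supremum is one of real numbers; for network classes with bounded parameters the set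
  is nonempty and bounded above.\<close>

definition chi2_estimator ::
    "('a \<Rightarrow> real) set \<Rightarrow> nat \<Rightarrow> (nat \<Rightarrow> 'a) \<times> (nat \<Rightarrow> 'a) \<Rightarrow> real" where
  "chi2_estimator G n =
     (\<lambda>(x, y). \<Squnion>g\<in>G. 1 / real n * (\<Sum>i<n. g (x i) - g (y i) - 1 / 4 * (g (y i))\<^sup>2))"

definition chi2_risk ::
    "nat \<Rightarrow> ((nat \<Rightarrow> 'a) \<times> (nat \<Rightarrow> 'a) \<Rightarrow> real) \<Rightarrow> 'a measure \<times> 'a measure \<Rightarrow> ennreal" where
  "chi2_risk n D =
     (\<lambda>(\<mu>, \<nu>). \<integral>\<^sup>+z. ennreal \<bar>D z - enn2real (chi2_div \<mu> \<nu>)\<bar> \<partial>sample_law n \<mu> \<nu>)"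

definition sup_risk ::
    "nat \<Rightarrow> ('a measure \<times> 'a measure) set \<Rightarrow> ((nat \<Rightarrow> 'a) \<times> (nat \<Rightarrow> 'a) \<Rightarrow> real) \<Rightarrow> ennreal" where
  "sup_risk n Q D = (\<Squnion>p\<in>Q. chi2_risk n D p)"

end

theory Submission
  imports Defs "HOL-Real_Asymp.Real_Asymp"
begin

text \<open>
  Put \<open>f = 2 (d\<mu>/d\<nu> - 1)\<close> and \<open>L g = E\<^sub>\<mu> g - E\<^sub>\<nu> g - E\<^sub>\<nu> g\<^sup>2 / 4\<close>. Completing the square gives
  \<open>L g = \<chi>\<^sup>2(\<mu>, \<nu>) - E\<^sub>\<nu> (f - g)\<^sup>2 / 4\<close> (\<open>chi2_variational\<close>). The estimator maximizes the empirical
  version of \<open>L\<close> over networks, so its error is at most the best squared approximation error of \<open>f\<close>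
  plus the largest deviation of the empirical objective from \<open>L\<close> (\<open>chi2_risk_le\<close>). Both
  contributions are at most of order \<open>1 / sqrt n\<close>, without a logarithm.

  Deviation. A network whose outer weights, linear part and bias have total size at most
  \<open>A\<close> is a combination, with coefficients of total size at most \<open>A\<close>, of
  monotone functions of affine forms. The superlevel sets of such a function are halfspaces, so by
  the layer-cake formula the deviation of the empirical mean of \<open>g\<close> or of
  \<open>g\<^sup>2\<close> is controlled by the deviation of the empirical measure on intersections
  of two halfspaces (\<open>mixture_product_deviation\<close>). The number of neurons does not
  enter. By Radon's theorem and the Sauer--Shelah lemma these intersections cut out only
  polynomially many subsets of a finite set of points (\<open>trace_growth_halfspace_Int\<close>);
  Dudley's argument turns this into packing numbers that do not depend on \<open>n\<close>
  (\<open>packing_bound\<close>), and chaining over the resulting nets together with symmetrization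
  bounds the expected deviation of \<open>n\<close> samples by a constant times \<open>sqrt
  n\<close> (\<open>rademacher_chaining\<close>, \<open>expected_sup_deviation_le\<close>).

  Approximation. A Fourier representation writes \<open>f\<close> on the cube as an average of plane waves.
  Taylor's formula along the direction of the frequency turns the second-order remainder of a wave
  into an integral of ReLU neurons with weight at most the square of the \<open>l\<^sub>1\<close>-norm of the frequency
  (\<open>relu_remainder\<close>); the first-order remainder is an integral of step functions with weight at most
  that norm (\<open>step_remainder\<close>), and steep sigmoids approximate the steps (\<open>sigmoid_step_error\<close>). So
  up to an affine function, respectively a constant and a small error, \<open>f\<close> lies in the closed convex
  hull of scaled neurons, and a greedy form of Maurey's argument finds \<open>n\<close> neurons with squared error
  of order \<open>1/n\<close> (\<open>maurey_greedy\<close>, \<open>relu_approximation\<close>, \<open>sigmoid_approximation\<close>). With sigmoids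
  of slope \<open>sqrt n ln n\<close> the steps cost a squared error of order \<open>1 / (sqrt n ln n)\<close>.

  Lower bound. Let \<open>\<nu>\<close> be uniform on two opposite corners of the cube and let \<open>\<mu>\<close> have density
  \<open>1 + 2 \<delta> cos (w \<bullet> x)\<close>, with \<open>w\<close> chosen so that the cosine is \<open>1\<close> and \<open>-1\<close> at the corners. The
  potential is \<open>4 \<delta> cos (w \<bullet> x)\<close>, whose spectrum consists of \<open>w\<close> and \<open>-w\<close>, and the divergence is
  \<open>4 \<delta>\<^sup>2\<close>. Changing a fixed \<open>\<delta>\<close> by a relative amount \<open>1 / sqrt n\<close> moves the divergence by order
  \<open>1 / sqrt n\<close> while \<open>n\<close> samples cannot tell the two laws apart, so Le Cam's two-point method applies
  (\<open>le_cam_likelihood\<close>, \<open>minimax_lower_bound\<close>).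
\<close>

section \<open>Traces of set families on finite sets\<close>

definition shattered :: "'i set set \<Rightarrow> 'i set \<Rightarrow> bool" where
  "shattered F A \<longleftrightarrow> (\<lambda>S. S \<inter> A) ` F = Pow A"

lemma shatteredI:
  assumes "\<And>B. B \<subseteq> A \<Longrightarrow> \<exists>S\<in>F. S \<inter> A = B"
  shows "shattered F A"
  unfolding shattered_def
proof (intro equalityI subsetI)
  fix B assume "B \<in> Pow A"
  then obtain S where "S \<in> F" "S \<inter> A = B" using assms by blast
  then show "B \<in> (\<lambda>S. S \<inter> A) ` F" by blast
qed blast

lemma shatteredD:
  assumes "shattered F A" "B \<subseteq> A"
  obtains S where "S \<in> F" "S \<inter> A = B"
  using assms unfolding shattered_def by (metis (no_types, lifting) PowI imageE)

text \<open>Pajor's form of the Sauer--Shelah lemma. Induction on the ground set: split \<open>F\<close> by membership of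
  \<open>x\<close> and delete \<open>x\<close>. A set shattered by one of the two halves is shattered by \<open>F\<close>; a set \<open>A\<close>
  shattered by both halves counts twice, and \<open>insert x A\<close> is then shattered by \<open>F\<close> as well.\<close>
lemma card_le_card_shattered:
  assumes "finite S" "F \<subseteq> Pow S"
  shows "card F \<le> card {A. A \<subseteq> S \<and> shattered F A}"
  using assms
proof (induction S arbitrary: F rule: finite_induct)
  case empty
  show ?case
  proof (cases "F = {}")
    case False
    then have "F = {{}}" using empty by auto
    then have "{A. A \<subseteq> {} \<and> shattered F A} = {{}}" by (auto simp: shattered_def)
    then show ?thesis using \<open>F = {{}}\<close> by simp
  qed simp
next
  case (insert x S)
  define F0 where "F0 = {A \<in> F. x \<notin> A}"
  define F1 where "F1 = (\<lambda>A. A - {x}) ` {A \<in> F. x \<in> A}"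
  let ?sh = "\<lambda>G. {A. A \<subseteq> S \<and> shattered G A}"
  let ?R = "{A. A \<subseteq> insert x S \<and> shattered F A}"
  have fF: "finite F" using insert by (meson finite_Pow_iff finite_insert finite_subset)
  have s0: "F0 \<subseteq> Pow S" and s1: "F1 \<subseteq> Pow S" using insert.prems by (auto simp: F0_def F1_def)
  have c1: "card F1 = card {A \<in> F. x \<in> A}"
    unfolding F1_def by (rule card_image) (auto simp: inj_on_def)
  have "card F = card F0 + card {A \<in> F. x \<in> A}"
    unfolding F0_def using fF
    by (subst card_Un_disjoint[symmetric]) (auto intro!: arg_cong[where f=card])
  then have cF: "card F = card F0 + card F1" using c1 by simp
  have fin: "finite (?sh G)" for G using insert.hyps(1) by simp
  have up0: "shattered F A" if A: "A \<subseteq> S" and sh: "shattered F0 A" for A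
  proof (rule shatteredI)
    fix B assume "B \<subseteq> A"
    then obtain T where "T \<in> F0" "T \<inter> A = B" by (rule shatteredD[OF sh])
    then show "\<exists>S\<in>F. S \<inter> A = B" by (auto simp: F0_def)
  qed
  have up1: "\<exists>S\<in>F. x \<in> S \<and> S \<inter> A = B" if A: "A \<subseteq> S" and sh: "shattered F1 A" and B: "B \<subseteq> A" for A B
  proof -
    obtain T where T: "T \<in> F1" "T \<inter> A = B" by (rule shatteredD[OF sh B])
    then obtain U where "U \<in> F" "x \<in> U" "T = U - {x}" by (auto simp: F1_def)
    moreover have "x \<notin> A" using A insert.hyps by auto
    ultimately show ?thesis using T by (intro bexI[of _ U]) auto
  qed
  have both: "shattered F (insert x A)" if A: "A \<subseteq> S" and a0: "shattered F0 A" and a1: "shattered F1 A" for A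
  proof (rule shatteredI)
    fix B assume B: "B \<subseteq> insert x A"
    have xA: "x \<notin> A" using A insert.hyps by auto
    show "\<exists>S\<in>F. S \<inter> insert x A = B"
    proof (cases "x \<in> B")
      case True
      obtain U where "U \<in> F" "x \<in> U" "U \<inter> A = B - {x}"
        using up1[OF A a1, of "B - {x}"] B by blast
      then show ?thesis using True xA by (intro bexI[of _ U]) auto
    next
      case False
      then have "B \<subseteq> A" using B by auto
      then obtain T where "T \<in> F0" "T \<inter> A = B" by (rule shatteredD[OF a0])
      then show ?thesis using False by (intro bexI[of _ T]) (auto simp: F0_def)
    qed
  qed
  have "card F \<le> card (?sh F0) + card (?sh F1)"
    using insert.IH[OF s0] insert.IH[OF s1] cF by simp
  also have "\<dots> = card (?sh F0 \<union> ?sh F1) + card (?sh F0 \<inter> ?sh F1)"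
    by (rule card_Un_Int) (rule fin)+
  also have "card (?sh F0 \<inter> ?sh F1) = card (insert x ` (?sh F0 \<inter> ?sh F1))"
    using insert.hyps(2) by (intro card_image[symmetric]) (auto simp: inj_on_def)
  also have "card (?sh F0 \<union> ?sh F1) + card (insert x ` (?sh F0 \<inter> ?sh F1))
      = card ((?sh F0 \<union> ?sh F1) \<union> insert x ` (?sh F0 \<inter> ?sh F1))"
    using fin insert.hyps(2) by (intro card_Un_disjoint[symmetric]) auto
  also have "\<dots> \<le> card ?R"
  proof (rule card_mono)
    show "finite ?R" using insert.hyps(1) by simp
    have "shattered F A" if "A \<subseteq> S" "shattered F1 A" for A
      using up1[OF that] by (intro shatteredI) blast
    then show "?sh F0 \<union> ?sh F1 \<union> insert x ` (?sh F0 \<inter> ?sh F1) \<subseteq> ?R"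
      using up0 both by auto
  qed
  finally show ?case .
qed

lemma card_small_subsets_le:
  assumes "finite S"
  shows "card {A. A \<subseteq> S \<and> card A \<le> V} \<le> (card S + 1) ^ V"
proof -
  let ?B = "insert None (Some ` S)"
  let ?L = "{xs. set xs \<subseteq> ?B \<and> length xs = V}"
  have "{A. A \<subseteq> S \<and> card A \<le> V} \<subseteq> (\<lambda>xs. {a. Some a \<in> set xs}) ` ?L"
  proof safe
    fix A assume A: "A \<subseteq> S" "card A \<le> V"
    then have "finite A" using assms finite_subset by blast
    then obtain l where l: "set l = A" "distinct l" using finite_distinct_list by blast
    then have ll: "length l \<le> V" using A distinct_card by metis
    \<comment> \<open>a set of size at most \<open>V\<close> becomes a list of length exactly \<open>V\<close>, padded with \<open>None\<close>\<close>
    show "A \<in> (\<lambda>xs. {a. Some a \<in> set xs}) ` ?L"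
      by (rule image_eqI[of _ _ "map Some l @ replicate (V - length l) None"]) (use l ll A in auto)
  qed
  then have "card {A. A \<subseteq> S \<and> card A \<le> V} \<le> card ?L"
    by (rule surj_card_le[rotated]) (use assms in \<open>auto intro: finite_lists_length_eq\<close>)
  also have "\<dots> = card ?B ^ V" by (rule card_lists_length_eq) (use assms in auto)
  also have "card ?B = card S + 1" using assms by (simp add: card_insert_if card_image)
  finally show ?thesis by simp
qed

text \<open>Polynomial growth of the number of traces on finite sets. This is the form in which finiteness of
  the Vapnik--Chervonenkis dimension is used; unlike the dimension it passes to pairwise
  intersections with an explicit constant.\<close>
definition trace_growth :: "nat \<Rightarrow> 'i set set \<Rightarrow> bool" where
  "trace_growth V F \<longleftrightarrow> (\<forall>A. finite A \<longrightarrow> card ((\<lambda>S. S \<inter> A) ` F) \<le> (card A + 1) ^ V)"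

lemma trace_growth_of_not_shattered:
  assumes "\<And>A. finite A \<Longrightarrow> shattered F A \<Longrightarrow> card A \<le> V"
  shows "trace_growth V F"
  unfolding trace_growth_def
proof (intro allI impI)
  fix A :: "'a set" assume fA: "finite A"
  let ?G = "(\<lambda>S. S \<inter> A) ` F"
  have "card ?G \<le> card {B. B \<subseteq> A \<and> shattered ?G B}"
    by (rule card_le_card_shattered) (use fA in auto)
  also have "\<dots> \<le> card {B. B \<subseteq> A \<and> card B \<le> V}"
  proof (rule card_mono)
    show "finite {B. B \<subseteq> A \<and> card B \<le> V}" using fA by simp
    show "{B. B \<subseteq> A \<and> shattered ?G B} \<subseteq> {B. B \<subseteq> A \<and> card B \<le> V}"
    proof safe
      fix B assume B: "B \<subseteq> A" "shattered ?G B"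
      have "shattered F B"
      proof (rule shatteredI)
        fix C assume "C \<subseteq> B"
        then obtain S where "S \<in> ?G" "S \<inter> B = C" by (rule shatteredD[OF B(2)])
        then show "\<exists>S\<in>F. S \<inter> B = C" using B(1) by auto
      qed
      then show "card B \<le> V" using assms B fA finite_subset by blast
    qed
  qed
  also have "\<dots> \<le> (card A + 1) ^ V" by (rule card_small_subsets_le[OF fA])
  finally show "card ?G \<le> (card A + 1) ^ V" .
qed

lemma trace_growth_mono:
  assumes "trace_growth V F" "G \<subseteq> F"
  shows "trace_growth V G"
  unfolding trace_growth_def
proof (intro allI impI)
  fix A :: "'a set" assume fA: "finite A"
  have "card ((\<lambda>S. S \<inter> A) ` G) \<le> card ((\<lambda>S. S \<inter> A) ` F)"
    using assms(2) fA by (intro card_mono) (auto intro!: finite_subset[of _ "Pow A"])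
  then show "card ((\<lambda>S. S \<inter> A) ` G) \<le> (card A + 1) ^ V"
    using assms(1) fA unfolding trace_growth_def using le_trans by blast
qed

lemma trace_growth_restrict:
  assumes "trace_growth V F"
  shows "trace_growth V ((\<lambda>S. S \<inter> B) ` F)"
  unfolding trace_growth_def
proof (intro allI impI)
  fix A :: "'a set" assume fA: "finite A"
  have "(\<lambda>S. S \<inter> A) ` (\<lambda>S. S \<inter> B) ` F = (\<lambda>S. S \<inter> (A \<inter> B)) ` F"
    unfolding image_image by (intro image_cong) auto
  then have "card ((\<lambda>S. S \<inter> A) ` (\<lambda>S. S \<inter> B) ` F) \<le> (card (A \<inter> B) + 1) ^ V"
    using assms fA unfolding trace_growth_def by simp
  also have "\<dots> \<le> (card A + 1) ^ V" using fA by (intro power_mono add_mono card_mono) auto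
  finally show "card ((\<lambda>S. S \<inter> A) ` (\<lambda>S. S \<inter> B) ` F) \<le> (card A + 1) ^ V" .
qed

lemma trace_growth_Int:
  assumes "trace_growth V F" "trace_growth V G"
  shows "trace_growth (2 * V) {S \<inter> T |S T. S \<in> F \<and> T \<in> G}"
  unfolding trace_growth_def
proof (intro allI impI)
  fix A :: "'a set" assume fA: "finite A"
  let ?f = "(\<lambda>S. S \<inter> A) ` F" and ?g = "(\<lambda>S. S \<inter> A) ` G"
  have fin: "finite ?f" "finite ?g" using fA by (auto intro!: finite_subset[of _ "Pow A"])
  have "(\<lambda>S. S \<inter> A) ` {S \<inter> T |S T. S \<in> F \<and> T \<in> G} \<subseteq> (\<lambda>(S,T). S \<inter> T) ` (?f \<times> ?g)"
  proof safe
    fix S T assume "S \<in> F" "T \<in> G"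
    then show "S \<inter> T \<inter> A \<in> (\<lambda>(S,T). S \<inter> T) ` (?f \<times> ?g)"
      by (intro image_eqI[of _ _ "(S \<inter> A, T \<inter> A)"]) auto
  qed
  then have "card ((\<lambda>S. S \<inter> A) ` {S \<inter> T |S T. S \<in> F \<and> T \<in> G}) \<le> card (?f \<times> ?g)"
    by (rule surj_card_le[rotated]) (use fin in auto)
  also have "\<dots> = card ?f * card ?g" by (simp add: card_cartesian_product)
  also have "\<dots> \<le> (card A + 1) ^ V * (card A + 1) ^ V"
    using assms fA unfolding trace_growth_def by (intro mult_mono) auto
  also have "\<dots> = (card A + 1) ^ (2 * V)" by (simp add: power_add mult_2)
  finally show "card ((\<lambda>S. S \<inter> A) ` {S \<inter> T |S T. S \<in> F \<and> T \<in> G}) \<le> (card A + 1) ^ (2 * V)" .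
qed

text \<open>Dudley's probabilistic argument, by counting: if \<open>m\<close> points of \<open>S\<close> are drawn at random, two sets
  whose symmetric difference fills more than a fraction \<open>\<delta>\<close> of \<open>S\<close> fail to be separated with
  probability at most \<open>(1 - \<delta>) ^ m\<close>, so by the union bound some draw separates all pairs of
  members of \<open>P\<close>.\<close>
lemma separating_subsample_exists:
  fixes \<delta> :: real
  assumes S: "finite S" "S \<noteq> {}" and P: "finite P" and d: "0 < \<delta>" "\<delta> \<le> 1"
    and sep: "\<And>A B. A \<in> P \<Longrightarrow> B \<in> P \<Longrightarrow> A \<noteq> B \<Longrightarrow> \<delta> * card S < card (sym_diff A B \<inter> S)"
    and m: "real (card P) ^ 2 * (1 - \<delta>) ^ m < 1"
  shows "\<exists>A. finite A \<and> card A \<le> m \<and> inj_on (\<lambda>B. B \<inter> A) P"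
proof -
  let ?n = "real (card S)"
  let ?E = "\<lambda>T. PiE {..<m} (\<lambda>_. T)"
  let ?pairs = "{(A,B). A \<in> P \<and> B \<in> P \<and> A \<noteq> B}"
  let ?bad = "\<Union>(A,B)\<in>?pairs. ?E (S - sym_diff A B)"
  have npos: "?n > 0" using S by (simp add: card_gt_0_iff)
  have fp: "finite ?pairs" by (rule finite_subset[of _ "P \<times> P"]) (use P in auto)
  have cp: "card ?pairs \<le> card P ^ 2"
    using card_mono[of "P \<times> P" ?pairs] P by (auto simp: card_cartesian_product power2_eq_square)
  have one: "real (card (?E (S - sym_diff A B))) \<le> ((1 - \<delta>) * ?n) ^ m" if "(A, B) \<in> ?pairs" for A B
  proof -
    have "card (S - sym_diff A B) = card S - card (sym_diff A B \<inter> S)"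
      using S(1) by (metis Int_commute card_Diff_subset_Int finite_Int)
    moreover have "card (sym_diff A B \<inter> S) \<le> card S" using S by (intro card_mono) auto
    ultimately have "real (card (S - sym_diff A B)) = ?n - real (card (sym_diff A B \<inter> S))" by linarith
    also have "\<dots> \<le> (1 - \<delta>) * ?n" using sep[of A B] that by (auto simp: algebra_simps)
    finally show ?thesis using power_mono[of _ "(1 - \<delta>) * ?n" m] by (simp add: card_PiE)
  qed
  have "real (card ?bad) \<le> (\<Sum>(A,B)\<in>?pairs. real (card (?E (S - sym_diff A B))))"
  proof -
    have "card ?bad \<le> (\<Sum>p\<in>?pairs. card (case p of (A,B) \<Rightarrow> ?E (S - sym_diff A B)))"
      by (rule card_UN_le[OF fp])
    then have "real (card ?bad) \<le> real (\<Sum>p\<in>?pairs. card (case p of (A,B) \<Rightarrow> ?E (S - sym_diff A B)))"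
      by linarith
    then show ?thesis by (simp add: case_prod_unfold)
  qed
  also have "\<dots> \<le> (\<Sum>(A,B)\<in>?pairs. ((1 - \<delta>) * ?n) ^ m)" using one by (intro sum_mono) auto
  also have "\<dots> = real (card ?pairs) * ((1 - \<delta>) * ?n) ^ m" by (simp add: case_prod_unfold)
  also have "\<dots> \<le> real (card P ^ 2) * ((1 - \<delta>) * ?n) ^ m"
    using cp d npos by (intro mult_right_mono zero_le_power) (simp_all del: of_nat_power)
  also have "\<dots> = (real (card P) ^ 2 * (1 - \<delta>) ^ m) * ?n ^ m" by (simp add: power_mult_distrib)
  also have "\<dots> < 1 * ?n ^ m" using m npos by (intro mult_strict_right_mono) auto
  also have "\<dots> = real (card (?E S))" by (simp add: card_PiE)
  finally have lt: "card ?bad < card (?E S)" by simp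
  have "\<not> ?E S \<subseteq> ?bad"
  proof
    assume "?E S \<subseteq> ?bad"
    moreover have "finite ?bad" using fp S by (auto intro!: finite_PiE)
    ultimately have "card (?E S) \<le> card ?bad" by (rule card_mono[rotated])
    then show False using lt by simp
  qed
  then obtain \<sigma> where \<sigma>: "\<sigma> \<in> ?E S" "\<sigma> \<notin> ?bad" by blast
  let ?A = "\<sigma> ` {..<m}"
  have "inj_on (\<lambda>B. B \<inter> ?A) P"
  proof (rule inj_onI, rule ccontr)
    fix B C assume BC: "B \<in> P" "C \<in> P" "B \<inter> ?A = C \<inter> ?A" "B \<noteq> C"
    then have "(B, C) \<in> ?pairs" by simp
    then have "\<sigma> \<notin> ?E (S - sym_diff B C)" using \<sigma>(2) UN_I[of "(B, C)" ?pairs \<sigma>] by auto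
    then have "\<exists>k<m. \<sigma> k \<in> sym_diff B C" using \<sigma>(1) by (auto simp: PiE_iff)
    then obtain k where "k < m" "\<sigma> k \<in> sym_diff B C" by blast
    moreover have "\<sigma> k \<in> B \<longleftrightarrow> \<sigma> k \<in> C" using BC(3) \<open>k < m\<close> by (metis IntD1 IntI image_eqI lessThan_iff)
    ultimately show False by blast
  qed
  moreover have "card ?A \<le> m" using card_image_le[of "{..<m}" \<sigma>] by simp
  ultimately show ?thesis by blast
qed

text \<open>A separating sample of size about \<open>2 ln (card P) / \<delta>\<close> exists, and \<open>P\<close> has at most polynomially
  many traces on it. So \<open>card P\<close> is at most a power of its own logarithm, divided by \<open>\<delta>\<close>, which
  bounds it. The bound is independent of \<open>card S\<close>; this is what later removes the logarithm from
  the rate.\<close>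
lemma packing_bound:
  fixes \<delta> :: real
  assumes S: "finite S" "S \<noteq> {}" and P: "finite P" and d: "0 < \<delta>" "\<delta> \<le> 1"
    and sep: "\<And>A B. A \<in> P \<Longrightarrow> B \<in> P \<Longrightarrow> A \<noteq> B \<Longrightarrow> \<delta> * card S < card (sym_diff A B \<inter> S)"
    and gr: "trace_growth V P" and V: "V \<ge> 1"
  shows "real (card P) \<le> ((4 * real V + 3) / \<delta>) ^ (2 * V)"
proof (cases "card P \<le> 1")
  case True
  have "1 \<le> (4 * real V + 3) / \<delta>" using d by (subst le_divide_eq_1_pos) (simp, linarith)
  then have "1 \<le> ((4 * real V + 3) / \<delta>) ^ (2 * V)" by (rule one_le_power)
  moreover have "real (card P) \<le> 1" using True by simp
  ultimately show ?thesis by linarith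
next
  case False
  define N where "N = real (card P)"
  have N: "N \<ge> 2" using False by (simp add: N_def)
  define m where "m = nat \<lfloor>2 * ln N / \<delta>\<rfloor> + 1"
  have lnN: "ln N > 0" using N by simp
  have m1: "2 * ln N / \<delta> < real m" unfolding m_def using lnN d by simp linarith
  have m2: "real m \<le> 2 * ln N / \<delta> + 1" unfolding m_def using lnN d
    by (simp add: divide_nonneg_pos)
  have "(1 - \<delta>) ^ m \<le> exp (- \<delta>) ^ m"
    using d exp_ge_add_one_self[of "-\<delta>"] by (intro power_mono) auto
  also have "\<dots> = exp (- (\<delta> * m))" by (simp add: exp_of_nat_mult[symmetric] mult.commute)
  also have "\<dots> < exp (- (2 * ln N))" using m1 d by (simp add: field_simps)
  also have "exp (- (2 * ln N)) = 1 / N ^ 2"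
  proof -
    have "exp (2 * ln N) = exp (ln N) ^ 2" by (simp add: exp_double)
    then show ?thesis using N by (simp add: exp_minus field_simps)
  qed
  finally have "(1 - \<delta>) ^ m < 1 / N ^ 2" .
  then have "N ^ 2 * (1 - \<delta>) ^ m < 1" using N by (simp add: field_simps)
  then obtain A where A: "finite A" "card A \<le> m" "inj_on (\<lambda>B. B \<inter> A) P"
    using separating_subsample_exists[OF S P d sep] unfolding N_def by blast
  have "card P = card ((\<lambda>B. B \<inter> A) ` P)" using A(3) by (simp add: card_image)
  also have "\<dots> \<le> (card A + 1) ^ V" using gr A(1) by (simp add: trace_growth_def)
  also have "\<dots> \<le> (m + 1) ^ V" using A(2) by (intro power_mono) auto
  finally have "N \<le> (real m + 1) ^ V" unfolding N_def
    by (metis of_nat_1 of_nat_add of_nat_mono of_nat_power)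
  also have "\<dots> \<le> (2 * ln N / \<delta> + 2) ^ V" using m2 by (intro power_mono) auto
  finally have N1: "N \<le> (2 * ln N / \<delta> + 2) ^ V" .
  \<comment> \<open>bounding \<open>ln N\<close> by \<open>2 * V * r\<close> uses up half of \<open>N = r ^ (2 * V)\<close>, so \<open>r ^ V\<close> remains to be bounded\<close>
  define r where "r = N powr (1 / (2 * V))"
  have r1: "r \<ge> 1" unfolding r_def using N by (simp add: ge_one_powr_ge_zero)
  have rV: "r ^ (2 * V) = N"
    unfolding r_def using N V by (simp add: powr_realpow[symmetric] powr_powr)
  have "ln N = 2 * V * ln r" unfolding r_def using V N by (simp add: ln_powr)
  also have "\<dots> \<le> 2 * V * r" using ln_le_minus_one[of r] r1 V by (intro mult_left_mono) auto
  finally have "2 * ln N / \<delta> + 2 \<le> (4 * V * r) / \<delta> + 3 * r / \<delta>"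
  proof -
    assume "ln N \<le> 2 * V * r"
    then have "2 * ln N \<le> 4 * V * r" by linarith
    then have "2 * ln N / \<delta> \<le> 4 * V * r / \<delta>" using d divide_right_mono[of "2 * ln N" "4 * V * r" \<delta>] by linarith
    moreover have "2 \<le> 3 * r / \<delta>" using r1 d by (simp add: field_simps)
    ultimately show ?thesis by linarith
  qed
  also have "\<dots> = ((4 * real V + 3) / \<delta>) * r" by (simp add: add_divide_distrib distrib_right)
  finally have "(2 * ln N / \<delta> + 2) ^ V \<le> (((4 * real V + 3) / \<delta>) * r) ^ V"
    using lnN d by (intro power_mono) auto
  then have N2: "N \<le> ((4 * real V + 3) / \<delta>) ^ V * r ^ V"
    using N1 unfolding power_mult_distrib by linarith
  have "r ^ V * r ^ V = N" using rV by (simp add: mult_2 power_add)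
  then have "r ^ V * r ^ V \<le> ((4 * real V + 3) / \<delta>) ^ V * r ^ V" using N2 by simp
  then have le: "r ^ V \<le> ((4 * real V + 3) / \<delta>) ^ V" using r1 by simp
  have "N = r ^ V * r ^ V" using rV by (simp add: mult_2 power_add)
  also have "\<dots> \<le> ((4 * real V + 3) / \<delta>) ^ V * ((4 * real V + 3) / \<delta>) ^ V"
    using le r1 d by (intro mult_mono) auto
  also have "\<dots> = ((4 * real V + 3) / \<delta>) ^ (2 * V)" by (simp add: mult_2 power_add)
  finally show ?thesis unfolding N_def .
qed

section \<open>Rademacher averages and chaining\<close>

abbreviation signs :: "'i set \<Rightarrow> ('i \<Rightarrow> real) set" where
  "signs S \<equiv> PiE S (\<lambda>_. {- 1, 1})"

text \<open>This is the auxiliary estimate behind Hoeffding's lemma, at \<open>p = 1/2\<close>.\<close>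
lemma cosh_le_exp_half_square: "cosh (x::real) \<le> exp (x\<^sup>2 / 2)"
proof -
  have *: "cosh y \<le> exp (y\<^sup>2 / 2)" if "y \<ge> 0" for y :: real
  proof -
    have e: "1 + 1 / 2 * (exp (2 * y) - 1) = exp y * cosh y"
    proof -
      have "exp (2 * y) = exp y * exp y" by (metis mult_2 exp_add)
      then show ?thesis by (simp add: cosh_def exp_minus field_simps)
    qed
    have "- (2 * y) * (1 / 2) + ln (exp y * cosh y) \<le> (2 * y)\<^sup>2 / 8"
      using Hoeffdings_lemma_aux[of "2 * y" "1/2"] that unfolding e by simp
    moreover have "ln (exp y * cosh y) = y + ln (cosh y)"
      by (subst ln_mult) (auto simp: cosh_real_pos)
    ultimately have "ln (cosh y) \<le> y\<^sup>2 / 2" by (simp add: power2_eq_square)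
    then show ?thesis by (metis cosh_real_pos exp_le_cancel_iff exp_ln)
  qed
  show ?thesis using *[of x] *[of "- x"] by (cases "x \<ge> 0") simp_all
qed

lemma rademacher_mgf:
  fixes a :: "'i \<Rightarrow> real"
  assumes "finite S"
  shows "(\<Sum>e\<in>signs S. exp (l * (\<Sum>i\<in>S. e i * a i)))
      \<le> 2 ^ card S * exp (l\<^sup>2 / 2 * (\<Sum>i\<in>S. (a i)\<^sup>2))"
proof -
  have "(\<Sum>e\<in>signs S. exp (l * (\<Sum>i\<in>S. e i * a i))) = (\<Sum>e\<in>signs S. \<Prod>i\<in>S. exp (l * (e i * a i)))"
    using assms by (simp add: sum_distrib_left exp_sum)
  also have "\<dots> = (\<Prod>i\<in>S. \<Sum>e\<in>{- 1, 1}. exp (l * (e * a i)))"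
    by (rule prod_sum_PiE[symmetric]) (use assms in auto)
  also have "\<dots> = (\<Prod>i\<in>S. 2 * cosh (l * a i))"
    by (intro prod.cong refl) (simp add: cosh_def)
  also have "\<dots> \<le> (\<Prod>i\<in>S. 2 * exp ((l * a i)\<^sup>2 / 2))"
    by (intro prod_mono) (auto simp: cosh_le_exp_half_square cosh_real_nonneg)
  also have "\<dots> = 2 ^ card S * exp (l\<^sup>2 / 2 * (\<Sum>i\<in>S. (a i)\<^sup>2))"
    using assms by (simp add: prod.distrib exp_sum sum_distrib_left power_mult_distrib)
  finally show ?thesis .
qed

text \<open>Massart's finite class lemma, as a sum over all sign vectors. Jensen's inequality is replaced by
  the tangent of the exponential at \<open>ln Q\<close>, where \<open>Q\<close> bounds the average of \<open>exp (l * Max \<dots>)\<close>. The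
  parameter \<open>l\<close> stays free so that each chaining level can use its own.\<close>
lemma rademacher_max_bound:
  fixes T :: "('i \<Rightarrow> real) set"
  assumes S: "finite S" and T: "finite T" "T \<noteq> {}" and l: "l > 0"
    and v: "\<And>a. a \<in> T \<Longrightarrow> (\<Sum>i\<in>S. (a i)\<^sup>2) \<le> v"
    and K: "real (card T) \<le> K"
  shows "(\<Sum>e\<in>signs S. Max ((\<lambda>a. \<bar>\<Sum>i\<in>S. e i * a i\<bar>) ` T))
      \<le> 2 ^ card S * ((ln (2 * K) + l\<^sup>2 / 2 * v) / l)"
proof -
  let ?M = "\<lambda>e. Max ((\<lambda>a. \<bar>\<Sum>i\<in>S. e i * a i\<bar>) ` T)"
  have Kp: "K \<ge> 1" using T K by (metis One_nat_def Suc_leI card_gt_0_iff of_nat_1 of_nat_le_iff order_trans)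
  define Q where "Q = 2 * K * exp (l\<^sup>2 / 2 * v)"
  have Q: "Q > 0" using Kp by (simp add: Q_def)
  have cs: "card (signs S) = 2 ^ card S" using S by (simp add: card_PiE numeral_2_eq_2)
  have fs: "finite (signs S)" using S by (intro finite_PiE) auto
  have e1: "exp (l * ?M e) \<le> (\<Sum>a\<in>T. exp (l * (\<Sum>i\<in>S. e i * a i)) + exp ((- l) * (\<Sum>i\<in>S. e i * a i)))" for e
  proof -
    have "?M e \<in> (\<lambda>a. \<bar>\<Sum>i\<in>S. e i * a i\<bar>) ` T" by (intro Max_in) (use T in auto)
    then obtain a where a: "a \<in> T" "?M e = \<bar>\<Sum>i\<in>S. e i * a i\<bar>" by auto
    have "exp (l * ?M e) \<le> exp (l * (\<Sum>i\<in>S. e i * a i)) + exp ((- l) * (\<Sum>i\<in>S. e i * a i))"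
      unfolding a(2) by (auto simp: abs_if)
    also have "\<dots> \<le> (\<Sum>a\<in>T. exp (l * (\<Sum>i\<in>S. e i * a i)) + exp ((- l) * (\<Sum>i\<in>S. e i * a i)))"
      by (rule member_le_sum[OF a(1), where f="\<lambda>a. exp (l * (\<Sum>i\<in>S. e i * a i)) + exp ((- l) * (\<Sum>i\<in>S. e i * a i))"]) (use T in \<open>auto intro: add_nonneg_nonneg\<close>)
    finally show ?thesis .
  qed
  have "(\<Sum>e\<in>signs S. exp (l * ?M e)) \<le> (\<Sum>e\<in>signs S. \<Sum>a\<in>T. exp (l * (\<Sum>i\<in>S. e i * a i)) + exp ((- l) * (\<Sum>i\<in>S. e i * a i)))"
    by (intro sum_mono e1)
  also have "\<dots> = (\<Sum>a\<in>T. (\<Sum>e\<in>signs S. exp (l * (\<Sum>i\<in>S. e i * a i))) + (\<Sum>e\<in>signs S. exp ((- l) * (\<Sum>i\<in>S. e i * a i))))"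
    by (subst sum.swap) (simp add: sum.distrib)
  also have "\<dots> \<le> (\<Sum>a\<in>T. 2 ^ card S * exp (l\<^sup>2 / 2 * v) + 2 ^ card S * exp (l\<^sup>2 / 2 * v))"
  proof (intro sum_mono add_mono)
    fix a assume a: "a \<in> T"
    have le: "2 ^ card S * exp (l\<^sup>2 / 2 * (\<Sum>i\<in>S. (a i)\<^sup>2)) \<le> 2 ^ card S * exp (l\<^sup>2 / 2 * v)"
      using v[OF a] by (intro mult_left_mono) (auto intro!: mult_left_mono)
    show "(\<Sum>e\<in>signs S. exp (l * (\<Sum>i\<in>S. e i * a i))) \<le> 2 ^ card S * exp (l\<^sup>2 / 2 * v)"
      by (rule order_trans[OF rademacher_mgf[OF S] le])
    show "(\<Sum>e\<in>signs S. exp ((- l) * (\<Sum>i\<in>S. e i * a i))) \<le> 2 ^ card S * exp (l\<^sup>2 / 2 * v)"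
      by (rule order_trans[OF rademacher_mgf[OF S, of "- l"]]) (use le in simp)
  qed
  also have "\<dots> = real (card T) * (2 ^ card S * (2 * exp (l\<^sup>2 / 2 * v)))" by simp
  also have "\<dots> \<le> K * (2 ^ card S * (2 * exp (l\<^sup>2 / 2 * v)))"
    using K by (intro mult_right_mono) auto
  also have "\<dots> = 2 ^ card S * Q" by (simp add: Q_def)
  finally have mg: "(\<Sum>e\<in>signs S. exp (l * ?M e)) \<le> 2 ^ card S * Q" .
  have pt: "l * ?M e \<le> ln Q - 1 + exp (l * ?M e) / Q" for e
  proof -
    have "1 + (l * ?M e - ln Q) \<le> exp (l * ?M e - ln Q)" by (rule exp_ge_add_one_self)
    also have "\<dots> = exp (l * ?M e) / Q" using Q by (simp add: exp_diff)
    finally show ?thesis by linarith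
  qed
  have "l * (\<Sum>e\<in>signs S. ?M e) \<le> (\<Sum>e\<in>signs S. ln Q - 1 + exp (l * ?M e) / Q)"
    unfolding sum_distrib_left by (intro sum_mono pt)
  also have "\<dots> = 2 ^ card S * (ln Q - 1) + (\<Sum>e\<in>signs S. exp (l * ?M e)) / Q"
    by (simp add: sum.distrib cs sum_divide_distrib)
  also have "\<dots> \<le> 2 ^ card S * (ln Q - 1) + (2 ^ card S * Q) / Q"
    using mg Q by (intro add_mono divide_right_mono) auto
  also have "\<dots> = 2 ^ card S * ln Q" using Q by (simp add: algebra_simps)
  also have "ln Q = ln (2 * K) + l\<^sup>2 / 2 * v"
    unfolding Q_def using Kp by (subst ln_mult) auto
  finally show ?thesis using l by (simp add: field_simps)
qed

text \<open>A maximal \<open>\<delta>\<close>-separated subfamily is a \<open>\<delta>\<close>-net, and its size is bounded as a packing.\<close>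
lemma net_exists:
  fixes \<delta> :: real
  assumes S: "finite S" "S \<noteq> {}" and F: "F \<subseteq> Pow S" "F \<noteq> {}" and d: "0 < \<delta>" "\<delta> \<le> 1"
    and gr: "trace_growth V F" and V: "V \<ge> 1"
  shows "\<exists>p. (\<forall>A\<in>F. p A \<in> F \<and> card (sym_diff A (p A)) \<le> \<delta> * card S) \<and>
    real (card (p ` F)) \<le> ((4 * real V + 3) / \<delta>) ^ (2 * V)"
proof -
  define sep where "sep P \<longleftrightarrow> (\<forall>A\<in>P. \<forall>B\<in>P. A \<noteq> B \<longrightarrow> \<delta> * card S < card (sym_diff A B))" for P :: "'a set set"
  have fF: "finite F" using F S finite_subset by blast
  let ?Q = "{P. P \<subseteq> F \<and> sep P}"
  have "finite ?Q" "?Q \<noteq> {}" using fF by (auto simp: sep_def)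
  then have "\<exists>m\<in>?Q. \<forall>b\<in>?Q. m \<subseteq> b \<longrightarrow> m = b" by (rule finite_has_maximal)
  then obtain P where P0: "P \<in> ?Q" and P1: "\<forall>b\<in>?Q. P \<subseteq> b \<longrightarrow> P = b" by (elim bexE)
  have P: "P \<subseteq> F" "sep P" using P0 by auto
  have mx: "P' = P" if "P' \<subseteq> F" "sep P'" "P \<subseteq> P'" for P' using P1 that by auto
  have near: "\<exists>B\<in>P. card (sym_diff A B) \<le> \<delta> * card S" if A: "A \<in> F" for A
  proof (rule ccontr)
    assume neg: "\<not> ?thesis"
    have "sep (insert A P)"
      unfolding sep_def
    proof (intro ballI impI)
      fix B C assume BC: "B \<in> insert A P" "C \<in> insert A P" "B \<noteq> C"
      have sy: "sym_diff B C = sym_diff C B" by blast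
      show "\<delta> * card S < card (sym_diff B C)"
        using BC neg P(2) unfolding sep_def by (metis sy insertE not_le)
    qed
    then have "insert A P = P" using mx[of "insert A P"] A P by blast
    then have "A \<in> P" by blast
    then show False using neg d S by (auto intro!: bexI[of _ A])
  qed
  define p where "p A = (SOME B. B \<in> P \<and> card (sym_diff A B) \<le> \<delta> * card S)" for A
  have p: "p A \<in> P \<and> card (sym_diff A (p A)) \<le> \<delta> * card S" if "A \<in> F" for A
    unfolding p_def by (rule someI_ex) (use near[OF that] in blast)
  have fP: "finite P" using P fF finite_subset by blast
  have "real (card P) \<le> ((4 * real V + 3) / \<delta>) ^ (2 * V)"
  proof (rule packing_bound[OF S fP d _ trace_growth_mono[OF gr P(1)] V])
    fix A B assume AB: "A \<in> P" "B \<in> P" "A \<noteq> B"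
    then have "sym_diff A B \<inter> S = sym_diff A B" using P F by blast
    then show "\<delta> * card S < card (sym_diff A B \<inter> S)" using P(2) AB unfolding sep_def by metis
  qed
  moreover have "card (p ` F) \<le> card P" using p fP by (intro card_mono) auto
  ultimately have "real (card (p ` F)) \<le> ((4 * real V + 3) / \<delta>) ^ (2 * V)" by linarith
  then show ?thesis using p P by (intro exI[of _ p]) auto
qed

lemma sum_linear_geometric_le:
  fixes a b :: real
  assumes "a \<ge> 0" "b \<ge> 0"
  shows "(\<Sum>j<J. (a + b * real j) / 2 ^ j) \<le> 2 * a + 2 * b"
proof -
  have "(\<Sum>j<J. (a + b * real j) / 2 ^ j) = 2 * a + 2 * b - (2 * a + 2 * b + 2 * b * real J) / 2 ^ J"
  proof (induction J)
    case (Suc J)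
    show ?case unfolding sum.lessThan_Suc Suc.IH by (simp add: field_simps)
  qed simp
  then show ?thesis using assms by simp
qed

text \<open>The first bracket comes from the coarsest net, the second from summing the increments between
  consecutive nets by \<open>sum_linear_geometric_le\<close>.\<close>
definition chain_const :: "nat \<Rightarrow> real" where
  "chain_const V = (ln 2 + 1 / 2 + 2 * real V * ln (4 * real V + 3)) +
     (2 * (ln 2 + 1 + 4 * real V * ln (4 * real V + 3) + 4 * real V * ln 4) + 2 * (4 * real V * ln 4))"

lemma chain_const_pos: "chain_const V > 0"
proof -
  define x y where "x = real V * ln (4 * real V + 3)" and "y = real V * ln 4"
  have "x \<ge> 0" "y \<ge> 0" by (simp_all add: x_def y_def)
  moreover have "ln (2::real) > 0" by simp
  moreover have "chain_const V = 3 * ln 2 + 5 / 2 + 10 * x + 16 * y"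
    unfolding chain_const_def x_def y_def by (simp add: algebra_simps)
  ultimately show ?thesis by linarith
qed

text \<open>Chaining. At level \<open>j\<close> every set is replaced by a member of a net at scale \<open>1 / 4 ^ j\<close>; the
  telescoping increments at level \<open>j\<close> have variance at most \<open>2 * n / 4 ^ j\<close>, and the logarithm of their
  number grows linearly in \<open>j\<close>. So level \<open>j\<close> contributes at most of order \<open>(1 + j) * sqrt n / 2 ^ j\<close>,
  which is summable.\<close>
lemma rademacher_chaining:
  assumes S: "finite S" "S \<noteq> {}" and F: "F \<subseteq> Pow S" "F \<noteq> {}"
    and gr: "trace_growth V F" and V: "V \<ge> 1"
  shows "(\<Sum>e\<in>signs S. Max ((\<lambda>A. \<bar>\<Sum>i\<in>A. e i\<bar>) ` F)) \<le> 2 ^ card S * (chain_const V * sqrt (card S))"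
proof -
  define n where "n = card S"
  have n: "n > 0" using S by (simp add: n_def card_gt_0_iff)
  have fF: "finite F" using F S finite_subset by blast
  have "\<forall>j::nat. \<exists>p. (\<forall>A\<in>F. p A \<in> F \<and> card (sym_diff A (p A)) \<le> (1 / 4 ^ j) * card S) \<and>
    real (card (p ` F)) \<le> ((4 * real V + 3) / (1 / 4 ^ j)) ^ (2 * V)"
    by (intro allI net_exists[OF S F _ _ gr V]) auto
  then obtain p where p0: "\<And>j. (\<forall>A\<in>F. p j A \<in> F \<and> card (sym_diff A (p j A)) \<le> (1 / 4 ^ j) * card S) \<and>
    real (card (p j ` F)) \<le> ((4 * real V + 3) / (1 / 4 ^ j)) ^ (2 * V)" by metis
  have pF: "p j A \<in> F" and pd: "real (card (sym_diff A (p j A))) \<le> real n / 4 ^ j" if "A \<in> F" for j A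
    using p0[of j] that by (auto simp: n_def)
  define N where "N j = ((4 * real V + 3) * 4 ^ j) ^ (2 * V)" for j
  have N1: "N j \<ge> 1" for j
  proof -
    have "1 \<le> (4::real) ^ j" by simp
    then have "1 * 1 \<le> (4 * real V + 3) * 4 ^ j" by (intro mult_mono) auto
    then show ?thesis unfolding N_def by (intro one_le_power) simp
  qed
  have Nmono: "N j \<le> N (Suc j)" for j
    unfolding N_def by (intro power_mono mult_left_mono power_increasing) auto
  have pN: "real (card (p j ` F)) \<le> N j" for j
    using p0[of j] by (simp add: N_def)
  have subS: "A \<subseteq> S" "finite A" if "A \<in> F" for A
    using that F S by (auto intro: rev_finite_subset[OF S(1)])
  \<comment> \<open>at this level the net is finer than one point, so the approximation is exact\<close>
  obtain J where J: "real n < 4 ^ J" using real_arch_pow[of 4 "real n"] by auto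
  have pJ: "p J A = A" if A: "A \<in> F" for A
  proof -
    have "real (card (sym_diff A (p J A))) < 1" using pd[OF A, of J] J by (smt (verit) divide_less_eq_1_pos zero_less_power)
    then have "card (sym_diff A (p J A)) = 0" by linarith
    moreover have "finite (sym_diff A (p J A))" using subS A pF[OF A] by simp
    ultimately show ?thesis by auto
  qed
  define w where "w A = (\<lambda>i. if i \<in> A then 1 else 0 :: real)" for A :: "'a set"
  have ip: "(\<Sum>i\<in>S. e i * w A i) = (\<Sum>i\<in>A. e i)" if "A \<in> F" for e A
    using subS[OF that] S by (simp add: w_def if_distrib sum.If_cases Int_absorb1 cong: if_cong)
  define T0 where "T0 = w ` p 0 ` F"
  define T where "T j = (\<lambda>A. (\<lambda>i. w (p (Suc j) A) i - w (p j A) i)) ` F" for j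
  let ?X = "\<lambda>T e. Max ((\<lambda>a. \<bar>\<Sum>i\<in>S. e i * a i\<bar>) ` T)"
  have fT0: "finite T0" "T0 \<noteq> {}" and fT: "finite (T j)" "T j \<noteq> {}" for j
    using fF F by (auto simp: T0_def T_def)
  have pair: "\<bar>\<Sum>i\<in>A. e i\<bar> \<le> ?X T0 e + (\<Sum>j<J. ?X (T j) e)" if A: "A \<in> F" for A e
  proof -
    have tel: "(\<Sum>j<J. (\<Sum>i\<in>S. e i * (w (p (Suc j) A) i - w (p j A) i))) = (\<Sum>i\<in>S. e i * w (p J A) i) - (\<Sum>i\<in>S. e i * w (p 0 A) i)"
    proof -
      have "(\<Sum>j<J. (\<Sum>i\<in>S. e i * (w (p (Suc j) A) i - w (p j A) i)))
        = (\<Sum>j<J. (\<Sum>i\<in>S. e i * w (p (Suc j) A) i) - (\<Sum>i\<in>S. e i * w (p j A) i))"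
        by (simp add: right_diff_distrib sum_subtractf)
      also have "\<dots> = (\<Sum>i\<in>S. e i * w (p J A) i) - (\<Sum>i\<in>S. e i * w (p 0 A) i)"
        by (rule sum_lessThan_telescope)
      finally show ?thesis .
    qed
    have a: "(\<Sum>i\<in>A. e i) = (\<Sum>i\<in>S. e i * w (p 0 A) i) + (\<Sum>j<J. (\<Sum>i\<in>S. e i * (w (p (Suc j) A) i - w (p j A) i)))"
      unfolding tel by (simp add: ip[OF A] pJ[OF A])
    have b: "\<bar>\<Sum>i\<in>S. e i * w (p 0 A) i\<bar> \<le> ?X T0 e"
      by (rule Max_ge) (use fT0 A in \<open>auto simp: T0_def\<close>)
    have c: "\<bar>\<Sum>i\<in>S. e i * (w (p (Suc j) A) i - w (p j A) i)\<bar> \<le> ?X (T j) e" for j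
      by (rule Max_ge) (use fT A in \<open>auto simp: T_def\<close>)
    have "\<bar>\<Sum>j<J. (\<Sum>i\<in>S. e i * (w (p (Suc j) A) i - w (p j A) i))\<bar> \<le> (\<Sum>j<J. ?X (T j) e)"
      by (rule order_trans[OF sum_abs]) (intro sum_mono c)
    with a b show ?thesis by linarith
  qed
  have "(\<Sum>e\<in>signs S. Max ((\<lambda>A. \<bar>\<Sum>i\<in>A. e i\<bar>) ` F)) \<le> (\<Sum>e\<in>signs S. ?X T0 e + (\<Sum>j<J. ?X (T j) e))"
    using pair fF F by (intro sum_mono Max.boundedI) auto
  also have "\<dots> = (\<Sum>e\<in>signs S. ?X T0 e) + (\<Sum>j<J. \<Sum>e\<in>signs S. ?X (T j) e)"
    by (simp add: sum.distrib sum.swap[of _ "{..<J}"])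
  finally have main: "(\<Sum>e\<in>signs S. Max ((\<lambda>A. \<bar>\<Sum>i\<in>A. e i\<bar>) ` F)) \<le> (\<Sum>e\<in>signs S. ?X T0 e) + (\<Sum>j<J. \<Sum>e\<in>signs S. ?X (T j) e)" .
  define s where "s = sqrt (real n)"
  have s: "s > 0" "s\<^sup>2 = real n" using n by (auto simp: s_def)
  let ?a = "ln 2 + 1 + 4 * real V * ln (4 * real V + 3) + 4 * real V * ln 4"
  let ?b = "4 * real V * ln 4"
  have lnN: "ln (N j) = 2 * real V * (ln (4 * real V + 3) + real j * ln 4)" for j
    unfolding N_def by (simp add: ln_realpow ln_mult)
  have lev: "(\<Sum>e\<in>signs S. ?X (T j) e) \<le> 2 ^ n * (s * ((?a + ?b * real j) / 2 ^ j))" for j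
  proof -
    have cT: "real (card (T j)) \<le> N (Suc j) * N (Suc j)"
    proof -
      have "T j \<subseteq> (\<lambda>(B, C). (\<lambda>i. w B i - w C i)) ` (p (Suc j) ` F \<times> p j ` F)" by (auto simp: T_def image_iff)
      then have "card (T j) \<le> card (p (Suc j) ` F \<times> p j ` F)"
        by (rule surj_card_le[rotated]) (use fF in auto)
      then have "real (card (T j)) \<le> real (card (p (Suc j) ` F)) * real (card (p j ` F))"
        by (simp add: card_cartesian_product flip: of_nat_mult)
      also have "\<dots> \<le> N (Suc j) * N (Suc j)"
        using pN[of j] pN[of "Suc j"] Nmono[of j] N1[of "Suc j"] by (intro mult_mono) auto
      finally show ?thesis .
    qed
    have var: "(\<Sum>i\<in>S. (a i)\<^sup>2) \<le> 2 * real n / 4 ^ j" if aT: "a \<in> T j" for a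
    proof -
      obtain A where A: "A \<in> F" "a = (\<lambda>i. w (p (Suc j) A) i - w (p j A) i)" using aT unfolding T_def by blast
      let ?B = "p (Suc j) A" and ?C = "p j A"
      have "(\<Sum>i\<in>S. (a i)\<^sup>2) = (\<Sum>i\<in>S. if i \<in> sym_diff ?B ?C then 1 else 0)"
        unfolding A(2)
      proof (intro sum.cong refl)
        fix i
        show "(w ?B i - w ?C i)\<^sup>2 = (if i \<in> sym_diff ?B ?C then 1 else 0)"
          by (cases "i \<in> ?B"; cases "i \<in> ?C"; simp add: w_def)
      qed
      also have "\<dots> = real (card (S \<inter> sym_diff ?B ?C))" using S by (simp add: sum.If_cases Int_def)
      also have "\<dots> \<le> real (card (sym_diff A ?B \<union> sym_diff A ?C))"
        using subS[OF A(1)] subS[OF pF[OF A(1)]] by (intro of_nat_mono card_mono) auto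
      also have "\<dots> \<le> real (card (sym_diff A ?B)) + real (card (sym_diff A ?C))"
        by (metis card_Un_le of_nat_add of_nat_mono)
      also have "\<dots> \<le> real n / 4 ^ Suc j + real n / 4 ^ j"
        using pd[OF A(1), of "Suc j"] pd[OF A(1), of j] by (rule add_mono)
      also have "\<dots> \<le> 2 * real n / 4 ^ j" by (simp add: field_simps)
      finally show ?thesis .
    qed
    \<comment> \<open>the choice that makes the variance term equal to \<open>1\<close>\<close>
    define l where "l = 2 ^ j / s"
    have l: "l > 0" using s by (simp add: l_def)
    have "(\<Sum>e\<in>signs S. ?X (T j) e) \<le> 2 ^ card S * ((ln (2 * (N (Suc j) * N (Suc j))) + l\<^sup>2 / 2 * (2 * real n / 4 ^ j)) / l)"
      by (rule rademacher_max_bound[OF S(1) fT l var cT])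
    also have "l\<^sup>2 / 2 * (2 * real n / 4 ^ j) = 1"
    proof -
      have "l\<^sup>2 = 4 ^ j / real n" unfolding l_def using s by (simp add: power_divide power_mult[symmetric] mult.commute[of j] power_mult)
      then show ?thesis using n by simp
    qed
    also have "ln (2 * (N (Suc j) * N (Suc j))) = ln 2 + 2 * ln (N (Suc j))"
      using N1[of "Suc j"] by (simp add: ln_mult)
    also have "(ln 2 + 2 * ln (N (Suc j)) + 1) = ?a + ?b * real j"
      unfolding lnN by (simp add: algebra_simps)
    also have "(?a + ?b * real j) / l = s * ((?a + ?b * real j) / 2 ^ j)" by (simp add: l_def)
    finally show ?thesis by (simp add: n_def)
  qed
  have lev0: "(\<Sum>e\<in>signs S. ?X T0 e) \<le> 2 ^ n * (s * (ln 2 + 1 / 2 + 2 * real V * ln (4 * real V + 3)))"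
  proof -
    have cT: "real (card T0) \<le> N 0"
      using pN[of 0] card_image_le[of "p 0 ` F" w] fF by (simp add: T0_def)
    have var: "(\<Sum>i\<in>S. (a i)\<^sup>2) \<le> real n" if "a \<in> T0" for a
    proof -
      have "(\<Sum>i\<in>S. (a i)\<^sup>2) \<le> (\<Sum>i\<in>S. 1)" using that by (intro sum_mono) (auto simp: T0_def w_def)
      then show ?thesis by (simp add: n_def)
    qed
    have "(\<Sum>e\<in>signs S. ?X T0 e) \<le> 2 ^ card S * ((ln (2 * N 0) + (1 / s)\<^sup>2 / 2 * real n) / (1 / s))"
      by (rule rademacher_max_bound[OF S(1) fT0 _ var cT]) (use s in auto)
    also have "(1 / s)\<^sup>2 / 2 * real n = 1 / 2" using s n by (simp add: power_divide)
    also have "ln (2 * N 0) = ln 2 + 2 * real V * ln (4 * real V + 3)" using lnN[of 0] N1[of 0] by (simp add: ln_mult)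
    finally show ?thesis by (simp add: n_def mult.commute algebra_simps)
  qed
  have "(\<Sum>j<J. \<Sum>e\<in>signs S. ?X (T j) e) \<le> (\<Sum>j<J. 2 ^ n * (s * ((?a + ?b * real j) / 2 ^ j)))"
    by (intro sum_mono lev)
  also have "\<dots> = 2 ^ n * (s * (\<Sum>j<J. (?a + ?b * real j) / 2 ^ j))" by (simp add: sum_distrib_left)
  also have "\<dots> \<le> 2 ^ n * (s * (2 * ?a + 2 * ?b))"
    using s by (intro mult_left_mono sum_linear_geometric_le) auto
  finally have "(\<Sum>j<J. \<Sum>e\<in>signs S. ?X (T j) e) \<le> 2 ^ n * (s * (2 * ?a + 2 * ?b))" .
  with main lev0 have "(\<Sum>e\<in>signs S. Max ((\<lambda>A. \<bar>\<Sum>i\<in>A. e i\<bar>) ` F))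
     \<le> 2 ^ n * (s * (ln 2 + 1 / 2 + 2 * real V * ln (4 * real V + 3))) + 2 ^ n * (s * (2 * ?a + 2 * ?b))" by linarith
  also have "\<dots> = 2 ^ n * ((ln 2 + 1 / 2 + 2 * real V * ln (4 * real V + 3) + (2 * ?a + 2 * ?b)) * s)"
    by (simp add: algebra_simps)
  finally show ?thesis unfolding chain_const_def n_def s_def .
qed

section \<open>Halfspaces and uniform deviations\<close>

definition halfspace :: "'a::euclidean_space \<Rightarrow> real \<Rightarrow> 'a set" where
  "halfspace w b = {x. w \<bullet> x + b > 0}"

lemma convex_halfspace: "convex (halfspace w b)" "convex (- halfspace w b)"
proof -
  have "halfspace w b = {x. w \<bullet> x > - b}" "- halfspace w b = {x. w \<bullet> x \<le> - b}"
    by (auto simp: halfspace_def)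
  then show "convex (halfspace w b)" "convex (- halfspace w b)"
    by (simp_all add: convex_halfspace_gt convex_halfspace_le)
qed

lemma borel_halfspace [measurable]: "halfspace w b \<in> sets borel"
  unfolding halfspace_def by measurable

text \<open>Radon's theorem: among more than \<open>DIM('a) + 1\<close> points, two disjoint subsets have intersecting
  convex hulls, so no halfspace contains exactly one of the two subsets.\<close>
lemma trace_growth_halfspaces:
  fixes x :: "'i \<Rightarrow> 'a::euclidean_space"
  shows "trace_growth (DIM('a) + 1) {{i. x i \<in> halfspace w b} |w b. True}" (is "trace_growth _ ?F")
proof (rule trace_growth_of_not_shattered, rule ccontr)
  fix A assume A: "finite A" and sh: "shattered ?F A" and big: "\<not> card A \<le> DIM('a) + 1"
  have pick: "\<exists>w b. \<forall>i\<in>A. x i \<in> halfspace w b \<longleftrightarrow> i \<in> B" if B: "B \<subseteq> A" for B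
  proof -
    obtain S where "S \<in> ?F" "S \<inter> A = B" by (rule shatteredD[OF sh B])
    then show ?thesis by auto
  qed
  have inj: "inj_on x A"
  proof (rule inj_onI, rule ccontr)
    fix i j assume ij: "i \<in> A" "j \<in> A" "x i = x j" "i \<noteq> j"
    from pick[of "{i}"] ij(1) obtain w b where "\<forall>k\<in>A. x k \<in> halfspace w b \<longleftrightarrow> k = i" by auto
    then show False using ij by metis
  qed
  then have "affine_dependent (x ` A)"
    using A big by (intro affine_dependent_biggerset) (auto simp: card_image)
  then obtain m p where mp: "m \<subseteq> x ` A" "p \<subseteq> x ` A" "m \<inter> p = {}" "convex hull m \<inter> convex hull p \<noteq> {}"
    by (rule Radon)
  obtain w b where wb: "\<forall>i\<in>A. x i \<in> halfspace w b \<longleftrightarrow> i \<in> {i \<in> A. x i \<in> m}"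
    using pick[of "{i \<in> A. x i \<in> m}"] by auto
  have m: "m \<subseteq> halfspace w b" using wb mp(1) by auto
  have p: "p \<subseteq> - halfspace w b"
  proof
    fix y assume y: "y \<in> p"
    then obtain i where "i \<in> A" "y = x i" using mp(2) by auto
    moreover have "y \<notin> m" using y mp(3) by auto
    ultimately show "y \<in> - halfspace w b" using wb by auto
  qed
  from m p have "convex hull m \<subseteq> halfspace w b" "convex hull p \<subseteq> - halfspace w b"
    by (simp_all add: hull_minimal convex_halfspace)
  then show False using mp(4) by blast
qed

lemma trace_growth_halfspace_Int:
  fixes x :: "'i \<Rightarrow> 'a::euclidean_space"
  shows "trace_growth (2 * (DIM('a) + 1)) {{i. x i \<in> halfspace w b \<inter> halfspace w' b'} |w b w' b'. True}"
proof (rule trace_growth_mono[OF trace_growth_Int[OF trace_growth_halfspaces[of x] trace_growth_halfspaces[of x]]], rule subsetI)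
  fix A assume "A \<in> {{i. x i \<in> halfspace w b \<inter> halfspace w' b'} |w b w' b'. True}"
  then obtain w b w' b' where "A = {i. x i \<in> halfspace w b} \<inter> {i. x i \<in> halfspace w' b'}" by auto
  then show "A \<in> {S \<inter> T |S T. S \<in> {{i. x i \<in> halfspace w b} |w b. True} \<and> T \<in> {{i. x i \<in> halfspace w b} |w b. True}}"
    by blast
qed

text \<open>Chaining applied separately to the traces on the sample \<open>z 0, \<dots>, z (n - 1)\<close> and on the ghost
  sample \<open>z n, \<dots>, z (2 * n - 1)\<close>.\<close>
lemma symmetrized_average_le:
  fixes z :: "nat \<Rightarrow> 'a" and \<H> :: "'a set set"
  assumes gr: "\<And>x :: nat \<Rightarrow> 'a. trace_growth V ((\<lambda>H. {i. x i \<in> H}) ` \<H>)" and V: "V \<ge> 1" and n: "n \<ge> 1"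
  shows "(\<Sum>e\<in>signs {..<n}. \<Squnion>H\<in>\<H>. ennreal \<bar>\<Sum>i<n. e i * (indicator H (z i) - indicator H (z (n + i)))\<bar>)
    \<le> ennreal (2 ^ n * (2 * chain_const V * sqrt n))"
proof (cases "\<H> = {}")
  case True
  then show ?thesis by (simp add: bot_ennreal)
next
  case False
  define F where "F u = (\<lambda>H. {i\<in>{..<n}. u i \<in> H}) ` \<H>" for u :: "nat \<Rightarrow> 'a"
  let ?M = "\<lambda>u e. Max ((\<lambda>A. \<bar>\<Sum>i\<in>A. e i\<bar>) ` F u)"
  have F: "F u \<subseteq> Pow {..<n}" "F u \<noteq> {}" "finite (F u)" for u
    using False by (auto simp: F_def intro!: finite_subset[of _ "Pow {..<n}"])
  have grF: "trace_growth V (F u)" for u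
  proof -
    have "F u = (\<lambda>S. S \<inter> {..<n}) ` ((\<lambda>H. {i. u i \<in> H}) ` \<H>)"
      unfolding F_def image_image by (intro image_cong) auto
    then show ?thesis using trace_growth_restrict[OF gr[of u]] by simp
  qed
  have ind: "\<bar>\<Sum>i<n. e i * indicator H (u i)\<bar> \<le> ?M u e" if "H \<in> \<H>" for H u and e :: "nat \<Rightarrow> real"
  proof -
    have "(\<Sum>i<n. e i * indicator H (u i)) = (\<Sum>i\<in>{i\<in>{..<n}. u i \<in> H}. e i)"
    proof -
      have "(\<Sum>i<n. e i * indicator H (u i)) = (\<Sum>i<n. if u i \<in> H then e i else 0)" by (intro sum.cong) auto
      also have "\<dots> = (\<Sum>i\<in>{i\<in>{..<n}. u i \<in> H}. e i)" by (rule sum.inter_filter[symmetric]) simp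
      finally show ?thesis .
    qed
    moreover have "\<bar>\<Sum>i\<in>{i\<in>{..<n}. u i \<in> H}. e i\<bar> \<le> ?M u e"
      using F that by (intro Max_ge) (auto simp: F_def)
    ultimately show ?thesis by simp
  qed
  have M0: "?M u e \<ge> 0" for u and e :: "nat \<Rightarrow> real"
  proof -
    obtain A where "A \<in> F u" using F by blast
    then have "\<bar>\<Sum>i\<in>A. e i\<bar> \<le> ?M u e" using F by (intro Max_ge) auto
    then show ?thesis by linarith
  qed
  let ?z' = "\<lambda>i. z (n + i)"
  have "(\<Sum>e\<in>signs {..<n}. \<Squnion>H\<in>\<H>. ennreal \<bar>\<Sum>i<n. e i * (indicator H (z i) - indicator H (z (n + i)))\<bar>)
     \<le> (\<Sum>e\<in>signs {..<n}. ennreal (?M z e + ?M ?z' e))"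
  proof (intro sum_mono SUP_least ennreal_leI)
    fix e :: "nat \<Rightarrow> real" and H assume H: "H \<in> \<H>"
    have "(\<Sum>i<n. e i * (indicator H (z i) - indicator H (z (n + i))))
      = (\<Sum>i<n. e i * indicator H (z i)) - (\<Sum>i<n. e i * indicator H (?z' i))"
      by (simp add: right_diff_distrib sum_subtractf)
    then show "\<bar>\<Sum>i<n. e i * (indicator H (z i) - indicator H (z (n + i)))\<bar> \<le> ?M z e + ?M ?z' e"
      using ind[OF H, of e z] ind[OF H, of e ?z'] by linarith
  qed
  also have "\<dots> = ennreal ((\<Sum>e\<in>signs {..<n}. ?M z e) + (\<Sum>e\<in>signs {..<n}. ?M ?z' e))"
    using M0 by (subst sum_ennreal) (auto simp: sum.distrib intro!: add_nonneg_nonneg)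
  also have "\<dots> \<le> ennreal (2 ^ n * (2 * chain_const V * sqrt n))"
  proof (rule ennreal_leI)
    have "(\<Sum>e\<in>signs {..<n}. ?M u e) \<le> 2 ^ n * (chain_const V * sqrt n)" for u
      using rademacher_chaining[OF _ _ F(1,2) grF V, of u] n by (auto simp: lessThan_empty_iff)
    from this[of z] this[of ?z']
    show "(\<Sum>e\<in>signs {..<n}. ?M z e) + (\<Sum>e\<in>signs {..<n}. ?M ?z' e) \<le> 2 ^ n * (2 * chain_const V * sqrt n)"
      by simp
  qed
  finally show ?thesis .
qed

text \<open>Exchanging \<open>z i\<close> with \<open>z (n + i)\<close> preserves the product law and flips the sign of the \<open>i\<close>-th
  difference. Hence the expectation is unchanged by any choice of signs and equals its average over
  all signs.\<close>
lemma ghost_sample_bound: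
  fixes \<nu> :: "'a measure" and \<H> :: "'a set set" and n :: nat
  assumes \<nu>: "prob_space \<nu>" and cH: "countable \<H>" and sH: "\<H> \<subseteq> sets \<nu>"
    and gr: "\<And>x :: nat \<Rightarrow> 'a. trace_growth V ((\<lambda>H. {i. x i \<in> H}) ` \<H>)" and V: "V \<ge> 1" and n: "n \<ge> 1"
  shows "(\<integral>\<^sup>+z. (\<Squnion>H\<in>\<H>. ennreal \<bar>\<Sum>i<n. indicator H (z i) - indicator H (z (n + i))\<bar>) \<partial>(\<Pi>\<^sub>M i\<in>{..<n} \<union> {n..<2*n}. \<nu>))
    \<le> ennreal (2 * chain_const V * sqrt n)"
proof -
  have un: "{..<n} \<union> {n..<2*n} = {..<2*n}" by (intro set_eqI) (simp; presburger)
  define P where "P = (\<Pi>\<^sub>M i\<in>{..<2*n}. \<nu>)"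
  interpret \<nu>: prob_space \<nu> by fact
  interpret P: prob_space P unfolding P_def by (intro prob_space_PiM \<nu>)
  define \<Phi> where "\<Phi> e z = (\<Squnion>H\<in>\<H>. ennreal \<bar>\<Sum>i<n. e i * (indicator H (z i) - indicator H (z (n + i)))\<bar>)" for e :: "nat \<Rightarrow> real" and z
  have [measurable]: "(\<lambda>z. indicator H (z k) :: real) \<in> borel_measurable P" if "H \<in> \<H>" "k < 2 * n" for H k
  proof -
    have "H \<in> sets \<nu>" "k \<in> {..<2*n}" using sH that by auto
    then show ?thesis unfolding P_def by measurable
  qed
  have \<Phi>m: "\<Phi> e \<in> borel_measurable P" for e
    unfolding \<Phi>_def using cH by measurable
  define I where "I = (\<integral>\<^sup>+z. \<Phi> (\<lambda>_. 1) z \<partial>P)"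
  have swap: "(\<integral>\<^sup>+z. \<Phi> e z \<partial>P) = I" if e: "e \<in> signs {..<n}" for e
  proof -
    \<comment> \<open>the coordinate permutation that exchanges \<open>i\<close> and \<open>n + i\<close> wherever \<open>e i = - 1\<close>\<close>
    define \<tau> where "\<tau> k = (if k < n then (if e k = 1 then k else n + k) else (if e (k - n) = 1 then k else k - n))" for k
    define t where "t z = (\<lambda>k\<in>{..<2*n}. z (\<tau> k))" for z :: "nat \<Rightarrow> 'a"
    have "inj_on \<tau> {..<2*n}" by (auto simp: inj_on_def \<tau>_def split: if_splits)
    moreover have "\<tau> \<in> {..<2*n} \<rightarrow> {..<2*n}" by (auto simp: \<tau>_def split: if_splits)
    ultimately have d: "distr P P t = P"
      unfolding P_def t_def by (intro distr_PiM_reindex[of "{..<2*n}" "\<lambda>_. \<nu>" \<tau> "{..<2*n}"]) (auto simp: \<nu>)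
    have tm: "t \<in> measurable P P"
      unfolding P_def t_def by (intro measurable_restrict measurable_component_singleton) (auto simp: \<tau>_def)
    have "I = (\<integral>\<^sup>+z. \<Phi> (\<lambda>_. 1) z \<partial>distr P P t)" unfolding d I_def ..
    also have "\<dots> = (\<integral>\<^sup>+z. \<Phi> (\<lambda>_. 1) (t z) \<partial>P)" by (rule nn_integral_distr) (use tm \<Phi>m in auto)
    also have "\<dots> = (\<integral>\<^sup>+z. \<Phi> e z \<partial>P)"
    proof (intro nn_integral_cong)
      fix z
      have "1 * (indicator H (t z i) - indicator H (t z (n + i))) = e i * (indicator H (z i) - indicator H (z (n + i)) :: real)" if "i < n" for i H
      proof -
        have "e i = 1 \<or> e i = - 1" using e that by (auto simp: PiE_iff)
        then show ?thesis using that by (auto simp: t_def \<tau>_def)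
      qed
      then show "\<Phi> (\<lambda>_. 1) (t z) = \<Phi> e z" unfolding \<Phi>_def by (intro SUP_cong refl arg_cong[where f=ennreal] arg_cong[where f=abs] sum.cong) auto
    qed
    finally show ?thesis by simp
  qed
  have "ennreal (2 ^ n) * I = (\<Sum>e\<in>signs {..<n}. I)"
    by (simp add: card_PiE numeral_2_eq_2 ennreal_power ennreal_of_nat_eq_real_of_nat)
  also have "\<dots> = (\<Sum>e\<in>signs {..<n}. \<integral>\<^sup>+z. \<Phi> e z \<partial>P)" using swap by (intro sum.cong) auto
  also have "\<dots> = (\<integral>\<^sup>+z. (\<Sum>e\<in>signs {..<n}. \<Phi> e z) \<partial>P)"
    by (rule nn_integral_sum[symmetric]) (rule \<Phi>m)
  also have "\<dots> \<le> (\<integral>\<^sup>+z. ennreal (2 ^ n * (2 * chain_const V * sqrt n)) \<partial>P)"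
    unfolding \<Phi>_def by (intro nn_integral_mono symmetrized_average_le gr V n)
  also have "\<dots> = ennreal (2 ^ n) * ennreal (2 * chain_const V * sqrt n)"
    using chain_const_pos[of V] by (simp add: P.emeasure_space_1 ennreal_mult)
  finally have "I \<le> ennreal (2 * chain_const V * sqrt n)"
    by (subst (asm) ennreal_mult_le_mult_iff) auto
  then show ?thesis unfolding I_def \<Phi>_def P_def un by simp
qed

text \<open>The measure of \<open>H\<close> is the expected frequency of \<open>H\<close> in an independent ghost sample; the supremum
  of an expectation is at most the expectation of the supremum. The family is countable so that the
  supremum is measurable.\<close>
theorem expected_sup_deviation_le:
  fixes \<nu> :: "'a measure" and \<H> :: "'a set set" and n :: nat
  assumes \<nu>: "prob_space \<nu>" and cH: "countable \<H>" and sH: "\<H> \<subseteq> sets \<nu>"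
    and gr: "\<And>x :: nat \<Rightarrow> 'a. trace_growth V ((\<lambda>H. {i. x i \<in> H}) ` \<H>)" and V: "V \<ge> 1" and n: "n \<ge> 1"
  shows "(\<integral>\<^sup>+x. (\<Squnion>H\<in>\<H>. ennreal \<bar>(\<Sum>i<n. indicator H (x i)) - n * measure \<nu> H\<bar>) \<partial>(\<Pi>\<^sub>M i\<in>{..<n}. \<nu>))
    \<le> ennreal (2 * chain_const V * sqrt n)"
proof -
  interpret \<nu>: prob_space \<nu> by fact
  interpret PS: product_sigma_finite "\<lambda>_::nat. \<nu>" by standard
  define J where "J = {n..<2*n}"
  define PJ where "PJ = (\<Pi>\<^sub>M i\<in>J. \<nu>)"
  interpret PJ: prob_space PJ unfolding PJ_def by (intro prob_space_PiM \<nu>)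
  define \<Phi> where "\<Phi> z = (\<Squnion>H\<in>\<H>. ennreal \<bar>\<Sum>i<n. indicator H (z i) - indicator H (z (n + i))\<bar>)" for z :: "nat \<Rightarrow> 'a"
  have \<Phi>m: "\<Phi> \<in> borel_measurable (\<Pi>\<^sub>M i\<in>{..<n} \<union> J. \<nu>)"
  proof -
    have [measurable]: "(\<lambda>z. indicator H (z k) :: real) \<in> borel_measurable (\<Pi>\<^sub>M i\<in>{..<n} \<union> J. \<nu>)" if "H \<in> \<H>" "k < 2 * n" for H k
    proof -
      have "H \<in> sets \<nu>" "k \<in> {..<n} \<union> J" using sH that by (auto simp: J_def)
      then show ?thesis by measurable
    qed
    show ?thesis unfolding \<Phi>_def using cH by measurable
  qed
  have "(\<Squnion>H\<in>\<H>. ennreal \<bar>(\<Sum>i<n. indicator H (x i)) - n * measure \<nu> H\<bar>) \<le> (\<integral>\<^sup>+y. \<Phi> (merge {..<n} J (x, y)) \<partial>PJ)" for x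
  proof (rule SUP_least)
    fix H assume H: "H \<in> \<H>"
    then have Hs [measurable]: "H \<in> sets \<nu>" using sH by auto
    define g where "g y = (\<Sum>i<n. indicator H (x i) - indicator H (y (n + i)) :: real)" for y :: "nat \<Rightarrow> 'a"
    have mk: "(\<lambda>y. indicator H (y (n + i)) :: real) \<in> borel_measurable PJ" if "i < n" for i
    proof -
      have "n + i \<in> J" using that by (simp add: J_def)
      then show ?thesis unfolding PJ_def by measurable
    qed
    have ik: "integrable PJ (\<lambda>y. indicator H (y (n + i)) :: real)" if "i < n" for i
      by (rule PJ.integrable_const_bound[of _ 1, OF _ mk[OF that]]) (auto simp: indicator_def)
    have ek: "(\<integral>y. indicator H (y (n + i)) \<partial>PJ) = measure \<nu> H" if "i < n" for i
    proof -
      have nJ: "n + i \<in> J" using that by (simp add: J_def)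
      have "measure \<nu> H = (\<integral>x. indicator H x \<partial>\<nu>)" by simp
      also have "\<dots> = (\<integral>x. indicator H x \<partial>distr PJ \<nu> (\<lambda>\<omega>. \<omega> (n + i)))"
        unfolding PJ_def by (subst distr_PiM_component[OF _ nJ]) (auto simp: \<nu>)
      also have "\<dots> = (\<integral>y. indicator H (y (n + i)) \<partial>PJ)"
        by (rule integral_distr) (use nJ in \<open>auto simp: PJ_def\<close>)
      finally show ?thesis by simp
    qed
    have ig: "integrable PJ g" unfolding g_def using ik by auto
    have "(\<integral>y. g y \<partial>PJ) = (\<Sum>i<n. indicator H (x i)) - n * measure \<nu> H"
    proof -
      have "integrable PJ (\<lambda>y. \<Sum>i<n. indicator H (y (n + i)) :: real)" using ik by auto
      then have "(\<integral>y. g y \<partial>PJ) = (\<Sum>i<n. indicator H (x i)) - (\<integral>y. (\<Sum>i<n. indicator H (y (n + i))) \<partial>PJ)"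
        unfolding g_def sum_subtractf by (subst Bochner_Integration.integral_diff) (auto simp: PJ.prob_space)
      also have "(\<integral>y. (\<Sum>i<n. indicator H (y (n + i))) \<partial>PJ) = n * measure \<nu> H"
        using ik ek by (subst Bochner_Integration.integral_sum) auto
      finally show ?thesis .
    qed
    then have "ennreal \<bar>(\<Sum>i<n. indicator H (x i)) - n * measure \<nu> H\<bar> = ennreal \<bar>\<integral>y. g y \<partial>PJ\<bar>" by simp
    also have "\<dots> \<le> ennreal (\<integral>y. \<bar>g y\<bar> \<partial>PJ)" by (intro ennreal_leI integral_abs_bound)
    also have "\<dots> = (\<integral>\<^sup>+y. ennreal \<bar>g y\<bar> \<partial>PJ)"
      by (rule nn_integral_eq_integral[symmetric]) (use ig in auto)
    also have "\<dots> \<le> (\<integral>\<^sup>+y. \<Phi> (merge {..<n} J (x, y)) \<partial>PJ)"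
    proof (intro nn_integral_mono)
      fix y
      have "g y = (\<Sum>i<n. indicator H (merge {..<n} J (x, y) i) - indicator H (merge {..<n} J (x, y) (n + i)))"
        unfolding g_def by (intro sum.cong) (auto simp: merge_def J_def)
      then show "ennreal \<bar>g y\<bar> \<le> \<Phi> (merge {..<n} J (x, y))"
        unfolding \<Phi>_def by (simp only:) (rule SUP_upper[OF H])
    qed
    finally show "ennreal \<bar>(\<Sum>i<n. indicator H (x i)) - n * measure \<nu> H\<bar> \<le> (\<integral>\<^sup>+y. \<Phi> (merge {..<n} J (x, y)) \<partial>PJ)" .
  qed
  then have "(\<integral>\<^sup>+x. (\<Squnion>H\<in>\<H>. ennreal \<bar>(\<Sum>i<n. indicator H (x i)) - n * measure \<nu> H\<bar>) \<partial>(\<Pi>\<^sub>M i\<in>{..<n}. \<nu>))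
    \<le> (\<integral>\<^sup>+x. (\<integral>\<^sup>+y. \<Phi> (merge {..<n} J (x, y)) \<partial>PJ) \<partial>(\<Pi>\<^sub>M i\<in>{..<n}. \<nu>))"
    by (intro nn_integral_mono)
  also have "\<dots> = (\<integral>\<^sup>+z. \<Phi> z \<partial>(\<Pi>\<^sub>M i\<in>{..<n} \<union> J. \<nu>))"
    unfolding PJ_def by (rule PS.product_nn_integral_fold[symmetric]) (auto simp: J_def \<Phi>m[unfolded J_def])
  also have "\<dots> \<le> ennreal (2 * chain_const V * sqrt n)"
    unfolding \<Phi>_def J_def by (rule ghost_sample_bound[OF assms])
  finally show ?thesis .
qed

section \<open>Mixtures of ridge functions\<close>

text \<open>The neurons. The bound \<open>2\<close> is the largest value on the cube of a ReLU neuron whose inner weight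
  and bias are at most \<open>1\<close>; continuity makes the superlevel sets open halfspaces.\<close>
definition ridge_fun :: "(real^'d \<Rightarrow> real) \<Rightarrow> bool" where
  "ridge_fun u \<longleftrightarrow> (\<exists>\<phi> w b. mono \<phi> \<and> continuous_on UNIV \<phi> \<and> u = (\<lambda>x. \<phi> (w \<bullet> x + b))
     \<and> (\<forall>x\<in>cbox 0 1. 0 \<le> u x \<and> u x \<le> 2))"

lemma ridge_superlevel_halfspace:
  assumes "ridge_fun u"
  shows "\<exists>w b. {x. t < u x} = halfspace w b"
proof -
  obtain \<phi> w b where m: "mono \<phi>" and c: "continuous_on UNIV \<phi>" and u: "u = (\<lambda>x. \<phi> (w \<bullet> x + b))"
    using assms unfolding ridge_fun_def by blast
  define U where "U = {y. t < \<phi> y}"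
  have oU: "open U" unfolding U_def using c by (intro open_Collect_less) auto
  have up: "y' \<in> U" if "y \<in> U" "y \<le> y'" for y y'
    using that monoD[OF m, of y y'] by (auto simp: U_def)
  have uU: "{x. t < u x} = {x. w \<bullet> x + b \<in> U}" by (auto simp: u U_def)
  consider "U = {}" | "U = UNIV" | y1 y0 where "y1 \<in> U" "y0 \<notin> U" by blast
  then show ?thesis
  proof cases
    case 1
    then have "{x. t < u x} = halfspace 0 (- 1)" unfolding uU by (auto simp: halfspace_def)
    then show ?thesis by blast
  next
    case 2
    then have "{x. t < u x} = halfspace 0 1" unfolding uU by (auto simp: halfspace_def)
    then show ?thesis by blast
  next
    case 3
    have lb: "y0 \<le> y" if "y \<in> U" for y using up[OF that, of y0] 3 by (meson linear)
    then have bdd: "bdd_below U" by (auto simp: bdd_below_def)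
    have "y \<in> U \<longleftrightarrow> Inf U < y" for y
    proof
      assume y: "y \<in> U"
      obtain e where e: "e > 0" "ball y e \<subseteq> U" using oU y by (meson open_contains_ball)
      then have "y - e / 2 \<in> U" by (auto simp: dist_real_def subset_iff)
      then have "Inf U \<le> y - e / 2" by (rule cInf_lower[OF _ bdd])
      then show "Inf U < y" using e by simp
    next
      assume "Inf U < y"
      then obtain z where "z \<in> U" "z < y" using cInf_lessD[of U y] 3 by blast
      then show "y \<in> U" using up[of z y] by simp
    qed
    then have "{x. t < u x} = {x. Inf U < w \<bullet> x + b}" unfolding uU by simp
    also have "\<dots> = halfspace w (b - Inf U)" unfolding halfspace_def by (intro Collect_cong) linarith
    finally have "{x. t < u x} = halfspace w (b - Inf U)" .
    then show ?thesis by blast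
  qed
qed

lemma ridge_fun_continuous: "ridge_fun u \<Longrightarrow> continuous_on S u"
proof -
  assume "ridge_fun u"
  then obtain \<phi> w b where c: "continuous_on UNIV \<phi>" and u: "u = (\<lambda>x. \<phi> (w \<bullet> x + b))"
    unfolding ridge_fun_def by blast
  have "continuous_on S (\<lambda>x. w \<bullet> x + b)" by (intro continuous_intros)
  then show "continuous_on S u" unfolding u by (rule continuous_on_compose2[OF c]) simp
qed

lemma ridge_fun_bounds: "ridge_fun u \<Longrightarrow> x \<in> cbox 0 1 \<Longrightarrow> 0 \<le> u x \<and> u x \<le> 2"
  unfolding ridge_fun_def by blast

lemma ridge_fun_const: "0 \<le> c \<Longrightarrow> c \<le> 2 \<Longrightarrow> ridge_fun (\<lambda>x. c)"
  unfolding ridge_fun_def by (intro exI[of _ "\<lambda>_. c"]) (auto simp: mono_def)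

text \<open>The parameter \<open>A\<close> bounds the total size of the coefficients. Measuring a network by \<open>A\<close> and not by
  its number of neurons is what makes the deviation bound independent of the width.\<close>
inductive ridge_mixture :: "real \<Rightarrow> (real^'d \<Rightarrow> real) \<Rightarrow> bool" where
  zero: "ridge_mixture 0 (\<lambda>x. 0)"
| add_ridge: "ridge_mixture A g \<Longrightarrow> ridge_fun u \<Longrightarrow> ridge_mixture (A + \<bar>c\<bar>) (\<lambda>x. g x + c * u x)"

lemma ridge_mixture_nonneg: "ridge_mixture A g \<Longrightarrow> 0 \<le> A"
  by (induction rule: ridge_mixture.induct) auto

lemma ridge_mixture_continuous: "ridge_mixture A g \<Longrightarrow> continuous_on S g"
proof (induction rule: ridge_mixture.induct)
  case (add_ridge A g u c)
  then show ?case using ridge_fun_continuous[of u S] by (intro continuous_on_add continuous_on_mult_left)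
qed simp

lemma ridge_mixture_measurable: "ridge_mixture A g \<Longrightarrow> g \<in> borel_measurable borel"
  using ridge_mixture_continuous[of A g UNIV] by (rule borel_measurable_continuous_onI)

lemma ridge_mixture_bound:
  assumes "ridge_mixture A g" "x \<in> cbox 0 1"
  shows "\<bar>g x\<bar> \<le> 2 * A"
  using assms(1)
proof (induction rule: ridge_mixture.induct)
  case (add_ridge A g u c)
  have "\<bar>c * u x\<bar> \<le> \<bar>c\<bar> * 2" using ridge_fun_bounds[OF add_ridge(2) assms(2)]
    unfolding abs_mult by (intro mult_left_mono) auto
  then show ?case using add_ridge abs_triangle_ineq[of "g x" "c * u x"] by (simp add: algebra_simps)
qed simp

lemma ridge_mixture_add:
  assumes "ridge_mixture B h" "ridge_mixture A g"
  shows "ridge_mixture (A + B) (\<lambda>x. g x + h x)"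
  using assms(1)
proof (induction rule: ridge_mixture.induct)
  case (add_ridge B h u c)
  from ridge_mixture.add_ridge[OF add_ridge(3,2), of c] show ?case by (simp add: add.assoc)
qed (use assms in simp)

lemma ridge_mixture_sum:
  assumes "finite J" "\<And>j. j \<in> J \<Longrightarrow> ridge_fun (u j)"
  shows "ridge_mixture (\<Sum>j\<in>J. \<bar>c j\<bar>) (\<lambda>x. \<Sum>j\<in>J. c j * u j x)"
  using assms
proof (induction J rule: finite_induct)
  case (insert j J)
  from ridge_mixture.add_ridge[OF insert(3), of "u j" "c j"] insert
  show ?case by (simp add: add.commute)
qed (simp add: ridge_mixture.zero)

lemma ridge_mixture_mono:
  assumes "ridge_mixture A g" "A \<le> B"
  shows "ridge_mixture B g"
  using ridge_mixture.add_ridge[OF assms(1) ridge_fun_const[of 0], of "B - A"] assms(2) by simp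

text \<open>Since \<open>u\<close> takes values in \<open>[0, 2]\<close>, it is the integral over \<open>t\<close> in \<open>[0, 2]\<close> of the indicators of
  \<open>{x. t < u x}\<close>. The proof uses Riemann sums \<open>v n\<close> of this integral, which converge uniformly. The
  factor \<open>k\<close> allows a second application to a product of two ridge functions.\<close>
lemma layer_cake_deviation:
  fixes u k :: "'a \<Rightarrow> real"
  assumes p1: "prob_space \<rho>1" and p2: "prob_space \<rho>2" and s: "sets \<rho>1 = sets N" "sets \<rho>2 = sets N"
    and k: "k \<in> borel_measurable N" "\<And>x. x \<in> space N \<Longrightarrow> \<bar>k x\<bar> \<le> K"
    and u: "u \<in> borel_measurable N" "\<And>x. x \<in> space N \<Longrightarrow> 0 \<le> u x \<and> u x \<le> 2"
    and d: "\<And>t. \<bar>(\<integral>x. k x * indicator {x. t < u x} x \<partial>\<rho>1) - (\<integral>x. k x * indicator {x. t < u x} x \<partial>\<rho>2)\<bar> \<le> \<delta>"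
  shows "\<bar>(\<integral>x. k x * u x \<partial>\<rho>1) - (\<integral>x. k x * u x \<partial>\<rho>2)\<bar> \<le> 2 * \<delta>"
proof -
  define v where "v n x = (\<Sum>j<2 * n. (1 / real n) * indicator {x. real j / real n < u x} x)" for n x
  have sp: "space \<rho>1 = space N" "space \<rho>2 = space N" using s by (auto dest: sets_eq_imp_space_eq)
  have vu: "\<bar>u x - v n x\<bar> \<le> 1 / real n" if x: "x \<in> space N" and n: "n \<ge> 1" for x n
  proof -
    define m where "m = nat \<lceil>real n * u x\<rceil>"
    have ux: "0 \<le> u x" "u x \<le> 2" using u(2)[OF x] by auto
    have ny: "0 \<le> real n * u x" "real n * u x \<le> real (2 * n)"
      using ux n mult_left_mono[of "u x" 2 "real n"] by auto
    have m: "real n * u x \<le> real m" "real m < real n * u x + 1" "m \<le> 2 * n"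
      unfolding m_def using ny by linarith+
    have "v n x = (\<Sum>j<2 * n. if j < m then 1 / real n else 0)"
      unfolding v_def
    proof (intro sum.cong refl)
      fix j
      have "real j / real n < u x \<longleftrightarrow> real j < real n * u x" using n by (simp add: field_simps)
      also have "\<dots> \<longleftrightarrow> j < m" unfolding m_def using ny by linarith
      finally show "1 / real n * indicator {x. real j / real n < u x} x = (if j < m then 1 / real n else 0)" by simp
    qed
    also have "\<dots> = (\<Sum>j\<in>{j\<in>{..<2*n}. j < m}. 1 / real n)" by (rule sum.inter_filter[symmetric]) simp
    also have "{j\<in>{..<2*n}. j < m} = {..<m}" using m(3) by auto
    finally have "v n x = real m / real n" by simp
    then have "u x - v n x = (real n * u x - real m) / real n" using n by (simp add: field_simps)
    then have "\<bar>u x - v n x\<bar> = \<bar>real n * u x - real m\<bar> / real n" by simp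
    also have "\<dots> \<le> 1 / real n" using m by (intro divide_right_mono) auto
    finally show ?thesis .
  qed
  have K0: "K \<ge> 0"
  proof -
    obtain x where "x \<in> space N" using prob_space.not_empty[OF p1] sp by blast
    then show ?thesis using k(2)[of x] by linarith
  qed
  have int: "integrable \<rho> (\<lambda>x. k x * indicator {x. t < u x} x)" "integrable \<rho> (\<lambda>x. k x * u x)"
    "integrable \<rho> (\<lambda>x. k x * v n x)"
    if p: "prob_space \<rho>" "sets \<rho> = sets N" for \<rho> t n
  proof -
    interpret prob_space \<rho> by fact
    have sp: "space \<rho> = space N" using p by (auto dest: sets_eq_imp_space_eq)
    have [measurable]: "k \<in> borel_measurable \<rho>" "u \<in> borel_measurable \<rho>"
      using k(1) u(1) measurable_cong_sets[OF p(2) refl] by auto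
    have I: "integrable \<rho> (\<lambda>x. k x * indicator {x. t < u x} x)" for t
    proof (rule integrable_const_bound[of _ K])
      show "AE x in \<rho>. norm (k x * indicator {x. t < u x} x) \<le> K"
        using k(2) sp K0 by (auto simp: indicator_def)
      have "(\<lambda>x. k x * indicator {x\<in>space \<rho>. t < u x} x) \<in> borel_measurable \<rho>" by measurable
      then show "(\<lambda>x. k x * indicator {x. t < u x} x) \<in> borel_measurable \<rho>"
        by (rule measurable_cong[THEN iffD1, rotated]) (auto simp: indicator_def)
    qed
    show "integrable \<rho> (\<lambda>x. k x * indicator {x. t < u x} x)" by (rule I)
    show "integrable \<rho> (\<lambda>x. k x * u x)"
    proof (rule integrable_const_bound[of _ "K * 2"])
      show "AE x in \<rho>. norm (k x * u x) \<le> K * 2"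
        using k(2) u(2) sp K0 by (auto simp: abs_mult intro!: mult_mono)
    qed measurable
    have "(\<lambda>x. k x * v n x) = (\<lambda>x. \<Sum>j<2 * n. (1 / real n) * (k x * indicator {x. real j / real n < u x} x))"
      unfolding v_def by (auto simp: sum_distrib_left fun_eq_iff intro!: sum.cong)
    then show "integrable \<rho> (\<lambda>x. k x * v n x)" by (auto intro!: Bochner_Integration.integrable_sum I)
  qed
  have vi: "(\<integral>x. k x * v n x \<partial>\<rho>) = (\<Sum>j<2 * n. (1 / real n) * (\<integral>x. k x * indicator {x. real j / real n < u x} x \<partial>\<rho>))"
    if p: "prob_space \<rho>" "sets \<rho> = sets N" for \<rho> n
  proof -
    have "(\<integral>x. k x * v n x \<partial>\<rho>) = (\<integral>x. (\<Sum>j<2 * n. (1 / real n) * (k x * indicator {x. real j / real n < u x} x)) \<partial>\<rho>)"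
      unfolding v_def by (intro Bochner_Integration.integral_cong) (auto simp: sum_distrib_left intro!: sum.cong)
    then show ?thesis using int(1)[OF p] by (simp add: Bochner_Integration.integral_sum)
  qed
  have app: "\<bar>(\<integral>x. k x * u x \<partial>\<rho>) - (\<integral>x. k x * v n x \<partial>\<rho>)\<bar> \<le> K / real n"
    if p: "prob_space \<rho>" "sets \<rho> = sets N" and n: "n \<ge> 1" for \<rho> n
  proof -
    interpret prob_space \<rho> by fact
    have sp: "space \<rho> = space N" using p by (auto dest: sets_eq_imp_space_eq)
    have "\<bar>(\<integral>x. k x * u x \<partial>\<rho>) - (\<integral>x. k x * v n x \<partial>\<rho>)\<bar> = \<bar>\<integral>x. k x * u x - k x * v n x \<partial>\<rho>\<bar>"
      using int[OF p] by simp
    also have "\<dots> \<le> (\<integral>x. \<bar>k x * u x - k x * v n x\<bar> \<partial>\<rho>)" by (rule integral_abs_bound)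
    also have "\<dots> \<le> (\<integral>x. K / real n \<partial>\<rho>)"
    proof (rule integral_mono)
      show "integrable \<rho> (\<lambda>x. \<bar>k x * u x - k x * v n x\<bar>)" using int[OF p] by auto
      fix x assume "x \<in> space \<rho>"
      then have "\<bar>k x\<bar> * \<bar>u x - v n x\<bar> \<le> K * (1 / real n)"
        using k(2) vu[OF _ n] sp K0 by (intro mult_mono) auto
      then show "\<bar>k x * u x - k x * v n x\<bar> \<le> K / real n" by (simp add: abs_mult flip: right_diff_distrib)
    qed simp
    also have "\<dots> = K / real n" by (simp add: prob_space)
    finally show ?thesis .
  qed
  have fin: "\<bar>(\<integral>x. k x * u x \<partial>\<rho>1) - (\<integral>x. k x * u x \<partial>\<rho>2)\<bar> \<le> 2 * \<delta> + 2 * K / real n" if n: "n \<ge> 1" for n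
  proof -
    have "\<bar>(\<integral>x. k x * v n x \<partial>\<rho>1) - (\<integral>x. k x * v n x \<partial>\<rho>2)\<bar>
       = \<bar>\<Sum>j<2*n. (1 / real n) * ((\<integral>x. k x * indicator {x. real j / real n < u x} x \<partial>\<rho>1) - (\<integral>x. k x * indicator {x. real j / real n < u x} x \<partial>\<rho>2))\<bar>"
      unfolding vi[OF p1 s(1)] vi[OF p2 s(2)] by (simp add: sum_subtractf diff_divide_distrib)
    also have "\<dots> \<le> (\<Sum>j<2*n. (1 / real n) * \<delta>)"
    proof (rule order_trans[OF sum_abs], rule sum_mono)
      fix j
      show "\<bar>(1 / real n) * ((\<integral>x. k x * indicator {x. real j / real n < u x} x \<partial>\<rho>1) - (\<integral>x. k x * indicator {x. real j / real n < u x} x \<partial>\<rho>2))\<bar> \<le> (1 / real n) * \<delta>"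
        unfolding abs_mult using d[of "real j / real n"] by (intro mult_mono) auto
    qed
    also have "\<dots> = 2 * \<delta>" using n by simp
    finally show ?thesis using app[OF p1 s(1) n] app[OF p2 s(2) n] by linarith
  qed
  have "(\<lambda>n. 2 * \<delta> + 2 * K / real n) \<longlonglongrightarrow> 2 * \<delta> + 0"
    by (intro tendsto_intros lim_const_over_n)
  then show ?thesis by (intro LIMSEQ_le_const[of _ "2 * \<delta>"]) (auto intro!: exI[of _ 1] fin)
qed

lemma sets_restrict_cube_measurable:
  "f \<in> borel_measurable borel \<Longrightarrow> sets \<rho> = sets (restrict_space borel X) \<Longrightarrow> f \<in> borel_measurable \<rho>"
  using measurable_cong_sets[of \<rho> "restrict_space borel X" borel borel] measurable_restrict_space1[of f borel borel X]
  by blast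

text \<open>The statement is bilinear in \<open>g\<close> and \<open>h\<close>, so it suffices to treat two ridge functions. Two layer-cake
  decompositions reduce these to products of indicators of halfspaces, each costing a factor \<open>2\<close>.\<close>
lemma mixture_product_deviation:
  fixes \<rho>1 \<rho>2 :: "(real^'d) measure"
  assumes p1: "prob_space \<rho>1" and p2: "prob_space \<rho>2"
    and s: "sets \<rho>1 = sets (restrict_space borel (cbox 0 1))" "sets \<rho>2 = sets (restrict_space borel (cbox 0 1))"
    and d: "\<And>w b w' b'. \<bar>measure \<rho>1 (cbox 0 1 \<inter> (halfspace w b \<inter> halfspace w' b')) - measure \<rho>2 (cbox 0 1 \<inter> (halfspace w b \<inter> halfspace w' b'))\<bar> \<le> \<delta>"
    and g: "ridge_mixture A g" and h: "ridge_mixture B h"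
  shows "\<bar>(\<integral>x. g x * h x \<partial>\<rho>1) - (\<integral>x. g x * h x \<partial>\<rho>2)\<bar> \<le> 4 * A * B * \<delta>"
proof -
  let ?X = "cbox 0 1 :: (real^'d) set"
  let ?N = "restrict_space borel ?X"
  have sp: "space \<rho>1 = ?X" "space \<rho>2 = ?X" "space ?N = ?X"
    using s by (auto dest!: sets_eq_imp_space_eq simp: space_restrict_space)
  define T where "T f = (\<integral>x. f x \<partial>\<rho>1) - (\<integral>x. f x \<partial>\<rho>2)" for f :: "real^'d \<Rightarrow> real"
  have int: "integrable \<rho>1 f" "integrable \<rho>2 f"
    if "f \<in> borel_measurable borel" "\<And>x. x \<in> ?X \<Longrightarrow> \<bar>f x\<bar> \<le> c" for f and c :: real
    using sets_restrict_cube_measurable[OF that(1) s(1)] sets_restrict_cube_measurable[OF that(1) s(2)] that(2) p1 p2 sp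
    by (auto intro!: finite_measure.integrable_const_bound[of _ _ c] simp: prob_space_def)
  have um: "u \<in> borel_measurable borel" if "ridge_fun u" for u :: "real^'d \<Rightarrow> real"
    using ridge_fun_continuous[OF that] by (intro borel_measurable_continuous_onI)
  have hm: "halfspace w b \<inter> ?X \<in> sets \<rho>" if "sets \<rho> = sets ?N" for w b and \<rho> :: "(real^'d) measure"
    unfolding that by (auto simp: sets_restrict_space)
  have base: "\<bar>T (\<lambda>x. u x * v x)\<bar> \<le> 4 * \<delta>" if u: "ridge_fun u" and v: "ridge_fun v" for u v
  proof -
    have 1: "\<bar>T (\<lambda>x. indicator {x. t < u x} x * v x)\<bar> \<le> 2 * \<delta>" for t
      unfolding T_def
    proof (rule layer_cake_deviation[OF p1 p2 s, where K=1])
      obtain w b where wb: "{x. t < u x} = halfspace w b" using ridge_superlevel_halfspace[OF u] by blast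
      show "indicator {x. t < u x} \<in> borel_measurable ?N"
        unfolding wb by (intro measurable_restrict_space1) measurable
      show "v \<in> borel_measurable ?N" by (intro measurable_restrict_space1 um v)
      show "0 \<le> v x \<and> v x \<le> 2" if "x \<in> space ?N" for x using that ridge_fun_bounds[OF v] sp by auto
      fix r
      obtain w' b' where wb': "{x. r < v x} = halfspace w' b'" using ridge_superlevel_halfspace[OF v] by blast
      have eq: "(\<integral>x. (indicator (halfspace w b) x :: real) * indicator (halfspace w' b') x \<partial>\<rho>) = measure \<rho> (?X \<inter> (halfspace w b \<inter> halfspace w' b'))"
        if r: "sets \<rho> = sets ?N" "prob_space \<rho>" for \<rho> :: "(real^'d) measure"
      proof -
        interpret prob_space \<rho> by fact
        have spr: "space \<rho> = ?X" using r sp by (auto dest!: sets_eq_imp_space_eq)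
        have "(\<integral>x. (indicator (halfspace w b) x :: real) * indicator (halfspace w' b') x \<partial>\<rho>)
          = (\<integral>x. indicator (?X \<inter> (halfspace w b \<inter> halfspace w' b')) x \<partial>\<rho>)"
          by (intro Bochner_Integration.integral_cong refl) (auto simp: spr indicator_def)
        then show ?thesis by (simp add: spr Int_absorb2)
      qed
      show "\<bar>(\<integral>x. indicator {x. t < u x} x * indicator {x. r < v x} x \<partial>\<rho>1) - (\<integral>x. indicator {x. t < u x} x * indicator {x. r < v x} x \<partial>\<rho>2)\<bar> \<le> \<delta>"
        unfolding wb wb' eq[OF s(1) p1] eq[OF s(2) p2] by (rule d)
    qed (auto simp: indicator_def)
    have "\<bar>(\<integral>x. v x * u x \<partial>\<rho>1) - (\<integral>x. v x * u x \<partial>\<rho>2)\<bar> \<le> 2 * (2 * \<delta>)"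
    proof (rule layer_cake_deviation[OF p1 p2 s, where K=2])
      show "v \<in> borel_measurable ?N" "u \<in> borel_measurable ?N" by (intro measurable_restrict_space1 um v u)+
      show "0 \<le> u x \<and> u x \<le> 2" if "x \<in> space ?N" for x using that ridge_fun_bounds[OF u] sp by auto
      show "\<bar>v x\<bar> \<le> 2" if "x \<in> space ?N" for x using that ridge_fun_bounds[OF v, of x] sp by auto
      show "\<bar>(\<integral>x. v x * indicator {x. t < u x} x \<partial>\<rho>1) - (\<integral>x. v x * indicator {x. t < u x} x \<partial>\<rho>2)\<bar> \<le> 2 * \<delta>" for t
        using 1[of t] unfolding T_def by (simp add: mult.commute)
    qed
    then show ?thesis unfolding T_def by (simp add: mult.commute)
  qed
  have bnd: "\<bar>f x * k x\<bar> \<le> (2 * a) * (2 * c)" if "ridge_mixture a f" "ridge_mixture c k" "x \<in> ?X" for f k x and a c :: real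
    using ridge_mixture_bound[OF that(1,3)] ridge_mixture_bound[OF that(2,3)] ridge_mixture_nonneg[OF that(1)]
    unfolding abs_mult by (intro mult_mono) auto
  have single: "ridge_mixture 1 u" if "ridge_fun u" for u :: "real^'d \<Rightarrow> real"
    using ridge_mixture.add_ridge[OF ridge_mixture.zero that, of 1] by simp
  have Tadd: "T (\<lambda>x. (f x + c * u x) * k x) = T (\<lambda>x. f x * k x) + c * T (\<lambda>x. u x * k x)"
    if f: "ridge_mixture a f" and u: "ridge_fun u" and k: "ridge_mixture e k" for f u k and a c e :: real
  proof -
    have m: "(\<lambda>x. f x * k x) \<in> borel_measurable borel" "(\<lambda>x. u x * k x) \<in> borel_measurable borel"
      using ridge_mixture_measurable[OF f] ridge_mixture_measurable[OF k] um[OF u] by measurable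
    note i1 = int[OF m(1) bnd[OF f k]] and i2 = int[OF m(2) bnd[OF single[OF u] k]]
    have "(\<lambda>x. (f x + c * u x) * k x) = (\<lambda>x. f x * k x + c * (u x * k x))" by (simp add: algebra_simps)
    then show ?thesis unfolding T_def using i1 i2 by (simp add: algebra_simps)
  qed
  have step1: "\<bar>T (\<lambda>x. g x * v x)\<bar> \<le> 4 * A * \<delta>" if v: "ridge_fun v" for v
    using g
  proof (induction rule: ridge_mixture.induct)
    case (add_ridge A g u c)
    have "\<bar>c * T (\<lambda>x. u x * v x)\<bar> \<le> \<bar>c\<bar> * (4 * \<delta>)" unfolding abs_mult by (intro mult_left_mono base add_ridge v) simp
    then show ?case unfolding Tadd[OF add_ridge(1,2) single[OF v]] using add_ridge(3) by (simp add: algebra_simps)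
  qed (simp add: T_def)
  have "\<bar>T (\<lambda>x. h x * g x)\<bar> \<le> 4 * A * B * \<delta>"
    using h
  proof (induction rule: ridge_mixture.induct)
    case (add_ridge B h u c)
    have "\<bar>c * T (\<lambda>x. u x * g x)\<bar> \<le> \<bar>c\<bar> * (4 * A * \<delta>)"
      unfolding abs_mult using step1[OF add_ridge(2)] by (intro mult_left_mono) (simp_all add: mult.commute)
    then show ?case unfolding Tadd[OF add_ridge(1,2) g] using add_ridge(3) by (simp add: algebra_simps)
  qed (simp add: T_def)
  then show ?thesis unfolding T_def by (simp add: mult.commute)
qed

section \<open>Deviation of the empirical measure on network classes\<close>

lemma abs_inner_le_l1norm:
  fixes x :: "real^'d"
  assumes "x \<in> cbox 0 1"
  shows "\<bar>w \<bullet> x\<bar> \<le> l1norm w"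
proof -
  have x: "0 \<le> x $ i" "x $ i \<le> 1" for i using assms by (auto simp: mem_box_cart)
  have "\<bar>w \<bullet> x\<bar> \<le> (\<Sum>i\<in>UNIV. \<bar>w $ i * x $ i\<bar>)"
    unfolding inner_vec_def by (simp add: sum_abs)
  also have "\<dots> \<le> l1norm w"
    unfolding l1norm_def abs_mult using x by (intro sum_mono mult_left_le) auto
  finally show ?thesis .
qed

lemma ridge_fun_relu:
  assumes "l1norm w \<le> 1" "\<bar>b\<bar> \<le> 1"
  shows "ridge_fun (\<lambda>x :: real^'d. relu (w \<bullet> x + b))"
  unfolding ridge_fun_def
proof (intro exI conjI ballI)
  show "mono relu" by (auto simp: relu_def mono_def max_def)
  show "continuous_on UNIV relu" unfolding relu_def by (intro continuous_intros)
  fix x :: "real^'d" assume "x \<in> cbox 0 1"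
  then have "\<bar>w \<bullet> x\<bar> \<le> 1" using abs_inner_le_l1norm assms(1) by (meson order_trans)
  then show "0 \<le> relu (w \<bullet> x + b)" "relu (w \<bullet> x + b) \<le> 2" using assms(2) by (auto simp: relu_def)
qed simp

lemma sigmoid_bounds: "0 < sigmoid z" "sigmoid z < 1"
proof -
  have "1 < 1 + exp (- z)" by simp
  moreover have "0 < 1 + exp (- z)" by (simp add: add_pos_pos)
  ultimately show "0 < sigmoid z" "sigmoid z < 1" unfolding sigmoid_def by (simp_all add: inverse_less_1_iff)
qed

lemma continuous_sigmoid: "continuous_on S sigmoid"
proof -
  have "1 + exp (- z) \<noteq> 0" for z :: real using exp_gt_zero[of "- z"] by linarith
  then show ?thesis unfolding sigmoid_def by (intro continuous_intros) auto
qed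

lemma ridge_fun_sigmoid: "ridge_fun (\<lambda>x :: real^'d. sigmoid (w \<bullet> x + b))"
  unfolding ridge_fun_def
proof (intro exI conjI ballI)
  show "mono sigmoid" unfolding sigmoid_def mono_def
    by (auto intro!: le_imp_inverse_le add_pos_pos)
  show "continuous_on UNIV sigmoid" by (rule continuous_sigmoid)
  fix x :: "real^'d"
  show "0 \<le> sigmoid (w \<bullet> x + b)" "sigmoid (w \<bullet> x + b) \<le> 2"
    using sigmoid_bounds[of "w \<bullet> x + b"] by simp_all
qed simp

lemma ridge_fun_coordinate: "ridge_fun (\<lambda>x :: real^'d. x $ j)"
  unfolding ridge_fun_def
proof (intro exI[of _ "\<lambda>y. y"] exI[of _ "axis j 1"] exI[of _ 0] conjI ballI)
  fix x :: "real^'d" assume "x \<in> cbox 0 1"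
  then have "0 \<le> x $ j" "x $ j \<le> 1" by (auto simp: mem_box_cart)
  then show "0 \<le> x $ j" "x $ j \<le> 2" by auto
qed (auto simp: mono_def inner_axis')

lemma ridge_mixture_network:
  fixes k :: nat
  assumes r: "\<And>i. i \<in> {1..k} \<Longrightarrow> ridge_fun (\<lambda>x :: real^'d. \<phi> (w i \<bullet> x + b i))"
  shows "ridge_mixture ((\<Sum>i=1..k. \<bar>\<beta> i\<bar>) + l1norm w0 + \<bar>b0\<bar>)
     (\<lambda>x :: real^'d. (\<Sum>i=1..k. \<beta> i * \<phi> (w i \<bullet> x + b i)) + w0 \<bullet> x + b0)"
proof -
  have 1: "ridge_mixture (\<Sum>i=1..k. \<bar>\<beta> i\<bar>) (\<lambda>x :: real^'d. \<Sum>i=1..k. \<beta> i * \<phi> (w i \<bullet> x + b i))"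
    using r by (intro ridge_mixture_sum) auto
  have 2: "ridge_mixture (l1norm w0) (\<lambda>x :: real^'d. w0 \<bullet> x)"
    unfolding l1norm_def inner_vec_def
    by (simp only: inner_real_def) (intro ridge_mixture_sum ridge_fun_coordinate finite)
  from ridge_mixture.add_ridge[OF ridge_mixture_add[OF 2 1] ridge_fun_const[of 1], of b0]
  show ?thesis by simp
qed

text \<open>The outer weights contribute \<open>n * (2 * a / n) = 2 * a\<close>, the linear part and the bias at most
  \<open>a\<close> each.\<close>
lemma ridge_mixture_nets:
  fixes g :: "real^'d \<Rightarrow> real"
  assumes a: "a \<ge> 0" and n: "n \<ge> 1" and g: "g \<in> relu_nets n a \<or> g \<in> sigmoid_nets n a"
  shows "ridge_mixture (4 * a) g"
proof -
  have sumb: "(\<Sum>i=1..n. \<bar>\<beta> i\<bar>) \<le> 2 * a" if "\<And>i. i \<in> {1..n} \<Longrightarrow> \<bar>\<beta> i\<bar> \<le> 2 / real n * a" for \<beta> :: "nat \<Rightarrow> real"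
  proof -
    have "(\<Sum>i=1..n. \<bar>\<beta> i\<bar>) \<le> (\<Sum>i=1..n. 2 / real n * a)" using that by (intro sum_mono) auto
    also have "\<dots> = 2 * a" using n by simp
    finally show ?thesis .
  qed
  from g show ?thesis
  proof
    assume "g \<in> relu_nets n a"
    then obtain \<beta> and w :: "nat \<Rightarrow> real^'d" and b w0 b0 where
      h0: "\<forall>i\<in>{1..n}. max (l1norm (w i)) \<bar>b i\<bar> \<le> 1 \<and> \<bar>\<beta> i\<bar> \<le> 2 / real n * a" "\<bar>b0\<bar> \<le> a" "l1norm w0 \<le> a"
      and g: "g = (\<lambda>x. (\<Sum>i=1..n. \<beta> i * relu (w i \<bullet> x + b i)) + w0 \<bullet> x + b0)"
      unfolding relu_nets_def nn_class_def mem_Collect_eq by blast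
    have h: "l1norm (w i) \<le> 1" "\<bar>b i\<bar> \<le> 1" "\<bar>\<beta> i\<bar> \<le> 2 / real n * a" if "i \<in> {1..n}" for i
      using h0(1) that by (auto simp del: atLeastAtMost_iff)
    have "ridge_mixture ((\<Sum>i=1..n. \<bar>\<beta> i\<bar>) + l1norm w0 + \<bar>b0\<bar>) g"
      unfolding g by (intro ridge_mixture_network ridge_fun_relu h)
    moreover have "(\<Sum>i=1..n. \<bar>\<beta> i\<bar>) \<le> 2 * a" by (rule sumb) (rule h(3))
    ultimately show ?thesis using h0(2,3) by (intro ridge_mixture_mono[of _ g "4 * a"]) auto
  next
    assume "g \<in> sigmoid_nets n a"
    then obtain \<beta> and w :: "nat \<Rightarrow> real^'d" and b w0 b0 where
      h0: "\<forall>i\<in>{1..n}. max (l1norm (w i)) \<bar>b i\<bar> \<le> sqrt (real n) * ln (real n) \<and> \<bar>\<beta> i\<bar> \<le> 2 / real n * a" "\<bar>b0\<bar> \<le> a" "l1norm w0 \<le> 0"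
      and g: "g = (\<lambda>x. (\<Sum>i=1..n. \<beta> i * sigmoid (w i \<bullet> x + b i)) + w0 \<bullet> x + b0)"
      unfolding sigmoid_nets_def nn_class_def mem_Collect_eq by blast
    have h: "\<bar>\<beta> i\<bar> \<le> 2 / real n * a" if "i \<in> {1..n}" for i
      using h0(1) that by blast
    have "ridge_mixture ((\<Sum>i=1..n. \<bar>\<beta> i\<bar>) + l1norm w0 + \<bar>b0\<bar>) g"
      unfolding g by (intro ridge_mixture_network ridge_fun_sigmoid)
    moreover have "(\<Sum>i=1..n. \<bar>\<beta> i\<bar>) \<le> 2 * a" by (rule sumb) (rule h)
    ultimately show ?thesis using h0(2,3) a by (intro ridge_mixture_mono[of _ g "4 * a"]) auto
  qed
qed

definition dense_params :: "('a::euclidean_space \<times> real) set" where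
  "dense_params = (SOME D. countable D \<and> (\<forall>U. open U \<longrightarrow> U \<noteq> {} \<longrightarrow> (\<exists>d\<in>D. d \<in> U)))"

lemma dense_params:
  "countable (dense_params :: ('a::euclidean_space \<times> real) set)"
  "open U \<Longrightarrow> U \<noteq> {} \<Longrightarrow> \<exists>d\<in>(dense_params :: ('a \<times> real) set). d \<in> U"
proof -
  have "\<exists>D :: ('a \<times> real) set. countable D \<and> (\<forall>U. open U \<longrightarrow> U \<noteq> {} \<longrightarrow> (\<exists>d\<in>D. d \<in> U))"
    using countable_dense_exists[where 'a="'a \<times> real"] by metis
  then have "countable (dense_params :: ('a \<times> real) set) \<and> (\<forall>U. open U \<longrightarrow> U \<noteq> {} \<longrightarrow> (\<exists>d\<in>(dense_params :: ('a \<times> real) set). d \<in> U))"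
    unfolding dense_params_def by (rule someI_ex)
  then show "countable (dense_params :: ('a \<times> real) set)" "open U \<Longrightarrow> U \<noteq> {} \<Longrightarrow> \<exists>d\<in>(dense_params :: ('a \<times> real) set). d \<in> U"
    by auto
qed

text \<open>A countable family, so that suprema over it are measurable; by density it controls the
  intersections of all pairs of halfspaces.\<close>
definition cube_wedges :: "(real^'d) set set" where
  "cube_wedges = (\<lambda>(p, q). cbox 0 1 \<inter> (halfspace (fst p) (snd p) \<inter> halfspace (fst q) (snd q))) ` (dense_params \<times> dense_params)"

lemma countable_cube_wedges: "countable (cube_wedges :: (real^'d) set set)"
  unfolding cube_wedges_def
  by (rule countable_image) (rule countable_SIGMA; rule dense_params(1))

lemma cube_wedges_sets: "(cube_wedges :: (real^'d) set set) \<subseteq> sets (restrict_space borel (cbox 0 1))"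
proof
  fix H :: "(real^'d) set" assume "H \<in> cube_wedges"
  then obtain p q :: "(real^'d) \<times> real" where "H = cbox 0 1 \<inter> (halfspace (fst p) (snd p) \<inter> halfspace (fst q) (snd q))"
    unfolding cube_wedges_def by (elim imageE) (auto simp: case_prod_unfold)
  moreover have "halfspace (fst p) (snd p) \<inter> halfspace (fst q) (snd q) \<in> sets borel" by measurable
  ultimately show "H \<in> sets (restrict_space borel (cbox 0 1))"
    unfolding sets_restrict_space by blast
qed

lemma trace_growth_cube_wedges:
  fixes x :: "nat \<Rightarrow> real^'d"
  shows "trace_growth (2 * (CARD('d) + 1)) ((\<lambda>H. {i. x i \<in> H}) ` cube_wedges)"
proof -
  have g: "trace_growth (2 * (CARD('d) + 1)) {{i. x i \<in> halfspace w b \<inter> halfspace w' b'} |w b w' b'. True}"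
    using trace_growth_halfspace_Int[of x] by simp
  show ?thesis
    by (rule trace_growth_mono[OF trace_growth_restrict[OF g, of "{i. x i \<in> cbox 0 1}"]])
       (auto simp: cube_wedges_def image_iff; blast)
qed

text \<open>Parameters close to \<open>(w, b)\<close> alone would misclassify points on the boundary of the open halfspace.
  Approximating \<open>(w, b - e k)\<close> within a small multiple of \<open>e k\<close> leaves the boundary points outside,
  and every point of the halfspace itself is eventually included as \<open>e k\<close> tends to \<open>0\<close>.\<close>
lemma halfspace_approximation:
  fixes w :: "real^'d"
  shows "\<exists>p. (\<forall>k::nat. p k \<in> dense_params) \<and>
    (\<forall>x\<in>cbox 0 1. \<forall>\<^sub>F k in sequentially. x \<in> halfspace (fst (p k)) (snd (p k)) \<longleftrightarrow> x \<in> halfspace w b)"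
proof -
  define R where "R = 1 + real CARD('d)"
  have R: "R \<ge> 1" by (simp add: R_def)
  have nx: "norm x \<le> R" if "x \<in> cbox 0 1" for x :: "real^'d"
  proof -
    have "norm x \<le> (\<Sum>i\<in>UNIV. \<bar>x $ i\<bar>)" by (rule norm_le_l1_cart)
    also have "\<dots> \<le> (\<Sum>i\<in>(UNIV::'d set). 1)" using that by (intro sum_mono) (auto simp: mem_box_cart)
    finally show ?thesis by (simp add: R_def)
  qed
  define e where "e k = 1 / (real k + 1)" for k :: nat
  have e: "e k > 0" for k by (simp add: e_def)
  have "\<exists>d\<in>dense_params. d \<in> ball (w, b - e k) (e k / (4 * R))" for k
    by (rule dense_params) (use e[of k] R in \<open>simp_all add: not_le divide_pos_pos\<close>)
  then obtain p where p: "\<And>k. p k \<in> dense_params" "\<And>k. p k \<in> ball (w, b - e k) (e k / (4 * R))" by metis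
  have close: "\<bar>(fst (p k) \<bullet> x + snd (p k)) - (w \<bullet> x + b - e k)\<bar> \<le> e k / 2" if x: "x \<in> cbox 0 1" for k x
  proof -
    have d: "dist (p k) (w, b - e k) < e k / (4 * R)" using p(2)[of k] by (simp add: dist_commute)
    have d1: "norm (fst (p k) - w) \<le> e k / (4 * R)" using dist_fst_le[of "p k" "(w, b - e k)"] d by (simp add: dist_norm)
    have d2: "\<bar>snd (p k) - (b - e k)\<bar> \<le> e k / (4 * R)" using dist_snd_le[of "p k" "(w, b - e k)"] d by (simp add: dist_real_def)
    have "\<bar>(fst (p k) - w) \<bullet> x\<bar> \<le> norm (fst (p k) - w) * norm x" by (rule Cauchy_Schwarz_ineq2)
    also have "\<dots> \<le> e k / (4 * R) * R" using d1 nx[OF x] R e[of k] by (intro mult_mono) auto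
    also have "\<dots> = e k / 4" using R by simp
    finally have a: "\<bar>(fst (p k) - w) \<bullet> x\<bar> \<le> e k / 4" .
    have "e k / (4 * R) \<le> e k / 4" using R e[of k] by (intro divide_left_mono) auto
    with d2 have c: "\<bar>snd (p k) - (b - e k)\<bar> \<le> e k / 4" by linarith
    have "(fst (p k) \<bullet> x + snd (p k)) - (w \<bullet> x + b - e k) = (fst (p k) - w) \<bullet> x + (snd (p k) - (b - e k))"
      by (simp add: inner_diff_left)
    with a c show ?thesis by linarith
  qed
  have e0: "e \<longlonglongrightarrow> 0" unfolding e_def by real_asymp
  have "\<forall>\<^sub>F k in sequentially. x \<in> halfspace (fst (p k)) (snd (p k)) \<longleftrightarrow> x \<in> halfspace w b" if x: "x \<in> cbox 0 1" for x
  proof (cases "w \<bullet> x + b > 0")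
    case True
    then have "\<forall>\<^sub>F k in sequentially. e k < (w \<bullet> x + b) / 2" using e0 by (intro order_tendstoD(2)) auto
    then show ?thesis
    proof eventually_elim
      case (elim k)
      then show ?case using close[OF x, of k] True unfolding halfspace_def by (auto; linarith)
    qed
  next
    case False
    then show ?thesis
    proof (intro always_eventually allI)
      fix k
      show "x \<in> halfspace (fst (p k)) (snd (p k)) \<longleftrightarrow> x \<in> halfspace w b"
        using close[OF x, of k] False e[of k] unfolding halfspace_def by (auto; linarith)
    qed
  qed
  with p(1) show ?thesis by blast
qed

lemma wedge_deviation_dense:
  fixes \<rho>1 \<rho>2 :: "(real^'d) measure"
  assumes p1: "prob_space \<rho>1" and p2: "prob_space \<rho>2"
    and s: "sets \<rho>1 = sets (restrict_space borel (cbox 0 1))" "sets \<rho>2 = sets (restrict_space borel (cbox 0 1))"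
    and d: "\<And>H. H \<in> cube_wedges \<Longrightarrow> \<bar>measure \<rho>1 H - measure \<rho>2 H\<bar> \<le> \<delta>"
  shows "\<bar>measure \<rho>1 (cbox 0 1 \<inter> (halfspace w b \<inter> halfspace w' b')) - measure \<rho>2 (cbox 0 1 \<inter> (halfspace w b \<inter> halfspace w' b'))\<bar> \<le> \<delta>"
proof -
  let ?X = "cbox 0 1 :: (real^'d) set"
  obtain p where p: "\<And>k::nat. p k \<in> dense_params"
    "\<And>x. x \<in> ?X \<Longrightarrow> \<forall>\<^sub>F k in sequentially. x \<in> halfspace (fst (p k)) (snd (p k)) \<longleftrightarrow> x \<in> halfspace w b"
    using halfspace_approximation[of w b] by blast
  obtain q where q: "\<And>k::nat. q k \<in> dense_params"
    "\<And>x. x \<in> ?X \<Longrightarrow> \<forall>\<^sub>F k in sequentially. x \<in> halfspace (fst (q k)) (snd (q k)) \<longleftrightarrow> x \<in> halfspace w' b'"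
    using halfspace_approximation[of w' b'] by blast
  define H where "H k = ?X \<inter> (halfspace (fst (p k)) (snd (p k)) \<inter> halfspace (fst (q k)) (snd (q k)))" for k
  define G where "G = ?X \<inter> (halfspace w b \<inter> halfspace w' b')"
  have HW: "H k \<in> cube_wedges" for k
    unfolding H_def cube_wedges_def using p(1)[of k] q(1)[of k] by (intro image_eqI[of _ _ "(p k, q k)"]) auto
  have lim: "(\<lambda>k. measure \<rho> (H k)) \<longlonglongrightarrow> measure \<rho> G"
    if r: "prob_space \<rho>" "sets \<rho> = sets (restrict_space borel ?X)" for \<rho>
  proof -
    interpret prob_space \<rho> by fact
    have sp: "space \<rho> = ?X" using sets_eq_imp_space_eq[OF r(2)] by (simp add: space_restrict_space)
    have Hs [measurable]: "H k \<in> sets \<rho>" for k using HW cube_wedges_sets r by blast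
    have Gs [measurable]: "G \<in> sets \<rho>" unfolding r(2) G_def sets_restrict_space by (intro imageI sets.Int borel_halfspace)
    have "(\<lambda>k. \<integral>x. indicator (H k) x \<partial>\<rho>) \<longlonglongrightarrow> (\<integral>x. (indicator G x :: real) \<partial>\<rho>)"
    proof (rule integral_dominated_convergence[where w="\<lambda>_. 1"])
      show "AE x in \<rho>. (\<lambda>k. indicator (H k) x :: real) \<longlonglongrightarrow> indicator G x"
      proof (rule AE_I2)
        fix x assume "x \<in> space \<rho>"
        then have x: "x \<in> ?X" using sp by simp
        have "\<forall>\<^sub>F k in sequentially. (indicator (H k) x :: real) = indicator G x"
          using p(2)[OF x] q(2)[OF x] by eventually_elim (auto simp: H_def G_def indicator_def)
        then show "(\<lambda>k. indicator (H k) x :: real) \<longlonglongrightarrow> indicator G x" by (rule tendsto_eventually)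
      qed
    qed (auto simp: indicator_def)
    then show ?thesis by simp
  qed
  have "(\<lambda>k. \<bar>measure \<rho>1 (H k) - measure \<rho>2 (H k)\<bar>) \<longlonglongrightarrow> \<bar>measure \<rho>1 G - measure \<rho>2 G\<bar>"
    by (intro tendsto_intros lim p1 p2 s)
  then have "\<bar>measure \<rho>1 G - measure \<rho>2 G\<bar> \<le> \<delta>"
    by (rule LIMSEQ_le_const2) (auto intro!: d HW)
  then show ?thesis unfolding G_def .
qed

definition wedge_deviation :: "nat \<Rightarrow> (real^'d) measure \<Rightarrow> (nat \<Rightarrow> real^'d) \<Rightarrow> ennreal" where
  "wedge_deviation n \<nu> x = (\<Squnion>H\<in>cube_wedges. ennreal \<bar>(\<Sum>i<n. indicator H (x i)) - real n * measure \<nu> H\<bar>)"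

text \<open>Intersections of two halfspaces have growth exponent \<open>2 * (CARD('d) + 1)\<close>.\<close>
definition wedge_const :: "'d::finite itself \<Rightarrow> real" where
  "wedge_const _ = 2 * chain_const (2 * (CARD('d) + 1))"

lemma wedge_const_pos: "wedge_const TYPE('d::finite) > 0"
  unfolding wedge_const_def using chain_const_pos by simp

lemma wedge_deviation_measurable:
  fixes \<nu> :: "(real^'d) measure"
  assumes "sets \<nu> = sets (restrict_space borel (cbox 0 1))"
  shows "wedge_deviation n \<nu>' \<in> borel_measurable (\<Pi>\<^sub>M i\<in>{..<n}. \<nu>)"
proof -
  have m: "(\<lambda>x. (\<Sum>i<n. indicator H (x i)) :: real) \<in> borel_measurable (\<Pi>\<^sub>M i\<in>{..<n}. \<nu>)" if "H \<in> cube_wedges" for H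
  proof (intro borel_measurable_sum)
    fix i assume i: "i \<in> {..<n}"
    have "H \<in> sets \<nu>" using cube_wedges_sets that assms by blast
    then show "(\<lambda>x. indicator H (x i) :: real) \<in> borel_measurable (\<Pi>\<^sub>M i\<in>{..<n}. \<nu>)" using i by measurable
  qed
  show ?thesis
    unfolding wedge_deviation_def using countable_cube_wedges
    by (intro borel_measurable_SUP measurable_compose[OF _ measurable_ennreal] borel_measurable_abs borel_measurable_diff m) auto
qed

lemma expected_wedge_deviation:
  fixes \<nu> :: "(real^'d) measure"
  assumes "prob_space \<nu>" "sets \<nu> = sets (restrict_space borel (cbox 0 1))" "n \<ge> 1"
  shows "(\<integral>\<^sup>+x. wedge_deviation n \<nu> x \<partial>(\<Pi>\<^sub>M i\<in>{..<n}. \<nu>)) \<le> ennreal (wedge_const TYPE('d) * sqrt n)"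
  unfolding wedge_deviation_def wedge_const_def
  by (rule expected_sup_deviation_le[OF assms(1) countable_cube_wedges _ trace_growth_cube_wedges])
     (use assms cube_wedges_sets in auto)

lemma wedge_deviation_finite:
  fixes \<nu> :: "(real^'d) measure"
  assumes "prob_space \<nu>"
  shows "wedge_deviation n \<nu> x < \<infinity>"
proof -
  interpret prob_space \<nu> by fact
  have "wedge_deviation n \<nu> x \<le> ennreal (real n + real n)"
    unfolding wedge_deviation_def
  proof (intro SUP_least ennreal_leI)
    fix H :: "(real^'d) set"
    have "(\<Sum>i<n. indicator H (x i) :: real) \<le> (\<Sum>i<n. 1)" by (intro sum_mono) (auto simp: indicator_def)
    moreover have "(\<Sum>i<n. indicator H (x i) :: real) \<ge> 0" by (intro sum_nonneg) auto
    moreover have "real n * measure \<nu> H \<le> real n * 1" by (intro mult_left_mono) auto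
    moreover have "0 \<le> real n * measure \<nu> H" by simp
    ultimately show "\<bar>(\<Sum>i<n. indicator H (x i)) - real n * measure \<nu> H\<bar> \<le> real n + real n"
      unfolding sum_constant card_lessThan by linarith
  qed
  then show ?thesis by (simp add: le_less_trans)
qed

text \<open>The deviation bound for mixtures, applied to \<open>\<nu>\<close> and the empirical measure of the points
  \<open>x 0, \<dots>, x (n - 1)\<close>. The case \<open>h = 1\<close> covers means and the case \<open>h = g\<close> second moments.\<close>
lemma empirical_mixture_deviation:
  fixes \<nu> :: "(real^'d) measure"
  assumes \<nu>: "prob_space \<nu>" and s: "sets \<nu> = sets (restrict_space borel (cbox 0 1))" and n: "n \<ge> 1"
    and x: "\<And>i. i < n \<Longrightarrow> x i \<in> cbox 0 1"
    and g: "ridge_mixture A g" and h: "ridge_mixture B h"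
  shows "ennreal \<bar>(\<Sum>i<n. g (x i) * h (x i)) / n - (\<integral>x. g x * h x \<partial>\<nu>)\<bar>
     \<le> ennreal (4 * A * B / n) * wedge_deviation n \<nu> x"
proof -
  define D where "D = enn2real (wedge_deviation n \<nu> x)"
  have D: "wedge_deviation n \<nu> x = ennreal D" "D \<ge> 0"
    using wedge_deviation_finite[OF \<nu>, of n x] by (auto simp: D_def)
  have AB: "A \<ge> 0" "B \<ge> 0" using g h by (simp_all add: ridge_mixture_nonneg)
  let ?N = "restrict_space borel (cbox 0 1 :: (real^'d) set)"
  let ?U = "uniform_count_measure {..<n}"
  define \<rho> where "\<rho> = distr ?U ?N x"
  have ne: "{..<n} \<noteq> {}" using n by (auto simp: lessThan_empty_iff)
  have xm: "x \<in> measurable ?U ?N"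
    using x by (auto simp: measurable_def space_uniform_count_measure sets_uniform_count_measure space_restrict_space)
  interpret U: prob_space ?U by (rule prob_space_uniform_count_measure) (use ne in auto)
  have \<rho>: "prob_space \<rho>" unfolding \<rho>_def by (rule U.prob_space_distr[OF xm])
  have \<rho>s: "sets \<rho> = sets ?N" by (simp add: \<rho>_def)
  have int: "(\<integral>x. f x \<partial>\<rho>) = (\<Sum>i<n. f (x i)) / n" if "f \<in> borel_measurable ?N" for f :: "real^'d \<Rightarrow> real"
    unfolding \<rho>_def by (simp add: integral_distr[OF xm that] integral_uniform_count_measure)
  have "\<bar>measure \<rho> H - measure \<nu> H\<bar> \<le> D / n" if H: "H \<in> cube_wedges" for H
  proof -
    have Hs: "H \<in> sets ?N" using H cube_wedges_sets by blast
    then have sub: "H \<subseteq> cbox 0 1" by (auto simp: sets_restrict_space)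
    have "measure \<rho> H = (\<integral>x. indicator H x \<partial>\<rho>)" using Hs \<rho>s by simp
    also have "\<dots> = (\<Sum>i<n. indicator H (x i)) / n" by (rule int) (use Hs in simp)
    finally have e: "measure \<rho> H = (\<Sum>i<n. indicator H (x i)) / n" .
    have "ennreal \<bar>(\<Sum>i<n. indicator H (x i)) - real n * measure \<nu> H\<bar> \<le> ennreal D"
      unfolding D(1)[symmetric] wedge_deviation_def by (rule SUP_upper[OF H])
    then have le: "\<bar>(\<Sum>i<n. indicator H (x i)) - real n * measure \<nu> H\<bar> \<le> D" using D(2) by simp
    have "measure \<rho> H - measure \<nu> H = ((\<Sum>i<n. indicator H (x i)) - real n * measure \<nu> H) / n"
      unfolding e using n by (simp add: field_simps)
    then show ?thesis using le by (simp add: divide_right_mono)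
  qed
  note w = wedge_deviation_dense[OF \<rho> \<nu> \<rho>s s this]
  have "\<bar>(\<integral>x. g x * h x \<partial>\<rho>) - (\<integral>x. g x * h x \<partial>\<nu>)\<bar> \<le> 4 * A * B * (D / n)"
    by (rule mixture_product_deviation[OF \<rho> \<nu> \<rho>s s w g h])
  also have "(\<integral>x. g x * h x \<partial>\<rho>) = (\<Sum>i<n. g (x i) * h (x i)) / n"
    by (rule int) (intro measurable_restrict_space1 borel_measurable_times ridge_mixture_measurable[OF g] ridge_mixture_measurable[OF h])
  finally have "\<bar>(\<Sum>i<n. g (x i) * h (x i)) / n - (\<integral>x. g x * h x \<partial>\<nu>)\<bar> \<le> (4 * A * B / n) * D" by simp
  then show ?thesis unfolding D(1) using AB D(2) by (simp add: ennreal_mult[symmetric] ennreal_leI)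
qed

section \<open>Greedy approximation in a convex hull\<close>

text \<open>The hypothesis \<open>dual\<close> says that no bounded function separates \<open>R\<close> from \<open>D\<close> by more than \<open>1\<close>, which
  holds when \<open>R\<close> is in the closed convex hull of \<open>D\<close>. Choosing the next member almost orthogonal, or
  better, to the accumulated error makes the squared norm of the error grow by a constant per step;
  dividing by \<open>n\<^sup>2\<close> gives a squared error of order \<open>1/n\<close>. The greedy choice replaces sampling from a
  representing measure of \<open>R\<close>.\<close>
lemma maurey_greedy:
  fixes R :: "'a \<Rightarrow> real" and D :: "('a \<Rightarrow> real) set"
  assumes \<nu>: "prob_space \<nu>" and R: "R \<in> borel_measurable \<nu>" "\<And>x. x \<in> space \<nu> \<Longrightarrow> \<bar>R x\<bar> \<le> B"
    and D: "\<And>v. v \<in> D \<Longrightarrow> v \<in> borel_measurable \<nu>" "\<And>v x. v \<in> D \<Longrightarrow> x \<in> space \<nu> \<Longrightarrow> \<bar>v x\<bar> \<le> B"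
    and dual: "\<And>S c. S \<in> borel_measurable \<nu> \<Longrightarrow> (\<And>x. x \<in> space \<nu> \<Longrightarrow> \<bar>S x\<bar> \<le> c) \<Longrightarrow>
       \<exists>v\<in>D. (\<integral>x. S x * v x \<partial>\<nu>) \<le> (\<integral>x. S x * R x \<partial>\<nu>) + 1"
  shows "\<exists>v. (\<forall>i. v i \<in> D) \<and> (\<integral>x. (\<Sum>i=1..n. v i x - R x)\<^sup>2 \<partial>\<nu>) \<le> real n * (4 * B\<^sup>2 + 2)"
proof (induction n)
  case 0
  obtain v where "v \<in> D" using dual[of "\<lambda>_. 0" 0] by auto
  then show ?case by (intro exI[of _ "\<lambda>_. v"]) simp
next
  case (Suc n)
  interpret prob_space \<nu> by fact
  obtain v where v: "\<And>i. v i \<in> D" and le: "(\<integral>x. (\<Sum>i=1..n. v i x - R x)\<^sup>2 \<partial>\<nu>) \<le> real n * (4 * B\<^sup>2 + 2)"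
    using Suc.IH by blast
  define S where "S x = (\<Sum>i=1..n. v i x - R x)" for x
  have [measurable]: "R \<in> borel_measurable \<nu>" "v i \<in> borel_measurable \<nu>" for i
    using R(1) D(1)[OF v] by auto
  have Sm [measurable]: "S \<in> borel_measurable \<nu>" unfolding S_def by measurable
  have Sb: "\<bar>S x\<bar> \<le> real n * (2 * B)" if x: "x \<in> space \<nu>" for x
  proof -
    have "\<bar>S x\<bar> \<le> (\<Sum>i=1..n. \<bar>v i x - R x\<bar>)" unfolding S_def by (rule sum_abs)
    also have "\<dots> \<le> (\<Sum>i=1..n. 2 * B)"
    proof (rule sum_mono)
      fix i show "\<bar>v i x - R x\<bar> \<le> 2 * B" using D(2)[OF v[of i] x] R(2)[OF x] by linarith
    qed
    finally show ?thesis by simp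
  qed
  obtain u where u: "u \<in> D" and du: "(\<integral>x. S x * u x \<partial>\<nu>) \<le> (\<integral>x. S x * R x \<partial>\<nu>) + 1"
    using dual[OF Sm Sb] by blast
  have um [measurable]: "u \<in> borel_measurable \<nu>" by (rule D(1)[OF u])
  have uB: "\<bar>u x - R x\<bar> \<le> 2 * B" if "x \<in> space \<nu>" for x using D(2)[OF u that] R(2)[OF that] by linarith
  have i1: "integrable \<nu> (\<lambda>x. (S x)\<^sup>2)"
  proof (rule integrable_const_bound[of _ "(real n * (2 * B))\<^sup>2"])
    show "AE x in \<nu>. norm ((S x)\<^sup>2) \<le> (real n * (2 * B))\<^sup>2"
    proof (rule AE_I2)
      fix x assume "x \<in> space \<nu>"
      then have "\<bar>S x\<bar>\<^sup>2 \<le> (real n * (2 * B))\<^sup>2" by (intro power_mono Sb) auto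
      then show "norm ((S x)\<^sup>2) \<le> (real n * (2 * B))\<^sup>2" by simp
    qed
  qed measurable
  have i2: "integrable \<nu> (\<lambda>x. S x * u x)"
    by (rule integrable_const_bound[of _ "(real n * (2 * B)) * B"])
       (auto intro!: AE_I2 mult_mono order_trans[OF abs_ge_zero Sb] simp: abs_mult Sb D(2)[OF u])
  have i3: "integrable \<nu> (\<lambda>x. S x * R x)"
    by (rule integrable_const_bound[of _ "(real n * (2 * B)) * B"])
       (auto intro!: AE_I2 mult_mono order_trans[OF abs_ge_zero Sb] simp: abs_mult Sb R(2))
  have u2: "(u x - R x)\<^sup>2 \<le> 4 * B\<^sup>2" if x: "x \<in> space \<nu>" for x
  proof -
    have "\<bar>u x - R x\<bar>\<^sup>2 \<le> (2 * B)\<^sup>2" using uB[OF x] by (intro power_mono) auto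
    then show ?thesis by (simp add: power_mult_distrib)
  qed
  have i4: "integrable \<nu> (\<lambda>x. (u x - R x)\<^sup>2)"
    by (rule integrable_const_bound[of _ "4 * B\<^sup>2"]) (auto intro!: AE_I2 u2)
  have "(\<integral>x. (u x - R x)\<^sup>2 \<partial>\<nu>) \<le> (\<integral>x. 4 * B\<^sup>2 \<partial>\<nu>)" by (rule integral_mono[OF i4]) (auto intro: u2)
  then have b4: "(\<integral>x. (u x - R x)\<^sup>2 \<partial>\<nu>) \<le> 4 * B\<^sup>2" by (simp add: prob_space)
  have "(\<lambda>x. (S x + (u x - R x))\<^sup>2) = (\<lambda>x. (S x)\<^sup>2 + 2 * (S x * u x - S x * R x) + (u x - R x)\<^sup>2)"
    by (auto simp: power2_eq_square algebra_simps)
  then have "(\<integral>x. (S x + (u x - R x))\<^sup>2 \<partial>\<nu>)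
     = (\<integral>x. (S x)\<^sup>2 \<partial>\<nu>) + 2 * ((\<integral>x. S x * u x \<partial>\<nu>) - (\<integral>x. S x * R x \<partial>\<nu>)) + (\<integral>x. (u x - R x)\<^sup>2 \<partial>\<nu>)"
    using i1 i2 i3 i4 by simp
  also have "\<dots> \<le> real n * (4 * B\<^sup>2 + 2) + 2 * 1 + 4 * B\<^sup>2"
    using le[folded S_def] du b4 by (intro add_mono mult_left_mono) simp_all
  also have "\<dots> = real (Suc n) * (4 * B\<^sup>2 + 2)" by (simp add: algebra_simps)
  finally have fin: "(\<integral>x. (S x + (u x - R x))\<^sup>2 \<partial>\<nu>) \<le> real (Suc n) * (4 * B\<^sup>2 + 2)" .
  define v' where "v' = v(Suc n := u)"
  have "(\<Sum>i=1..Suc n. v' i x - R x) = S x + (u x - R x)" for x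
  proof -
    have "(\<Sum>i=1..n. v' i x - R x) = S x" unfolding S_def by (intro sum.cong) (auto simp: v'_def)
    then show ?thesis by (simp add: v'_def)
  qed
  then have "(\<integral>x. (\<Sum>i=1..Suc n. v' i x - R x)\<^sup>2 \<partial>\<nu>) \<le> real (Suc n) * (4 * B\<^sup>2 + 2)"
    using fin by (simp only:)
  then show ?case using v u by (intro exI[of _ v']) (auto simp: v'_def)
qed

text \<open>Averages of neurons \<open>V \<theta>\<close> with signed weight \<open>W\<close>. By Fubini's theorem, a function that nearly
  annihilates every neuron nearly annihilates the average: this is the duality that the greedy step
  needs.\<close>
lemma kernel_average:
  fixes W :: "'b \<Rightarrow> real" and V :: "'b \<Rightarrow> 'a \<Rightarrow> real"
  assumes \<kappa>: "sigma_finite_measure \<kappa>" and \<nu>: "prob_space \<nu>" and W: "integrable \<kappa> W"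
    and Vm: "(\<lambda>p. V (fst p) (snd p)) \<in> borel_measurable (\<kappa> \<Otimes>\<^sub>M \<nu>)"
    and Vb: "\<And>\<theta> x. x \<in> space \<nu> \<Longrightarrow> \<bar>V \<theta> x\<bar> \<le> C" and C: "C \<ge> 0"
  shows "(\<lambda>x. \<integral>\<theta>. W \<theta> * V \<theta> x \<partial>\<kappa>) \<in> borel_measurable \<nu>"
    and "x \<in> space \<nu> \<Longrightarrow> integrable \<kappa> (\<lambda>\<theta>. W \<theta> * V \<theta> x)"
    and "x \<in> space \<nu> \<Longrightarrow> \<bar>\<integral>\<theta>. W \<theta> * V \<theta> x \<partial>\<kappa>\<bar> \<le> (\<integral>\<theta>. \<bar>W \<theta>\<bar> \<partial>\<kappa>) * C"
    and "\<lbrakk>S \<in> borel_measurable \<nu>; \<And>x. x \<in> space \<nu> \<Longrightarrow> \<bar>S x\<bar> \<le> b; \<And>\<theta>. \<bar>\<integral>x. S x * V \<theta> x \<partial>\<nu>\<bar> \<le> K\<rbrakk>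
      \<Longrightarrow> \<bar>\<integral>x. S x * (\<integral>\<theta>. W \<theta> * V \<theta> x \<partial>\<kappa>) \<partial>\<nu>\<bar> \<le> (\<integral>\<theta>. \<bar>W \<theta>\<bar> \<partial>\<kappa>) * K"
proof -
  interpret \<kappa>: sigma_finite_measure \<kappa> by fact
  interpret \<nu>: prob_space \<nu> by fact
  interpret P: pair_sigma_finite \<kappa> \<nu> by standard
  have Wm [measurable]: "W \<in> borel_measurable \<kappa>" using W by auto
  have Vm' [measurable]: "(\<lambda>(\<theta>, x). V \<theta> x) \<in> borel_measurable (\<kappa> \<Otimes>\<^sub>M \<nu>)"
    using Vm by (simp add: case_prod_unfold)
  have sw [measurable]: "(\<lambda>(x, \<theta>). V \<theta> x) \<in> borel_measurable (\<nu> \<Otimes>\<^sub>M \<kappa>)"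
    using measurable_compose[OF measurable_pair_swap' Vm'] by (simp add: case_prod_unfold)
  have Vx [measurable]: "(\<lambda>\<theta>. V \<theta> x) \<in> borel_measurable \<kappa>" if "x \<in> space \<nu>" for x
    using measurable_compose[OF measurable_Pair2'[OF that] Vm'] by simp
  have "(\<lambda>(x, \<theta>). W \<theta> * V \<theta> x) \<in> borel_measurable (\<nu> \<Otimes>\<^sub>M \<kappa>)"
    using sw by (auto simp: case_prod_unfold intro!: borel_measurable_times)
  then show m: "(\<lambda>x. \<integral>\<theta>. W \<theta> * V \<theta> x \<partial>\<kappa>) \<in> borel_measurable \<nu>"
    by (rule \<kappa>.borel_measurable_lebesgue_integral)
  show int: "integrable \<kappa> (\<lambda>\<theta>. W \<theta> * V \<theta> x)" if x: "x \<in> space \<nu>" for x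
  proof (rule Bochner_Integration.integrable_bound[of _ "\<lambda>\<theta>. C * W \<theta>"])
    show "integrable \<kappa> (\<lambda>\<theta>. C * W \<theta>)" using W by simp
    show "(\<lambda>\<theta>. W \<theta> * V \<theta> x) \<in> borel_measurable \<kappa>" using Vx[OF x] by measurable
    show "AE \<theta> in \<kappa>. norm (W \<theta> * V \<theta> x) \<le> norm (C * W \<theta>)"
    proof (rule AE_I2)
      fix \<theta>
      have "\<bar>W \<theta>\<bar> * \<bar>V \<theta> x\<bar> \<le> \<bar>W \<theta>\<bar> * C" using Vb[OF x, of \<theta>] by (intro mult_left_mono) auto
      then show "norm (W \<theta> * V \<theta> x) \<le> norm (C * W \<theta>)" using C by (simp add: abs_mult mult.commute)
    qed
  qed
  show "\<bar>\<integral>\<theta>. W \<theta> * V \<theta> x \<partial>\<kappa>\<bar> \<le> (\<integral>\<theta>. \<bar>W \<theta>\<bar> \<partial>\<kappa>) * C" if x: "x \<in> space \<nu>"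
  proof -
    have "\<bar>\<integral>\<theta>. W \<theta> * V \<theta> x \<partial>\<kappa>\<bar> \<le> (\<integral>\<theta>. \<bar>W \<theta> * V \<theta> x\<bar> \<partial>\<kappa>)" by (rule integral_abs_bound)
    also have "\<dots> \<le> (\<integral>\<theta>. \<bar>W \<theta>\<bar> * C \<partial>\<kappa>)"
    proof (rule integral_mono)
      show "integrable \<kappa> (\<lambda>\<theta>. \<bar>W \<theta> * V \<theta> x\<bar>)" using int[OF x] by (rule integrable_abs)
      show "integrable \<kappa> (\<lambda>\<theta>. \<bar>W \<theta>\<bar> * C)" using W by auto
      show "\<bar>W \<theta> * V \<theta> x\<bar> \<le> \<bar>W \<theta>\<bar> * C" for \<theta>
        unfolding abs_mult using Vb[OF x] by (intro mult_left_mono) auto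
    qed
    finally show ?thesis by simp
  qed
  assume S [measurable]: "S \<in> borel_measurable \<nu>" and Sb: "\<And>x. x \<in> space \<nu> \<Longrightarrow> \<bar>S x\<bar> \<le> b"
    and K: "\<And>\<theta>. \<bar>\<integral>x. S x * V \<theta> x \<partial>\<nu>\<bar> \<le> K"
  have b0: "b \<ge> 0" using \<nu>.not_empty Sb by (meson abs_ge_zero all_not_in_conv order_trans)
  have fm: "(\<lambda>(\<theta>, x). S x * (W \<theta> * V \<theta> x)) \<in> borel_measurable (\<kappa> \<Otimes>\<^sub>M \<nu>)"
    using Vm' by (auto simp: case_prod_unfold intro!: borel_measurable_times)
  have bd: "\<bar>S x * (W \<theta> * V \<theta> x)\<bar> \<le> b * C * \<bar>W \<theta>\<bar>" if x: "x \<in> space \<nu>" for x \<theta>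
  proof -
    have "\<bar>S x\<bar> * \<bar>V \<theta> x\<bar> \<le> b * C" using Sb[OF x] Vb[OF x] b0 by (intro mult_mono) auto
    then have "\<bar>S x\<bar> * \<bar>V \<theta> x\<bar> * \<bar>W \<theta>\<bar> \<le> b * C * \<bar>W \<theta>\<bar>" by (intro mult_right_mono) auto
    then show ?thesis by (simp add: abs_mult ac_simps)
  qed
  have sec: "(\<lambda>x. S x * (W \<theta> * V \<theta> x)) \<in> borel_measurable \<nu>" if "\<theta> \<in> space \<kappa>" for \<theta>
    using measurable_compose[OF measurable_Pair1'[OF that] fm] by simp
  have seci: "integrable \<nu> (\<lambda>x. S x * (W \<theta> * V \<theta> x))" if "\<theta> \<in> space \<kappa>" for \<theta>
    by (rule \<nu>.integrable_const_bound[of _ "b * C * \<bar>W \<theta>\<bar>", OF _ sec[OF that]]) (auto intro!: AE_I2 bd)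
  have fi: "integrable (\<kappa> \<Otimes>\<^sub>M \<nu>) (\<lambda>(\<theta>, x). S x * (W \<theta> * V \<theta> x))"
  proof (rule P.Fubini_integrable[OF fm])
    have nm: "(\<lambda>(\<theta>, x). norm (S x * (W \<theta> * V \<theta> x))) \<in> borel_measurable (\<kappa> \<Otimes>\<^sub>M \<nu>)"
      using measurable_compose[OF fm borel_measurable_norm] by (simp add: case_prod_unfold)
    show "integrable \<kappa> (\<lambda>\<theta>. \<integral>x. norm (case (\<theta>, x) of (\<theta>, x) \<Rightarrow> S x * (W \<theta> * V \<theta> x)) \<partial>\<nu>)"
    proof (rule Bochner_Integration.integrable_bound[of _ "\<lambda>\<theta>. b * C * \<bar>W \<theta>\<bar>"])
      show "integrable \<kappa> (\<lambda>\<theta>. b * C * \<bar>W \<theta>\<bar>)" using W by simp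
      show "(\<lambda>\<theta>. \<integral>x. norm (case (\<theta>, x) of (\<theta>, x) \<Rightarrow> S x * (W \<theta> * V \<theta> x)) \<partial>\<nu>) \<in> borel_measurable \<kappa>"
        using \<nu>.borel_measurable_lebesgue_integral[OF nm] by simp
      show "AE \<theta> in \<kappa>. norm (\<integral>x. norm (case (\<theta>, x) of (\<theta>, x) \<Rightarrow> S x * (W \<theta> * V \<theta> x)) \<partial>\<nu>) \<le> norm (b * C * \<bar>W \<theta>\<bar>)"
      proof (rule AE_I2)
        fix \<theta> assume \<theta>: "\<theta> \<in> space \<kappa>"
        have "(\<integral>x. \<bar>S x * (W \<theta> * V \<theta> x)\<bar> \<partial>\<nu>) \<le> (\<integral>x. b * C * \<bar>W \<theta>\<bar> \<partial>\<nu>)"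
          using seci[OF \<theta>] by (intro integral_mono) (auto intro: bd)
        then have le: "(\<integral>x. \<bar>S x * (W \<theta> * V \<theta> x)\<bar> \<partial>\<nu>) \<le> b * C * \<bar>W \<theta>\<bar>" by (simp add: \<nu>.prob_space)
        have "0 \<le> (\<integral>x. \<bar>S x * (W \<theta> * V \<theta> x)\<bar> \<partial>\<nu>)" by (intro Bochner_Integration.integral_nonneg) auto
        then show "norm (\<integral>x. norm (case (\<theta>, x) of (\<theta>, x) \<Rightarrow> S x * (W \<theta> * V \<theta> x)) \<partial>\<nu>) \<le> norm (b * C * \<bar>W \<theta>\<bar>)"
          using le by (simp del: abs_mult)
      qed
    qed
    show "AE \<theta> in \<kappa>. integrable \<nu> (\<lambda>x. case (\<theta>, x) of (\<theta>, x) \<Rightarrow> S x * (W \<theta> * V \<theta> x))"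
      using seci by (auto intro!: AE_I2)
  qed
  have "(\<integral>x. S x * (\<integral>\<theta>. W \<theta> * V \<theta> x \<partial>\<kappa>) \<partial>\<nu>) = (\<integral>x. (\<integral>\<theta>. S x * (W \<theta> * V \<theta> x) \<partial>\<kappa>) \<partial>\<nu>)" by simp
  also have "\<dots> = (\<integral>\<theta>. (\<integral>x. S x * (W \<theta> * V \<theta> x) \<partial>\<nu>) \<partial>\<kappa>)"
    by (rule P.Fubini_integral) (use fi in simp)
  also have "\<dots> = (\<integral>\<theta>. W \<theta> * (\<integral>x. S x * V \<theta> x \<partial>\<nu>) \<partial>\<kappa>)"
  proof (rule Bochner_Integration.integral_cong[OF refl])
    fix \<theta>
    have "(\<lambda>x. S x * (W \<theta> * V \<theta> x)) = (\<lambda>x. W \<theta> * (S x * V \<theta> x))" by (auto simp: ac_simps)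
    then show "(\<integral>x. S x * (W \<theta> * V \<theta> x) \<partial>\<nu>) = W \<theta> * (\<integral>x. S x * V \<theta> x \<partial>\<nu>)" by simp
  qed
  finally have eq: "(\<integral>x. S x * (\<integral>\<theta>. W \<theta> * V \<theta> x \<partial>\<kappa>) \<partial>\<nu>) = (\<integral>\<theta>. W \<theta> * (\<integral>x. S x * V \<theta> x \<partial>\<nu>) \<partial>\<kappa>)" .
  have im: "(\<lambda>\<theta>. \<integral>x. S x * V \<theta> x \<partial>\<nu>) \<in> borel_measurable \<kappa>"
    by (rule \<nu>.borel_measurable_lebesgue_integral)
       (use Vm' in \<open>auto simp: case_prod_unfold intro!: borel_measurable_times\<close>)
  have le: "\<bar>W \<theta> * (\<integral>x. S x * V \<theta> x \<partial>\<nu>)\<bar> \<le> \<bar>W \<theta>\<bar> * K" for \<theta>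
    unfolding abs_mult using K by (intro mult_left_mono) auto
  have i2: "integrable \<kappa> (\<lambda>\<theta>. \<bar>W \<theta> * (\<integral>x. S x * V \<theta> x \<partial>\<nu>)\<bar>)"
  proof (rule Bochner_Integration.integrable_bound[of _ "\<lambda>\<theta>. \<bar>W \<theta>\<bar> * K"])
    show "AE \<theta> in \<kappa>. norm \<bar>W \<theta> * (\<integral>x. S x * V \<theta> x \<partial>\<nu>)\<bar> \<le> norm (\<bar>W \<theta>\<bar> * K)"
    proof (rule AE_I2)
      fix \<theta>
      show "norm \<bar>W \<theta> * (\<integral>x. S x * V \<theta> x \<partial>\<nu>)\<bar> \<le> norm (\<bar>W \<theta>\<bar> * K)"
        using order_trans[OF le[of \<theta>] abs_ge_self] by simp
    qed
  qed (use W im in auto)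
  have "\<bar>\<integral>\<theta>. W \<theta> * (\<integral>x. S x * V \<theta> x \<partial>\<nu>) \<partial>\<kappa>\<bar> \<le> (\<integral>\<theta>. \<bar>W \<theta> * (\<integral>x. S x * V \<theta> x \<partial>\<nu>)\<bar> \<partial>\<kappa>)"
    by (rule integral_abs_bound)
  also have "\<dots> \<le> (\<integral>\<theta>. \<bar>W \<theta>\<bar> * K \<partial>\<kappa>)" using W by (intro integral_mono[OF i2] le) auto
  finally show "\<bar>\<integral>x. S x * (\<integral>\<theta>. W \<theta> * V \<theta> x \<partial>\<kappa>) \<partial>\<nu>\<bar> \<le> (\<integral>\<theta>. \<bar>W \<theta>\<bar> \<partial>\<kappa>) * K"
    unfolding eq by simp
qed

section \<open>Plane waves as averages of neurons\<close>

lemma l1norm_nonneg [simp]: "0 \<le> l1norm w"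
  unfolding l1norm_def by (simp add: sum_nonneg)

lemma l1norm_scaleR: "l1norm (c *\<^sub>R w) = \<bar>c\<bar> * l1norm w"
  unfolding l1norm_def by (simp add: abs_mult sum_distrib_left)

lemma l1norm_eq_0 [simp]: "l1norm w = 0 \<longleftrightarrow> w = 0"
  unfolding l1norm_def by (simp add: sum_nonneg_eq_0_iff vec_eq_iff)

lemma l1norm_uminus [simp]: "l1norm (- w) = l1norm w"
  unfolding l1norm_def by simp

lemma l1norm_zero [simp]: "l1norm 0 = 0"
  unfolding l1norm_def by simp

lemma continuous_l1norm: "continuous_on S l1norm"
  unfolding l1norm_def by (intro continuous_intros)

lemma l1norm_measurable [measurable]: "l1norm \<in> borel_measurable borel"
  by (intro borel_measurable_continuous_onI continuous_l1norm)

text \<open>The value at \<open>0\<close> is \<open>0\<close>; this is harmless since only \<open>l1norm w * (direction w \<bullet> x)\<close> matters.\<close>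
definition direction :: "real^'d \<Rightarrow> real^'d" where
  "direction w = (1 / l1norm w) *\<^sub>R w"

lemma direction_measurable [measurable]: "direction \<in> borel_measurable borel"
  unfolding direction_def by measurable

lemma l1norm_direction_le: "l1norm (direction w) \<le> 1"
  unfolding direction_def l1norm_scaleR by (cases "w = 0") (auto simp: abs_if)

lemma inner_direction: "l1norm w * (direction w \<bullet> x) = w \<bullet> x"
  unfolding direction_def by (cases "w = 0") auto

text \<open>The average over frequencies \<open>\<omega>\<close> and offsets \<open>t\<close> of neurons \<open>\<psi> (\<sigma> * (direction \<omega> \<bullet> x) - t)\<close>, with a
  weight \<open>c\<close> dominated by a power of the norm of \<open>\<omega>\<close> and hence of total size at most \<open>M\<close>. The sign
  \<open>\<sigma>\<close> treats the positive and the negative side of the Taylor expansion in one statement. On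
  the cube the argument of \<open>\<psi>\<close> stays in \<open>[- 2, 2]\<close>.\<close>
lemma ridge_kernel:
  fixes m :: "(real^'d) measure" and \<nu> :: "(real^'d) measure" and c :: "real^'d \<Rightarrow> real \<Rightarrow> real"
  assumes m: "finite_measure m" "sets m = sets borel"
    and mom: "(\<integral>\<^sup>+\<omega>. ennreal (l1norm \<omega> ^ p) \<partial>m) \<le> ennreal M" and M: "M \<ge> 0"
    and cm: "(\<lambda>\<theta>. c (fst \<theta>) (snd \<theta>)) \<in> borel_measurable borel" and cb: "\<And>\<omega> t. \<bar>c \<omega> t\<bar> \<le> l1norm \<omega> ^ p"
    and \<psi>: "continuous_on UNIV \<psi>" "\<And>y. \<bar>y\<bar> \<le> 2 \<Longrightarrow> \<bar>\<psi> y\<bar> \<le> C" and \<sigma>: "\<sigma> \<in> {1, - 1 :: real}"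
    and \<nu>: "prob_space \<nu>" "sets \<nu> = sets (restrict_space borel (cbox 0 1))"
  defines "sect \<equiv> (\<lambda>x \<omega>. \<integral>t. indicator {0..1} t * (c \<omega> t * \<psi> (\<sigma> * (direction \<omega> \<bullet> x) - t)) \<partial>lborel)"
  defines "P \<equiv> (\<lambda>x. \<integral>\<omega>. sect x \<omega> \<partial>m)"
  shows "P \<in> borel_measurable \<nu>"
    and "x \<in> cbox 0 1 \<Longrightarrow> integrable m (sect x)"
    and "x \<in> cbox 0 1 \<Longrightarrow> \<bar>P x\<bar> \<le> M * C"
    and "\<lbrakk>S \<in> borel_measurable \<nu>; \<And>x. x \<in> space \<nu> \<Longrightarrow> \<bar>S x\<bar> \<le> b;
      \<And>u t. l1norm u \<le> 1 \<Longrightarrow> 0 \<le> t \<Longrightarrow> t \<le> 1 \<Longrightarrow> \<bar>\<integral>x. S x * \<psi> (u \<bullet> x - t) \<partial>\<nu>\<bar> \<le> K\<rbrakk>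
      \<Longrightarrow> \<bar>\<integral>x. S x * P x \<partial>\<nu>\<bar> \<le> M * K"
proof -
  let ?\<kappa> = "m \<Otimes>\<^sub>M (lborel :: real measure)"
  interpret m: finite_measure m by fact
  interpret \<nu>: prob_space \<nu> by fact
  interpret mL: pair_sigma_finite m lborel by standard
  have sp: "space m = UNIV" "space \<nu> = cbox 0 1"
    using sets_eq_imp_space_eq[OF m(2)] sets_eq_imp_space_eq[OF \<nu>(2)] by (auto simp: space_restrict_space)
  have C0: "C \<ge> 0" using \<psi>(2)[of 0] by (simp add: order_trans[OF abs_ge_zero])
  define W where "W \<theta> = indicator {0..1} (snd \<theta>) * c (fst \<theta>) (snd \<theta>)" for \<theta> :: "(real^'d) \<times> real"
  define V where "V \<theta> x = indicator {0..1} (snd \<theta>) * \<psi> (\<sigma> * (direction (fst \<theta>) \<bullet> x) - snd \<theta>)" for \<theta> :: "(real^'d) \<times> real" and x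
  have s\<kappa>: "sets ?\<kappa> = sets (borel :: ((real^'d) \<times> real) measure)"
    using sets_pair_measure_cong[OF m(2) sets_lborel] by (simp only: borel_prod)
  have Wm: "W \<in> borel_measurable ?\<kappa>"
  proof -
    have "(snd :: (real^'d) \<times> real \<Rightarrow> real) \<in> borel_measurable borel"
      by (intro borel_measurable_continuous_onI continuous_intros)
    from measurable_compose[OF this borel_measurable_indicator[of "{0..1}" borel]]
    have "(\<lambda>\<theta> :: (real^'d) \<times> real. indicator {0..1} (snd \<theta>) :: real) \<in> borel_measurable borel" by simp
    then show ?thesis
      unfolding measurable_cong_sets[OF s\<kappa> refl] W_def using cm by (rule borel_measurable_times)
  qed
  have Wb: "\<bar>W \<theta>\<bar> \<le> indicator {0..1} (snd \<theta>) * l1norm (fst \<theta>) ^ p" for \<theta>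
    unfolding W_def using cb by (auto simp: indicator_def abs_mult)
  have l1m: "(\<lambda>\<omega>. ennreal (l1norm \<omega> ^ p)) \<in> borel_measurable m"
    unfolding measurable_cong_sets[OF m(2) refl] by measurable
  have "(\<integral>\<^sup>+\<theta>. ennreal \<bar>W \<theta>\<bar> \<partial>?\<kappa>) \<le> (\<integral>\<^sup>+\<theta>. ennreal (l1norm (fst \<theta>) ^ p) * indicator {0..1} (snd \<theta>) \<partial>?\<kappa>)"
  proof (rule nn_integral_mono)
    fix \<theta>
    show "ennreal \<bar>W \<theta>\<bar> \<le> ennreal (l1norm (fst \<theta>) ^ p) * indicator {0..1} (snd \<theta>)"
      using Wb[of \<theta>] by (cases "snd \<theta> \<in> {0..1}") (simp_all add: ennreal_leI)
  qed
  also have "\<dots> = (\<integral>\<^sup>+\<omega>. \<integral>\<^sup>+t. ennreal (l1norm \<omega> ^ p) * indicator {0..1::real} t \<partial>lborel \<partial>m)"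
  proof (subst lborel.nn_integral_fst[symmetric])
    have "(\<lambda>\<theta>. ennreal (l1norm (fst \<theta>) ^ p)) \<in> borel_measurable ?\<kappa>"
      using measurable_compose[OF measurable_fst l1m] by simp
    moreover have "(\<lambda>\<theta>. indicator {0..1} (snd \<theta>) :: ennreal) \<in> borel_measurable ?\<kappa>"
      by measurable
    ultimately show "(\<lambda>\<theta>. ennreal (l1norm (fst \<theta>) ^ p) * indicator {0..1} (snd \<theta>)) \<in> borel_measurable ?\<kappa>"
      by measurable
  qed simp
  also have "\<dots> = (\<integral>\<^sup>+\<omega>. ennreal (l1norm \<omega> ^ p) \<partial>m)" by (simp add: nn_integral_cmult)
  finally have Wn: "(\<integral>\<^sup>+\<theta>. ennreal \<bar>W \<theta>\<bar> \<partial>?\<kappa>) \<le> ennreal M" using mom by simp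
  then have Wi: "integrable ?\<kappa> W"
    using Wm by (intro integrableI_bounded) (auto simp: less_top[symmetric] top_unique intro: le_less_trans)
  have "ennreal (\<integral>\<theta>. \<bar>W \<theta>\<bar> \<partial>?\<kappa>) \<le> ennreal M"
    using Wn Wi by (subst nn_integral_eq_integral[symmetric]) auto
  then have WM: "(\<integral>\<theta>. \<bar>W \<theta>\<bar> \<partial>?\<kappa>) \<le> M" using M by (simp add: ennreal_le_iff)
  have Vm: "(\<lambda>p. V (fst p) (snd p)) \<in> borel_measurable (?\<kappa> \<Otimes>\<^sub>M \<nu>)"
  proof -
    have [measurable]: "(\<lambda>p :: ((real^'d) \<times> real) \<times> (real^'d). snd p) \<in> borel_measurable (?\<kappa> \<Otimes>\<^sub>M \<nu>)"
    proof -
      have "(\<lambda>x. x) \<in> borel_measurable \<nu>" by (rule sets_restrict_cube_measurable[OF _ \<nu>(2)]) simp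
      then show ?thesis using measurable_compose[OF measurable_snd] by blast
    qed
    have [measurable]: "(\<lambda>p :: ((real^'d) \<times> real) \<times> (real^'d). fst (fst p)) \<in> borel_measurable (?\<kappa> \<Otimes>\<^sub>M \<nu>)"
    proof -
      have "(\<lambda>x. x) \<in> borel_measurable m" unfolding measurable_cong_sets[OF m(2) refl] by simp
      moreover have "(\<lambda>p. fst (fst p)) \<in> measurable (?\<kappa> \<Otimes>\<^sub>M \<nu>) m" by measurable
      ultimately show ?thesis by (rule measurable_compose[rotated])
    qed
    have [measurable]: "(\<lambda>p :: ((real^'d) \<times> real) \<times> (real^'d). snd (fst p)) \<in> borel_measurable (?\<kappa> \<Otimes>\<^sub>M \<nu>)"
      using measurable_compose[OF measurable_fst, of snd ?\<kappa> borel \<nu>] by simp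
    have [measurable]: "\<psi> \<in> borel_measurable borel" using \<psi>(1) by (rule borel_measurable_continuous_onI)
    show ?thesis unfolding V_def by measurable
  qed
  have dir: "\<bar>direction \<omega> \<bullet> x\<bar> \<le> 1" if "x \<in> cbox 0 1" for \<omega> x :: "real^'d"
    using abs_inner_le_l1norm[OF that, of "direction \<omega>"] l1norm_direction_le[of \<omega>] by linarith
  have Vb: "\<bar>V \<theta> x\<bar> \<le> C" if "x \<in> space \<nu>" for \<theta> x
  proof (cases "snd \<theta> \<in> {0..1}")
    case True
    have "\<bar>direction (fst \<theta>) \<bullet> x\<bar> \<le> 1" using dir that sp by auto
    then have "\<bar>\<sigma> * (direction (fst \<theta>) \<bullet> x) - snd \<theta>\<bar> \<le> 2" using True \<sigma> by auto
    then show ?thesis unfolding V_def using \<psi>(2) True by simp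
  qed (use C0 in \<open>simp add: V_def\<close>)
  have \<kappa>sf: "sigma_finite_measure ?\<kappa>" by (rule mL.P.sigma_finite_measure_axioms)
  note KA0 = kernel_average[OF \<kappa>sf \<nu>(1) Wi Vm _ C0]
  have KA1: "(\<lambda>x. \<integral>\<theta>. W \<theta> * V \<theta> x \<partial>?\<kappa>) \<in> borel_measurable \<nu>"
    by (rule KA0(1)) (rule Vb)
  have KA2: "integrable ?\<kappa> (\<lambda>\<theta>. W \<theta> * V \<theta> x)" if "x \<in> space \<nu>" for x
    by (rule KA0(2)[OF _ that]) (rule Vb)
  have KA3: "\<bar>\<integral>\<theta>. W \<theta> * V \<theta> x \<partial>?\<kappa>\<bar> \<le> (\<integral>\<theta>. \<bar>W \<theta>\<bar> \<partial>?\<kappa>) * C" if "x \<in> space \<nu>" for x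
    by (rule KA0(3)[OF _ that]) (rule Vb)
  have WV: "W \<theta> * V \<theta> x = indicator {0..1} (snd \<theta>) * (c (fst \<theta>) (snd \<theta>) * \<psi> (\<sigma> * (direction (fst \<theta>) \<bullet> x) - snd \<theta>))" for \<theta> x
    unfolding W_def V_def by (auto simp: indicator_def)
  have Pe: "P x = (\<integral>\<theta>. W \<theta> * V \<theta> x \<partial>?\<kappa>)" "integrable m (sect x)" if x: "x \<in> cbox 0 1" for x
  proof -
    have i: "integrable ?\<kappa> (\<lambda>\<theta>. W \<theta> * V \<theta> x)" using KA2[of x] x sp by simp
    from mL.integral_fst'[OF i] mL.integrable_fst'[OF i]
    show "P x = (\<integral>\<theta>. W \<theta> * V \<theta> x \<partial>?\<kappa>)" "integrable m (sect x)"
      unfolding WV P_def sect_def by simp_all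
  qed
  show "P \<in> borel_measurable \<nu>"
  proof -
    have "(P \<in> borel_measurable \<nu>) = ((\<lambda>x. \<integral>\<theta>. W \<theta> * V \<theta> x \<partial>?\<kappa>) \<in> borel_measurable \<nu>)"
      by (rule measurable_cong) (simp add: Pe(1) sp(2))
    then show ?thesis using KA1 by simp
  qed
  show "integrable m (sect x)" if "x \<in> cbox 0 1" for x by (rule Pe(2)[OF that])
  show "\<bar>P x\<bar> \<le> M * C" if "x \<in> cbox 0 1" for x
    using KA3[of x] that sp(2) Pe(1)[OF that] mult_right_mono[OF WM C0] by simp
  assume S: "S \<in> borel_measurable \<nu>" and Sb: "\<And>x. x \<in> space \<nu> \<Longrightarrow> \<bar>S x\<bar> \<le> b"
    and K: "\<And>u t. l1norm u \<le> 1 \<Longrightarrow> 0 \<le> t \<Longrightarrow> t \<le> 1 \<Longrightarrow> \<bar>\<integral>x. S x * \<psi> (u \<bullet> x - t) \<partial>\<nu>\<bar> \<le> K"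
  have K0: "K \<ge> 0" using K[of 0 0] by (simp add: order_trans[OF abs_ge_zero])
  have K': "\<bar>\<integral>x. S x * V \<theta> x \<partial>\<nu>\<bar> \<le> K" for \<theta>
  proof (cases "snd \<theta> \<in> {0..1}")
    case True
    have "l1norm (\<sigma> *\<^sub>R direction (fst \<theta>)) \<le> 1"
      unfolding l1norm_scaleR using \<sigma> l1norm_direction_le[of "fst \<theta>"] by auto
    from K[OF this, of "snd \<theta>"] True show ?thesis unfolding V_def by simp
  qed (use K0 in \<open>simp add: V_def\<close>)
  have "\<bar>\<integral>x. S x * (\<integral>\<theta>. W \<theta> * V \<theta> x \<partial>?\<kappa>) \<partial>\<nu>\<bar> \<le> (\<integral>\<theta>. \<bar>W \<theta>\<bar> \<partial>?\<kappa>) * K"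
    by (rule KA0(4)[OF _ S]) (rule Vb Sb K'; assumption?)+
  also have "\<dots> \<le> M * K" using WM K0 by (rule mult_right_mono)
  also have "(\<integral>x. S x * (\<integral>\<theta>. W \<theta> * V \<theta> x \<partial>?\<kappa>) \<partial>\<nu>) = (\<integral>x. S x * P x \<partial>\<nu>)"
    by (intro Bochner_Integration.integral_cong) (auto simp: Pe(1) sp)
  finally show "\<bar>\<integral>x. S x * P x \<partial>\<nu>\<bar> \<le> M * K" .
qed

text \<open>Taylor's formula with integral remainder: for \<open>0 \<le> t \<le> 1\<close> the factor \<open>relu (y - t)\<close> is \<open>y - t\<close>
  below \<open>y\<close> and \<open>0\<close> above, and \<open>(y - t) * q1 t + q t\<close> is an antiderivative of \<open>(y - t) * q2 t\<close>.\<close>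
lemma relu_remainder_pos:
  fixes q q1 q2 :: "real \<Rightarrow> real"
  assumes d: "\<And>t. (q has_real_derivative q1 t) (at t)" "\<And>t. (q1 has_real_derivative q2 t) (at t)"
    and c: "continuous_on UNIV q2" and y: "0 \<le> y" "y \<le> 1"
  shows "(\<integral>t. indicator {0..1} t * (q2 t * relu (y - t)) \<partial>lborel) = q y - q 0 - q1 0 * y"
proof -
  have "(\<integral>t. indicator {0..1} t * (q2 t * relu (y - t)) \<partial>lborel) = (\<integral>t. (y - t) * q2 t * indicator {0..y} t \<partial>lborel)"
    using y by (intro Bochner_Integration.integral_cong) (auto simp: relu_def indicator_def max_def)
  also have "\<dots> = ((y - y) * q1 y + q y) - ((y - 0) * q1 0 + q 0)"
  proof (rule integral_FTC_Icc_real[OF y(1)])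
    fix t
    show "((\<lambda>t. (y - t) * q1 t + q t) has_real_derivative (y - t) * q2 t) (at t)"
      using d by (auto intro!: derivative_eq_intros)
    have "isCont q2 t" using c by (simp add: continuous_on_eq_continuous_at)
    then show "isCont (\<lambda>t. (y - t) * q2 t) t" by (intro continuous_intros)
  qed
  finally show ?thesis by (simp add: algebra_simps)
qed

text \<open>For \<open>y \<le> 0\<close> apply the one-sided formula to the reflection of \<open>q\<close>; the integral that belongs to the
  other sign of \<open>y\<close> vanishes. So the sum of both is correct for either sign.\<close>
lemma relu_remainder:
  fixes q q1 q2 :: "real \<Rightarrow> real"
  assumes d: "\<And>t. (q has_real_derivative q1 t) (at t)" "\<And>t. (q1 has_real_derivative q2 t) (at t)"
    and c: "continuous_on UNIV q2" and y: "\<bar>y\<bar> \<le> 1"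
  shows "(\<integral>t. indicator {0..1} t * (q2 t * relu (1 * y - t)) \<partial>lborel)
      + (\<integral>t. indicator {0..1} t * (q2 (- t) * relu ((- 1) * y - t)) \<partial>lborel) = q y - q 0 - q1 0 * y"
proof -
  have z: "(\<integral>t. indicator {0..1} t * (r t * relu (z - t)) \<partial>lborel) = 0" if "z \<le> 0" for z and r :: "real \<Rightarrow> real"
  proof -
    have "(\<lambda>t. indicator {0..1} t * (r t * relu (z - t))) = (\<lambda>t. 0)"
      using that by (auto simp: relu_def indicator_def max_def fun_eq_iff)
    then show ?thesis by simp
  qed
  have dm: "((\<lambda>t. r (- t)) has_real_derivative - r' (- t)) (at t)"
    if "\<And>t. (r has_real_derivative r' t) (at t)" for r r' :: "real \<Rightarrow> real" and t
    using DERIV_mirror that by blast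
  show ?thesis
  proof (cases "y \<ge> 0")
    case True
    then show ?thesis using relu_remainder_pos[OF d c True] y z[of "- y" "\<lambda>t. q2 (- t)"] by simp
  next
    case False
    have d1: "((\<lambda>t. - q1 (- t)) has_real_derivative q2 (- t)) (at t)" for t
      using DERIV_minus[OF dm[OF d(2)]] by simp
    have c': "continuous_on UNIV (\<lambda>t. q2 (- t))" by (intro continuous_on_compose2[OF c] continuous_intros) auto
    show ?thesis using relu_remainder_pos[OF dm[OF d(1)] d1 c', of "- y"] False y z[of y q2] by simp
  qed
qed

lemma step_remainder_pos:
  fixes q q1 :: "real \<Rightarrow> real"
  assumes d: "\<And>t. (q has_real_derivative q1 t) (at t)" and c: "continuous_on UNIV q1" and y: "0 \<le> y" "y \<le> 1"
  shows "(\<integral>t. indicator {0..1} t * (q1 t * of_bool (t \<le> y)) \<partial>lborel) = q y - q 0"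
proof -
  have "(\<integral>t. indicator {0..1} t * (q1 t * of_bool (t \<le> y)) \<partial>lborel) = (\<integral>t. q1 t * indicator {0..y} t \<partial>lborel)"
    using y by (intro Bochner_Integration.integral_cong) (auto simp: indicator_def)
  also have "\<dots> = q y - q 0"
  proof (rule integral_FTC_Icc_real[OF y(1) d])
    show "isCont q1 t" for t using c by (simp add: continuous_on_eq_continuous_at)
  qed
  finally show ?thesis .
qed

lemma abs_sigmoid_le: "\<bar>sigmoid z\<bar> \<le> 1"
  using sigmoid_bounds[of z] by linarith

text \<open>The scaled sigmoid differs from the step by at most \<open>1\<close> within distance \<open>\<eta> = 1 / sqrt a\<close> of the
  jump, and by at most \<open>exp (- a * \<eta>) \<le> \<eta>\<close> elsewhere.\<close>
lemma sigmoid_step_error: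
  assumes a: "a > 0" and q: "continuous_on UNIV q1" "\<And>t. \<bar>q1 t\<bar> \<le> s"
  shows "\<bar>(\<integral>t. indicator {0..1} t * (q1 t * sigmoid (a * (y - t))) \<partial>lborel)
      - (\<integral>t. indicator {0..1} t * (q1 t * of_bool (t \<le> y)) \<partial>lborel)\<bar> \<le> s * (3 / sqrt a)"
proof -
  define \<eta> where "\<eta> = 1 / sqrt a"
  have \<eta>: "\<eta> > 0" "a * \<eta> = sqrt a" using a by (auto simp: \<eta>_def real_div_sqrt)
  have s0: "s \<ge> 0" using q(2)[of 0] by linarith
  have [measurable]: "q1 \<in> borel_measurable borel" "sigmoid \<in> borel_measurable borel"
    using q(1) continuous_sigmoid by (auto intro: borel_measurable_continuous_onI)
  have obm [measurable]: "(\<lambda>t. of_bool (t \<le> y) :: real) \<in> borel_measurable borel"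
  proof -
    have "(\<lambda>t. of_bool (t \<le> y) :: real) = indicator {..y}" by (auto simp: indicator_def)
    then show ?thesis by simp
  qed
  define D where "D t = sigmoid (a * (y - t)) - of_bool (t \<le> y)" for t
  have tail: "\<bar>D t\<bar> \<le> \<eta>" if "\<bar>t - y\<bar> \<ge> \<eta>" for t
  proof -
    have e: "exp (- u) \<le> \<eta>" if "u \<ge> a * \<eta>" for u
    proof -
      have u: "u \<ge> sqrt a" "u > 0" using that \<eta> a by (auto intro: less_le_trans[of 0 "sqrt a"])
      have "u \<le> exp u" using exp_ge_add_one_self[of u] by linarith
      then have "exp (- u) \<le> 1 / u" using u by (simp add: exp_minus field_simps)
      also have "\<dots> \<le> 1 / sqrt a" using u a by (intro divide_left_mono) auto
      finally show ?thesis by (simp add: \<eta>_def)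
    qed
    have s1: "1 - sigmoid z \<le> exp (- z)" for z
    proof -
      have "sigmoid z = 1 / (1 + exp (- z))" by (simp add: sigmoid_def inverse_eq_divide)
      moreover have "1 - 1 / (1 + E) \<le> E" if "E > 0" for E :: real using that by (simp add: field_simps)
      ultimately show ?thesis by simp
    qed
    have s2: "sigmoid z \<le> exp z" for z
    proof -
      have "sigmoid z = 1 / (1 + exp (- z))" by (simp add: sigmoid_def inverse_eq_divide)
      also have "\<dots> \<le> 1 / exp (- z)" by (intro divide_left_mono) (auto intro!: mult_pos_pos add_pos_pos)
      finally show ?thesis by (simp add: exp_minus divide_inverse)
    qed
    show ?thesis
    proof (cases "t \<le> y")
      case True
      then have "a * (y - t) \<ge> a * \<eta>" using that a \<eta> by (intro mult_left_mono) auto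
      then show ?thesis unfolding D_def using True e s1[of "a * (y - t)"] sigmoid_bounds[of "a * (y - t)"] by force
    next
      case False
      then have "a * (t - y) \<ge> a * \<eta>" using that a \<eta> by (intro mult_left_mono) auto
      moreover have "a * (y - t) = - (a * (t - y))" by (simp add: algebra_simps)
      ultimately show ?thesis unfolding D_def using False e[of "a * (t - y)"] s2[of "a * (y - t)"] sigmoid_bounds[of "a * (y - t)"]
        by auto
    qed
  qed
  have D1: "\<bar>D t\<bar> \<le> 1" for t unfolding D_def using sigmoid_bounds[of "a * (y - t)"] by (auto simp: abs_if)
  have ib: "integrable lborel (\<lambda>t. indicator {0..1} t * (q1 t * f t))" if "f \<in> borel_measurable borel" "\<And>t. \<bar>f t\<bar> \<le> 1" for f :: "real \<Rightarrow> real"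
  proof (rule Bochner_Integration.integrable_bound[of _ "\<lambda>t. s * indicator {0..1::real} t"])
    show "AE t in lborel. norm (indicator {0..1} t * (q1 t * f t)) \<le> norm (s * indicator {0..1::real} t)"
      using q(2) that(2) s0 mult_mono[OF q(2) that(2), of _ _] by (auto simp: indicator_def abs_mult intro!: AE_I2)
  qed (use that(1) in auto)
  have Dm: "D \<in> borel_measurable borel" unfolding D_def by measurable
  have eqD: "indicator {0..1} t * (q1 t * D t) = indicator {0..1} t * (q1 t * sigmoid (a * (y - t)))
      - indicator {0..1} t * (q1 t * of_bool (t \<le> y))" for t
    unfolding D_def by (simp add: indicator_def right_diff_distrib[of "q1 t"])
  have "(\<integral>t. indicator {0..1} t * (q1 t * sigmoid (a * (y - t))) \<partial>lborel)
      - (\<integral>t. indicator {0..1} t * (q1 t * of_bool (t \<le> y)) \<partial>lborel) = (\<integral>t. indicator {0..1} t * (q1 t * D t) \<partial>lborel)"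
    unfolding eqD
  proof (rule Bochner_Integration.integral_diff[symmetric])
    show "integrable lborel (\<lambda>t. indicator {0..1} t * (q1 t * sigmoid (a * (y - t))))"
      by (rule ib) (measurable, rule abs_sigmoid_le)
    show "integrable lborel (\<lambda>t. indicator {0..1} t * (q1 t * of_bool (t \<le> y)))"
      by (rule ib) (rule obm, simp)
  qed
  also have "\<bar>\<dots>\<bar> \<le> (\<integral>t. \<bar>indicator {0..1} t * (q1 t * D t)\<bar> \<partial>lborel)" by (rule integral_abs_bound)
  also have "\<dots> \<le> (\<integral>t. s * indicator {y - \<eta>..y + \<eta>} t + (s * \<eta>) * indicator {0..1} t \<partial>lborel)"
  proof (rule integral_mono)
    show "integrable lborel (\<lambda>t. \<bar>indicator {0..1} t * (q1 t * D t)\<bar>)" by (intro integrable_abs ib Dm D1)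
    show "integrable lborel (\<lambda>t. s * indicator {y - \<eta>..y + \<eta>} t + (s * \<eta>) * indicator {0..1} t)"
      by (intro Bochner_Integration.integrable_add integrable_mult_right integrable_real_indicator)
         (auto simp: emeasure_lborel_Icc_eq)
    fix t
    show "\<bar>indicator {0..1} t * (q1 t * D t)\<bar> \<le> s * indicator {y - \<eta>..y + \<eta>} t + (s * \<eta>) * indicator {0..1} t"
    proof (cases "t \<in> {0..1}")
      case True
      show ?thesis
      proof (cases "\<bar>t - y\<bar> \<ge> \<eta>")
        case far: True
        have "\<bar>q1 t\<bar> * \<bar>D t\<bar> \<le> s * \<eta>" using q(2)[of t] tail[OF far] s0 by (intro mult_mono) auto
        moreover have "0 \<le> s * indicator {y - \<eta>..y + \<eta>} t" using s0 by simp
        ultimately show ?thesis using True by (simp add: abs_mult)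
      next
        case near: False
        have "\<bar>q1 t\<bar> * \<bar>D t\<bar> \<le> s * 1" using q(2)[of t] D1[of t] s0 by (intro mult_mono) auto
        moreover have "t \<in> {y - \<eta>..y + \<eta>}" using near by auto
        moreover have "0 \<le> s * \<eta>" using s0 \<eta> by simp
        ultimately show ?thesis using True by (simp add: abs_mult)
      qed
    qed (use s0 in simp)
  qed
  also have "\<dots> = s * (2 * \<eta>) + s * \<eta>" using \<eta> by (subst Bochner_Integration.integral_add) auto
  also have "\<dots> = s * (3 / sqrt a)" by (simp add: \<eta>_def)
  finally show ?thesis .
qed

text \<open>The first-order analogue of \<open>relu_remainder\<close>: the fundamental theorem of calculus on either side of
  \<open>0\<close>. For \<open>y = 0\<close> both integrals vanish because the steps overlap the range only in one point.\<close>
lemma step_remainder: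
  fixes q q1 :: "real \<Rightarrow> real"
  assumes d: "\<And>t. (q has_real_derivative q1 t) (at t)" and c: "continuous_on UNIV q1" and y: "\<bar>y\<bar> \<le> 1"
  shows "(\<integral>t. indicator {0..1} t * (q1 t * of_bool (t \<le> 1 * y)) \<partial>lborel)
      + (\<integral>t. indicator {0..1} t * (- q1 (- t) * of_bool (t \<le> (- 1) * y)) \<partial>lborel) = q y - q 0"
proof -
  have d': "((\<lambda>t. q (- t)) has_real_derivative - q1 (- t)) (at t)" for t
    using DERIV_mirror d by blast
  have c': "continuous_on UNIV (\<lambda>t. - q1 (- t))"
    by (intro continuous_on_minus continuous_on_compose2[OF c] continuous_intros) auto
  have z: "(\<integral>t. indicator {0..1} t * (r t * of_bool (t \<le> w)) \<partial>lborel) = 0" if "w < 0" for w and r :: "real \<Rightarrow> real"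
  proof -
    have "(\<lambda>t. indicator {0..1} t * (r t * of_bool (t \<le> w))) = (\<lambda>t. 0)"
      using that by (auto simp: indicator_def fun_eq_iff)
    then show ?thesis by simp
  qed
  consider "y = 0" | "y > 0" | "y < 0" by linarith
  then show ?thesis
  proof cases
    case 1
    then show ?thesis using step_remainder_pos[OF d c, of 0] step_remainder_pos[OF d' c', of 0] by simp
  next
    case 2
    then show ?thesis using step_remainder_pos[OF d c, of y] z[of "- y" "\<lambda>t. - q1 (- t)"] y by simp
  next
    case 3
    then show ?thesis using step_remainder_pos[OF d' c', of "- y"] z[of y q1] y by simp
  qed
qed

text \<open>The real wave \<open>Re (exp (\<i> * y) * z)\<close> with complex amplitude \<open>z\<close>, and its derivative in \<open>y\<close>.\<close>
definition osc :: "complex \<Rightarrow> real \<Rightarrow> real" where "osc z y = Re z * cos y - Im z * sin y"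
definition osc' :: "complex \<Rightarrow> real \<Rightarrow> real" where "osc' z y = - (Re z * sin y + Im z * cos y)"

lemma osc_eq: "osc z y = Re (exp (\<i> * complex_of_real y) * z)"
  unfolding osc_def cis_conv_exp[symmetric] by (simp add: algebra_simps)

lemma osc'_eq: "osc' z y = Re (exp (\<i> * complex_of_real y) * (\<i> * z))"
  unfolding osc'_def cis_conv_exp[symmetric] by (simp add: algebra_simps)

lemma abs_osc_le: "\<bar>osc z y\<bar> \<le> cmod z" "\<bar>osc' z y\<bar> \<le> cmod z"
proof -
  have "cmod (exp (\<i> * complex_of_real y) * z) = cmod z" "cmod (exp (\<i> * complex_of_real y) * (\<i> * z)) = cmod z"
    by (simp_all add: norm_mult)
  then show "\<bar>osc z y\<bar> \<le> cmod z" "\<bar>osc' z y\<bar> \<le> cmod z"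
    unfolding osc_eq osc'_eq by (metis abs_Re_le_cmod)+
qed

lemma osc_taylor:
  "\<bar>osc z y - osc z 0\<bar> \<le> cmod z * \<bar>y\<bar>"
  "\<bar>osc z y - osc z 0 - osc' z 0 * y\<bar> \<le> cmod z * (y\<^sup>2 / 2)"
proof -
  have "osc z y - osc z 0 = Re ((exp (\<i> * complex_of_real y) - 1) * z)"
    unfolding osc_eq by (simp add: algebra_simps)
  also have "\<bar>\<dots>\<bar> \<le> cmod (exp (\<i> * complex_of_real y) - 1) * cmod z"
    using abs_Re_le_cmod by (metis norm_mult)
  also have "\<dots> \<le> \<bar>y\<bar> * cmod z" using iexp_approx1[of y 0] by (intro mult_right_mono) auto
  finally show "\<bar>osc z y - osc z 0\<bar> \<le> cmod z * \<bar>y\<bar>" by (simp add: mult.commute)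
  have "osc z y - osc z 0 - osc' z 0 * y = Re ((exp (\<i> * complex_of_real y) - (1 + \<i> * complex_of_real y)) * z)"
    unfolding osc_eq osc'_eq by (simp add: algebra_simps)
  also have "\<bar>\<dots>\<bar> \<le> cmod (exp (\<i> * complex_of_real y) - (1 + \<i> * complex_of_real y)) * cmod z"
    using abs_Re_le_cmod by (metis norm_mult)
  also have "\<dots> \<le> (y\<^sup>2 / 2) * cmod z"
    using iexp_approx1[of y 1] by (intro mult_right_mono) (auto simp: numeral_2_eq_2)
  finally show "\<bar>osc z y - osc z 0 - osc' z 0 * y\<bar> \<le> cmod z * (y\<^sup>2 / 2)" by (simp add: mult.commute)
qed

lemma osc_DERIV:
  "((\<lambda>y. osc z (s * y)) has_real_derivative s * osc' z (s * y)) (at y)"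
  "((\<lambda>y. s * osc' z (s * y)) has_real_derivative - s\<^sup>2 * osc z (s * y)) (at y)"
  unfolding osc_def osc'_def
  by (auto intro!: derivative_eq_intros simp: algebra_simps power2_eq_square)

lemma continuous_osc:
  fixes g :: "'a::t2_space \<Rightarrow> real"
  shows "continuous_on S g \<Longrightarrow> continuous_on S (\<lambda>x. osc z (g x))"
  "continuous_on S g \<Longrightarrow> continuous_on S (\<lambda>x. osc' z (g x))"
  unfolding osc_def osc'_def by (auto intro!: continuous_intros)

lemma osc_measurable [measurable (raw)]:
  assumes [measurable]: "h \<in> borel_measurable N" "g \<in> borel_measurable N"
  shows "(\<lambda>x. osc (h x) (g x)) \<in> borel_measurable N" "(\<lambda>x. osc' (h x) (g x)) \<in> borel_measurable N"
proof -
  have [measurable]: "(\<lambda>x. cos (g x)) \<in> borel_measurable N" "(\<lambda>x. sin (g x)) \<in> borel_measurable N"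
    by (intro measurable_compose[OF assms(2)] borel_measurable_continuous_onI continuous_on_cos continuous_on_sin continuous_on_id)+
  show "(\<lambda>x. osc (h x) (g x)) \<in> borel_measurable N" "(\<lambda>x. osc' (h x) (g x)) \<in> borel_measurable N"
    unfolding osc_def osc'_def by measurable
qed

text \<open>Taking real parts makes the representation of a real function an average of real waves against a
  finite positive measure. Finiteness of the total variation comes from integrability of the polar
  density, which has modulus \<open>1\<close>.\<close>
lemma fourier_representation_real:
  fixes f :: "real^'d \<Rightarrow> real"
  assumes "fourier_representation f F"
  obtains h where "finite_measure (total_variation F)" "sets (total_variation F) = sets borel"
    "h \<in> borel_measurable borel" "\<And>\<omega>. cmod (h \<omega>) = 1"
    "\<And>x. f x = (\<integral>\<omega>. osc (h \<omega>) (\<omega> \<bullet> x) \<partial>total_variation F)"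
proof -
  let ?T = "total_variation F"
  have sT: "sets ?T = sets borel"
    unfolding total_variation_def using sets.sigma_sets_eq[of "borel :: (real^'d) measure"] by (simp add: sets_measure_of)
  obtain h where i: "integrable ?T h" and n: "\<And>\<omega>. cmod (h \<omega>) = 1"
    and f: "\<And>x. complex_of_real (f x) = (LINT \<omega>|?T. exp (\<i> * complex_of_real (\<omega> \<bullet> x)) * h \<omega>)"
    using assms unfolding fourier_representation_def polar_density_def by blast
  have "integrable ?T (\<lambda>\<omega>. cmod (h \<omega>))" using i by (rule integrable_norm)
  then have i1: "integrable ?T (\<lambda>\<omega>. 1 :: real)" by (simp add: n)
  have "emeasure ?T (space ?T) \<noteq> \<infinity>"
    using i1 by (simp add: integrable_iff_bounded less_top)
  then have fin: "finite_measure ?T" by (rule finite_measureI)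
  interpret finite_measure ?T by (rule fin)
  have "h \<in> borel_measurable ?T" using i by (rule borel_measurable_integrable)
  then have hm: "h \<in> borel_measurable borel" using measurable_cong_sets[OF sT refl] by blast
  have "f x = (\<integral>\<omega>. osc (h \<omega>) (\<omega> \<bullet> x) \<partial>?T)" for x
  proof -
    have m: "(\<lambda>\<omega>. exp (\<i> * complex_of_real (\<omega> \<bullet> x)) * h \<omega>) \<in> borel_measurable ?T"
      unfolding measurable_cong_sets[OF sT refl] using hm by measurable
    have ii: "integrable ?T (\<lambda>\<omega>. exp (\<i> * complex_of_real (\<omega> \<bullet> x)) * h \<omega>)"
      by (rule integrable_const_bound[of _ 1, OF _ m]) (auto simp: norm_mult n)
    have "f x = Re (LINT \<omega>|?T. exp (\<i> * complex_of_real (\<omega> \<bullet> x)) * h \<omega>)" by (simp flip: f)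
    also have "\<dots> = (\<integral>\<omega>. osc (h \<omega>) (\<omega> \<bullet> x) \<partial>?T)" unfolding osc_eq by (rule integral_Re[OF ii, symmetric])
    finally show ?thesis .
  qed
  then show thesis using that fin sT hm n by blast
qed

lemma moment_integrable:
  fixes m :: "(real^'d) measure"
  assumes m: "sets m = sets borel" and mom: "(\<integral>\<^sup>+\<omega>. ennreal (l1norm \<omega> ^ p) \<partial>m) \<le> ennreal c" and c: "c \<ge> 0"
  shows "integrable m (\<lambda>\<omega>. l1norm \<omega> ^ p)" "(\<integral>\<omega>. l1norm \<omega> ^ p \<partial>m) \<le> c"
proof -
  have lm: "(\<lambda>\<omega>. l1norm \<omega> ^ p) \<in> borel_measurable m" unfolding measurable_cong_sets[OF m refl] by measurable
  show i: "integrable m (\<lambda>\<omega>. l1norm \<omega> ^ p)"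
    using mom by (intro integrableI_bounded lm) (auto simp: less_top[symmetric] top_unique)
  show "(\<integral>\<omega>. l1norm \<omega> ^ p \<partial>m) \<le> c"
    using mom c by (subst (asm) nn_integral_eq_integral[OF i]) (auto simp: ennreal_le_iff)
qed

lemma sup_radius_cube_ge: "1 \<le> sup_radius (cbox 0 1 :: (real^'d) set)"
proof -
  have "(1::real) \<le> infnorm (1 :: real^'d)" using component_le_infnorm_cart[of "1 :: real^'d" undefined] by simp
  then have "1 \<le> ennreal (infnorm (1 :: real^'d))" by simp
  also have "\<dots> \<le> sup_radius (cbox 0 1 :: (real^'d) set)"
    unfolding sup_radius_def by (rule SUP_upper) (auto simp: mem_box_cart)
  finally show ?thesis .
qed

lemma spectral_moment_le_of_radius:
  fixes F :: "(real^'d) set \<Rightarrow> complex"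
  assumes "sup_radius (cbox 0 1 :: (real^'d) set) * spectral_moment p F \<le> ennreal c"
  shows "(\<integral>\<^sup>+\<omega>. ennreal (l1norm \<omega> ^ p) \<partial>total_variation F) \<le> ennreal c"
proof -
  have "1 * spectral_moment p F \<le> sup_radius (cbox 0 1 :: (real^'d) set) * spectral_moment p F"
    by (intro mult_right_mono sup_radius_cube_ge) simp
  then show ?thesis using assms unfolding spectral_moment_def by simp
qed

text \<open>If \<open>R\<close> pairs with every bounded \<open>S\<close> to at most \<open>2 * M\<close> times the largest pairing of \<open>S\<close> with a
  neuron, then the dictionary of neurons with outer weight at most \<open>2 * M\<close> satisfies the duality
  hypothesis of the greedy lemma for \<open>R\<close>; averaging the \<open>n\<close> chosen members gives the outer weights
  \<open>2 * M / n\<close>.\<close>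
lemma network_from_dual:
  fixes \<nu> :: "(real^'d) measure" and \<phi> :: "real \<Rightarrow> real"
  assumes \<nu>: "prob_space \<nu>" "sets \<nu> = sets (restrict_space borel (cbox 0 1))" and M: "M > 0" and n: "n \<ge> (1::nat)"
    and a: "a \<ge> 0" and \<phi>: "continuous_on UNIV \<phi>"
    and bd: "\<And>w b x. l1norm w \<le> a \<Longrightarrow> \<bar>b\<bar> \<le> a \<Longrightarrow> x \<in> cbox 0 1 \<Longrightarrow> \<bar>\<phi> (w \<bullet> (x :: real^'d) + b)\<bar> \<le> C"
    and R: "(R :: real^'d \<Rightarrow> real) \<in> borel_measurable \<nu>" "\<And>x. x \<in> cbox 0 1 \<Longrightarrow> \<bar>R x\<bar> \<le> 2 * M * C"
    and dual: "\<And>(S :: real^'d \<Rightarrow> real) c K. S \<in> borel_measurable \<nu> \<Longrightarrow> (\<And>x. x \<in> space \<nu> \<Longrightarrow> \<bar>S x\<bar> \<le> c) \<Longrightarrow>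
      (\<And>w b. l1norm w \<le> a \<Longrightarrow> \<bar>b\<bar> \<le> a \<Longrightarrow> \<bar>\<integral>x. S x * \<phi> (w \<bullet> x + b) \<partial>\<nu>\<bar> \<le> K) \<Longrightarrow> \<bar>\<integral>x. S x * R x \<partial>\<nu>\<bar> \<le> 2 * M * K"
  shows "\<exists>\<beta> w b. (\<forall>i\<in>{1..n}. max (l1norm (w i)) \<bar>b i\<bar> \<le> a \<and> \<bar>\<beta> i\<bar> \<le> 2 / real n * M) \<and>
    (\<integral>x. ((\<Sum>i=1..n. \<beta> i * \<phi> (w i \<bullet> x + b i)) - R x)\<^sup>2 \<partial>\<nu>) \<le> (4 * (2 * M * C)\<^sup>2 + 2) / n"
proof -
  have sp: "space \<nu> = cbox 0 1" using sets_eq_imp_space_eq[OF \<nu>(2)] by (simp add: space_restrict_space)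
  have C0: "C \<ge> 0" using bd[of 0 0 0] a by (auto intro: order_trans[OF abs_ge_zero] simp: mem_box_cart)
  define D where "D = {(\<lambda>x :: real^'d. \<beta> * \<phi> (w \<bullet> x + b)) |\<beta> w b. l1norm w \<le> a \<and> \<bar>b\<bar> \<le> a \<and> \<bar>\<beta>\<bar> \<le> 2 * M}"
  have \<phi>m: "(\<lambda>x. \<phi> (w \<bullet> x + b)) \<in> borel_measurable \<nu>" for w b
  proof (rule sets_restrict_cube_measurable[OF _ \<nu>(2)])
    show "(\<lambda>x. \<phi> (w \<bullet> x + b)) \<in> borel_measurable borel"
      by (intro borel_measurable_continuous_onI continuous_on_compose2[OF \<phi>] continuous_intros) auto
  qed
  have "\<exists>v. (\<forall>i. v i \<in> D) \<and> (\<integral>x. (\<Sum>i=1..n. v i x - R x)\<^sup>2 \<partial>\<nu>) \<le> real n * (4 * (2 * M * C)\<^sup>2 + 2)"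
  proof (rule maurey_greedy[OF \<nu>(1) R(1)])
    show "\<bar>R x\<bar> \<le> 2 * M * C" if "x \<in> space \<nu>" for x using R(2) that sp by simp
    show "v \<in> borel_measurable \<nu>" if "v \<in> D" for v using that \<phi>m unfolding D_def by auto
    show "\<bar>v x\<bar> \<le> 2 * M * C" if "v \<in> D" "x \<in> space \<nu>" for v x
    proof -
      obtain \<beta> w b where v: "v = (\<lambda>x. \<beta> * \<phi> (w \<bullet> x + b))" "l1norm w \<le> a" "\<bar>b\<bar> \<le> a" "\<bar>\<beta>\<bar> \<le> 2 * M"
        using \<open>v \<in> D\<close> unfolding D_def by blast
      have "\<bar>\<beta>\<bar> * \<bar>\<phi> (w \<bullet> x + b)\<bar> \<le> (2 * M) * C" using v bd[of w b x] that sp M by (intro mult_mono) auto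
      then show ?thesis unfolding v(1) by (simp add: abs_mult)
    qed
    fix S :: "real^'d \<Rightarrow> real" and c assume S: "S \<in> borel_measurable \<nu>" "\<And>x. x \<in> space \<nu> \<Longrightarrow> \<bar>S x\<bar> \<le> c"
    show "\<exists>v\<in>D. (\<integral>x. S x * v x \<partial>\<nu>) \<le> (\<integral>x. S x * R x \<partial>\<nu>) + 1"
    proof (rule ccontr)
      assume neg: "\<not> ?thesis"
      define I where "I = (\<integral>x. S x * R x \<partial>\<nu>)"
      \<comment> \<open>the failure of \<open>dual\<close>, for both signs of the outer weight, bounds all pairings of \<open>S\<close> by \<open>K\<close>\<close>
      define K where "K = (- I - 1) / (2 * M)"
      have "\<bar>\<integral>x. S x * \<phi> (w \<bullet> x + b) \<partial>\<nu>\<bar> \<le> K" if wb: "l1norm w \<le> a" "\<bar>b\<bar> \<le> a" for w b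
      proof -
        have gt: "\<beta> * (\<integral>x. S x * \<phi> (w \<bullet> x + b) \<partial>\<nu>) > I + 1" if "\<bar>\<beta>\<bar> \<le> 2 * M" for \<beta>
        proof -
          have "(\<lambda>x. \<beta> * \<phi> (w \<bullet> x + b)) \<in> D" using wb that unfolding D_def by blast
          then have "(\<integral>x. S x * (\<beta> * \<phi> (w \<bullet> x + b)) \<partial>\<nu>) > I + 1" using neg unfolding I_def by force
          moreover have "(\<lambda>x. S x * (\<beta> * \<phi> (w \<bullet> x + b))) = (\<lambda>x. \<beta> * (S x * \<phi> (w \<bullet> x + b)))" by (auto simp: ac_simps)
          ultimately show ?thesis by simp
        qed
        have "2 * M * \<bar>\<integral>x. S x * \<phi> (w \<bullet> x + b) \<partial>\<nu>\<bar> \<le> - I - 1"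
          using gt[of "2 * M"] gt[of "- (2 * M)"] M by (auto simp: abs_if)
        then show ?thesis unfolding K_def using M by (simp add: field_simps)
      qed
      from dual[OF S this] have "\<bar>I\<bar> \<le> 2 * M * K" unfolding I_def .
      then show False unfolding K_def using M by (auto simp: abs_if split: if_splits)
    qed
  qed
  then obtain v where v: "\<And>i. v i \<in> D" and le: "(\<integral>x. (\<Sum>i=1..n. v i x - R x)\<^sup>2 \<partial>\<nu>) \<le> real n * (4 * (2 * M * C)\<^sup>2 + 2)"
    by blast
  have "\<forall>i. \<exists>\<beta> w b. v i = (\<lambda>x. \<beta> * \<phi> (w \<bullet> x + b)) \<and> l1norm w \<le> a \<and> \<bar>b\<bar> \<le> a \<and> \<bar>\<beta>\<bar> \<le> 2 * M"
    using v unfolding D_def by blast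
  then obtain \<beta> w b where vi: "\<And>i. v i = (\<lambda>x. \<beta> i * \<phi> (w i \<bullet> x + b i))"
    and h: "\<And>i. l1norm (w i) \<le> a" "\<And>i. \<bar>b i\<bar> \<le> a" "\<And>i. \<bar>\<beta> i\<bar> \<le> 2 * M" by metis
  have eq: "((\<Sum>i=1..n. \<beta> i / n * \<phi> (w i \<bullet> x + b i)) - R x)\<^sup>2 = (1 / (real n)\<^sup>2) * (\<Sum>i=1..n. v i x - R x)\<^sup>2" for x
  proof -
    have "(\<Sum>i=1..n. v i x - R x) = real n * ((\<Sum>i=1..n. \<beta> i / n * \<phi> (w i \<bullet> x + b i)) - R x)"
      using n by (simp add: vi sum_subtractf sum_distrib_left right_diff_distrib)
    then show ?thesis using n by (simp add: power_mult_distrib)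
  qed
  have "(\<integral>x. ((\<Sum>i=1..n. \<beta> i / n * \<phi> (w i \<bullet> x + b i)) - R x)\<^sup>2 \<partial>\<nu>) = (1 / (real n)\<^sup>2) * (\<integral>x. (\<Sum>i=1..n. v i x - R x)\<^sup>2 \<partial>\<nu>)"
    unfolding eq by simp
  also have "\<dots> \<le> (1 / (real n)\<^sup>2) * (real n * (4 * (2 * M * C)\<^sup>2 + 2))" by (intro mult_left_mono le) auto
  also have "\<dots> = (4 * (2 * M * C)\<^sup>2 + 2) / n" using n by (simp add: power2_eq_square)
  finally have fin: "(\<integral>x. ((\<Sum>i=1..n. \<beta> i / n * \<phi> (w i \<bullet> x + b i)) - R x)\<^sup>2 \<partial>\<nu>) \<le> (4 * (2 * M * C)\<^sup>2 + 2) / n" .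
  have "\<bar>\<beta> i / n\<bar> \<le> 2 / real n * M" for i using h(3)[of i] n by (simp add: divide_right_mono)
  then show ?thesis using fin h by (intro exI[of _ "\<lambda>i. \<beta> i / n"] exI[of _ w] exI[of _ b]) auto
qed

section \<open>Approximation by ReLU networks\<close>

text \<open>The infimum in the coefficient need not be attained, hence a witness only for \<open>c > M\<close>.\<close>
lemma KB_coeff_witness:
  fixes f :: "real^'d \<Rightarrow> real"
  assumes "KB_coeff f (cbox 0 1) \<le> ennreal M" "M < c" "0 \<le> M"
  obtains f' F D where "fourier_representation f' F" "\<And>x. x \<in> cbox 0 1 \<Longrightarrow> f' x = f x"
    "(\<integral>\<^sup>+\<omega>. ennreal (l1norm \<omega> ^ 2) \<partial>total_variation F) \<le> ennreal c" "\<bar>f' 0\<bar> \<le> c"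
    "GDERIV f' 0 :> D" "l1norm D \<le> c"
proof -
  have "KB_coeff f (cbox 0 1) < ennreal c"
    using assms by (meson ennreal_lessI le_less_trans order_le_less_trans)
  then obtain c' f' F D where c': "0 \<le> c'" "ennreal c' < ennreal c" and
    "fourier_representation f' F" "\<forall>x\<in>cbox 0 1. f' x = f x"
    "sup_radius (cbox 0 1 :: (real^'d) set) * spectral_moment 2 F \<le> ennreal c'" "\<bar>f' 0\<bar> \<le> c'"
    "GDERIV f' 0 :> D" "l1norm D \<le> c'"
    unfolding KB_coeff_def Inf_less_iff by blast
  moreover have "c' \<le> c" using c' by (simp add: ennreal_less_iff)
  moreover from this have "ennreal c' \<le> ennreal c" by (rule ennreal_leI)
  ultimately show thesis
    using that[of f' F D] spectral_moment_le_of_radius[of 2 F c'] by (meson order_trans)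
qed

lemma B_coeff_witness:
  fixes f :: "real^'d \<Rightarrow> real"
  assumes "B_coeff f (cbox 0 1) \<le> ennreal M" "M < c" "0 \<le> M"
  obtains f' F where "fourier_representation f' F" "\<And>x. x \<in> cbox 0 1 \<Longrightarrow> f' x = f x"
    "(\<integral>\<^sup>+\<omega>. ennreal (l1norm \<omega> ^ 1) \<partial>total_variation F) \<le> ennreal c" "\<bar>f' 0\<bar> \<le> c"
proof -
  have "B_coeff f (cbox 0 1) < ennreal c"
    using assms by (meson ennreal_lessI le_less_trans order_le_less_trans)
  then obtain c' f' F where c': "0 \<le> c'" "ennreal c' < ennreal c" and
    "fourier_representation f' F" "\<forall>x\<in>cbox 0 1. f' x = f x"
    "sup_radius (cbox 0 1 :: (real^'d) set) * spectral_moment 1 F \<le> ennreal c'" "\<bar>f' 0\<bar> \<le> c'"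
    unfolding B_coeff_def Inf_less_iff by blast
  moreover have "c' \<le> c" using c' by (simp add: ennreal_less_iff)
  moreover from this have "ennreal c' \<le> ennreal c" by (rule ennreal_leI)
  ultimately show thesis
    using that[of f' F] spectral_moment_le_of_radius[of 1 F c'] by (meson order_trans)
qed

lemma osc_direction_measurable:
  fixes h :: "real^'d \<Rightarrow> complex"
  assumes h: "h \<in> borel_measurable borel" and r: "r = (\<lambda>t. t) \<or> r = uminus"
  shows "(\<lambda>\<theta>. osc (h (fst \<theta>)) (l1norm (fst \<theta>) * r (snd \<theta>))) \<in> borel_measurable (borel :: ((real^'d) \<times> real) measure)"
    and "(\<lambda>\<theta>. osc' (h (fst \<theta>)) (l1norm (fst \<theta>) * r (snd \<theta>))) \<in> borel_measurable (borel :: ((real^'d) \<times> real) measure)"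
    and "(\<lambda>\<theta>. l1norm (fst \<theta>)) \<in> borel_measurable (borel :: ((real^'d) \<times> real) measure)"
proof -
  have f: "(fst :: (real^'d) \<times> real \<Rightarrow> real^'d) \<in> borel_measurable borel"
    and s [measurable]: "(snd :: (real^'d) \<times> real \<Rightarrow> real) \<in> borel_measurable borel"
    by (intro borel_measurable_continuous_onI continuous_intros)+
  have [measurable]: "(\<lambda>\<theta> :: (real^'d) \<times> real. h (fst \<theta>)) \<in> borel_measurable borel"
    by (rule measurable_compose[OF f h])
  show l [measurable]: "(\<lambda>\<theta>. l1norm (fst \<theta>)) \<in> borel_measurable (borel :: ((real^'d) \<times> real) measure)"
    by (rule measurable_compose[OF f l1norm_measurable])
  have [measurable]: "(\<lambda>\<theta> :: (real^'d) \<times> real. r (snd \<theta>)) \<in> borel_measurable borel" using r by auto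
  show "(\<lambda>\<theta>. osc (h (fst \<theta>)) (l1norm (fst \<theta>) * r (snd \<theta>))) \<in> borel_measurable (borel :: ((real^'d) \<times> real) measure)"
    "(\<lambda>\<theta>. osc' (h (fst \<theta>)) (l1norm (fst \<theta>) * r (snd \<theta>))) \<in> borel_measurable (borel :: ((real^'d) \<times> real) measure)"
    by measurable
qed

text \<open>Differentiation under the integral, along the ray through \<open>x\<close>: the second moment makes the error
  of the linear expansion of \<open>f (r *\<^sub>R x)\<close> quadratic in \<open>r\<close>, and derivatives are unique.\<close>
lemma gradient_eq_integral:
  fixes m :: "(real^'d) measure" and h :: "real^'d \<Rightarrow> complex"
  assumes m: "finite_measure m" "sets m = sets borel" and h: "h \<in> borel_measurable borel" "\<And>\<omega>. cmod (h \<omega>) = 1"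
    and mom: "(\<integral>\<^sup>+\<omega>. ennreal (l1norm \<omega> ^ 2) \<partial>m) \<le> ennreal c" "c \<ge> 0"
    and f: "\<And>x. f x = (\<integral>\<omega>. osc (h \<omega>) (\<omega> \<bullet> x) \<partial>m)" and D: "GDERIV f 0 :> D" and x: "x \<in> cbox 0 1"
  shows "integrable m (\<lambda>\<omega>. osc' (h \<omega>) 0 * (\<omega> \<bullet> x))" "D \<bullet> x = (\<integral>\<omega>. osc' (h \<omega>) 0 * (\<omega> \<bullet> x) \<partial>m)"
proof -
  interpret finite_measure m by fact
  note mi = moment_integrable[OF m(2) mom]
  have hm: "h \<in> borel_measurable m" unfolding measurable_cong_sets[OF m(2) refl] by (rule h)
  have idm: "(\<lambda>\<omega>. \<omega> \<bullet> x) \<in> borel_measurable m" for x unfolding measurable_cong_sets[OF m(2) refl] by measurable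
  have om: "(\<lambda>\<omega>. osc (h \<omega>) (\<omega> \<bullet> x)) \<in> borel_measurable m" "(\<lambda>\<omega>. osc' (h \<omega>) 0) \<in> borel_measurable m" for x
    using hm idm by measurable
  have oi: "integrable m (\<lambda>\<omega>. osc (h \<omega>) (\<omega> \<bullet> x))" for x
    by (rule integrable_const_bound[of _ 1, OF _ om(1)]) (auto intro!: AE_I2 order_trans[OF abs_osc_le(1)] simp: h(2))
  have wx: "\<bar>\<omega> \<bullet> x\<bar> \<le> l1norm \<omega>" for \<omega> by (rule abs_inner_le_l1norm[OF x])
  show li: "integrable m (\<lambda>\<omega>. osc' (h \<omega>) 0 * (\<omega> \<bullet> x))"
  proof (rule Bochner_Integration.integrable_bound[of _ "\<lambda>\<omega>. 1 + l1norm \<omega> ^ 2"])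
    show "integrable m (\<lambda>\<omega>. 1 + l1norm \<omega> ^ 2)" using mi(1) by auto
    show "(\<lambda>\<omega>. osc' (h \<omega>) 0 * (\<omega> \<bullet> x)) \<in> borel_measurable m" using om(2) idm by measurable
    show "AE \<omega> in m. norm (osc' (h \<omega>) 0 * (\<omega> \<bullet> x)) \<le> norm (1 + l1norm \<omega> ^ 2)"
    proof (rule AE_I2)
      fix \<omega>
      have "\<bar>osc' (h \<omega>) 0\<bar> * \<bar>\<omega> \<bullet> x\<bar> \<le> 1 * l1norm \<omega>"
        using abs_osc_le(2)[of "h \<omega>" 0] h(2)[of \<omega>] wx[of \<omega>] by (intro mult_mono) auto
      also have "\<dots> \<le> 1 + l1norm \<omega> ^ 2"
        using sum_squares_bound[of 1 "l1norm \<omega>"] l1norm_nonneg[of \<omega>] unfolding power2_eq_square by linarith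
      finally show "norm (osc' (h \<omega>) 0 * (\<omega> \<bullet> x)) \<le> norm (1 + l1norm \<omega> ^ 2)" by (simp add: abs_mult)
    qed
  qed
  \<comment> \<open>the candidate derivative; the quadratic bound below identifies it with \<open>D \<bullet> x\<close>\<close>
  define l where "l = (\<integral>\<omega>. osc' (h \<omega>) 0 * (\<omega> \<bullet> x) \<partial>m)"
  have quad: "\<bar>f (r *\<^sub>R x) - f 0 - r * l\<bar> \<le> r\<^sup>2 * c" for r :: real
  proof -
    have "f (r *\<^sub>R x) - f 0 - r * l = (\<integral>\<omega>. osc (h \<omega>) (\<omega> \<bullet> (r *\<^sub>R x)) - osc (h \<omega>) (\<omega> \<bullet> 0) - r * (osc' (h \<omega>) 0 * (\<omega> \<bullet> x)) \<partial>m)"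
      unfolding f l_def using oi[of "r *\<^sub>R x"] oi[of 0] li by simp
    also have "\<bar>\<dots>\<bar> \<le> (\<integral>\<omega>. \<bar>osc (h \<omega>) (\<omega> \<bullet> (r *\<^sub>R x)) - osc (h \<omega>) (\<omega> \<bullet> 0) - r * (osc' (h \<omega>) 0 * (\<omega> \<bullet> x))\<bar> \<partial>m)"
      by (rule integral_abs_bound)
    also have "\<dots> \<le> (\<integral>\<omega>. r\<^sup>2 * l1norm \<omega> ^ 2 \<partial>m)"
    proof (rule integral_mono)
      show "integrable m (\<lambda>\<omega>. \<bar>osc (h \<omega>) (\<omega> \<bullet> (r *\<^sub>R x)) - osc (h \<omega>) (\<omega> \<bullet> 0) - r * (osc' (h \<omega>) 0 * (\<omega> \<bullet> x))\<bar>)"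
        by (intro integrable_abs Bochner_Integration.integrable_diff oi integrable_mult_right li)
      show "integrable m (\<lambda>\<omega>. r\<^sup>2 * l1norm \<omega> ^ 2)" using mi(1) by simp
      fix \<omega>
      have "\<bar>osc (h \<omega>) (r * (\<omega> \<bullet> x)) - osc (h \<omega>) 0 - osc' (h \<omega>) 0 * (r * (\<omega> \<bullet> x))\<bar> \<le> 1 * ((r * (\<omega> \<bullet> x))\<^sup>2 / 2)"
        using osc_taylor(2)[of "h \<omega>" "r * (\<omega> \<bullet> x)"] h(2)[of \<omega>] by simp
      also have "\<dots> \<le> r\<^sup>2 * (\<omega> \<bullet> x)\<^sup>2" by (simp add: power_mult_distrib)
      also have "\<dots> \<le> r\<^sup>2 * l1norm \<omega> ^ 2"
        using wx[of \<omega>] by (intro mult_left_mono abs_le_square_iff[THEN iffD1]) auto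
      finally show "\<bar>osc (h \<omega>) (\<omega> \<bullet> (r *\<^sub>R x)) - osc (h \<omega>) (\<omega> \<bullet> 0) - r * (osc' (h \<omega>) 0 * (\<omega> \<bullet> x))\<bar> \<le> r\<^sup>2 * l1norm \<omega> ^ 2"
        by (simp add: ac_simps)
    qed
    also have "\<dots> = r\<^sup>2 * (\<integral>\<omega>. l1norm \<omega> ^ 2 \<partial>m)" by simp
    also have "\<dots> \<le> r\<^sup>2 * c" using mi(2) by (intro mult_left_mono) auto
    finally show ?thesis .
  qed
  have d1: "((\<lambda>r. f (r *\<^sub>R x)) has_real_derivative l) (at 0)"
  proof -
    have "((\<lambda>r. (f ((0 + r) *\<^sub>R x) - f (0 *\<^sub>R x)) / r) \<longlongrightarrow> l) (at 0)"
    proof (rule LIM_zero_cancel, rule tendsto_rabs_zero_cancel)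
      have "((\<lambda>r::real. \<bar>r\<bar> * c) \<longlongrightarrow> \<bar>0\<bar> * c) (at 0)" by (intro tendsto_intros)
      then have t: "((\<lambda>r::real. \<bar>r\<bar> * c) \<longlongrightarrow> 0) (at 0)" by simp
      show "((\<lambda>r. \<bar>(f ((0 + r) *\<^sub>R x) - f (0 *\<^sub>R x)) / r - l\<bar>) \<longlongrightarrow> 0) (at 0)"
      proof (rule tendsto_sandwich[OF _ _ tendsto_const t])
        have "\<bar>(f ((0 + r) *\<^sub>R x) - f (0 *\<^sub>R x)) / r - l\<bar> \<le> \<bar>r\<bar> * c" if "r \<noteq> 0" for r
        proof -
          have "(f ((0 + r) *\<^sub>R x) - f (0 *\<^sub>R x)) / r - l = (f (r *\<^sub>R x) - f 0 - r * l) / r" using that by (simp add: field_simps)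
          then have "\<bar>(f ((0 + r) *\<^sub>R x) - f (0 *\<^sub>R x)) / r - l\<bar> = \<bar>f (r *\<^sub>R x) - f 0 - r * l\<bar> / \<bar>r\<bar>" by simp
          also have "\<dots> \<le> (r\<^sup>2 * c) / \<bar>r\<bar>" by (intro divide_right_mono quad) simp
          also have "\<dots> = \<bar>r\<bar> * c" using that by (simp add: power2_eq_square abs_if)
          finally show ?thesis .
        qed
        then show "\<forall>\<^sub>F r in at 0. \<bar>(f ((0 + r) *\<^sub>R x) - f (0 *\<^sub>R x)) / r - l\<bar> \<le> \<bar>r\<bar> * c"
          by (auto simp: eventually_at_filter)
      qed simp
    qed
    then show ?thesis by (simp add: DERIV_def)
  qed
  have d2: "((\<lambda>r. f (r *\<^sub>R x)) has_real_derivative D \<bullet> x) (at 0)"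
  proof -
    have fd: "(f has_derivative (\<lambda>h. h \<bullet> D)) (at ((0::real) *\<^sub>R x))" using D by (simp add: gderiv_def)
    have "((\<lambda>r::real. r *\<^sub>R x) has_derivative (\<lambda>r. r *\<^sub>R x)) (at 0)"
      by (auto intro!: derivative_eq_intros)
    from has_derivative_compose[OF this fd]
    have "((\<lambda>r. f (r *\<^sub>R x)) has_derivative (\<lambda>r. (r *\<^sub>R x) \<bullet> D)) (at 0)" .
    moreover have "(\<lambda>r. (r *\<^sub>R x) \<bullet> D) = (*) (D \<bullet> x)" by (auto simp: fun_eq_iff inner_commute)
    ultimately show ?thesis unfolding has_field_derivative_def by simp
  qed
  show "D \<bullet> x = (\<integral>\<omega>. osc' (h \<omega>) 0 * (\<omega> \<bullet> x) \<partial>m)"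
    using DERIV_unique[OF d2 d1] unfolding l_def .
qed

text \<open>On the cube \<open>f\<close> is an affine function plus the average \<open>Q\<close> of ReLU neurons, of total weight
  \<open>2 * c\<close> with \<open>c\<close> slightly larger than \<open>M\<close>. The network approximates \<open>M / c\<close> times this function, so
  that all parameters obey the bounds for \<open>M\<close>. With \<open>c = M + 1 / n\<close> the rescaling costs only \<open>6 / n\<close>
  uniformly.\<close>
lemma relu_approximation:
  fixes f :: "real^'d \<Rightarrow> real" and \<nu> :: "(real^'d) measure"
  assumes M: "M > 0" and KB: "KB_coeff f (cbox 0 1) \<le> ennreal M"
    and \<nu>: "prob_space \<nu>" "sets \<nu> = sets (restrict_space borel (cbox 0 1))" and n: "n \<ge> (1::nat)"
  shows "f \<in> borel_measurable \<nu>" "\<And>x. x \<in> cbox 0 1 \<Longrightarrow> \<bar>f x\<bar> \<le> 6 * (M + 1)"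
    and "\<exists>g\<in>relu_nets n M. (\<integral>x. (f x - g x)\<^sup>2 \<partial>\<nu>) \<le> (76 + 128 * M\<^sup>2) / n"
proof -
  interpret \<nu>: prob_space \<nu> by fact
  have sp: "space \<nu> = cbox 0 1" using sets_eq_imp_space_eq[OF \<nu>(2)] by (simp add: space_restrict_space)
  define c where "c = M + 1 / n"
  have c: "M < c" "c > 0" "c \<le> M + 1" using M n by (auto simp: c_def add_pos_pos)
  obtain f' F D where F: "fourier_representation f' F" and ff: "\<And>x. x \<in> cbox 0 1 \<Longrightarrow> f' x = f x"
    and mom: "(\<integral>\<^sup>+\<omega>. ennreal (l1norm \<omega> ^ 2) \<partial>total_variation F) \<le> ennreal c" and f0: "\<bar>f' 0\<bar> \<le> c"
    and D: "GDERIV f' 0 :> D" "l1norm D \<le> c"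
    by (rule KB_coeff_witness[OF KB c(1)]) (use M in auto)
  define m where "m = total_variation F"
  obtain h where m: "finite_measure m" "sets m = sets borel" and h: "h \<in> borel_measurable borel" "\<And>\<omega>. cmod (h \<omega>) = 1"
    and f': "\<And>x. f' x = (\<integral>\<omega>. osc (h \<omega>) (\<omega> \<bullet> x) \<partial>m)"
    using fourier_representation_real[OF F] unfolding m_def by metis
  interpret m: finite_measure m by fact
  have mom': "(\<integral>\<^sup>+\<omega>. ennreal (l1norm \<omega> ^ 2) \<partial>m) \<le> ennreal c" and c0: "0 \<le> c" using mom c by (auto simp: m_def)
  \<comment> \<open>second derivative of the wave along the unit direction, at \<open>r t = t\<close> or \<open>r t = - t\<close>\<close>
  define w where "w r \<omega> t = - (l1norm \<omega>)\<^sup>2 * osc (h \<omega>) (l1norm \<omega> * r t)" for r :: "real \<Rightarrow> real" and \<omega> t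
  have wm: "(\<lambda>\<theta>. w r (fst \<theta>) (snd \<theta>)) \<in> borel_measurable borel" if "r = (\<lambda>t. t) \<or> r = uminus" for r
    unfolding w_def using osc_direction_measurable[OF h(1) that] by measurable
  have wb: "\<bar>w r \<omega> t\<bar> \<le> l1norm \<omega> ^ 2" for r \<omega> t
    unfolding w_def abs_mult using abs_osc_le(1)[of "h \<omega>" "l1norm \<omega> * r t"] h(2)[of \<omega>] mult_left_le[of "\<bar>osc (h \<omega>) (l1norm \<omega> * r t)\<bar>" "(l1norm \<omega>)\<^sup>2"]
    by simp
  have rc: "continuous_on UNIV relu" unfolding relu_def by (intro continuous_intros)
  have rb: "\<bar>relu y\<bar> \<le> 2" if "\<bar>y\<bar> \<le> 2" for y using that by (auto simp: relu_def)
  define G where "G r \<sigma> x \<omega> = (\<integral>t. indicator {0..1} t * (w r \<omega> t * relu (\<sigma> * (direction \<omega> \<bullet> x) - t)) \<partial>lborel)" for r \<sigma> x \<omega>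
  define P where "P r \<sigma> x = (\<integral>\<omega>. G r \<sigma> x \<omega> \<partial>m)" for r \<sigma> x
  note RK = ridge_kernel[OF m mom' c0 wm wb rc rb _ \<nu>, folded G_def, folded P_def]
  let ?i = "\<lambda>t::real. t"
  have P1m: "P ?i 1 \<in> borel_measurable \<nu>" and P2m: "P uminus (- 1) \<in> borel_measurable \<nu>"
    by (rule RK(1); simp)+
  have G1i: "integrable m (G ?i 1 x)" and G2i: "integrable m (G uminus (- 1) x)" if "x \<in> cbox 0 1" for x
    by (rule RK(2); (simp add: that)?)+
  have P1b: "\<bar>P ?i 1 x\<bar> \<le> c * 2" and P2b: "\<bar>P uminus (- 1) x\<bar> \<le> c * 2" if "x \<in> cbox 0 1" for x
    by (rule RK(3); (simp add: that)?)+
  define Q where "Q x = P ?i 1 x + P uminus (- 1) x" for x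
  have Qm: "Q \<in> borel_measurable \<nu>" unfolding Q_def using P1m P2m by measurable
  have Qb: "\<bar>Q x\<bar> \<le> 4 * c" if "x \<in> cbox 0 1" for x
    unfolding Q_def using P1b[OF that] P2b[OF that] by linarith
  have rep: "f' x = f' 0 + D \<bullet> x + Q x" if x: "x \<in> cbox 0 1" for x
  proof -
    note gr = gradient_eq_integral[OF m h mom' c0 f' D(1) x]
    have y: "\<bar>direction \<omega> \<bullet> x\<bar> \<le> 1" for \<omega>
      using abs_inner_le_l1norm[OF x, of "direction \<omega>"] l1norm_direction_le[of \<omega>] by linarith
    have pt: "G ?i 1 x \<omega> + G uminus (- 1) x \<omega> = osc (h \<omega>) (\<omega> \<bullet> x) - osc (h \<omega>) 0 - osc' (h \<omega>) 0 * (\<omega> \<bullet> x)" for \<omega>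
    proof -
      have cc: "continuous_on UNIV (\<lambda>t. - (l1norm \<omega>)\<^sup>2 * osc (h \<omega>) (l1norm \<omega> * t))"
        by (intro continuous_on_mult continuous_osc continuous_intros)
      have "G ?i 1 x \<omega> + G uminus (- 1) x \<omega> = osc (h \<omega>) (l1norm \<omega> * (direction \<omega> \<bullet> x)) - osc (h \<omega>) (l1norm \<omega> * 0)
          - (l1norm \<omega> * osc' (h \<omega>) (l1norm \<omega> * 0)) * (direction \<omega> \<bullet> x)"
        unfolding G_def w_def by (rule relu_remainder[OF osc_DERIV cc y])
      then show ?thesis by (simp add: inner_direction mult.assoc mult.left_commute[of _ "osc' (h \<omega>) 0"])
    qed
    have oi: "integrable m (\<lambda>\<omega>. osc (h \<omega>) (\<omega> \<bullet> z))" for z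
    proof (rule m.integrable_const_bound[of _ 1])
      show "(\<lambda>\<omega>. osc (h \<omega>) (\<omega> \<bullet> z)) \<in> borel_measurable m"
        unfolding measurable_cong_sets[OF m(2) refl] using h(1) by measurable
    qed (auto intro!: AE_I2 order_trans[OF abs_osc_le(1)] simp: h(2))
    have "Q x = (\<integral>\<omega>. G ?i 1 x \<omega> + G uminus (- 1) x \<omega> \<partial>m)"
      unfolding Q_def P_def using G1i[OF x] G2i[OF x] by simp
    also have "\<dots> = (\<integral>\<omega>. osc (h \<omega>) (\<omega> \<bullet> x) - osc (h \<omega>) (\<omega> \<bullet> 0) - osc' (h \<omega>) 0 * (\<omega> \<bullet> x) \<partial>m)"
      unfolding pt by simp
    also have "\<dots> = f' x - f' 0 - D \<bullet> x"
      unfolding f' gr(2) using oi[of x] oi[of 0] gr(1) by simp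
    finally show ?thesis by simp
  qed
  have f'b: "\<bar>f' x\<bar> \<le> 6 * c" if x: "x \<in> cbox 0 1" for x
    using rep[OF x] f0 Qb[OF x] abs_inner_le_l1norm[OF x, of D] D(2) by linarith
  show "\<bar>f x\<bar> \<le> 6 * (M + 1)" if "x \<in> cbox 0 1" for x
    using f'b[OF that] unfolding ff[OF that] by (rule order_trans) (use c(3) in simp)
  have lin: "(\<lambda>x. D \<bullet> x) \<in> borel_measurable \<nu>" by (rule sets_restrict_cube_measurable[OF _ \<nu>(2)]) measurable
  have f'm: "(\<lambda>x. f' 0 + D \<bullet> x + Q x) \<in> borel_measurable \<nu>" using lin Qm by measurable
  have "(f \<in> borel_measurable \<nu>) = ((\<lambda>x. f' 0 + D \<bullet> x + Q x) \<in> borel_measurable \<nu>)"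
    by (rule measurable_cong) (simp add: sp ff[symmetric] rep[symmetric])
  then show fm: "f \<in> borel_measurable \<nu>" using f'm by simp
  \<comment> \<open>the factor that brings a witness for \<open>c\<close> back within the parameter bounds for \<open>M\<close>\<close>
  define \<eta> where "\<eta> = M / c"
  have \<eta>: "0 \<le> \<eta>" "\<eta> \<le> 1" "\<eta> * c = M" using M c by (auto simp: \<eta>_def)
  have \<eta>le: "\<eta> * a \<le> M" if "a \<le> c" for a using mult_left_mono[OF that \<eta>(1)] \<eta>(3) by simp
  have "\<exists>\<beta> w b. (\<forall>i\<in>{1..n}. max (l1norm (w i)) \<bar>b i\<bar> \<le> 1 \<and> \<bar>\<beta> i\<bar> \<le> 2 / real n * M) \<and>
    (\<integral>x. ((\<Sum>i=1..n. \<beta> i * relu (w i \<bullet> x + b i)) - \<eta> * Q x)\<^sup>2 \<partial>\<nu>) \<le> (4 * (2 * M * 2)\<^sup>2 + 2) / n"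
  proof (rule network_from_dual[OF \<nu> M n _ rc])
    show "\<bar>relu (w \<bullet> x + b)\<bar> \<le> 2" if "l1norm w \<le> 1" "\<bar>b\<bar> \<le> 1" "x \<in> cbox 0 1" for w x :: "real^'d" and b
      using abs_inner_le_l1norm[OF that(3), of w] that by (intro rb) linarith
    show "(\<lambda>x. \<eta> * Q x) \<in> borel_measurable \<nu>" using Qm by measurable
    show "\<bar>\<eta> * Q x\<bar> \<le> 2 * M * 2" if "x \<in> cbox 0 1" for x
    proof -
      have "\<eta> * \<bar>Q x\<bar> \<le> \<eta> * (4 * c)" using Qb[OF that] \<eta> by (intro mult_left_mono) auto
      then show ?thesis using \<eta> by (simp add: abs_mult mult.left_commute)
    qed
    fix S :: "real^'d \<Rightarrow> real" and s K :: real
    assume S: "S \<in> borel_measurable \<nu>" "\<And>x. x \<in> space \<nu> \<Longrightarrow> \<bar>S x\<bar> \<le> s"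
      and K: "\<And>w b. l1norm w \<le> 1 \<Longrightarrow> \<bar>b\<bar> \<le> 1 \<Longrightarrow> \<bar>\<integral>x. S x * relu (w \<bullet> x + b) \<partial>\<nu>\<bar> \<le> K"
    have K': "\<bar>\<integral>x. S x * relu (u \<bullet> x - t) \<partial>\<nu>\<bar> \<le> K" if "l1norm u \<le> 1" "0 \<le> t" "t \<le> 1" for u t
      using K[of u "- t"] that by simp
    have b1: "\<bar>\<integral>x. S x * P ?i 1 x \<partial>\<nu>\<bar> \<le> c * K" by (rule RK(4)[OF _ _ _ S K']) auto
    have b2: "\<bar>\<integral>x. S x * P uminus (- 1) x \<partial>\<nu>\<bar> \<le> c * K" by (rule RK(4)[OF _ _ _ S K']) auto
    have s0: "s \<ge> 0" using \<nu>.not_empty S(2) by (meson abs_ge_zero all_not_in_conv order_trans)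
    have int: "integrable \<nu> (\<lambda>x. S x * p x)" if "p \<in> borel_measurable \<nu>" "\<And>x. x \<in> cbox 0 1 \<Longrightarrow> \<bar>p x\<bar> \<le> c * 2" for p
      by (rule \<nu>.integrable_const_bound[of _ "s * (c * 2)"])
         (use S that sp s0 in \<open>auto intro!: AE_I2 mult_mono simp: abs_mult\<close>)
    have "(\<integral>x. S x * (\<eta> * Q x) \<partial>\<nu>) = (\<integral>x. \<eta> * (S x * P ?i 1 x + S x * P uminus (- 1) x) \<partial>\<nu>)"
      unfolding Q_def by (simp add: algebra_simps)
    also have "\<dots> = \<eta> * ((\<integral>x. S x * P ?i 1 x \<partial>\<nu>) + (\<integral>x. S x * P uminus (- 1) x \<partial>\<nu>))"
      using int[OF P1m P1b] int[OF P2m P2b] by simp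
    finally have "\<bar>\<integral>x. S x * (\<eta> * Q x) \<partial>\<nu>\<bar> = \<eta> * \<bar>(\<integral>x. S x * P ?i 1 x \<partial>\<nu>) + (\<integral>x. S x * P uminus (- 1) x \<partial>\<nu>)\<bar>"
      using \<eta> by (simp add: abs_mult)
    also have "\<dots> \<le> \<eta> * (2 * c * K)" using b1 b2 \<eta> by (intro mult_left_mono) auto
    also have "\<dots> = 2 * M * K" using \<eta>(3) by (simp add: mult.assoc[symmetric] mult.commute[of \<eta>])
    finally show "\<bar>\<integral>x. S x * (\<eta> * Q x) \<partial>\<nu>\<bar> \<le> 2 * M * K" .
  qed simp
  then obtain \<beta> and ww :: "nat \<Rightarrow> real^'d" and b where net: "\<forall>i\<in>{1..n}. max (l1norm (ww i)) \<bar>b i\<bar> \<le> 1 \<and> \<bar>\<beta> i\<bar> \<le> 2 / real n * M"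
    and err: "(\<integral>x. ((\<Sum>i=1..n. \<beta> i * relu (ww i \<bullet> x + b i)) - \<eta> * Q x)\<^sup>2 \<partial>\<nu>) \<le> (4 * (2 * M * 2)\<^sup>2 + 2) / n" by blast
  define N where "N x = (\<Sum>i=1..n. \<beta> i * relu (ww i \<bullet> x + b i))" for x
  define g where "g x = N x + (\<eta> *\<^sub>R D) \<bullet> x + \<eta> * f' 0" for x
  have gin: "g \<in> relu_nets n M"
    unfolding relu_nets_def nn_class_def mem_Collect_eq
  proof (intro exI conjI)
    show "\<bar>\<eta> * f' 0\<bar> \<le> M" using \<eta>le[OF f0] \<eta> by (simp add: abs_mult)
    show "l1norm (\<eta> *\<^sub>R D) \<le> M" using \<eta>le[OF D(2)] \<eta> by (simp add: l1norm_scaleR)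
    show "g = (\<lambda>x. (\<Sum>i=1..n. \<beta> i * relu (ww i \<bullet> x + b i)) + (\<eta> *\<^sub>R D) \<bullet> x + \<eta> * f' 0)"
      by (simp add: g_def N_def fun_eq_iff)
  qed (rule net)
  have Nm: "N \<in> borel_measurable \<nu>"
  proof (rule sets_restrict_cube_measurable[OF _ \<nu>(2)])
    show "N \<in> borel_measurable borel" unfolding N_def relu_def by measurable
  qed
  have Nb: "\<bar>N x\<bar> \<le> 2 * (4 * M)" if x: "x \<in> cbox 0 1" for x
  proof -
    have "(\<lambda>x. N x + 0 \<bullet> x + 0) \<in> relu_nets n M"
      unfolding relu_nets_def nn_class_def mem_Collect_eq N_def using net M
      by (intro exI[of _ \<beta>] exI[of _ ww] exI[of _ b] exI[of _ 0]) auto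
    then have "ridge_mixture (4 * M) (\<lambda>x. N x + 0 \<bullet> x + 0)" using M n by (intro ridge_mixture_nets) auto
    from ridge_mixture_bound[OF this x] show ?thesis by simp
  qed
  have dif: "(f x - g x)\<^sup>2 \<le> 2 * (36 / n) + 2 * (N x - \<eta> * Q x)\<^sup>2" if x: "x \<in> cbox 0 1" for x
  proof -
    have e: "f x - g x = (1 - \<eta>) * f' x - (N x - \<eta> * Q x)"
      using rep[OF x] ff[OF x] unfolding g_def by (simp add: algebra_simps)
    have "\<bar>(1 - \<eta>) * f' x\<bar> \<le> (1 - \<eta>) * (6 * c)" unfolding abs_mult using \<eta> f'b[OF x] by (intro mult_mono) auto
    also have "\<dots> = 6 * (c - \<eta> * c)" by (simp add: algebra_simps)
    also have "\<dots> = 6 / n" unfolding \<eta>(3) by (simp add: c_def)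
    finally have "((1 - \<eta>) * f' x)\<^sup>2 \<le> (6 / n)\<^sup>2" using n by (intro abs_le_square_iff[THEN iffD1]) auto
    also have "\<dots> = 36 / (real n * real n)" by (simp add: power2_eq_square)
    also have "\<dots> \<le> 36 / n" using n by (intro divide_left_mono) auto
    finally have a: "((1 - \<eta>) * f' x)\<^sup>2 \<le> 36 / n" .
    have "(p - q)\<^sup>2 \<le> 2 * p\<^sup>2 + 2 * q\<^sup>2" for p q :: real
      using zero_le_power2[of "p + q"] by (simp add: power2_eq_square algebra_simps)
    from this[of "(1 - \<eta>) * f' x" "N x - \<eta> * Q x"] a show ?thesis unfolding e by linarith
  qed
  have i2: "integrable \<nu> (\<lambda>x. (N x - \<eta> * Q x)\<^sup>2)"
  proof (rule \<nu>.integrable_const_bound[of _ "(8 * M + 4 * c)\<^sup>2"])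
    have "\<bar>N x - \<eta> * Q x\<bar> \<le> \<bar>8 * M + 4 * c\<bar>" if x: "x \<in> cbox 0 1" for x
    proof -
      have "\<eta> * \<bar>Q x\<bar> \<le> 1 * (4 * c)" using \<eta> Qb[OF x] by (intro mult_mono) auto
      then have "\<bar>\<eta> * Q x\<bar> \<le> 4 * c" using \<eta> by (simp add: abs_mult)
      then show ?thesis using Nb[OF x] by linarith
    qed
    then show "AE x in \<nu>. norm ((N x - \<eta> * Q x)\<^sup>2) \<le> (8 * M + 4 * c)\<^sup>2"
      by (auto intro!: AE_I2 abs_le_square_iff[THEN iffD1] simp: sp)
  qed (use Nm Qm in measurable)
  have "(\<integral>x. (f x - g x)\<^sup>2 \<partial>\<nu>) \<le> (\<integral>x. 2 * (36 / n) + 2 * (N x - \<eta> * Q x)\<^sup>2 \<partial>\<nu>)"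
  proof (rule integral_mono')
    show "integrable \<nu> (\<lambda>x. 2 * (36 / n) + 2 * (N x - \<eta> * Q x)\<^sup>2)" using i2 by simp
  qed (use dif sp in auto)
  also have "\<dots> = 2 * (36 / n) + 2 * (\<integral>x. (N x - \<eta> * Q x)\<^sup>2 \<partial>\<nu>)" using i2 by (simp add: \<nu>.prob_space)
  also have "\<dots> \<le> 2 * (36 / n) + 2 * ((4 * (2 * M * 2)\<^sup>2 + 2) / n)" using err unfolding N_def by (intro add_mono mult_left_mono) auto
  also have "\<dots> = (76 + 128 * M\<^sup>2) / n" by (simp add: power_mult_distrib add_divide_distrib)
  finally show "\<exists>g\<in>relu_nets n M. (\<integral>x. (f x - g x)\<^sup>2 \<partial>\<nu>) \<le> (76 + 128 * M\<^sup>2) / n" using gin by blast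
qed

section \<open>Approximation by sigmoid networks\<close>

text \<open>As for ReLU networks, with the first-order expansion and with steps replaced by sigmoids of slope
  \<open>a = sqrt n * ln n\<close>, the largest inner weight in the class. The replacement costs \<open>6 * M / sqrt a\<close>
  uniformly, hence the second term of the bound. For \<open>n = 1\<close> the slope is \<open>0\<close> and all networks in
  the class are constant, hence \<open>n \<ge> 2\<close>.\<close>
lemma sigmoid_approximation:
  fixes f :: "real^'d \<Rightarrow> real" and \<nu> :: "(real^'d) measure"
  assumes M: "M > 0" and B: "B_coeff f (cbox 0 1) \<le> ennreal M"
    and \<nu>: "prob_space \<nu>" "sets \<nu> = sets (restrict_space borel (cbox 0 1))" and n: "n \<ge> (2::nat)"
  shows "f \<in> borel_measurable \<nu>" "\<And>x. x \<in> cbox 0 1 \<Longrightarrow> \<bar>f x\<bar> \<le> 2 * (M + 1)"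
    and "\<exists>g\<in>sigmoid_nets n M. (\<integral>x. (f x - g x)\<^sup>2 \<partial>\<nu>)
      \<le> (18 + 48 * M\<^sup>2) / n + 108 * M\<^sup>2 / (sqrt n * ln n)"
proof -
  interpret \<nu>: prob_space \<nu> by fact
  have sp: "space \<nu> = cbox 0 1" using sets_eq_imp_space_eq[OF \<nu>(2)] by (simp add: space_restrict_space)
  define a where "a = sqrt (real n) * ln (real n)"
  have a: "a > 0" unfolding a_def using n by (intro mult_pos_pos) auto
  define c where "c = M + 1 / n"
  have c: "M < c" "c > 0" "c \<le> M + 1" using M n by (auto simp: c_def add_pos_pos)
  obtain f' F where F: "fourier_representation f' F" and ff: "\<And>x. x \<in> cbox 0 1 \<Longrightarrow> f' x = f x"
    and mom: "(\<integral>\<^sup>+\<omega>. ennreal (l1norm \<omega> ^ 1) \<partial>total_variation F) \<le> ennreal c" and f0: "\<bar>f' 0\<bar> \<le> c"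
    by (rule B_coeff_witness[OF B c(1)]) (use M in auto)
  define m where "m = total_variation F"
  obtain h where m: "finite_measure m" "sets m = sets borel" and h: "h \<in> borel_measurable borel" "\<And>\<omega>. cmod (h \<omega>) = 1"
    and f': "\<And>x. f' x = (\<integral>\<omega>. osc (h \<omega>) (\<omega> \<bullet> x) \<partial>m)"
    using fourier_representation_real[OF F] unfolding m_def by metis
  interpret m: finite_measure m by fact
  have mom': "(\<integral>\<^sup>+\<omega>. ennreal (l1norm \<omega> ^ 1) \<partial>m) \<le> ennreal c" and c0: "0 \<le> c" using mom c by (auto simp: m_def)
  note mi = moment_integrable[OF m(2) mom' c0]
  \<comment> \<open>derivative of the wave along the unit direction, for \<open>r t = t\<close> and, with a sign, \<open>r t = - t\<close>\<close>
  define w where "w \<sigma> r \<omega> t = \<sigma> * (l1norm \<omega> * osc' (h \<omega>) (l1norm \<omega> * r t))" for \<sigma> :: real and r :: "real \<Rightarrow> real" and \<omega> t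
  have wm: "(\<lambda>\<theta>. w \<sigma> r (fst \<theta>) (snd \<theta>)) \<in> borel_measurable borel" if "r = (\<lambda>t. t) \<or> r = uminus" for r \<sigma>
    unfolding w_def using osc_direction_measurable[OF h(1) that] by measurable
  have wb: "\<bar>w \<sigma> r \<omega> t\<bar> \<le> l1norm \<omega> ^ 1" if "\<sigma> \<in> {1, - 1}" for \<sigma> r \<omega> t
  proof -
    have "l1norm \<omega> * \<bar>osc' (h \<omega>) (l1norm \<omega> * r t)\<bar> \<le> l1norm \<omega> * 1"
      using abs_osc_le(2)[of "h \<omega>" "l1norm \<omega> * r t"] h(2)[of \<omega>] by (intro mult_left_mono) auto
    then show ?thesis unfolding w_def using that by (auto simp: abs_mult)
  qed
  define \<psi> where "\<psi> y = sigmoid (a * y)" for y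
  have pc: "continuous_on UNIV \<psi>" unfolding \<psi>_def
    by (intro continuous_on_compose2[OF continuous_sigmoid[of UNIV]] continuous_intros) auto
  have pb: "\<bar>\<psi> y\<bar> \<le> 1" for y unfolding \<psi>_def by (rule abs_sigmoid_le)
  define G where "G r \<sigma> x \<omega> = (\<integral>t. indicator {0..1} t * (w \<sigma> r \<omega> t * \<psi> (\<sigma> * (direction \<omega> \<bullet> x) - t)) \<partial>lborel)" for r \<sigma> x \<omega>
  define P where "P r \<sigma> x = (\<integral>\<omega>. G r \<sigma> x \<omega> \<partial>m)" for r \<sigma> x
  have sg: "(1::real) \<in> {1, - 1}" "(- 1 :: real) \<in> {1, - 1}" by auto
  have wm1: "(\<lambda>\<theta>. w 1 (\<lambda>t. t) (fst \<theta>) (snd \<theta>)) \<in> borel_measurable borel"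
    and wm2: "(\<lambda>\<theta>. w (- 1) uminus (fst \<theta>) (snd \<theta>)) \<in> borel_measurable borel"
    by (rule wm; simp)+
  have wb1: "\<bar>w 1 (\<lambda>t. t) \<omega> t\<bar> \<le> l1norm \<omega> ^ 1" and wb2: "\<bar>w (- 1) uminus \<omega> t\<bar> \<le> l1norm \<omega> ^ 1" for \<omega> t
    by (rule wb; simp)+
  note R1 = ridge_kernel[OF m mom' c0 wm1 wb1 pc pb sg(1) \<nu>, folded G_def, folded P_def]
  note R2 = ridge_kernel[OF m mom' c0 wm2 wb2 pc pb sg(2) \<nu>, folded G_def, folded P_def]
  let ?i = "\<lambda>t::real. t"
  have P1m: "P ?i 1 \<in> borel_measurable \<nu>" and P2m: "P uminus (- 1) \<in> borel_measurable \<nu>"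
    by (rule R1(1) R2(1))+
  have G1i: "integrable m (G ?i 1 x)" and G2i: "integrable m (G uminus (- 1) x)" if "x \<in> cbox 0 1" for x
    by (rule R1(2)[OF that] R2(2)[OF that])+
  have P1b: "\<bar>P ?i 1 x\<bar> \<le> c * 1" and P2b: "\<bar>P uminus (- 1) x\<bar> \<le> c * 1" if "x \<in> cbox 0 1" for x
    by (rule R1(3)[OF that] R2(3)[OF that])+
  define Q where "Q x = P ?i 1 x + P uminus (- 1) x" for x
  have Qm: "Q \<in> borel_measurable \<nu>" unfolding Q_def using P1m P2m by measurable
  have Qb: "\<bar>Q x\<bar> \<le> 2 * c" if "x \<in> cbox 0 1" for x
    unfolding Q_def using P1b[OF that] P2b[OF that] by linarith
  have oim: "(\<lambda>\<omega>. osc (h \<omega>) (\<omega> \<bullet> z)) \<in> borel_measurable m" for z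
    unfolding measurable_cong_sets[OF m(2) refl] using h(1) by measurable
  have oi: "integrable m (\<lambda>\<omega>. osc (h \<omega>) (\<omega> \<bullet> z))" for z
    by (rule m.integrable_const_bound[of _ 1, OF _ oim]) (auto intro!: AE_I2 order_trans[OF abs_osc_le(1)] simp: h(2))
  have f'diff: "f' x - f' 0 = (\<integral>\<omega>. osc (h \<omega>) (\<omega> \<bullet> x) - osc (h \<omega>) 0 \<partial>m)" for x
    unfolding f' using oi[of x] oi[of 0] by simp
  have f'b: "\<bar>f' x\<bar> \<le> 2 * c" if x: "x \<in> cbox 0 1" for x
  proof -
    have "\<bar>f' x - f' 0\<bar> \<le> (\<integral>\<omega>. \<bar>osc (h \<omega>) (\<omega> \<bullet> x) - osc (h \<omega>) 0\<bar> \<partial>m)" unfolding f'diff by (rule integral_abs_bound)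
    also have "\<dots> \<le> (\<integral>\<omega>. l1norm \<omega> ^ 1 \<partial>m)"
    proof (rule integral_mono[OF _ mi(1)])
      show "integrable m (\<lambda>\<omega>. \<bar>osc (h \<omega>) (\<omega> \<bullet> x) - osc (h \<omega>) 0\<bar>)" using oi[of x] oi[of 0] by simp
      show "\<bar>osc (h \<omega>) (\<omega> \<bullet> x) - osc (h \<omega>) 0\<bar> \<le> l1norm \<omega> ^ 1" for \<omega>
        using osc_taylor(1)[of "h \<omega>" "\<omega> \<bullet> x"] h(2)[of \<omega>] abs_inner_le_l1norm[OF x, of \<omega>] by simp
    qed
    finally show ?thesis using mi(2) f0 by linarith
  qed
  have rep: "\<bar>f' x - (f' 0 + Q x)\<bar> \<le> c * (6 / sqrt a)" if x: "x \<in> cbox 0 1" for x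
  proof -
    have y: "\<bar>direction \<omega> \<bullet> x\<bar> \<le> 1" for \<omega>
      using abs_inner_le_l1norm[OF x, of "direction \<omega>"] l1norm_direction_le[of \<omega>] by linarith
    have pt: "\<bar>(G ?i 1 x \<omega> + G uminus (- 1) x \<omega>) - (osc (h \<omega>) (\<omega> \<bullet> x) - osc (h \<omega>) 0)\<bar> \<le> l1norm \<omega> ^ 1 * (6 / sqrt a)" for \<omega>
    proof -
      define q1 where "q1 t = l1norm \<omega> * osc' (h \<omega>) (l1norm \<omega> * t)" for t
      have cc: "continuous_on UNIV q1"
        unfolding q1_def by (intro continuous_on_mult continuous_osc continuous_intros)
      have cc': "continuous_on UNIV (\<lambda>t. - q1 (- t))"
        by (intro continuous_on_minus continuous_on_compose2[OF cc] continuous_intros) auto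
      have q1b: "\<bar>q1 t\<bar> \<le> l1norm \<omega>" for t
        using wb1[of \<omega> t] unfolding w_def q1_def by simp
      have G1: "G ?i 1 x \<omega> = (\<integral>t. indicator {0..1} t * (q1 t * sigmoid (a * (1 * (direction \<omega> \<bullet> x) - t))) \<partial>lborel)"
        unfolding G_def w_def \<psi>_def q1_def by simp
      have G2: "G uminus (- 1) x \<omega> = (\<integral>t. indicator {0..1} t * (- q1 (- t) * sigmoid (a * ((- 1) * (direction \<omega> \<bullet> x) - t))) \<partial>lborel)"
        unfolding G_def w_def \<psi>_def q1_def by simp
      have e1: "\<bar>G ?i 1 x \<omega> - (\<integral>t. indicator {0..1} t * (q1 t * of_bool (t \<le> 1 * (direction \<omega> \<bullet> x))) \<partial>lborel)\<bar> \<le> l1norm \<omega> * (3 / sqrt a)"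
        unfolding G1 by (rule sigmoid_step_error[OF a cc q1b])
      have e2: "\<bar>G uminus (- 1) x \<omega> - (\<integral>t. indicator {0..1} t * (- q1 (- t) * of_bool (t \<le> (- 1) * (direction \<omega> \<bullet> x))) \<partial>lborel)\<bar> \<le> l1norm \<omega> * (3 / sqrt a)"
        unfolding G2 by (rule sigmoid_step_error[OF a cc']) (use q1b in simp)
      have "(\<integral>t. indicator {0..1} t * (q1 t * of_bool (t \<le> 1 * (direction \<omega> \<bullet> x))) \<partial>lborel)
        + (\<integral>t. indicator {0..1} t * (- q1 (- t) * of_bool (t \<le> (- 1) * (direction \<omega> \<bullet> x))) \<partial>lborel)
        = osc (h \<omega>) (l1norm \<omega> * (direction \<omega> \<bullet> x)) - osc (h \<omega>) (l1norm \<omega> * 0)"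
        by (rule step_remainder[OF _ cc y]) (unfold q1_def, rule osc_DERIV)
      then have e3: "(\<integral>t. indicator {0..1} t * (q1 t * of_bool (t \<le> 1 * (direction \<omega> \<bullet> x))) \<partial>lborel)
        + (\<integral>t. indicator {0..1} t * (- q1 (- t) * of_bool (t \<le> (- 1) * (direction \<omega> \<bullet> x))) \<partial>lborel)
        = osc (h \<omega>) (\<omega> \<bullet> x) - osc (h \<omega>) 0" by (simp add: inner_direction)
      have tri: "\<bar>(p + q) - (u + v)\<bar> \<le> k + k" if "\<bar>p - u\<bar> \<le> k" "\<bar>q - v\<bar> \<le> k" for p q u v k :: real
        using that by linarith
      from tri[OF e1 e2] have "\<bar>(G ?i 1 x \<omega> + G uminus (- 1) x \<omega>) - (osc (h \<omega>) (\<omega> \<bullet> x) - osc (h \<omega>) 0)\<bar>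
        \<le> l1norm \<omega> * (3 / sqrt a) + l1norm \<omega> * (3 / sqrt a)" unfolding e3 .
      also have "\<dots> = l1norm \<omega> ^ 1 * (6 / sqrt a)" by (simp add: field_simps)
      finally show ?thesis .
    qed
    have Gi: "integrable m (\<lambda>\<omega>. G ?i 1 x \<omega> + G uminus (- 1) x \<omega>)" using G1i[OF x] G2i[OF x] by simp
    have oo: "integrable m (\<lambda>\<omega>. osc (h \<omega>) (\<omega> \<bullet> x) - osc (h \<omega>) 0)" using oi[of x] oi[of 0] by simp
    have "Q x = (\<integral>\<omega>. G ?i 1 x \<omega> + G uminus (- 1) x \<omega> \<partial>m)"
      unfolding Q_def P_def using G1i[OF x] G2i[OF x] by simp
    then have "\<bar>Q x - (f' x - f' 0)\<bar> = \<bar>\<integral>\<omega>. (G ?i 1 x \<omega> + G uminus (- 1) x \<omega>) - (osc (h \<omega>) (\<omega> \<bullet> x) - osc (h \<omega>) 0) \<partial>m\<bar>"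
      unfolding f'diff by (simp only: Bochner_Integration.integral_diff[OF Gi oo])
    also have "\<dots> \<le> (\<integral>\<omega>. \<bar>(G ?i 1 x \<omega> + G uminus (- 1) x \<omega>) - (osc (h \<omega>) (\<omega> \<bullet> x) - osc (h \<omega>) 0)\<bar> \<partial>m)"
      by (rule integral_abs_bound)
    also have "\<dots> \<le> (\<integral>\<omega>. l1norm \<omega> ^ 1 * (6 / sqrt a) \<partial>m)"
    proof (rule integral_mono)
      show "integrable m (\<lambda>\<omega>. \<bar>(G ?i 1 x \<omega> + G uminus (- 1) x \<omega>) - (osc (h \<omega>) (\<omega> \<bullet> x) - osc (h \<omega>) 0)\<bar>)"
        by (intro integrable_abs Bochner_Integration.integrable_diff[OF Gi oo])
      show "integrable m (\<lambda>\<omega>. l1norm \<omega> ^ 1 * (6 / sqrt a))" using mi(1) by simp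
    qed (rule pt)
    also have "\<dots> = (\<integral>\<omega>. l1norm \<omega> ^ 1 \<partial>m) * (6 / sqrt a)" by simp
    also have "\<dots> \<le> c * (6 / sqrt a)" using mi(2) a by (intro mult_right_mono) auto
    finally show ?thesis by linarith
  qed
  show fb: "\<bar>f x\<bar> \<le> 2 * (M + 1)" if "x \<in> cbox 0 1" for x
    using f'b[OF that] unfolding ff[OF that] by (rule order_trans) (use c(3) in simp)
  have f'm: "f' \<in> borel_measurable \<nu>"
  proof (rule sets_restrict_cube_measurable[OF _ \<nu>(2)])
    have hm: "(\<lambda>(x, \<omega>). osc (h \<omega>) (\<omega> \<bullet> x)) \<in> borel_measurable (borel \<Otimes>\<^sub>M m)"
    proof -
      have [measurable]: "h \<in> borel_measurable m" "(\<lambda>\<omega>. \<omega>) \<in> borel_measurable m"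
        unfolding measurable_cong_sets[OF m(2) refl] using h(1) by auto
      show ?thesis by measurable
    qed
    have "(\<lambda>x. \<integral>\<omega>. osc (h \<omega>) (\<omega> \<bullet> x) \<partial>m) \<in> borel_measurable borel"
      by (rule m.borel_measurable_lebesgue_integral[OF hm])
    then show "f' \<in> borel_measurable borel" by (simp add: f'[abs_def])
  qed
  have "(f \<in> borel_measurable \<nu>) = (f' \<in> borel_measurable \<nu>)"
    by (rule measurable_cong) (simp add: sp ff)
  then show fm: "f \<in> borel_measurable \<nu>" using f'm by simp
  \<comment> \<open>the factor that brings a witness for \<open>c\<close> back within the parameter bounds for \<open>M\<close>\<close>
  define \<eta> where "\<eta> = M / c"
  have \<eta>: "0 \<le> \<eta>" "\<eta> \<le> 1" "\<eta> * c = M" using M c by (auto simp: \<eta>_def)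
  have \<eta>le: "\<eta> * u \<le> M" if "u \<le> c" for u using mult_left_mono[OF that \<eta>(1)] \<eta>(3) by simp
  have "\<exists>\<beta> w b. (\<forall>i\<in>{1..n}. max (l1norm (w i)) \<bar>b i\<bar> \<le> a \<and> \<bar>\<beta> i\<bar> \<le> 2 / real n * M) \<and>
    (\<integral>x. ((\<Sum>i=1..n. \<beta> i * sigmoid (w i \<bullet> x + b i)) - \<eta> * Q x)\<^sup>2 \<partial>\<nu>) \<le> (4 * (2 * M * 1)\<^sup>2 + 2) / n"
  proof (rule network_from_dual[OF \<nu> M _ _ continuous_sigmoid])
    show "\<bar>sigmoid (w \<bullet> x + b)\<bar> \<le> 1" for w x :: "real^'d" and b by (rule abs_sigmoid_le)
    show "(\<lambda>x. \<eta> * Q x) \<in> borel_measurable \<nu>" using Qm by measurable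
    show "\<bar>\<eta> * Q x\<bar> \<le> 2 * M * 1" if "x \<in> cbox 0 1" for x
    proof -
      have "\<eta> * \<bar>Q x\<bar> \<le> \<eta> * (2 * c)" using Qb[OF that] \<eta> by (intro mult_left_mono) auto
      then show ?thesis using \<eta> by (simp add: abs_mult mult.left_commute)
    qed
    fix S :: "real^'d \<Rightarrow> real" and s K :: real
    assume S: "S \<in> borel_measurable \<nu>" "\<And>x. x \<in> space \<nu> \<Longrightarrow> \<bar>S x\<bar> \<le> s"
      and K: "\<And>w b. l1norm w \<le> a \<Longrightarrow> \<bar>b\<bar> \<le> a \<Longrightarrow> \<bar>\<integral>x. S x * sigmoid (w \<bullet> x + b) \<partial>\<nu>\<bar> \<le> K"
    have K': "\<bar>\<integral>x. S x * \<psi> (u \<bullet> x - t) \<partial>\<nu>\<bar> \<le> K" if ut: "l1norm u \<le> 1" "0 \<le> t" "t \<le> 1" for u t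
    proof -
      have "l1norm (a *\<^sub>R u) \<le> a" "\<bar>- (a * t)\<bar> \<le> a"
        using ut a by (auto simp: l1norm_scaleR abs_mult intro: mult_left_le)
      from K[OF this] show ?thesis unfolding \<psi>_def by (simp add: right_diff_distrib)
    qed
    have b1: "\<bar>\<integral>x. S x * P ?i 1 x \<partial>\<nu>\<bar> \<le> c * K" by (rule R1(4)[OF S K'])
    have b2: "\<bar>\<integral>x. S x * P uminus (- 1) x \<partial>\<nu>\<bar> \<le> c * K" by (rule R2(4)[OF S K'])
    have s0: "s \<ge> 0" using \<nu>.not_empty S(2) by (meson abs_ge_zero all_not_in_conv order_trans)
    have int: "integrable \<nu> (\<lambda>x. S x * p x)" if "p \<in> borel_measurable \<nu>" "\<And>x. x \<in> cbox 0 1 \<Longrightarrow> \<bar>p x\<bar> \<le> c * 1" for p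
      by (rule \<nu>.integrable_const_bound[of _ "s * (c * 1)"])
         (use S that sp s0 in \<open>auto intro!: AE_I2 mult_mono simp: abs_mult\<close>)
    have "(\<integral>x. S x * (\<eta> * Q x) \<partial>\<nu>) = (\<integral>x. \<eta> * (S x * P ?i 1 x + S x * P uminus (- 1) x) \<partial>\<nu>)"
      unfolding Q_def by (simp add: algebra_simps)
    also have "\<dots> = \<eta> * ((\<integral>x. S x * P ?i 1 x \<partial>\<nu>) + (\<integral>x. S x * P uminus (- 1) x \<partial>\<nu>))"
      using int[OF P1m P1b] int[OF P2m P2b] by simp
    finally have "\<bar>\<integral>x. S x * (\<eta> * Q x) \<partial>\<nu>\<bar> = \<eta> * \<bar>(\<integral>x. S x * P ?i 1 x \<partial>\<nu>) + (\<integral>x. S x * P uminus (- 1) x \<partial>\<nu>)\<bar>"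
      using \<eta> by (simp add: abs_mult)
    also have "\<dots> \<le> \<eta> * (2 * c * K)" using b1 b2 \<eta> by (intro mult_left_mono) auto
    also have "\<dots> = 2 * M * K" using \<eta>(3) by (simp add: mult.assoc[symmetric] mult.commute[of \<eta>])
    finally show "\<bar>\<integral>x. S x * (\<eta> * Q x) \<partial>\<nu>\<bar> \<le> 2 * M * K" .
  qed (use n a in auto)
  then obtain \<beta> and ww :: "nat \<Rightarrow> real^'d" and b where net: "\<forall>i\<in>{1..n}. max (l1norm (ww i)) \<bar>b i\<bar> \<le> a \<and> \<bar>\<beta> i\<bar> \<le> 2 / real n * M"
    and err: "(\<integral>x. ((\<Sum>i=1..n. \<beta> i * sigmoid (ww i \<bullet> x + b i)) - \<eta> * Q x)\<^sup>2 \<partial>\<nu>) \<le> (4 * (2 * M * 1)\<^sup>2 + 2) / n" by blast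
  define N where "N x = (\<Sum>i=1..n. \<beta> i * sigmoid (ww i \<bullet> x + b i))" for x
  define g where "g x = N x + \<eta> * f' 0" for x
  have gin: "g \<in> sigmoid_nets n M"
    unfolding sigmoid_nets_def nn_class_def mem_Collect_eq
  proof (intro exI conjI)
    show "\<bar>\<eta> * f' 0\<bar> \<le> M" using \<eta>le[OF f0] \<eta> by (simp add: abs_mult)
    show "l1norm (0 :: real^'d) \<le> 0" by simp
    show "g = (\<lambda>x. (\<Sum>i=1..n. \<beta> i * sigmoid (ww i \<bullet> x + b i)) + 0 \<bullet> x + \<eta> * f' 0)"
      by (simp add: g_def N_def fun_eq_iff)
  qed (rule net[unfolded a_def])
  have Nm: "N \<in> borel_measurable \<nu>"
  proof (rule sets_restrict_cube_measurable[OF _ \<nu>(2)])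
    have [measurable]: "sigmoid \<in> borel_measurable borel" using continuous_sigmoid by (rule borel_measurable_continuous_onI)
    show "N \<in> borel_measurable borel" unfolding N_def by measurable
  qed
  have Nb: "\<bar>N x\<bar> \<le> 2 * (4 * M)" if x: "x \<in> cbox 0 1" for x
  proof -
    have "(\<lambda>x. N x + 0 \<bullet> x + 0) \<in> sigmoid_nets n M"
      unfolding sigmoid_nets_def nn_class_def mem_Collect_eq N_def using net[unfolded a_def] M
      by (intro exI[of _ \<beta>] exI[of _ ww] exI[of _ b] exI[of _ 0]) auto
    then have "ridge_mixture (4 * M) (\<lambda>x. N x + 0 \<bullet> x + 0)" using M n by (intro ridge_mixture_nets[of M n]) auto
    from ridge_mixture_bound[OF this x] show ?thesis by simp
  qed
  have dif: "(f x - g x)\<^sup>2 \<le> 3 * (4 / n) + 3 * (36 * M\<^sup>2 / a) + 3 * (N x - \<eta> * Q x)\<^sup>2" if x: "x \<in> cbox 0 1" for x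
  proof -
    \<comment> \<open>three errors: rescaling by \<open>\<eta>\<close>, sigmoids instead of steps, and the greedy approximation of \<open>\<eta> * Q x\<close>\<close>
    define r where "r = \<eta> * (f' x - (f' 0 + Q x))"
    have e: "f x - g x = (1 - \<eta>) * f' x + r - (N x - \<eta> * Q x)"
      using ff[OF x] unfolding g_def r_def by (simp add: algebra_simps)
    have "\<bar>(1 - \<eta>) * f' x\<bar> \<le> (1 - \<eta>) * (2 * c)" unfolding abs_mult using \<eta> f'b[OF x] by (intro mult_mono) auto
    also have "\<dots> = 2 * (c - \<eta> * c)" by (simp add: algebra_simps)
    also have "\<dots> = 2 / n" unfolding \<eta>(3) by (simp add: c_def)
    finally have "((1 - \<eta>) * f' x)\<^sup>2 \<le> (2 / n)\<^sup>2" using n by (intro abs_le_square_iff[THEN iffD1]) auto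
    also have "\<dots> = 4 / (real n * real n)" by (simp add: power2_eq_square)
    also have "\<dots> \<le> 4 / n" using n by (intro divide_left_mono) auto
    finally have a1: "((1 - \<eta>) * f' x)\<^sup>2 \<le> 4 / n" .
    have "\<bar>r\<bar> \<le> \<eta> * (c * (6 / sqrt a))" unfolding r_def abs_mult using \<eta> rep[OF x] by (intro mult_mono) auto
    also have "\<dots> = 6 * M / sqrt a" using \<eta>(3) by (simp add: mult.assoc[symmetric])
    finally have "r\<^sup>2 \<le> (6 * M / sqrt a)\<^sup>2" using M a by (intro abs_le_square_iff[THEN iffD1]) auto
    also have "\<dots> = 36 * M\<^sup>2 / a" using a by (simp add: power_divide power_mult_distrib)
    finally have a2: "r\<^sup>2 \<le> 36 * M\<^sup>2 / a" .
    have "(p + q - k)\<^sup>2 \<le> 3 * p\<^sup>2 + 3 * q\<^sup>2 + 3 * k\<^sup>2" for p q k :: real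
      using zero_le_power2[of "p - q"] zero_le_power2[of "p + k"] zero_le_power2[of "q + k"]
      by (simp add: power2_eq_square algebra_simps)
    from this[of "(1 - \<eta>) * f' x" r "N x - \<eta> * Q x"] a1 a2 show ?thesis unfolding e by linarith
  qed
  have i2: "integrable \<nu> (\<lambda>x. (N x - \<eta> * Q x)\<^sup>2)"
  proof (rule \<nu>.integrable_const_bound[of _ "(8 * M + 2 * c)\<^sup>2"])
    have "\<bar>N x - \<eta> * Q x\<bar> \<le> \<bar>8 * M + 2 * c\<bar>" if x: "x \<in> cbox 0 1" for x
    proof -
      have "\<eta> * \<bar>Q x\<bar> \<le> 1 * (2 * c)" using \<eta> Qb[OF x] by (intro mult_mono) auto
      then have "\<bar>\<eta> * Q x\<bar> \<le> 2 * c" using \<eta> by (simp add: abs_mult)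
      then show ?thesis using Nb[OF x] by linarith
    qed
    then show "AE x in \<nu>. norm ((N x - \<eta> * Q x)\<^sup>2) \<le> (8 * M + 2 * c)\<^sup>2"
      by (auto intro!: AE_I2 abs_le_square_iff[THEN iffD1] simp: sp)
  qed (use Nm Qm in measurable)
  have "(\<integral>x. (f x - g x)\<^sup>2 \<partial>\<nu>) \<le> (\<integral>x. (3 * (4 / n) + 3 * (36 * M\<^sup>2 / a)) + 3 * (N x - \<eta> * Q x)\<^sup>2 \<partial>\<nu>)"
  proof (rule integral_mono')
    show "integrable \<nu> (\<lambda>x. (3 * (4 / n) + 3 * (36 * M\<^sup>2 / a)) + 3 * (N x - \<eta> * Q x)\<^sup>2)" using i2 by simp
    fix x assume "x \<in> space \<nu>"
    then have x: "x \<in> cbox 0 1" using sp by simp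
    show le: "(f x - g x)\<^sup>2 \<le> (3 * (4 / n) + 3 * (36 * M\<^sup>2 / a)) + 3 * (N x - \<eta> * Q x)\<^sup>2" by (rule dif[OF x])
    show "0 \<le> (3 * (4 / n) + 3 * (36 * M\<^sup>2 / a)) + 3 * (N x - \<eta> * Q x)\<^sup>2"
      by (rule order_trans[OF zero_le_power2 le])
  qed
  also have "\<dots> = (3 * (4 / n) + 3 * (36 * M\<^sup>2 / a)) + 3 * (\<integral>x. (N x - \<eta> * Q x)\<^sup>2 \<partial>\<nu>)" using i2 by (simp add: \<nu>.prob_space)
  also have "\<dots> \<le> (3 * (4 / n) + 3 * (36 * M\<^sup>2 / a)) + 3 * ((4 * (2 * M * 1)\<^sup>2 + 2) / n)"
    using err unfolding N_def by (intro add_mono mult_left_mono) auto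
  also have "\<dots> = (18 + 48 * M\<^sup>2) / n + 108 * M\<^sup>2 / a" by (simp add: power_mult_distrib add_divide_distrib)
  finally show "\<exists>g\<in>sigmoid_nets n M. (\<integral>x. (f x - g x)\<^sup>2 \<partial>\<nu>) \<le> (18 + 48 * M\<^sup>2) / n + 108 * M\<^sup>2 / (sqrt n * ln n)"
    using gin unfolding a_def by blast
qed

section \<open>The estimator and its risk\<close>

lemma countable_dense_subset:
  fixes S :: "'a::second_countable_topology set"
  obtains T where "countable T" "T \<subseteq> S" "S \<subseteq> closure T"
proof -
  obtain B :: "'a set set" where B: "countable B" "topological_basis B" using ex_countable_basis by blast
  define T where "T = (\<lambda>b. SOME p. p \<in> b \<inter> S) ` {b \<in> B. b \<inter> S \<noteq> {}}"
  have pick: "(SOME p. p \<in> b \<inter> S) \<in> b \<inter> S" if "b \<inter> S \<noteq> {}" for b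
    using that by (meson ex_in_conv someI_ex)
  have cT: "countable T" unfolding T_def using B(1) by (intro countable_image) auto
  have TS: "T \<subseteq> S" unfolding T_def using pick by auto
  have dense: "S \<subseteq> closure T"
  proof (rule subsetI, rule ccontr)
    fix x assume x: "x \<in> S" "x \<notin> closure T"
    then obtain b where b: "b \<in> B" "x \<in> b" "b \<subseteq> - closure T"
      using topological_basisE[OF B(2), of "- closure T" x] by auto
    then have ne: "b \<inter> S \<noteq> {}" using x by auto
    have "(SOME p. p \<in> b \<inter> S) \<in> T" unfolding T_def using b(1) ne by blast
    then have "(SOME p. p \<in> b \<inter> S) \<in> closure T" using closure_subset by blast
    then show False using pick[OF ne] b(3) by auto
  qed
  show thesis by (rule that[OF cT TS dense])
qed

definition empirical_objective :: "nat \<Rightarrow> (nat \<Rightarrow> 'a) \<times> (nat \<Rightarrow> 'a) \<Rightarrow> ('a \<Rightarrow> real) \<Rightarrow> real" where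
  "empirical_objective n z g = 1 / real n * (\<Sum>i<n. g (fst z i) - g (snd z i) - 1 / 4 * (g (snd z i))\<^sup>2)"

lemma chi2_estimator_eq: "chi2_estimator G n z = (\<Squnion>g\<in>G. empirical_objective n z g)"
  by (cases z) (simp only: chi2_estimator_def empirical_objective_def prod.case fst_conv snd_conv)

lemma empirical_objective_le:
  assumes "\<And>i. i < n \<Longrightarrow> \<bar>g (fst z i)\<bar> \<le> b \<and> \<bar>g (snd z i)\<bar> \<le> b" "n \<ge> 1"
  shows "empirical_objective n z g \<le> 2 * b"
proof -
  have "(\<Sum>i<n. g (fst z i) - g (snd z i) - 1 / 4 * (g (snd z i))\<^sup>2) \<le> (\<Sum>i<n. 2 * b)"
  proof (rule sum_mono)
    fix i assume "i \<in> {..<n}"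
    then have "\<bar>g (fst z i)\<bar> \<le> b" "\<bar>g (snd z i)\<bar> \<le> b" using assms(1) by auto
    moreover have "0 \<le> 1 / 4 * (g (snd z i))\<^sup>2" by simp
    ultimately show "g (fst z i) - g (snd z i) - 1 / 4 * (g (snd z i))\<^sup>2 \<le> 2 * b" by linarith
  qed
  then have "1 / real n * (\<Sum>i<n. g (fst z i) - g (snd z i) - 1 / 4 * (g (snd z i))\<^sup>2) \<le> 1 / real n * (real n * (2 * b))"
    by (intro mult_left_mono) auto
  then show ?thesis unfolding empirical_objective_def using assms(2) by simp
qed

lemma sample_in_cube:
  fixes z :: "(nat \<Rightarrow> real^'d) \<times> (nat \<Rightarrow> real^'d)"
  assumes "z \<in> space ((\<Pi>\<^sub>M i\<in>{..<n}. restrict_space borel X) \<Otimes>\<^sub>M (\<Pi>\<^sub>M i\<in>{..<n}. restrict_space borel X))" "i < n"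
  shows "fst z i \<in> X" "snd z i \<in> X"
proof -
  have "fst z \<in> PiE {..<n} (\<lambda>_. X)" "snd z \<in> PiE {..<n} (\<lambda>_. X)"
    using assms(1) by (simp_all add: space_pair_measure space_PiM space_restrict_space mem_Times_iff)
  then show "fst z i \<in> X" "snd z i \<in> X" using assms(2) by (auto dest: PiE_mem)
qed

text \<open>The objective is continuous in the network parameters, so the supremum over the parameter set equals
  the one over a countable dense subset. The parameters live in a product of function spaces, which
  is second countable.\<close>
lemma chi2_estimator_measurable:
  fixes \<phi> :: "real \<Rightarrow> real"
  assumes n: "n \<ge> 1" and ne: "nn_class k a1 a2 a3 a4 \<phi> \<noteq> ({} :: (real^'d \<Rightarrow> real) set)" and \<phi>: "continuous_on UNIV \<phi>"
    and mix: "\<And>g :: real^'d \<Rightarrow> real. g \<in> nn_class k a1 a2 a3 a4 \<phi> \<Longrightarrow> ridge_mixture A g"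
  shows "chi2_estimator (nn_class k a1 a2 a3 a4 \<phi> :: (real^'d \<Rightarrow> real) set) n \<in> estimators n (cbox 0 1)"
proof -
  let ?X = "cbox 0 1 :: (real^'d) set"
  let ?Z = "(\<Pi>\<^sub>M i\<in>{..<n}. restrict_space borel ?X) \<Otimes>\<^sub>M (\<Pi>\<^sub>M i\<in>{..<n}. restrict_space borel ?X)"
  let ?G = "nn_class k a1 a2 a3 a4 \<phi> :: (real^'d \<Rightarrow> real) set"
  define net :: "(nat \<Rightarrow> real) \<times> (nat \<Rightarrow> real^'d) \<times> (nat \<Rightarrow> real) \<times> (real^'d) \<times> real \<Rightarrow> real^'d \<Rightarrow> real" where
    "net = (\<lambda>(\<beta>, w, b, w0, b0) x. (\<Sum>i=1..k. \<beta> i * \<phi> (w i \<bullet> x + b i)) + w0 \<bullet> x + b0)"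
  define \<Theta> :: "((nat \<Rightarrow> real) \<times> (nat \<Rightarrow> real^'d) \<times> (nat \<Rightarrow> real) \<times> (real^'d) \<times> real) set" where
    "\<Theta> = {(\<beta>, w, b, w0, b0). (\<forall>i\<in>{1..k}. max (l1norm (w i)) \<bar>b i\<bar> \<le> a1 \<and> \<bar>\<beta> i\<bar> \<le> a2) \<and> \<bar>b0\<bar> \<le> a3 \<and> l1norm w0 \<le> a4}"
  have G: "?G = net ` \<Theta>"
  proof (intro set_eqI iffI)
    fix g assume "g \<in> ?G"
    then obtain \<beta> w b w0 b0 where
      h: "(\<forall>i\<in>{1..k}. max (l1norm (w i)) \<bar>b i\<bar> \<le> a1 \<and> \<bar>\<beta> i\<bar> \<le> a2) \<and> \<bar>b0\<bar> \<le> a3 \<and> l1norm w0 \<le> a4"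
      "g = (\<lambda>x. (\<Sum>i=1..k. \<beta> i * \<phi> (w i \<bullet> x + b i)) + w0 \<bullet> x + b0)"
      unfolding nn_class_def mem_Collect_eq by blast
    have "(\<beta>, w, b, w0, b0) \<in> \<Theta>" using h(1) by (simp add: \<Theta>_def)
    moreover have "g = net (\<beta>, w, b, w0, b0)" unfolding h(2) net_def by simp
    ultimately show "g \<in> net ` \<Theta>" by blast
  next
    fix g assume "g \<in> net ` \<Theta>"
    then obtain \<beta> w b w0 b0 where h: "(\<beta>, w, b, w0, b0) \<in> \<Theta>" "g = net (\<beta>, w, b, w0, b0)" by auto
    have "(\<forall>i\<in>{1..k}. max (l1norm (w i)) \<bar>b i\<bar> \<le> a1 \<and> \<bar>\<beta> i\<bar> \<le> a2)" "\<bar>b0\<bar> \<le> a3" "l1norm w0 \<le> a4"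
      using h(1) by (simp_all add: \<Theta>_def)
    moreover have "g = (\<lambda>x. (\<Sum>i=1..k. \<beta> i * \<phi> (w i \<bullet> x + b i)) + w0 \<bullet> x + b0)"
      unfolding h(2) net_def by simp
    ultimately show "g \<in> ?G" unfolding nn_class_def mem_Collect_eq by blast
  qed
  obtain T where T: "countable T" "T \<subseteq> \<Theta>" "\<Theta> \<subseteq> closure T" by (rule countable_dense_subset)
  have cont: "continuous_on UNIV (\<lambda>p. net p x)" for x
  proof -
    have pc: "continuous_on UNIV (\<lambda>p :: (nat \<Rightarrow> real) \<times> (nat \<Rightarrow> real^'d) \<times> (nat \<Rightarrow> real) \<times> (real^'d) \<times> real. fst p i)"
      "continuous_on UNIV (\<lambda>p :: (nat \<Rightarrow> real) \<times> (nat \<Rightarrow> real^'d) \<times> (nat \<Rightarrow> real) \<times> (real^'d) \<times> real. fst (snd p) i)"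
      "continuous_on UNIV (\<lambda>p :: (nat \<Rightarrow> real) \<times> (nat \<Rightarrow> real^'d) \<times> (nat \<Rightarrow> real) \<times> (real^'d) \<times> real. fst (snd (snd p)) i)" for i
      by (rule continuous_on_product_then_coordinatewise, intro continuous_on_fst continuous_on_snd continuous_on_id)+
    have "continuous_on UNIV (\<lambda>p :: (nat \<Rightarrow> real) \<times> (nat \<Rightarrow> real^'d) \<times> (nat \<Rightarrow> real) \<times> (real^'d) \<times> real.
      (\<Sum>i=1..k. fst p i * \<phi> (fst (snd p) i \<bullet> x + fst (snd (snd p)) i)) + fst (snd (snd (snd p))) \<bullet> x + snd (snd (snd (snd p))))"
      by (intro continuous_on_add continuous_on_sum continuous_on_mult continuous_on_inner continuous_on_const
          continuous_on_compose2[OF \<phi>] pc continuous_on_fst continuous_on_snd continuous_on_id) auto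
    then show ?thesis unfolding net_def by (simp add: case_prod_unfold)
  qed
  have contJ: "continuous_on UNIV (\<lambda>p. empirical_objective n z (net p))" for z
    unfolding empirical_objective_def by (intro continuous_intros cont)
  have bdd: "empirical_objective n z (net p) \<le> 2 * (2 * A)" if "z \<in> space ?Z" "p \<in> \<Theta>" for z p
  proof (rule empirical_objective_le[OF _ n])
    fix i assume i: "i < n"
    have "ridge_mixture A (net p)" using mix that(2) G by auto
    then show "\<bar>net p (fst z i)\<bar> \<le> 2 * A \<and> \<bar>net p (snd z i)\<bar> \<le> 2 * A"
      using ridge_mixture_bound sample_in_cube[OF that(1) i] by blast
  qed
  have neT: "T \<noteq> {}" using T(3) ne G by auto
  have eq: "chi2_estimator ?G n z = (\<Squnion>p\<in>T. empirical_objective n z (net p))" if z: "z \<in> space ?Z" for z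
  proof -
    let ?J = "\<lambda>p. empirical_objective n z (net p)"
    have b\<Theta>: "bdd_above (?J ` \<Theta>)" by (rule bdd_aboveI2) (rule bdd[OF z])
    have bT: "bdd_above (?J ` T)" by (rule bdd_above_mono[OF b\<Theta> image_mono[OF T(2)]])
    have "(\<Squnion>p\<in>\<Theta>. ?J p) \<le> (\<Squnion>p\<in>T. ?J p)"
    proof (rule cSUP_least)
      show "\<Theta> \<noteq> {}" using neT T(2) by blast
      have "closed {p. ?J p \<le> (\<Squnion>p\<in>T. ?J p)}"
        by (intro closed_Collect_le contJ continuous_on_const)
      moreover have "T \<subseteq> {p. ?J p \<le> (\<Squnion>p\<in>T. ?J p)}" using cSUP_upper[OF _ bT] by (intro subsetI CollectI)
      ultimately have "closure T \<subseteq> {p. ?J p \<le> (\<Squnion>p\<in>T. ?J p)}" by (rule closure_minimal[rotated])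
      then show "?J p \<le> (\<Squnion>p\<in>T. ?J p)" if "p \<in> \<Theta>" for p using that T(3) by auto
    qed
    moreover have "(\<Squnion>p\<in>T. ?J p) \<le> (\<Squnion>p\<in>\<Theta>. ?J p)" by (rule cSUP_subset_mono[OF neT b\<Theta> T(2)]) simp
    ultimately show ?thesis unfolding chi2_estimator_eq G image_image by simp
  qed
  have mJ: "(\<lambda>z. empirical_objective n z (net p)) \<in> borel_measurable ?Z" if "p \<in> T" for p
  proof -
    have "ridge_mixture A (net p)" using mix that T(2) G by auto
    then have m: "net p \<in> borel_measurable (restrict_space borel ?X)"
      by (intro measurable_restrict_space1 ridge_mixture_measurable)
    have "(\<lambda>z. net p (fst z i)) \<in> borel_measurable ?Z" "(\<lambda>z. net p (snd z i)) \<in> borel_measurable ?Z" if "i \<in> {..<n}" for i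
      using measurable_compose[OF measurable_compose[OF measurable_fst measurable_component_singleton[OF that]] m]
        measurable_compose[OF measurable_compose[OF measurable_snd measurable_component_singleton[OF that]] m] by auto
    then show ?thesis unfolding empirical_objective_def
      by (intro borel_measurable_times borel_measurable_sum borel_measurable_diff borel_measurable_power borel_measurable_const)
  qed
  have "(\<lambda>z. \<Squnion>p\<in>T. empirical_objective n z (net p)) \<in> borel_measurable ?Z"
  proof (rule borel_measurable_cSUP[OF T(1) mJ])
    fix z assume z: "z \<in> space ?Z"
    show "bdd_above ((\<lambda>p. empirical_objective n z (net p)) ` T)"
      by (rule bdd_aboveI2) (use bdd[OF z] T(2) in blast)
  qed
  moreover have "(chi2_estimator ?G n \<in> borel_measurable ?Z) = ((\<lambda>z. \<Squnion>p\<in>T. empirical_objective n z (net p)) \<in> borel_measurable ?Z)"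
    by (rule measurable_cong) (rule eq)
  ultimately show ?thesis unfolding estimators_def by simp
qed

lemma zero_in_nn_class:
  assumes "0 \<le> a1" "0 \<le> a2" "0 \<le> a3" "0 \<le> a4"
  shows "(\<lambda>x. 0) \<in> nn_class k a1 a2 a3 a4 \<phi>"
  unfolding nn_class_def mem_Collect_eq
  by (rule exI[of _ "\<lambda>_. 0"], rule exI[of _ "\<lambda>_. 0"], rule exI[of _ "\<lambda>_. 0"], rule exI[of _ 0], rule exI[of _ 0])
     (simp add: assms)

lemma zero_in_nets:
  assumes "a \<ge> 0" "n \<ge> 1"
  shows "(\<lambda>x. 0) \<in> relu_nets n a" "(\<lambda>x. 0) \<in> sigmoid_nets n a"
proof -
  have "0 \<le> 2 / real n * a" "0 \<le> sqrt (real n) * ln (real n)" using assms by simp_all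
  then show "(\<lambda>x. 0) \<in> relu_nets n a" "(\<lambda>x. 0) \<in> sigmoid_nets n a"
    unfolding relu_nets_def sigmoid_nets_def using assms(1) by (simp_all add: zero_in_nn_class)
qed

lemma nn_class_mono:
  assumes "a2 \<le> a2'" "a3 \<le> a3'" "a4 \<le> a4'"
  shows "nn_class k a1 a2 a3 a4 \<phi> \<subseteq> nn_class k a1 a2' a3' a4' \<phi>"
proof
  fix g assume "g \<in> nn_class k a1 a2 a3 a4 \<phi>"
  then obtain \<beta> w b w0 b0 where h:
    "\<forall>i\<in>{1..k}. max (l1norm (w i)) \<bar>b i\<bar> \<le> a1 \<and> \<bar>\<beta> i\<bar> \<le> a2" "\<bar>b0\<bar> \<le> a3" "l1norm w0 \<le> a4"
    "g = (\<lambda>x. (\<Sum>i=1..k. \<beta> i * \<phi> (w i \<bullet> x + b i)) + w0 \<bullet> x + b0)"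
    unfolding nn_class_def mem_Collect_eq by blast
  have "\<forall>i\<in>{1..k}. max (l1norm (w i)) \<bar>b i\<bar> \<le> a1 \<and> \<bar>\<beta> i\<bar> \<le> a2'"
    using h(1) order_trans[OF _ assms(1)] by blast
  moreover have "\<bar>b0\<bar> \<le> a3'" "l1norm w0 \<le> a4'" using h(2,3) assms(2,3) by simp_all
  ultimately show "g \<in> nn_class k a1 a2' a3' a4' \<phi>"
    unfolding nn_class_def mem_Collect_eq using h(4) by blast
qed

lemma nets_mono:
  assumes "M \<le> a"
  shows "relu_nets n M \<subseteq> relu_nets n a" "sigmoid_nets n M \<subseteq> sigmoid_nets n a"
proof -
  have le: "2 / real n * M \<le> 2 / real n * a" using assms by (intro mult_left_mono) auto
  show "relu_nets n M \<subseteq> relu_nets n a" unfolding relu_nets_def by (rule nn_class_mono[OF le assms assms])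
  show "sigmoid_nets n M \<subseteq> sigmoid_nets n a" unfolding sigmoid_nets_def by (rule nn_class_mono[OF le assms order_refl])
qed

lemma chi2_estimator_nets_measurable:
  assumes "a \<ge> 0" "n \<ge> 1"
  shows "chi2_estimator (relu_nets n a :: (real^'d \<Rightarrow> real) set) n \<in> estimators n (cbox 0 1)"
    "chi2_estimator (sigmoid_nets n a :: (real^'d \<Rightarrow> real) set) n \<in> estimators n (cbox 0 1)"
proof -
  show "chi2_estimator (relu_nets n a :: (real^'d \<Rightarrow> real) set) n \<in> estimators n (cbox 0 1)"
    unfolding relu_nets_def
  proof (rule chi2_estimator_measurable[OF assms(2)])
    show "nn_class n 1 (2 / real n * a) a a relu \<noteq> ({} :: (real^'d \<Rightarrow> real) set)"
      using zero_in_nets(1)[OF assms] unfolding relu_nets_def by blast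
    show "continuous_on UNIV relu" unfolding relu_def by (intro continuous_intros)
    show "ridge_mixture (4 * a) g" if "g \<in> nn_class n 1 (2 / real n * a) a a relu" for g :: "real^'d \<Rightarrow> real"
      by (rule ridge_mixture_nets[OF assms]) (use that in \<open>simp add: relu_nets_def\<close>)
  qed
  show "chi2_estimator (sigmoid_nets n a :: (real^'d \<Rightarrow> real) set) n \<in> estimators n (cbox 0 1)"
    unfolding sigmoid_nets_def
  proof (rule chi2_estimator_measurable[OF assms(2)])
    show "nn_class n (sqrt (real n) * ln (real n)) (2 / real n * a) a 0 sigmoid \<noteq> ({} :: (real^'d \<Rightarrow> real) set)"
      using zero_in_nets(2)[OF assms] unfolding sigmoid_nets_def by blast
    show "continuous_on UNIV sigmoid" by (rule continuous_sigmoid)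
    show "ridge_mixture (4 * a) g" if "g \<in> nn_class n (sqrt (real n) * ln (real n)) (2 / real n * a) a 0 sigmoid" for g :: "real^'d \<Rightarrow> real"
      by (rule ridge_mixture_nets[OF assms]) (use that in \<open>simp add: sigmoid_nets_def\<close>)
  qed
qed

text \<open>Since \<open>\<mu>\<close> has density \<open>1 + f / 2\<close> with respect to \<open>\<nu>\<close>, the objective at \<open>g\<close> is
  \<open>E\<^sub>\<nu> (f * g) / 2 - E\<^sub>\<nu> g\<^sup>2 / 4\<close>; complete the square.\<close>
lemma chi2_variational:
  fixes \<mu> \<nu> :: "(real^'d) measure" and f g :: "real^'d \<Rightarrow> real"
  assumes p: "(\<mu>, \<nu>) \<in> chi2_pairs (cbox 0 1)" and f: "f \<in> chi2_potentials \<mu> \<nu>"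
    and fb: "\<And>x. x \<in> cbox 0 1 \<Longrightarrow> \<bar>f x\<bar> \<le> b"
    and g: "g \<in> borel_measurable borel" "\<And>x. x \<in> cbox 0 1 \<Longrightarrow> \<bar>g x\<bar> \<le> b'"
  shows "(\<integral>x. g x \<partial>\<mu>) - (\<integral>x. g x \<partial>\<nu>) - 1 / 4 * (\<integral>x. (g x)\<^sup>2 \<partial>\<nu>)
     = enn2real (chi2_div \<mu> \<nu>) - 1 / 4 * (\<integral>x. (f x - g x)\<^sup>2 \<partial>\<nu>)"
    and "enn2real (chi2_div \<mu> \<nu>) = 1 / 4 * (\<integral>x. (f x)\<^sup>2 \<partial>\<nu>)"
proof -
  have \<mu>: "prob_space \<mu>" "sets \<mu> = sets (restrict_space borel (cbox 0 1))"
    and \<nu>: "prob_space \<nu>" "sets \<nu> = sets (restrict_space borel (cbox 0 1))"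
    and ac: "absolutely_continuous \<nu> \<mu>"
    using p unfolding chi2_pairs_def borel_prob_measures_def by auto
  interpret \<mu>: prob_space \<mu> by fact
  interpret \<nu>: prob_space \<nu> by fact
  have sp: "space \<nu> = cbox 0 1" using sets_eq_imp_space_eq[OF \<nu>(2)] by (simp add: space_restrict_space)
  have seq: "sets \<mu> = sets \<nu>" using \<mu>(2) \<nu>(2) by simp
  have fm [measurable]: "f \<in> borel_measurable \<nu>" and fe: "AE x in \<nu>. f x = 2 * (enn2real (RN_deriv \<nu> \<mu> x) - 1)"
    using f unfolding chi2_potentials_def by auto
  have gm [measurable]: "g \<in> borel_measurable \<nu>" by (rule sets_restrict_cube_measurable[OF g(1) \<nu>(2)])
  have fin: "AE x in \<nu>. RN_deriv \<nu> \<mu> x \<noteq> \<infinity>"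
    by (rule \<nu>.RN_deriv_finite[OF \<mu>.sigma_finite_measure_axioms ac seq])
  have fe': "AE x in \<nu>. 1 + f x / 2 = enn2real (RN_deriv \<nu> \<mu> x)" using fe by eventually_elim (simp add: field_simps)
  then have nn: "AE x in \<nu>. 0 \<le> 1 + f x / 2" by eventually_elim simp
  have "\<mu> = density \<nu> (RN_deriv \<nu> \<mu>)" using \<nu>.density_RN_deriv[OF ac seq] by simp
  also have "\<dots> = density \<nu> (\<lambda>x. ennreal (1 + f x / 2))"
  proof (rule density_cong)
    show "AE x in \<nu>. RN_deriv \<nu> \<mu> x = ennreal (1 + f x / 2)"
      using fe' fin by eventually_elim (simp add: less_top)
  qed auto
  finally have md: "\<mu> = density \<nu> (\<lambda>x. ennreal (1 + f x / 2))" .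
  have int\<mu>: "(\<integral>x. g x \<partial>\<mu>) = (\<integral>x. (1 + f x / 2) * g x \<partial>\<nu>)"
    by (subst md, rule integral_real_density) (use nn in auto)
  have b0: "b \<ge> 0" "b' \<ge> 0"
    using fb[of 0] g(2)[of 0] by (auto simp: mem_box_cart intro: order_trans[OF abs_ge_zero])
  have i1: "integrable \<nu> g" by (rule \<nu>.integrable_const_bound[of _ b']) (auto simp: sp g(2) intro!: AE_I2)
  have pb: "integrable \<nu> (\<lambda>x. p x * q x)"
    if "p \<in> borel_measurable \<nu>" "q \<in> borel_measurable \<nu>" "\<And>x. x \<in> cbox 0 1 \<Longrightarrow> \<bar>p x\<bar> \<le> b1"
      "\<And>x. x \<in> cbox 0 1 \<Longrightarrow> \<bar>q x\<bar> \<le> b2" "0 \<le> b1" for p q :: "real^'d \<Rightarrow> real" and b1 b2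
  proof (rule \<nu>.integrable_const_bound[of _ "b1 * b2"])
    show "AE x in \<nu>. norm (p x * q x) \<le> b1 * b2"
    proof (rule AE_I2)
      fix x assume "x \<in> space \<nu>"
      then have "\<bar>p x\<bar> * \<bar>q x\<bar> \<le> b1 * b2" using that(3-5) sp by (intro mult_mono) auto
      then show "norm (p x * q x) \<le> b1 * b2" by (simp only: real_norm_def abs_mult)
    qed
  qed (use that in measurable)
  have i2: "integrable \<nu> (\<lambda>x. f x * g x)"
    by (rule pb[OF fm gm fb g(2) b0(1)])
  have i3: "integrable \<nu> (\<lambda>x. f x * f x)"
    by (rule pb[OF fm fm fb fb b0(1)])
  have i4: "integrable \<nu> (\<lambda>x. g x * g x)"
    by (rule pb[OF gm gm g(2) g(2) b0(2)])
  have "chi2_div \<mu> \<nu> = (\<integral>\<^sup>+x. ennreal ((enn2real (RN_deriv \<nu> \<mu> x) - 1)\<^sup>2) \<partial>\<nu>)"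
    using ac by (simp add: chi2_div_def)
  also have "\<dots> = (\<integral>\<^sup>+x. ennreal (1 / 4 * (f x * f x)) \<partial>\<nu>)"
  proof (rule nn_integral_cong_AE)
    show "AE x in \<nu>. ennreal ((enn2real (RN_deriv \<nu> \<mu> x) - 1)\<^sup>2) = ennreal (1 / 4 * (f x * f x))"
      using fe'
    proof eventually_elim
      case (elim x)
      then have "enn2real (RN_deriv \<nu> \<mu> x) - 1 = f x / 2" by linarith
      then show ?case by (simp only:) (simp add: power2_eq_square)
    qed
  qed
  also have "\<dots> = ennreal (\<integral>x. 1 / 4 * (f x * f x) \<partial>\<nu>)"
    by (rule nn_integral_eq_integral) (use i3 in auto)
  finally have c: "enn2real (chi2_div \<mu> \<nu>) = 1 / 4 * (\<integral>x. f x * f x \<partial>\<nu>)" by simp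
  then show "enn2real (chi2_div \<mu> \<nu>) = 1 / 4 * (\<integral>x. (f x)\<^sup>2 \<partial>\<nu>)" by (simp add: power2_eq_square)
  have e1: "(\<integral>x. (1 + f x / 2) * g x \<partial>\<nu>) = (\<integral>x. g x \<partial>\<nu>) + 1 / 2 * (\<integral>x. f x * g x \<partial>\<nu>)"
  proof -
    have "(\<lambda>x. (1 + f x / 2) * g x) = (\<lambda>x. g x + 1 / 2 * (f x * g x))" by (auto simp: algebra_simps)
    then show ?thesis using i1 i2 by simp
  qed
  have e2: "(\<integral>x. (f x - g x)\<^sup>2 \<partial>\<nu>) = (\<integral>x. f x * f x \<partial>\<nu>) - 2 * (\<integral>x. f x * g x \<partial>\<nu>) + (\<integral>x. g x * g x \<partial>\<nu>)"
  proof -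
    have "(\<lambda>x. (f x - g x)\<^sup>2) = (\<lambda>x. f x * f x - 2 * (f x * g x) + g x * g x)" by (auto simp: power2_eq_square algebra_simps)
    then have "(\<integral>x. (f x - g x)\<^sup>2 \<partial>\<nu>) = (\<integral>x. (f x * f x - 2 * (f x * g x)) + g x * g x \<partial>\<nu>)" by simp
    also have "\<dots> = (\<integral>x. f x * f x - 2 * (f x * g x) \<partial>\<nu>) + (\<integral>x. g x * g x \<partial>\<nu>)"
      by (rule Bochner_Integration.integral_add[OF Bochner_Integration.integrable_diff[OF i3 integrable_mult_right[OF i2]] i4])
    also have "(\<integral>x. f x * f x - 2 * (f x * g x) \<partial>\<nu>) = (\<integral>x. f x * f x \<partial>\<nu>) - (\<integral>x. 2 * (f x * g x) \<partial>\<nu>)"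
      by (rule Bochner_Integration.integral_diff[OF i3 integrable_mult_right[OF i2]])
    finally show ?thesis by simp
  qed
  show "(\<integral>x. g x \<partial>\<mu>) - (\<integral>x. g x \<partial>\<nu>) - 1 / 4 * (\<integral>x. (g x)\<^sup>2 \<partial>\<nu>)
     = enn2real (chi2_div \<mu> \<nu>) - 1 / 4 * (\<integral>x. (f x - g x)\<^sup>2 \<partial>\<nu>)"
    unfolding int\<mu> c e1 e2 by (simp add: power2_eq_square algebra_simps)
qed

text \<open>The objective never exceeds the divergence and comes within \<open>\<eta>\<close> of it at \<open>g0\<close>, so the error of the
  supremum is at most \<open>\<eta>\<close> plus the uniform deviation. The latter involves \<open>g\<close> under both samples,
  bounded with coefficient \<open>4 * A\<close> each, and \<open>g\<^sup>2 / 4\<close> under the second one, with coefficient \<open>A\<^sup>2\<close>.\<close>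
lemma chi2_risk_le:
  fixes \<mu> \<nu> :: "(real^'d) measure" and f :: "real^'d \<Rightarrow> real"
  assumes p: "(\<mu>, \<nu>) \<in> chi2_pairs (cbox 0 1)" and f: "f \<in> chi2_potentials \<mu> \<nu>"
    and fb: "\<And>x. x \<in> cbox 0 1 \<Longrightarrow> \<bar>f x\<bar> \<le> b" and n: "n \<ge> 1"
    and mix: "\<And>g. g \<in> G \<Longrightarrow> ridge_mixture A g"
    and g0: "g0 \<in> G" "(\<integral>x. (f x - g0 x)\<^sup>2 \<partial>\<nu>) \<le> 4 * \<eta>"
  shows "chi2_risk n (chi2_estimator G n) (\<mu>, \<nu>) \<le> ennreal (\<eta> + (8 * A + A\<^sup>2) * wedge_const TYPE('d) / sqrt n)"
proof -
  let ?X = "cbox 0 1 :: (real^'d) set"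
  have \<mu>: "prob_space \<mu>" "sets \<mu> = sets (restrict_space borel ?X)"
    and \<nu>: "prob_space \<nu>" "sets \<nu> = sets (restrict_space borel ?X)"
    using p unfolding chi2_pairs_def borel_prob_measures_def by auto
  interpret \<mu>: prob_space \<mu> by fact
  interpret \<nu>: prob_space \<nu> by fact
  have sp: "space \<mu> = ?X" "space \<nu> = ?X"
    using sets_eq_imp_space_eq[OF \<mu>(2)] sets_eq_imp_space_eq[OF \<nu>(2)] by (auto simp: space_restrict_space)
  have A0: "A \<ge> 0" using mix[OF g0(1)] by (rule ridge_mixture_nonneg)
  define \<Xi> where "\<Xi> = enn2real (chi2_div \<mu> \<nu>)"
  define L where "L g = (\<integral>x. g x \<partial>\<mu>) - (\<integral>x. g x \<partial>\<nu>) - 1 / 4 * (\<integral>x. (g x)\<^sup>2 \<partial>\<nu>)" for g :: "real^'d \<Rightarrow> real"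
  have var: "L g = \<Xi> - 1 / 4 * (\<integral>x. (f x - g x)\<^sup>2 \<partial>\<nu>)" if "g \<in> G" for g
    unfolding L_def \<Xi>_def
    by (rule chi2_variational(1)[OF p f fb ridge_mixture_measurable[OF mix[OF that]] ridge_mixture_bound[OF mix[OF that]]])
  have Lle: "L g \<le> \<Xi>" if "g \<in> G" for g
    unfolding var[OF that] by simp
  have Lg0: "L g0 \<ge> \<Xi> - \<eta>" unfolding var[OF g0(1)] using g0(2) by simp
  have \<eta>0: "\<eta> \<ge> 0"
  proof -
    have "0 \<le> (\<integral>x. (f x - g0 x)\<^sup>2 \<partial>\<nu>)" by (intro Bochner_Integration.integral_nonneg) simp
    then show ?thesis using g0(2) by linarith
  qed
  define c1 c2 where "c1 = 4 * A / n" and "c2 = (4 * A + A\<^sup>2) / n"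
  have c0: "c1 \<ge> 0" "c2 \<ge> 0" using A0 by (auto simp: c1_def c2_def)
  let ?P = "\<Pi>\<^sub>M i\<in>{..<n}. \<mu>" and ?Q = "\<Pi>\<^sub>M i\<in>{..<n}. \<nu>"
  interpret P: prob_space ?P by (intro prob_space_PiM \<mu>)
  interpret Q: prob_space ?Q by (intro prob_space_PiM \<nu>)
  have one: "ridge_mixture 1 (\<lambda>x :: real^'d. 1)"
    using ridge_mixture.add_ridge[OF ridge_mixture.zero ridge_fun_const[of 1], of 1] by simp
  have pt: "ennreal \<bar>chi2_estimator G n z - \<Xi>\<bar> \<le> ennreal \<eta> + (ennreal c1 * wedge_deviation n \<mu> (fst z) + ennreal c2 * wedge_deviation n \<nu> (snd z))"
    if z: "z \<in> space (?P \<Otimes>\<^sub>M ?Q)" for z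
  proof -
    have zX: "fst z i \<in> ?X" "snd z i \<in> ?X" if "i < n" for i
      using z that sp by (auto simp: space_pair_measure space_PiM PiE_iff)
    define d1 d2 where "d1 = enn2real (wedge_deviation n \<mu> (fst z))" and "d2 = enn2real (wedge_deviation n \<nu> (snd z))"
    have d: "wedge_deviation n \<mu> (fst z) = ennreal d1" "wedge_deviation n \<nu> (snd z) = ennreal d2" "d1 \<ge> 0" "d2 \<ge> 0"
      using wedge_deviation_finite[OF \<mu>(1), of n "fst z"] wedge_deviation_finite[OF \<nu>(1), of n "snd z"]
      by (auto simp: d1_def d2_def)
    have dev: "\<bar>empirical_objective n z g - L g\<bar> \<le> c1 * d1 + c2 * d2" if g: "g \<in> G" for g
    proof -
      have b1: "\<bar>(\<Sum>i<n. g (fst z i)) / n - (\<integral>x. g x \<partial>\<mu>)\<bar> \<le> 4 * A / n * d1"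
        using empirical_mixture_deviation[where x="fst z", OF \<mu> n zX(1) mix[OF g] one] A0 d(3) unfolding d(1)
        by (simp add: ennreal_mult[symmetric])
      have b2: "\<bar>(\<Sum>i<n. g (snd z i)) / n - (\<integral>x. g x \<partial>\<nu>)\<bar> \<le> 4 * A / n * d2"
        using empirical_mixture_deviation[where x="snd z", OF \<nu> n zX(2) mix[OF g] one] A0 d(4) unfolding d(2)
        by (simp add: ennreal_mult[symmetric])
      have b3: "\<bar>(\<Sum>i<n. (g (snd z i))\<^sup>2) / n - (\<integral>x. (g x)\<^sup>2 \<partial>\<nu>)\<bar> \<le> 4 * A * A / n * d2"
        using empirical_mixture_deviation[where x="snd z", OF \<nu> n zX(2) mix[OF g] mix[OF g]] A0 d(4) unfolding d(2)
        by (simp add: ennreal_mult[symmetric] power2_eq_square)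
      have e: "empirical_objective n z g = (\<Sum>i<n. g (fst z i)) / n - (\<Sum>i<n. g (snd z i)) / n - 1 / 4 * ((\<Sum>i<n. (g (snd z i))\<^sup>2) / n)"
        unfolding empirical_objective_def by (simp add: sum_subtractf diff_divide_distrib sum_divide_distrib sum_distrib_left)
      have tri: "\<bar>(a1 - a2 - 1 / 4 * a3) - (l1 - l2 - 1 / 4 * l3)\<bar> \<le> e1 + e2 + 1 / 4 * e3"
        if "\<bar>a1 - l1\<bar> \<le> e1" "\<bar>a2 - l2\<bar> \<le> e2" "\<bar>a3 - l3\<bar> \<le> e3" for a1 a2 a3 l1 l2 l3 e1 e2 e3 :: real
        using that by (auto simp: abs_le_iff field_simps)
      have "\<bar>empirical_objective n z g - L g\<bar> \<le> 4 * A / n * d1 + 4 * A / n * d2 + 1 / 4 * (4 * A * A / n * d2)"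
        unfolding e L_def by (rule tri[OF b1 b2 b3])
      also have "\<dots> = c1 * d1 + c2 * d2" unfolding c1_def c2_def by (simp add: power2_eq_square add_divide_distrib algebra_simps)
      finally show ?thesis .
    qed
    have up: "empirical_objective n z g \<le> \<Xi> + (c1 * d1 + c2 * d2)" if "g \<in> G" for g
      using dev[OF that] Lle[OF that] by linarith
    have "chi2_estimator G n z \<le> \<Xi> + (c1 * d1 + c2 * d2)"
      unfolding chi2_estimator_eq using g0(1) by (intro cSUP_least up) auto
    moreover have "empirical_objective n z g0 \<le> chi2_estimator G n z"
      unfolding chi2_estimator_eq using g0(1) up by (intro cSUP_upper) (auto simp: bdd_above_def)
    ultimately have "\<bar>chi2_estimator G n z - \<Xi>\<bar> \<le> \<eta> + (c1 * d1 + c2 * d2)"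
      using dev[OF g0(1)] Lg0 \<eta>0 by linarith
    then have "ennreal \<bar>chi2_estimator G n z - \<Xi>\<bar> \<le> ennreal (\<eta> + (c1 * d1 + c2 * d2))" by (rule ennreal_leI)
    also have "\<dots> = ennreal \<eta> + (ennreal c1 * ennreal d1 + ennreal c2 * ennreal d2)"
      using \<eta>0 c0 d(3,4) by (simp add: ennreal_mult)
    finally show ?thesis unfolding d(1,2) .
  qed
  have m1: "(\<lambda>z. wedge_deviation n \<mu> (fst z)) \<in> borel_measurable (?P \<Otimes>\<^sub>M ?Q)"
    by (rule measurable_compose[OF measurable_fst wedge_deviation_measurable[OF \<mu>(2)]])
  have m2: "(\<lambda>z. wedge_deviation n \<nu> (snd z)) \<in> borel_measurable (?P \<Otimes>\<^sub>M ?Q)"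
    by (rule measurable_compose[OF measurable_snd wedge_deviation_measurable[OF \<nu>(2)]])
  have f1: "(\<integral>\<^sup>+z. wedge_deviation n \<mu> (fst z) \<partial>(?P \<Otimes>\<^sub>M ?Q)) \<le> ennreal (wedge_const TYPE('d) * sqrt n)"
    using Q.nn_integral_fst[OF m1] expected_wedge_deviation[OF \<mu> n] by (simp add: Q.emeasure_space_1)
  have f2: "(\<integral>\<^sup>+z. wedge_deviation n \<nu> (snd z) \<partial>(?P \<Otimes>\<^sub>M ?Q)) \<le> ennreal (wedge_const TYPE('d) * sqrt n)"
    using Q.nn_integral_fst[OF m2] expected_wedge_deviation[OF \<nu> n] by (simp add: P.emeasure_space_1)
  interpret PQ: pair_prob_space ?P ?Q by unfold_locales
  have "chi2_risk n (chi2_estimator G n) (\<mu>, \<nu>) = (\<integral>\<^sup>+z. ennreal \<bar>chi2_estimator G n z - \<Xi>\<bar> \<partial>(?P \<Otimes>\<^sub>M ?Q))"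
    unfolding chi2_risk_def sample_law_def \<Xi>_def by simp
  also have "\<dots> \<le> (\<integral>\<^sup>+z. ennreal \<eta> + (ennreal c1 * wedge_deviation n \<mu> (fst z) + ennreal c2 * wedge_deviation n \<nu> (snd z)) \<partial>(?P \<Otimes>\<^sub>M ?Q))"
    by (rule nn_integral_mono) (rule pt)
  also have "\<dots> = ennreal \<eta> + (ennreal c1 * (\<integral>\<^sup>+z. wedge_deviation n \<mu> (fst z) \<partial>(?P \<Otimes>\<^sub>M ?Q)) + ennreal c2 * (\<integral>\<^sup>+z. wedge_deviation n \<nu> (snd z) \<partial>(?P \<Otimes>\<^sub>M ?Q)))"
    using m1 m2 PQ.emeasure_space_1 by (simp add: nn_integral_add nn_integral_cmult)
  also have "\<dots> \<le> ennreal \<eta> + (ennreal c1 * ennreal (wedge_const TYPE('d) * sqrt n) + ennreal c2 * ennreal (wedge_const TYPE('d) * sqrt n))"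
    by (intro add_mono mult_left_mono f1 f2) auto
  also have "\<dots> = ennreal (\<eta> + (c1 * (wedge_const TYPE('d) * sqrt n) + c2 * (wedge_const TYPE('d) * sqrt n)))"
    using \<eta>0 c0 wedge_const_pos[where 'd='d] by (simp add: ennreal_mult)
  also have "\<eta> + (c1 * (wedge_const TYPE('d) * sqrt n) + c2 * (wedge_const TYPE('d) * sqrt n))
      = \<eta> + (8 * A + A\<^sup>2) * wedge_const TYPE('d) / sqrt n"
  proof -
    have s: "sqrt n / n = 1 / sqrt n" using n by (simp add: real_div_sqrt field_simps)
    have "c1 * (wedge_const TYPE('d) * sqrt n) + c2 * (wedge_const TYPE('d) * sqrt n) = (8 * A + A\<^sup>2) * wedge_const TYPE('d) * (sqrt n / n)"
      unfolding c1_def c2_def by (simp add: add_divide_distrib algebra_simps)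
    then show ?thesis unfolding s by simp
  qed
  finally show ?thesis .
qed

section \<open>Two-point lower bounds and cosine potentials\<close>

text \<open>Le Cam's two-point bound for a likelihood ratio \<open>l\<close> with second moment at most \<open>K\<close>. Such an \<open>l\<close> is at
  least \<open>1/2\<close> on a set \<open>A\<close> of probability at least \<open>1 / (4 * K)\<close>, and on \<open>A\<close> the weighted errors at
  \<open>a0\<close> and \<open>a1\<close> add up to at least half of the distance between \<open>a0\<close> and \<open>a1\<close>.\<close>
lemma le_cam_likelihood:
  fixes l D :: "'a \<Rightarrow> real" and a0 a1 :: real
  assumes P: "prob_space P" and l: "l \<in> borel_measurable P" "\<And>x. x \<in> space P \<Longrightarrow> 0 \<le> l x"
    and l1: "integrable P l" "(\<integral>x. l x \<partial>P) = 1" and l2: "integrable P (\<lambda>x. (l x)\<^sup>2)" "(\<integral>x. (l x)\<^sup>2 \<partial>P) \<le> K"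
    and D: "D \<in> borel_measurable P"
  shows "ennreal (\<bar>a0 - a1\<bar> / (8 * K)) \<le> (\<integral>\<^sup>+x. ennreal \<bar>D x - a0\<bar> \<partial>P) + (\<integral>\<^sup>+x. ennreal (l x) * ennreal \<bar>D x - a1\<bar> \<partial>P)"
proof -
  interpret prob_space P by fact
  have [measurable]: "l \<in> borel_measurable P" "D \<in> borel_measurable P" by fact+
  define A where "A = {x \<in> space P. 1 / 2 \<le> l x}"
  have A [measurable]: "A \<in> sets P" unfolding A_def by measurable
  have K0: "K > 0"
  proof -
    have "(1::real) = (\<integral>x. l x \<partial>P)" using l1 by simp
    also have "\<dots> \<le> (\<integral>x. (1 + (l x)\<^sup>2) / 2 \<partial>P)"
    proof (rule integral_mono[OF l1(1)])
      show "integrable P (\<lambda>x. (1 + (l x)\<^sup>2) / 2)" using l2(1) by simp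
      show "l x \<le> (1 + (l x)\<^sup>2) / 2" for x
        using zero_le_power2[of "l x - 1"] by (simp add: power2_eq_square algebra_simps)
    qed
    also have "\<dots> = (1 + (\<integral>x. (l x)\<^sup>2 \<partial>P)) / 2" using l2(1) by (simp add: prob_space)
    finally show ?thesis using l2(2) by simp
  qed
  have pA: "1 / (4 * K) \<le> measure P A"
  proof -
    have iA: "integrable P (\<lambda>x. l x * indicator A x)"
      using l1(1) by (rule integrable_real_mult_indicator[OF A, of l, simplified mult.commute])
    have "(1::real) = (\<integral>x. l x \<partial>P)" using l1(2) by simp
    also have "\<dots> \<le> (\<integral>x. 1 / 2 + l x * indicator A x \<partial>P)"
    proof (rule integral_mono[OF l1(1)])
      show "integrable P (\<lambda>x. 1 / 2 + l x * indicator A x)" using iA by simp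
      show "l x \<le> 1 / 2 + l x * indicator A x" if "x \<in> space P" for x
        using that by (auto simp: A_def indicator_def)
    qed
    also have "\<dots> = 1 / 2 + (\<integral>x. l x * indicator A x \<partial>P)" using iA by (simp add: prob_space)
    finally have h: "1 / 2 \<le> (\<integral>x. l x * indicator A x \<partial>P)" by simp
    have iB: "integrable P (\<lambda>x. K * indicator A x)"
      by (intro integrable_mult_right integrable_real_indicator A) (simp add: emeasure_eq_measure)
    have iC: "integrable P (\<lambda>x. (l x)\<^sup>2 / (4 * K))" using l2(1) by (rule Bochner_Integration.integrable_divide)
    have "(\<integral>x. l x * indicator A x \<partial>P) \<le> (\<integral>x. (l x)\<^sup>2 / (4 * K) + K * indicator A x \<partial>P)"
    proof (rule integral_mono[OF iA])
      show "integrable P (\<lambda>x. (l x)\<^sup>2 / (4 * K) + K * indicator A x)" by (rule Bochner_Integration.integrable_add[OF iC iB])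
      \<comment> \<open>weighted so that the first term integrates to at most \<open>1/4\<close>, half of the lower bound \<open>h\<close>\<close>
      show "l x * indicator A x \<le> (l x)\<^sup>2 / (4 * K) + K * indicator A x" for x
      proof (cases "x \<in> A")
        case True
        have "0 \<le> (l x - 2 * K)\<^sup>2" by simp
        then have "4 * K * l x \<le> (l x)\<^sup>2 + 4 * K * K" by (simp add: power2_eq_square algebra_simps)
        then have "l x \<le> ((l x)\<^sup>2 + 4 * K * K) / (4 * K)" using K0 by (simp add: field_simps)
        also have "\<dots> = (l x)\<^sup>2 / (4 * K) + K" using K0 by (simp add: field_simps)
        finally show ?thesis using True by simp
      qed (use K0 in simp)
    qed
    also have "\<dots> = (\<integral>x. (l x)\<^sup>2 \<partial>P) / (4 * K) + K * measure P A"
      by (subst Bochner_Integration.integral_add[OF iC iB]) simp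
    also have "\<dots> \<le> K / (4 * K) + K * measure P A" using l2(2) K0 by (intro add_mono divide_right_mono) auto
    finally have "1 / 4 \<le> K * measure P A" using h K0 by simp
    then show ?thesis using K0 by (simp add: field_simps)
  qed
  have "ennreal (\<bar>a0 - a1\<bar> / (8 * K)) \<le> ennreal (\<bar>a0 - a1\<bar> / 2 * measure P A)"
  proof (rule ennreal_leI)
    have "\<bar>a0 - a1\<bar> / 2 * (1 / (4 * K)) \<le> \<bar>a0 - a1\<bar> / 2 * measure P A" by (intro mult_left_mono pA) simp
    then show "\<bar>a0 - a1\<bar> / (8 * K) \<le> \<bar>a0 - a1\<bar> / 2 * measure P A" by simp
  qed
  also have "\<dots> = (\<integral>\<^sup>+x. ennreal (\<bar>a0 - a1\<bar> / 2) * indicator A x \<partial>P)"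
    by (subst ennreal_mult) (auto simp: nn_integral_cmult emeasure_eq_measure)
  also have "\<dots> \<le> (\<integral>\<^sup>+x. ennreal \<bar>D x - a0\<bar> + ennreal (l x) * ennreal \<bar>D x - a1\<bar> \<partial>P)"
  proof (rule nn_integral_mono)
    fix x assume x: "x \<in> space P"
    show "ennreal (\<bar>a0 - a1\<bar> / 2) * indicator A x \<le> ennreal \<bar>D x - a0\<bar> + ennreal (l x) * ennreal \<bar>D x - a1\<bar>"
    proof (cases "x \<in> A")
      case True
      then have lx: "1 / 2 \<le> l x" by (simp add: A_def)
      have "\<bar>a0 - a1\<bar> / 2 \<le> (\<bar>D x - a0\<bar> + \<bar>D x - a1\<bar>) / 2"
        by (intro divide_right_mono) linarith+
      also have "\<dots> \<le> \<bar>D x - a0\<bar> + 1 / 2 * \<bar>D x - a1\<bar>" by simp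
      also have "\<dots> \<le> \<bar>D x - a0\<bar> + l x * \<bar>D x - a1\<bar>" using lx by (intro add_mono mult_right_mono) auto
      finally have "ennreal (\<bar>a0 - a1\<bar> / 2) \<le> ennreal (\<bar>D x - a0\<bar> + l x * \<bar>D x - a1\<bar>)" by (rule ennreal_leI)
      also have "\<dots> = ennreal \<bar>D x - a0\<bar> + ennreal (l x) * ennreal \<bar>D x - a1\<bar>"
        using l(2)[OF x] by (simp add: ennreal_mult)
      finally show ?thesis using True by simp
    qed simp
  qed
  also have "\<dots> = (\<integral>\<^sup>+x. ennreal \<bar>D x - a0\<bar> \<partial>P) + (\<integral>\<^sup>+x. ennreal (l x) * ennreal \<bar>D x - a1\<bar> \<partial>P)"
    by (rule nn_integral_add) auto
  finally show ?thesis .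
qed

lemma PiM_density_prod:
  fixes \<mu> :: "'a measure" and l :: "'a \<Rightarrow> real"
  assumes \<mu>: "prob_space \<mu>" and l: "l \<in> borel_measurable \<mu>" "\<And>x. 0 \<le> l x"
    and dp: "prob_space (density \<mu> (\<lambda>x. ennreal (l x)))" and I: "finite I"
  shows "(\<Pi>\<^sub>M i\<in>I. density \<mu> (\<lambda>x. ennreal (l x))) = density (\<Pi>\<^sub>M i\<in>I. \<mu>) (\<lambda>x. ennreal (\<Prod>i\<in>I. l (x i)))"
proof -
  interpret \<mu>: prob_space \<mu> by fact
  interpret d: prob_space "density \<mu> (\<lambda>x. ennreal (l x))" by fact
  interpret M: product_sigma_finite "\<lambda>_::'b. \<mu>" by standard
  interpret DM: product_sigma_finite "\<lambda>_::'b. density \<mu> (\<lambda>x. ennreal (l x))" by standard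
  have sPiM: "sets (\<Pi>\<^sub>M i\<in>I. density \<mu> (\<lambda>x. ennreal (l x))) = sets (\<Pi>\<^sub>M i\<in>I. \<mu>)"
    by (rule sets_PiM_cong) auto
  have lm [measurable]: "l \<in> borel_measurable \<mu>" by (rule l)
  have pm: "(\<lambda>x. ennreal (\<Prod>i\<in>I. l (x i))) \<in> borel_measurable (\<Pi>\<^sub>M i\<in>I. \<mu>)"
    by measurable
  have "density (\<Pi>\<^sub>M i\<in>I. \<mu>) (\<lambda>x. ennreal (\<Prod>i\<in>I. l (x i))) = (\<Pi>\<^sub>M i\<in>I. density \<mu> (\<lambda>x. ennreal (l x)))"
  proof (rule DM.PiM_eqI[OF I])
    show "sets (density (\<Pi>\<^sub>M i\<in>I. \<mu>) (\<lambda>x. ennreal (\<Prod>i\<in>I. l (x i)))) = sets (\<Pi>\<^sub>M i\<in>I. density \<mu> (\<lambda>x. ennreal (l x)))"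
      by (simp add: sPiM)
    fix A assume A: "\<And>i. i \<in> I \<Longrightarrow> A i \<in> sets (density \<mu> (\<lambda>x. ennreal (l x)))"
    then have A': "\<And>i. i \<in> I \<Longrightarrow> A i \<in> sets \<mu>" by simp
    have PA: "Pi\<^sub>E I A \<in> sets (\<Pi>\<^sub>M i\<in>I. \<mu>)" using A' I by (intro sets_PiM_I_finite) auto
    have "emeasure (density (\<Pi>\<^sub>M i\<in>I. \<mu>) (\<lambda>x. ennreal (\<Prod>i\<in>I. l (x i)))) (Pi\<^sub>E I A)
      = (\<integral>\<^sup>+x. ennreal (\<Prod>i\<in>I. l (x i)) * indicator (Pi\<^sub>E I A) x \<partial>(\<Pi>\<^sub>M i\<in>I. \<mu>))"
      by (rule emeasure_density[OF pm PA])
    also have "\<dots> = (\<integral>\<^sup>+x. (\<Prod>i\<in>I. ennreal (l (x i)) * indicator (A i) (x i)) \<partial>(\<Pi>\<^sub>M i\<in>I. \<mu>))"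
    proof (rule nn_integral_cong)
      fix x assume x: "x \<in> space (\<Pi>\<^sub>M i\<in>I. \<mu>)"
      have "indicator (Pi\<^sub>E I A) x = (\<Prod>i\<in>I. indicator (A i) (x i) :: ennreal)"
      proof (cases "x \<in> Pi\<^sub>E I A")
        case True
        then show ?thesis by (auto simp: PiE_iff intro!: prod.neutral[symmetric])
      next
        case False
        then obtain i where "i \<in> I" "x i \<notin> A i" using x by (auto simp: space_PiM PiE_iff)
        then have "(\<Prod>i\<in>I. indicator (A i) (x i) :: ennreal) = 0" using I by (intro prod_zero bexI[of _ i]) auto
        then show ?thesis using False by simp
      qed
      then show "ennreal (\<Prod>i\<in>I. l (x i)) * indicator (Pi\<^sub>E I A) x = (\<Prod>i\<in>I. ennreal (l (x i)) * indicator (A i) (x i))"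
        using l(2) by (simp add: prod.distrib prod_ennreal)
    qed
    also have "\<dots> = (\<Prod>i\<in>I. \<integral>\<^sup>+x. ennreal (l x) * indicator (A i) x \<partial>\<mu>)"
      by (rule M.product_nn_integral_prod[OF I]) (use A' in measurable)
    also have "\<dots> = (\<Prod>i\<in>I. emeasure (density \<mu> (\<lambda>x. ennreal (l x))) (A i))"
      using A' by (intro prod.cong refl) (simp add: emeasure_density)
    finally show "emeasure (density (\<Pi>\<^sub>M i\<in>I. \<mu>) (\<lambda>x. ennreal (\<Prod>i\<in>I. l (x i)))) (Pi\<^sub>E I A)
      = (\<Prod>i\<in>I. emeasure (density \<mu> (\<lambda>x. ennreal (l x))) (A i))" .
  qed
  then show ?thesis by simp
qed

text \<open>Every countable partition of \<open>A\<close> yields the same sum, by countable additivity.\<close>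
lemma total_variation_of_measure:
  fixes m :: "'a::topological_space measure"
  assumes "finite_measure m" "sets m = sets borel"
  shows "total_variation (\<lambda>A. complex_of_real (measure m A)) = m"
proof -
  interpret finite_measure m by fact
  have sp: "space m = UNIV" using sets_eq_imp_space_eq[OF assms(2)] by simp
  have eq: "(\<Squnion>P \<in> {P :: nat \<Rightarrow> 'a set. range P \<subseteq> sets borel \<and> disjoint_family P \<and> (\<Union>i. P i) = A}.
      \<Sum>i. ennreal (cmod (complex_of_real (measure m (P i))))) = emeasure m A" if A: "A \<in> sets borel" for A
  proof -
    have c: "(\<Sum>i. ennreal (cmod (complex_of_real (measure m (P i))))) = emeasure m A"
      if P: "range P \<subseteq> sets borel" "disjoint_family P" "(\<Union>i. P i) = A" for P :: "nat \<Rightarrow> 'a set"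
    proof -
      have "(\<Sum>i. ennreal (cmod (complex_of_real (measure m (P i))))) = (\<Sum>i. emeasure m (P i))"
        by (simp add: emeasure_eq_measure)
      also have "\<dots> = emeasure m (\<Union>i. P i)" by (rule suminf_emeasure) (use P assms(2) in auto)
      finally show ?thesis using P(3) by simp
    qed
    have "(\<lambda>n::nat. if n = 0 then A else {}) \<in> {P :: nat \<Rightarrow> 'a set. range P \<subseteq> sets borel \<and> disjoint_family P \<and> (\<Union>i. P i) = A}"
      using A by (auto simp: disjoint_family_on_def split: if_splits)
    then have ne: "{P :: nat \<Rightarrow> 'a set. range P \<subseteq> sets borel \<and> disjoint_family P \<and> (\<Union>i. P i) = A} \<noteq> {}" by blast
    show ?thesis
      by (rule trans[OF SUP_cong[OF refl c] SUP_const[OF ne]]) auto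
  qed
  have "total_variation (\<lambda>A. complex_of_real (measure m A)) = measure_of UNIV (sets borel) (emeasure m)"
    unfolding total_variation_def
  proof (rule measure_of_eq)
    fix A :: "'a set" assume "A \<in> sigma_sets UNIV (sets borel)"
    then have "A \<in> sets borel" using sets.sigma_sets_eq[of "borel :: 'a measure"] by simp
    then show "(\<Squnion>P \<in> {P :: nat \<Rightarrow> 'a set. range P \<subseteq> sets borel \<and> disjoint_family P \<and> (\<Union>i. P i) = A}.
      \<Sum>i. ennreal (cmod (complex_of_real (measure m (P i))))) = emeasure m A" by (rule eq)
  qed simp
  also have "\<dots> = m" using measure_of_of_measure[of m] sp assms(2) by simp
  finally show ?thesis .
qed

text \<open>Mass \<open>c / 2\<close> at each of \<open>w\<close> and \<open>- w\<close>: the spectral measure of \<open>c * cos (w \<bullet> x)\<close>.\<close>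
definition freq_law :: "real \<Rightarrow> 'a::euclidean_space \<Rightarrow> 'a measure" where
  "freq_law c w = density (distr (measure_pmf (bernoulli_pmf (1/2))) borel (\<lambda>b. if b then w else - w)) (\<lambda>_. ennreal c)"

lemma sets_freq_law [simp]: "sets (freq_law c w) = sets borel" "space (freq_law c w) = UNIV"
  by (simp_all add: freq_law_def)

lemma nn_integral_freq_law:
  assumes "g \<in> borel_measurable borel"
  shows "(\<integral>\<^sup>+\<omega>. g \<omega> \<partial>freq_law c w) = ennreal c * ((g w + g (- w)) / 2)"
proof -
  let ?D = "distr (measure_pmf (bernoulli_pmf (1/2))) borel (\<lambda>b. if b then w else - w)"
  have "(\<integral>\<^sup>+\<omega>. g \<omega> \<partial>freq_law c w) = (\<integral>\<^sup>+\<omega>. ennreal c * g \<omega> \<partial>?D)"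
    unfolding freq_law_def by (rule nn_integral_density) (use assms in auto)
  also have "\<dots> = (\<integral>\<^sup>+b. ennreal c * g (if b then w else - w) \<partial>measure_pmf (bernoulli_pmf (1/2)))"
    by (rule nn_integral_distr) (use assms in auto)
  also have "\<dots> = ennreal c * ((g w + g (- w)) / 2)"
  proof -
    have h: "ennreal (1 / 2) = inverse 2"
      by (metis ennreal_numeral inverse_ennreal inverse_eq_divide zero_less_numeral zero_le_numeral)
    show ?thesis
      by (subst nn_integral_bernoulli_pmf) (auto simp: h divide_ennreal_def distrib_left distrib_right mult.assoc)
  qed
  finally show ?thesis .
qed

lemma finite_freq_law: "finite_measure (freq_law c w)"
proof (rule finite_measureI)
  have "emeasure (freq_law c w) UNIV = (\<integral>\<^sup>+\<omega>. 1 \<partial>freq_law c w)" by simp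
  also have "\<dots> = ennreal c * ((1 + 1) / 2)" by (rule nn_integral_freq_law) simp
  also have "\<dots> < \<infinity>" by (auto simp: ennreal_mult_less_top ennreal_divide_eq_top_iff less_top[symmetric])
  finally show "emeasure (freq_law c w) (space (freq_law c w)) \<noteq> \<infinity>" by simp
qed

lemma integral_freq_law:
  fixes g :: "'a::euclidean_space \<Rightarrow> complex"
  assumes "g \<in> borel_measurable borel" "c \<ge> 0"
  shows "(\<integral>\<omega>. g \<omega> \<partial>freq_law c w) = of_real c * ((g w + g (- w)) / 2)"
proof -
  let ?D = "distr (measure_pmf (bernoulli_pmf (1/2))) borel (\<lambda>b. if b then w else - w)"
  have "(\<integral>\<omega>. g \<omega> \<partial>freq_law c w) = (\<integral>\<omega>. c *\<^sub>R g \<omega> \<partial>?D)"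
    unfolding freq_law_def by (rule integral_density) (use assms in auto)
  also have "\<dots> = (\<integral>b. c *\<^sub>R g (if b then w else - w) \<partial>measure_pmf (bernoulli_pmf (1/2)))"
    by (rule integral_distr) (use assms in auto)
  also have "\<dots> = of_real c * ((g w + g (- w)) / 2)"
    by (subst integral_measure_pmf[of UNIV]) (auto simp: UNIV_bool scaleR_conv_of_real field_simps)
  finally show ?thesis .
qed

lemma fourier_representation_cos:
  fixes w :: "'a::euclidean_space"
  assumes c: "c \<ge> 0"
  shows "fourier_representation (\<lambda>x. c * cos (w \<bullet> x)) (\<lambda>A. complex_of_real (measure (freq_law c w) A))"
proof -
  let ?m = "freq_law c w"
  interpret finite_measure ?m by (rule finite_freq_law)
  have tv: "total_variation (\<lambda>A. complex_of_real (measure ?m A)) = ?m"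
    by (rule total_variation_of_measure) (simp_all add: finite_freq_law)
  have "complex_borel_measure (\<lambda>A. complex_of_real (measure ?m A))"
    unfolding complex_borel_measure_def
  proof (intro allI impI)
    fix A :: "nat \<Rightarrow> 'a set" assume "range A \<subseteq> sets borel" "disjoint_family A"
    then have "(\<lambda>i. measure ?m (A i)) sums measure ?m (\<Union>i. A i)" by (intro finite_measure_UNION) auto
    then show "(\<lambda>i. complex_of_real (measure ?m (A i))) sums complex_of_real (measure ?m (\<Union>i. A i))" by (simp add: sums_of_real_iff)
  qed
  moreover have "polar_density (\<lambda>A. complex_of_real (measure ?m A)) (\<lambda>_. 1)"
    unfolding polar_density_def tv
  proof (intro conjI ballI allI)
    fix A :: "'a set" assume A: "A \<in> sets borel"
    have "(LINT \<omega>:A|?m. 1) = (\<integral>\<omega>. complex_of_real (indicator A \<omega>) \<partial>?m)"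
      unfolding set_lebesgue_integral_def by (simp add: scaleR_conv_of_real)
    also have "\<dots> = complex_of_real (\<integral>\<omega>. indicator A \<omega> \<partial>?m)" by (rule integral_complex_of_real)
    also have "(\<integral>\<omega>. indicator A \<omega> \<partial>?m) = measure ?m A" using A by simp
    finally show "complex_of_real (measure ?m A) = (LINT \<omega>:A|?m. 1)" by simp
  qed auto
  moreover have "complex_of_real (c * cos (w \<bullet> x)) = (LINT \<omega>|?m. exp (\<i> * complex_of_real (\<omega> \<bullet> x)) * 1)" for x
  proof -
    have "(LINT \<omega>|?m. exp (\<i> * complex_of_real (\<omega> \<bullet> x)) * 1)
      = of_real c * ((exp (\<i> * complex_of_real (w \<bullet> x)) + exp (\<i> * complex_of_real ((- w) \<bullet> x))) / 2)"
      using integral_freq_law[OF _ c, of "\<lambda>\<omega>. exp (\<i> * complex_of_real (\<omega> \<bullet> x))"] by simp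
    also have "(exp (\<i> * complex_of_real (w \<bullet> x)) + exp (\<i> * complex_of_real ((- w) \<bullet> x))) / 2 = cos (complex_of_real (w \<bullet> x))"
      by (simp add: cos_exp_eq)
    finally show ?thesis by (simp add: cos_of_real)
  qed
  ultimately show ?thesis unfolding fourier_representation_def tv by blast
qed

lemma sup_radius_cube_le: "sup_radius (cbox 0 1 :: (real^'d) set) \<le> 1"
  unfolding sup_radius_def
proof (rule SUP_least)
  fix x :: "real^'d" assume x: "x \<in> cbox 0 1"
  have "infnorm x \<le> 1"
    unfolding infnorm_Max
  proof (rule Max.boundedI)
    fix r assume "r \<in> (\<lambda>i. \<bar>x \<bullet> i\<bar>) ` Basis"
    then obtain j where "r = \<bar>x \<bullet> axis j 1\<bar>" by (auto simp: Basis_vec_def)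
    then have "r = \<bar>x $ j\<bar>" by (simp add: inner_axis)
    moreover have "0 \<le> x $ j" "x $ j \<le> 1" using x by (auto simp: mem_box_cart)
    ultimately show "r \<le> 1" by simp
  qed auto
  then show "ennreal (infnorm x) \<le> 1" by (metis ennreal_1 ennreal_leI)
qed

lemma spectral_moment_cos:
  fixes w :: "real^'d"
  assumes "c \<ge> 0"
  shows "sup_radius (cbox 0 1 :: (real^'d) set) * spectral_moment p (\<lambda>A. complex_of_real (measure (freq_law c w) A))
    \<le> ennreal (c * l1norm w ^ p)"
proof -
  have "total_variation (\<lambda>A. complex_of_real (measure (freq_law c w) A)) = freq_law c w"
    by (rule total_variation_of_measure) (simp_all add: finite_freq_law)
  then have "spectral_moment p (\<lambda>A. complex_of_real (measure (freq_law c w) A)) = (\<integral>\<^sup>+\<omega>. ennreal (l1norm \<omega> ^ p) \<partial>freq_law c w)"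
    by (simp add: spectral_moment_def)
  also have "\<dots> = ennreal c * ((ennreal (l1norm w ^ p) + ennreal (l1norm (- w) ^ p)) / 2)"
    by (rule nn_integral_freq_law) measurable
  also have "\<dots> = ennreal (c * l1norm w ^ p)"
  proof -
    have "(ennreal (l1norm w ^ p) + ennreal (l1norm (- w) ^ p)) / 2 = ennreal ((l1norm w ^ p + l1norm w ^ p) / 2)"
    proof -
      have "ennreal (l1norm w ^ p) + ennreal (l1norm w ^ p) = ennreal (l1norm w ^ p + l1norm w ^ p)"
        by (rule ennreal_plus[symmetric]) simp_all
      then show ?thesis using divide_ennreal[of "l1norm w ^ p + l1norm w ^ p" 2] by simp
    qed
    then show ?thesis using assms by (simp add: ennreal_mult)
  qed
  finally have e: "spectral_moment p (\<lambda>A. complex_of_real (measure (freq_law c w) A)) = ennreal (c * l1norm w ^ p)" .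
  have "sup_radius (cbox 0 1 :: (real^'d) set) * ennreal (c * l1norm w ^ p) \<le> 1 * ennreal (c * l1norm w ^ p)"
    by (intro mult_right_mono sup_radius_cube_le) simp
  then show ?thesis unfolding e by simp
qed

text \<open>The gradient at \<open>0\<close> vanishes, and \<open>l1norm w \<ge> 1\<close> makes the spectral moment dominate the value \<open>c\<close>
  at \<open>0\<close>.\<close>
lemma cos_coeffs_le:
  fixes w :: "real^'d"
  assumes c: "0 \<le> c" and w: "1 \<le> l1norm w"
  shows "KB_coeff (\<lambda>x. c * cos (w \<bullet> x)) (cbox 0 1) \<le> ennreal (c * l1norm w ^ 2)"
    and "B_coeff (\<lambda>x. c * cos (w \<bullet> x)) (cbox 0 1) \<le> ennreal (c * l1norm w ^ 1)"
proof -
  let ?F = "\<lambda>A. complex_of_real (measure (freq_law c w) A)"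
  let ?f = "\<lambda>x. c * cos (w \<bullet> x)"
  have le: "c \<le> c * l1norm w ^ p" for p
    using mult_left_mono[OF one_le_power[OF w] c, of p] by simp
  have D: "GDERIV ?f 0 :> 0"
    unfolding gderiv_def by (auto intro!: derivative_eq_intros)
  show "KB_coeff ?f (cbox 0 1) \<le> ennreal (c * l1norm w ^ 2)"
    unfolding KB_coeff_def
  proof (rule Inf_lower, intro CollectI exI conjI)
    show "fourier_representation ?f ?F" by (rule fourier_representation_cos[OF c])
    show "sup_radius (cbox 0 1 :: (real^'d) set) * spectral_moment 2 ?F \<le> ennreal (c * l1norm w ^ 2)" by (rule spectral_moment_cos[OF c])
    show "\<bar>?f 0\<bar> \<le> c * l1norm w ^ 2" using le[of 2] c by simp
    show "l1norm (0 :: real^'d) \<le> c * l1norm w ^ 2" using c by simp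
  qed (use c D in auto)
  show "B_coeff ?f (cbox 0 1) \<le> ennreal (c * l1norm w ^ 1)"
    unfolding B_coeff_def
  proof (rule Inf_lower, intro CollectI exI conjI)
    show "fourier_representation ?f ?F" by (rule fourier_representation_cos[OF c])
    show "sup_radius (cbox 0 1 :: (real^'d) set) * spectral_moment 1 ?F \<le> ennreal (c * l1norm w ^ 1)" by (rule spectral_moment_cos[OF c])
    show "\<bar>?f 0\<bar> \<le> c * l1norm w ^ 1" using le[of 1] c by simp
  qed (use c in auto)
qed

section \<open>Minimax lower bound\<close>

text \<open>The two pairs share the second law, so the likelihood ratio depends only on the first sample. Its
  second moment is the \<open>n\<close>-th power of that of \<open>l\<close>, hence at most \<open>(1 + 1 / n) ^ n \<le> exp 1\<close>.\<close>
lemma sup_risk_lower_bound: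
  fixes \<nu> :: "(real^'d) measure" and l :: "real^'d \<Rightarrow> real" and \<delta> :: real
  assumes Q: "(\<mu>0, \<nu>) \<in> Q" "(\<mu>1, \<nu>) \<in> Q" and D: "D \<in> estimators n X" and n: "n \<ge> (1::nat)"
    and \<nu>: "prob_space \<nu>" "sets \<nu> = sets (restrict_space borel X)"
    and \<mu>0: "prob_space \<mu>0" "sets \<mu>0 = sets (restrict_space borel X)"
    and \<mu>1: "prob_space \<mu>1" "\<mu>1 = density \<mu>0 (\<lambda>x. ennreal (l x))"
    and l: "l \<in> borel_measurable \<mu>0" "\<And>x. 0 \<le> l x"
    and l1: "integrable \<mu>0 l" "(\<integral>x. l x \<partial>\<mu>0) = 1"
    and l2: "integrable \<mu>0 (\<lambda>x. (l x)\<^sup>2)" "(\<integral>x. (l x)\<^sup>2 \<partial>\<mu>0) \<le> 1 + 1 / n"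
    and \<delta>: "\<delta> \<le> \<bar>enn2real (chi2_div \<mu>0 \<nu>) - enn2real (chi2_div \<mu>1 \<nu>)\<bar>"
  shows "ennreal (\<delta> / (16 * exp 1)) \<le> sup_risk n Q D"
proof -
  define a0 a1 where "a0 = enn2real (chi2_div \<mu>0 \<nu>)" and "a1 = enn2real (chi2_div \<mu>1 \<nu>)"
  let ?P = "\<Pi>\<^sub>M i\<in>{..<n}. \<mu>0" and ?Q = "\<Pi>\<^sub>M i\<in>{..<n}. \<nu>"
  interpret \<mu>0: prob_space \<mu>0 by fact
  interpret \<nu>: prob_space \<nu> by fact
  interpret P: prob_space ?P by (intro prob_space_PiM \<mu>0)
  interpret Q: prob_space ?Q by (intro prob_space_PiM \<nu>)
  interpret PQ: pair_prob_space ?P ?Q by unfold_locales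
  interpret M: product_sigma_finite "\<lambda>_::nat. \<mu>0" by standard
  define L where "L x = (\<Prod>i<n. l (x i))" for x :: "nat \<Rightarrow> real^'d"
  have Lm [measurable]: "L \<in> borel_measurable ?P" unfolding L_def using l(1) by measurable
  have L0: "L x \<ge> 0" for x unfolding L_def by (intro prod_nonneg) (use l(2) in auto)
  have Li: "integrable ?P L" "(\<integral>x. L x \<partial>?P) = 1"
    unfolding L_def using M.product_integrable_prod[of "{..<n}" "\<lambda>_. l"] M.product_integral_prod[of "{..<n}" "\<lambda>_. l"] l1 by auto
  have L2: "integrable ?P (\<lambda>x. (L x)\<^sup>2)" "(\<integral>x. (L x)\<^sup>2 \<partial>?P) \<le> exp 1"
  proof -
    have e: "(L x)\<^sup>2 = (\<Prod>i<n. (l (x i))\<^sup>2)" for x unfolding L_def by (rule prod_power_distrib)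
    show "integrable ?P (\<lambda>x. (L x)\<^sup>2)"
      unfolding e using M.product_integrable_prod[of "{..<n}" "\<lambda>_ x. (l x)\<^sup>2"] l2(1) by simp
    have "(\<integral>x. (L x)\<^sup>2 \<partial>?P) = (\<integral>x. (l x)\<^sup>2 \<partial>\<mu>0) ^ n"
      unfolding e using M.product_integral_prod[of "{..<n}" "\<lambda>_ x. (l x)\<^sup>2"] l2(1) by simp
    also have "\<dots> \<le> (1 + 1 / n) ^ n"
      by (intro power_mono l2(2) Bochner_Integration.integral_nonneg) simp
    also have "\<dots> \<le> exp (1 / n) ^ n" by (intro power_mono exp_ge_add_one_self) simp
    also have "\<dots> = exp 1" using n by (simp add: exp_of_nat_mult[symmetric])
    finally show "(\<integral>x. (L x)\<^sup>2 \<partial>?P) \<le> exp 1" .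
  qed
  have sPQ: "sets (?P \<Otimes>\<^sub>M ?Q) = sets ((\<Pi>\<^sub>M i\<in>{..<n}. restrict_space borel X) \<Otimes>\<^sub>M (\<Pi>\<^sub>M i\<in>{..<n}. restrict_space borel X))"
    by (intro sets_pair_measure_cong sets_PiM_cong refl \<nu>(2) \<mu>0(2))
  have Dm [measurable]: "D \<in> borel_measurable (?P \<Otimes>\<^sub>M ?Q)"
    unfolding measurable_cong_sets[OF sPQ refl] using D by (simp add: estimators_def)
  have fstd: "distr (?P \<Otimes>\<^sub>M ?Q) ?P fst = ?P"
    by (rule Q.distr_pair_fst)
  have fi: "integrable (?P \<Otimes>\<^sub>M ?Q) (\<lambda>z. g (fst z))" "(\<integral>z. g (fst z) \<partial>(?P \<Otimes>\<^sub>M ?Q)) = (\<integral>x. g x \<partial>?P)"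
    if "integrable ?P g" for g :: "(nat \<Rightarrow> real^'d) \<Rightarrow> real"
    using integrable_distr[OF measurable_fst, of ?P ?Q g] integral_distr[OF measurable_fst, of g ?P ?Q] that
    by (simp_all add: fstd)
  have m: "(\<lambda>z. L (fst z)) \<in> borel_measurable (?P \<Otimes>\<^sub>M ?Q)" by measurable
  have lc: "ennreal (\<bar>a0 - a1\<bar> / (8 * exp 1)) \<le> (\<integral>\<^sup>+z. ennreal \<bar>D z - a0\<bar> \<partial>(?P \<Otimes>\<^sub>M ?Q)) + (\<integral>\<^sup>+z. ennreal (L (fst z)) * ennreal \<bar>D z - a1\<bar> \<partial>(?P \<Otimes>\<^sub>M ?Q))"
    by (rule le_cam_likelihood[OF PQ.prob_space_axioms m L0 _ _ _ _ Dm])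
       (use fi[OF Li(1)] fi[OF L2(1)] Li(2) L2(2) in auto)
  have r0: "(\<integral>\<^sup>+z. ennreal \<bar>D z - a0\<bar> \<partial>(?P \<Otimes>\<^sub>M ?Q)) \<le> sup_risk n Q D"
    unfolding sup_risk_def using SUP_upper[OF Q(1), of "chi2_risk n D"]
    by (simp add: chi2_risk_def sample_law_def a0_def)
  have r1: "(\<integral>\<^sup>+z. ennreal (L (fst z)) * ennreal \<bar>D z - a1\<bar> \<partial>(?P \<Otimes>\<^sub>M ?Q)) \<le> sup_risk n Q D"
  proof -
    have PL: "(\<Pi>\<^sub>M i\<in>{..<n}. \<mu>1) = density ?P (\<lambda>x. ennreal (L x))"
      unfolding \<mu>1(2) L_def by (rule PiM_density_prod[OF \<mu>0(1) l]) (use \<mu>1 in auto)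
    have h: "(\<lambda>z. ennreal \<bar>D z - a1\<bar>) \<in> borel_measurable (?P \<Otimes>\<^sub>M ?Q)" by measurable
    have sPL: "sets (density ?P (\<lambda>x. ennreal (L x)) \<Otimes>\<^sub>M ?Q) = sets (?P \<Otimes>\<^sub>M ?Q)"
      by (intro sets_pair_measure_cong) auto
    have h': "(\<lambda>z. ennreal \<bar>D z - a1\<bar>) \<in> borel_measurable (density ?P (\<lambda>x. ennreal (L x)) \<Otimes>\<^sub>M ?Q)"
      unfolding measurable_cong_sets[OF sPL refl] by (rule h)
    have "(\<integral>\<^sup>+z. ennreal (L (fst z)) * ennreal \<bar>D z - a1\<bar> \<partial>(?P \<Otimes>\<^sub>M ?Q))
      = (\<integral>\<^sup>+x. \<integral>\<^sup>+y. ennreal (L x) * ennreal \<bar>D (x, y) - a1\<bar> \<partial>?Q \<partial>?P)"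
      by (subst Q.nn_integral_fst[symmetric]) simp_all
    also have "\<dots> = (\<integral>\<^sup>+x. ennreal (L x) * (\<integral>\<^sup>+y. ennreal \<bar>D (x, y) - a1\<bar> \<partial>?Q) \<partial>?P)"
      by (intro nn_integral_cong nn_integral_cmult) measurable
    also have "\<dots> = (\<integral>\<^sup>+x. (\<integral>\<^sup>+y. ennreal \<bar>D (x, y) - a1\<bar> \<partial>?Q) \<partial>density ?P (\<lambda>x. ennreal (L x)))"
      by (rule nn_integral_density[symmetric]) (use Q.borel_measurable_nn_integral_fst[OF h] in auto)
    also have "\<dots> = (\<integral>\<^sup>+z. ennreal \<bar>D z - a1\<bar> \<partial>(density ?P (\<lambda>x. ennreal (L x)) \<Otimes>\<^sub>M ?Q))"
      by (rule Q.nn_integral_fst[OF h'])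
    also have "\<dots> = chi2_risk n D (\<mu>1, \<nu>)"
      by (simp add: chi2_risk_def sample_law_def a1_def PL)
    also have "\<dots> \<le> sup_risk n Q D" unfolding sup_risk_def by (rule SUP_upper[OF Q(2)])
    finally show ?thesis .
  qed
  have "ennreal (\<bar>a0 - a1\<bar> / (8 * exp 1)) \<le> sup_risk n Q D + sup_risk n Q D"
    by (rule order_trans[OF lc add_mono[OF r0 r1]])
  then show ?thesis
  proof (cases "sup_risk n Q D")
    case (real r)
    with \<open>ennreal (\<bar>a0 - a1\<bar> / (8 * exp 1)) \<le> sup_risk n Q D + sup_risk n Q D\<close>
    have "ennreal (\<bar>a0 - a1\<bar> / (8 * exp 1)) \<le> ennreal (r + r)"
      using ennreal_plus[of r r] by simp
    then have "\<bar>a0 - a1\<bar> / (8 * exp 1) \<le> r + r" by (rule ennreal_le_iff[THEN iffD1, rotated]) (use real in simp)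
    moreover have "\<delta> / (16 * exp 1) \<le> \<bar>a0 - a1\<bar> / (16 * exp 1)"
      using \<delta> unfolding a0_def a1_def by (intro divide_right_mono) auto
    ultimately have "\<delta> / (16 * exp 1) \<le> r" by simp
    then show ?thesis using real by (simp add: ennreal_leI)
  qed simp
qed

text \<open>Uniform on the corners \<open>0\<close> and \<open>1 = (1, \<dots>, 1)\<close> of the cube.\<close>
definition corner_law :: "(real^'d) measure" where
  "corner_law = distr (measure_pmf (bernoulli_pmf (1/2))) (restrict_space borel (cbox 0 1)) (\<lambda>b. if b then 0 else 1)"

text \<open>Any single coordinate serves; the product with the corner \<open>1\<close> is \<open>pi\<close>.\<close>
definition wave_freq :: "real^'d" where
  "wave_freq = pi *\<^sub>R axis (SOME i. True) 1"

lemma wave_freq: "wave_freq \<bullet> (0 :: real^'d) = 0" "wave_freq \<bullet> (1 :: real^'d) = pi" "l1norm (wave_freq :: real^'d) = pi"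
proof -
  have "l1norm (axis (SOME i. True) 1 :: real^'d) = 1"
    unfolding l1norm_def axis_def by (simp add: if_distrib sum.delta cong: if_cong)
  then show "l1norm (wave_freq :: real^'d) = pi" unfolding wave_freq_def l1norm_scaleR by simp
  show "wave_freq \<bullet> (1 :: real^'d) = pi" unfolding wave_freq_def by (simp only: inner_scaleR_left inner_axis') simp
qed simp

lemma corner_law_measurable:
  "(\<lambda>b. if b then 0 else 1 :: real^'d) \<in> measurable (measure_pmf (bernoulli_pmf (1/2))) (restrict_space borel (cbox 0 1))"
  by (auto simp: measurable_restrict_space2_iff mem_box_cart)

lemma corner_law: "prob_space (corner_law :: (real^'d) measure)"
  "sets (corner_law :: (real^'d) measure) = sets (restrict_space borel (cbox 0 1))"
proof -
  show "prob_space (corner_law :: (real^'d) measure)"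
    unfolding corner_law_def by (rule prob_space.prob_space_distr[OF _ corner_law_measurable]) (rule prob_space_measure_pmf)
qed (simp add: corner_law_def)

lemma integral_corner_law:
  fixes g :: "real^'d \<Rightarrow> real"
  assumes "g \<in> borel_measurable (restrict_space borel (cbox 0 1))"
  shows "(\<integral>x. g x \<partial>corner_law) = (g 0 + g 1) / 2"
  unfolding corner_law_def by (subst integral_distr[OF corner_law_measurable assms]) simp

definition wave :: "real^'d \<Rightarrow> real" where
  "wave x = cos (wave_freq \<bullet> x)"

lemma wave: "wave (0 :: real^'d) = 1" "wave (1 :: real^'d) = - 1" "\<bar>wave x\<bar> \<le> 1"
  unfolding wave_def wave_freq by (simp_all add: abs_cos_le_one)

lemma wave_measurable [measurable]: "wave \<in> borel_measurable borel"
  unfolding wave_def by (intro borel_measurable_continuous_onI continuous_intros)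

definition tilted_law :: "real \<Rightarrow> (real^'d) measure" where
  "tilted_law \<delta> = density corner_law (\<lambda>x. ennreal (1 + 2 * \<delta> * wave x))"

lemma tilted_law_facts:
  assumes \<delta>: "0 < \<delta>" "\<delta> \<le> 1 / 4"
  shows "prob_space (tilted_law \<delta> :: (real^'d) measure)"
    and "sets (tilted_law \<delta> :: (real^'d) measure) = sets (restrict_space borel (cbox 0 1))"
    and "(tilted_law \<delta> :: (real^'d) measure, corner_law) \<in> chi2_pairs (cbox 0 1)"
    and "(\<lambda>x. 4 * \<delta> * wave x) \<in> chi2_potentials (tilted_law \<delta> :: (real^'d) measure) corner_law"
    and "chi2_div (tilted_law \<delta> :: (real^'d) measure) corner_law = ennreal (4 * \<delta>\<^sup>2)"
proof -
  let ?\<nu> = "corner_law :: (real^'d) measure" and ?\<mu> = "tilted_law \<delta> :: (real^'d) measure"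
  interpret \<nu>: prob_space ?\<nu> by (rule corner_law)
  have wm [measurable]: "(\<lambda>x. wave x) \<in> borel_measurable ?\<nu>"
    by (rule sets_restrict_cube_measurable[OF wave_measurable corner_law(2)])
  have wm': "wave \<in> borel_measurable (restrict_space borel (cbox 0 1 :: (real^'d) set))"
    by (intro measurable_restrict_space1 wave_measurable)
  have nn: "0 \<le> 1 + 2 * \<delta> * wave x" for x :: "real^'d"
  proof -
    have "\<bar>2 * \<delta> * wave x\<bar> \<le> 1 / 2 * 1" unfolding abs_mult using \<delta> wave(3)[of x] by (intro mult_mono) auto
    then show ?thesis by linarith
  qed
  have m1: "(\<lambda>x. 1 + 2 * \<delta> * wave x) \<in> borel_measurable ?\<nu>" by measurable
  have i1: "integrable ?\<nu> (\<lambda>x. 1 + 2 * \<delta> * wave x)"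
  proof (rule \<nu>.integrable_const_bound[of _ 2])
    show "AE x in ?\<nu>. norm (1 + 2 * \<delta> * wave x) \<le> 2"
    proof (rule AE_I2)
      fix x :: "real^'d"
      have "\<bar>2 * \<delta> * wave x\<bar> \<le> 1 / 2 * 1" unfolding abs_mult using \<delta> wave(3)[of x] by (intro mult_mono) auto
      then show "norm (1 + 2 * \<delta> * wave x) \<le> 2" unfolding real_norm_def by linarith
    qed
  qed measurable
  have I1: "(\<integral>x. 1 + 2 * \<delta> * wave x \<partial>?\<nu>) = 1"
    by (subst integral_corner_law) (use wm' in \<open>auto simp: wave\<close>)
  show pm: "prob_space ?\<mu>"
  proof (rule prob_spaceI)
    have "emeasure ?\<mu> (space ?\<mu>) = (\<integral>\<^sup>+x. ennreal (1 + 2 * \<delta> * wave x) \<partial>?\<nu>)"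
      unfolding tilted_law_def by (subst emeasure_density) (auto intro!: nn_integral_cong)
    also have "\<dots> = ennreal (\<integral>x. 1 + 2 * \<delta> * wave x \<partial>?\<nu>)"
      by (rule nn_integral_eq_integral[OF i1]) (use nn in auto)
    finally show "emeasure ?\<mu> (space ?\<mu>) = 1" by (simp add: I1)
  qed
  show sm: "sets ?\<mu> = sets (restrict_space borel (cbox 0 1))" by (simp add: tilted_law_def corner_law(2))
  have ac: "absolutely_continuous ?\<nu> ?\<mu>"
    unfolding tilted_law_def by (rule absolutely_continuousI_density) measurable
  have rn: "AE x in ?\<nu>. ennreal (1 + 2 * \<delta> * wave x) = RN_deriv ?\<nu> ?\<mu> x"
    by (rule \<nu>.RN_deriv_unique) (auto simp: tilted_law_def)
  have rn': "AE x in ?\<nu>. enn2real (RN_deriv ?\<nu> ?\<mu> x) - 1 = 2 * \<delta> * wave x"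
    using rn
  proof eventually_elim
    case (elim x)
    have "enn2real (RN_deriv ?\<nu> ?\<mu> x) = 1 + 2 * \<delta> * wave x"
      unfolding elim[symmetric] using nn by (rule enn2real_ennreal)
    then show ?case by simp
  qed
  show "(\<lambda>x. 4 * \<delta> * wave x) \<in> chi2_potentials ?\<mu> ?\<nu>"
    unfolding chi2_potentials_def
  proof (intro CollectI conjI)
    show "(\<lambda>x. 4 * \<delta> * wave x) \<in> borel_measurable ?\<nu>" by measurable
    show "AE x in ?\<nu>. 4 * \<delta> * wave x = 2 * (enn2real (RN_deriv ?\<nu> ?\<mu> x) - 1)"
      using rn' by eventually_elim simp
  qed
  have i2: "integrable ?\<nu> (\<lambda>x. (2 * \<delta> * wave x)\<^sup>2)"
  proof (rule \<nu>.integrable_const_bound[of _ "1"])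
    show "AE x in ?\<nu>. norm ((2 * \<delta> * wave x)\<^sup>2) \<le> 1"
    proof (rule AE_I2)
      fix x :: "real^'d"
      have "\<bar>2 * \<delta> * wave x\<bar> \<le> 1 * 1" unfolding abs_mult using \<delta> wave(3)[of x] by (intro mult_mono) auto
      then have "\<bar>2 * \<delta> * wave x\<bar>\<^sup>2 \<le> 1\<^sup>2" by (intro power_mono) auto
      then show "norm ((2 * \<delta> * wave x)\<^sup>2) \<le> 1" by simp
    qed
  qed measurable
  have "chi2_div ?\<mu> ?\<nu> = (\<integral>\<^sup>+x. ennreal ((2 * \<delta> * wave x)\<^sup>2) \<partial>?\<nu>)"
    unfolding chi2_div_def using ac rn' by (auto intro!: nn_integral_cong_AE)
  also have "\<dots> = ennreal (\<integral>x. (2 * \<delta> * wave x)\<^sup>2 \<partial>?\<nu>)"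
    by (rule nn_integral_eq_integral[OF i2]) auto
  also have "(\<integral>x. (2 * \<delta> * wave x)\<^sup>2 \<partial>?\<nu>) = 4 * \<delta>\<^sup>2"
    by (subst integral_corner_law) (use wm' in \<open>auto simp: wave power_mult_distrib\<close>)
  finally show c: "chi2_div ?\<mu> ?\<nu> = ennreal (4 * \<delta>\<^sup>2)" .
  show "(?\<mu>, ?\<nu>) \<in> chi2_pairs (cbox 0 1)"
    unfolding chi2_pairs_def borel_prob_measures_def using pm sm ac c corner_law by auto
qed

lemma tilted_law_in_classes:
  assumes \<delta>: "0 < \<delta>" "\<delta> \<le> 1 / 4" "4 * \<delta> * pi ^ 2 \<le> M"
  shows "(tilted_law \<delta> :: (real^'d) measure, corner_law) \<in> chi2_KB_class M (cbox 0 1)"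
    "(tilted_law \<delta> :: (real^'d) measure, corner_law) \<in> chi2_B_class M (cbox 0 1)"
proof -
  note T = tilted_law_facts[OF \<delta>(1,2), where 'd='d]
  have p1: "1 \<le> l1norm (wave_freq :: real^'d)" using pi_ge_two by (simp add: wave_freq)
  have pp: "pi \<le> pi ^ 2" "1 \<le> pi ^ 2" using pi_ge_two self_le_power[of pi 2] one_le_power[of pi 2] by auto
  have chi: "chi2_div (tilted_law \<delta> :: (real^'d) measure) corner_law \<le> ennreal M"
  proof -
    have "4 * \<delta>\<^sup>2 \<le> 4 * \<delta> * 1" using \<delta> by (simp add: power2_eq_square mult_left_le)
    also have "\<dots> \<le> 4 * \<delta> * pi ^ 2" using \<delta>(1) pp(2) by (intro mult_left_mono) auto
    finally show ?thesis unfolding T(5) using \<delta>(3) by (intro ennreal_leI) simp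
  qed
  have "KB_coeff (\<lambda>x :: real^'d. 4 * \<delta> * wave x) (cbox 0 1) \<le> ennreal (4 * \<delta> * pi ^ 2)"
    using cos_coeffs_le(1)[OF _ p1, of "4 * \<delta>"] \<delta>(1) unfolding wave_def[abs_def] wave_freq by simp
  also have "\<dots> \<le> ennreal M" by (rule ennreal_leI[OF \<delta>(3)])
  finally show "(tilted_law \<delta> :: (real^'d) measure, corner_law) \<in> chi2_KB_class M (cbox 0 1)"
    unfolding chi2_KB_class_def using T(3,4) chi by auto
  have "B_coeff (\<lambda>x :: real^'d. 4 * \<delta> * wave x) (cbox 0 1) \<le> ennreal (4 * \<delta> * pi ^ 1)"
    using cos_coeffs_le(2)[OF _ p1, of "4 * \<delta>"] \<delta>(1) unfolding wave_def[abs_def] wave_freq by simp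
  also have "\<dots> \<le> ennreal M"
  proof (rule ennreal_leI)
    have "4 * \<delta> * pi ^ 1 \<le> 4 * \<delta> * pi ^ 2" using \<delta>(1) pp(1) by (intro mult_left_mono) auto
    then show "4 * \<delta> * pi ^ 1 \<le> M" using \<delta>(3) by linarith
  qed
  finally show "(tilted_law \<delta> :: (real^'d) measure, corner_law) \<in> chi2_B_class M (cbox 0 1)"
    unfolding chi2_B_class_def using T(3,4) chi by auto
qed

text \<open>Compare \<open>d0\<close> with \<open>d1 = d0 * (1 + 1 / sqrt n)\<close>. The likelihood ratio of one observation deviates from
  \<open>1\<close> by at most \<open>4 * (d1 - d0) \<le> 1 / (2 * sqrt n)\<close>, while the divergences \<open>4 * d0\<^sup>2\<close> and \<open>4 * d1\<^sup>2\<close> differ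
  by at least \<open>8 * d0\<^sup>2 / sqrt n\<close>.\<close>
lemma minimax_lower_bound:
  fixes Q :: "((real^'d) measure \<times> (real^'d) measure) set"
  assumes Q: "\<And>\<delta>. 0 < \<delta> \<Longrightarrow> \<delta> \<le> 2 * d0 \<Longrightarrow> (tilted_law \<delta>, corner_law) \<in> Q"
    and d0: "0 < d0" "d0 \<le> 1 / 8" and n: "n \<ge> 1"
  shows "ennreal (d0\<^sup>2 / (2 * exp 1) / sqrt (real n)) \<le> (\<Sqinter>D\<in>estimators n (cbox 0 1). sup_risk n Q D)"
proof (rule INF_greatest)
  fix D :: "(nat \<Rightarrow> real^'d) \<times> (nat \<Rightarrow> real^'d) \<Rightarrow> real" assume D: "D \<in> estimators n (cbox 0 1)"
  define d1 where "d1 = d0 * (1 + 1 / sqrt n)"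
  have sn: "sqrt (real n) \<ge> 1" using n by simp
  then have "1 / sqrt n \<le> 1" by simp
  then have d1: "0 < d1" "d1 \<le> 2 * d0" "d0 \<le> d1"
    unfolding d1_def using d0 mult_left_mono[of "1 + 1 / sqrt n" 2 d0] mult_left_mono[of 1 "1 + 1 / sqrt n" d0]
    by (auto intro!: mult_pos_pos add_pos_nonneg)
  have dd: "d1 - d0 = d0 / sqrt n" unfolding d1_def by (simp add: field_simps)
  let ?\<nu> = "corner_law :: (real^'d) measure"
  have q: "d0 \<le> 1 / 4" "d1 \<le> 1 / 4" "d0 \<le> 2 * d0" using d0 d1 by auto
  note T0 = tilted_law_facts[OF d0(1) q(1), where 'd='d] and T1 = tilted_law_facts[OF d1(1) q(2), where 'd='d]
  interpret \<nu>: prob_space ?\<nu> by (rule corner_law)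
  have pos: "1 / 2 \<le> 1 + 2 * d * wave x" if "0 < d" "d \<le> 1 / 4" for d and x :: "real^'d"
  proof -
    have "\<bar>2 * d * wave x\<bar> \<le> 1 / 2 * 1" unfolding abs_mult using that wave(3)[of x] by (intro mult_mono) auto
    then show ?thesis by linarith
  qed
  define l where "l x = (1 + 2 * d1 * wave x) / (1 + 2 * d0 * wave x)" for x :: "real^'d"
  have p0: "0 < 1 + 2 * d0 * wave x" "0 < 1 + 2 * d1 * wave x" for x :: "real^'d"
    using pos[OF d0(1) q(1), of x] pos[OF d1(1) q(2), of x] by linarith+
  have l0: "0 \<le> l x" for x unfolding l_def using p0[of x] by (simp add: less_imp_le)
  have wm [measurable]: "(\<lambda>x. wave x) \<in> borel_measurable ?\<nu>"
    by (rule sets_restrict_cube_measurable[OF wave_measurable corner_law(2)])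
  have wm' [measurable]: "wave \<in> borel_measurable (restrict_space borel (cbox 0 1 :: (real^'d) set))"
    by (intro measurable_restrict_space1 wave_measurable)
  have lm [measurable]: "l \<in> borel_measurable ?\<nu>" unfolding l_def by measurable
  have dens: "tilted_law d1 = density (tilted_law d0) (\<lambda>x. ennreal (l x))"
  proof -
    have "density (tilted_law d0) (\<lambda>x. ennreal (l x)) = density ?\<nu> (\<lambda>x. ennreal (1 + 2 * d0 * wave x) * ennreal (l x))"
      unfolding tilted_law_def by (rule density_density_eq) measurable
    also have "\<dots> = tilted_law d1"
      unfolding tilted_law_def
    proof (rule density_cong)
      show "AE x in ?\<nu>. ennreal (1 + 2 * d0 * wave x) * ennreal (l x) = ennreal (1 + 2 * d1 * wave x)"
      proof (rule AE_I2)
        fix x :: "real^'d"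
        have "(1 + 2 * d0 * wave x) * l x = 1 + 2 * d1 * wave x" unfolding l_def using p0(1)[of x] by simp
        then show "ennreal (1 + 2 * d0 * wave x) * ennreal (l x) = ennreal (1 + 2 * d1 * wave x)"
          using p0(1)[of x] l0[of x] by (simp flip: ennreal_mult add: less_imp_le)
      qed
    qed measurable
    finally show ?thesis by simp
  qed
  interpret \<mu>0: prob_space "tilted_law d0 :: (real^'d) measure" by (rule T0(1))
  have lm0 [measurable]: "l \<in> borel_measurable (tilted_law d0)" unfolding tilted_law_def using lm by simp
  have lm': "l \<in> borel_measurable (restrict_space borel (cbox 0 1))" unfolding l_def by measurable
  have dev: "\<bar>l x - 1\<bar> \<le> 4 * (d1 - d0)" for x
  proof -
    have "l x - 1 = 2 * (d1 - d0) * wave x / (1 + 2 * d0 * wave x)" unfolding l_def using p0(1)[of x] by (simp add: field_simps)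
    then have "\<bar>l x - 1\<bar> = 2 * (d1 - d0) * \<bar>wave x\<bar> / (1 + 2 * d0 * wave x)" using p0(1)[of x] d1 by (simp add: abs_mult)
    also have "\<dots> \<le> 2 * (d1 - d0) * 1 / (1 / 2)"
      using d1 wave(3)[of x] pos[OF d0(1) q(1), of x] by (intro frac_le mult_left_mono) auto
    finally show ?thesis by simp
  qed
  have dev1: "4 * (d1 - d0) \<le> 1"
  proof -
    have "d0 / sqrt n \<le> d0 / 1" using d0 sn by (intro divide_left_mono) auto
    then show ?thesis unfolding dd using d0(2) by linarith
  qed
  have l2: "l x \<le> 2" for x using dev[of x] dev1 by linarith
  have li: "integrable (tilted_law d0) l"
    by (rule \<mu>0.integrable_const_bound[of _ 2]) (use l0 l2 in auto)
  have li2: "integrable (tilted_law d0) (\<lambda>x. (l x - 1)\<^sup>2)"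
  proof (rule \<mu>0.integrable_const_bound[of _ 1])
    have "\<bar>l x - 1\<bar>\<^sup>2 \<le> 1\<^sup>2" for x using dev[of x] dev1 by (intro power_mono) auto
    then show "AE x in tilted_law d0. norm ((l x - 1)\<^sup>2) \<le> 1" by simp
  qed measurable
  have I1: "(\<integral>x. l x \<partial>tilted_law d0) = 1"
  proof -
    have "(\<integral>x. l x \<partial>tilted_law d0) = (\<integral>x. (1 + 2 * d0 * wave x) * l x \<partial>?\<nu>)"
      unfolding tilted_law_def by (rule integral_real_density) (use p0 in \<open>auto simp: less_imp_le\<close>)
    also have "\<dots> = (\<integral>x. 1 + 2 * d1 * wave x \<partial>?\<nu>)"
    proof (rule Bochner_Integration.integral_cong[OF refl])
      show "(1 + 2 * d0 * wave x) * l x = 1 + 2 * d1 * wave x" for x unfolding l_def using p0(1)[of x] by simp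
    qed
    also have "\<dots> = 1" by (subst integral_corner_law) (use wm' in \<open>auto simp: wave\<close>)
    finally show ?thesis .
  qed
  have sq: "(l x)\<^sup>2 = (l x - 1)\<^sup>2 + (2 * l x - 1)" for x by (simp add: power2_eq_square algebra_simps)
  have I2: "(\<integral>x. (l x)\<^sup>2 \<partial>tilted_law d0) \<le> 1 + 1 / n"
  proof -
    have "(\<integral>x. (l x)\<^sup>2 \<partial>tilted_law d0) = (\<integral>x. (l x - 1)\<^sup>2 \<partial>tilted_law d0) + 1"
      unfolding sq using li li2 I1 by (simp add: \<mu>0.prob_space)
    also have "(\<integral>x. (l x - 1)\<^sup>2 \<partial>tilted_law d0) \<le> (\<integral>x. 1 / n \<partial>(tilted_law d0 :: (real^'d) measure))"
    proof (rule integral_mono[OF li2])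
      fix x
      have "\<bar>l x - 1\<bar> \<le> 1 * (1 / sqrt n)"
      proof -
        have "4 * d0 / sqrt n \<le> 1 / sqrt n" using d0 sn by (intro divide_right_mono) auto
        then show ?thesis using dev[of x] unfolding dd by simp
      qed
      then have "\<bar>l x - 1\<bar>\<^sup>2 \<le> (1 / sqrt n)\<^sup>2" by (intro power_mono) auto
      then show "(l x - 1)\<^sup>2 \<le> 1 / n" by (simp add: power_divide)
    qed simp
    finally show ?thesis by (simp add: \<mu>0.prob_space)
  qed
  have I2i: "integrable (tilted_law d0) (\<lambda>x. (l x)\<^sup>2)" unfolding sq using li li2 by simp
  have gap: "8 * d0\<^sup>2 / sqrt n \<le> \<bar>enn2real (chi2_div (tilted_law d0) ?\<nu>) - enn2real (chi2_div (tilted_law d1) ?\<nu>)\<bar>"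
  proof -
    have "8 * d0\<^sup>2 / sqrt n = 4 * (d0 + d0) * (d1 - d0)" unfolding dd by (simp add: power2_eq_square)
    also have "\<dots> \<le> 4 * (d1 + d0) * (d1 - d0)" using d1 by (intro mult_right_mono mult_left_mono) auto
    also have "\<dots> = 4 * d1\<^sup>2 - 4 * d0\<^sup>2" by (simp add: power2_eq_square algebra_simps)
    also have "\<dots> \<le> \<bar>4 * d0\<^sup>2 - 4 * d1\<^sup>2\<bar>" by linarith
    finally show ?thesis unfolding T0(5) T1(5) by simp
  qed
  have "ennreal (8 * d0\<^sup>2 / sqrt n / (16 * exp 1)) \<le> sup_risk n Q D"
    by (rule sup_risk_lower_bound[OF Q[OF d0(1) q(3)] Q[OF d1(1,2)] D n corner_law T0(1,2) T1(1) dens lm0 l0 li I1 I2i I2 gap])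
  moreover have "8 * d0\<^sup>2 / sqrt n / (16 * exp 1) = d0\<^sup>2 / (2 * exp 1) / sqrt (real n)" by simp
  ultimately show "ennreal (d0\<^sup>2 / (2 * exp 1) / sqrt (real n)) \<le> sup_risk n Q D"
    by (simp only:)
qed

section \<open>Rates\<close>

lemma le_four_times: "0 \<le> x \<Longrightarrow> x \<le> 4 * (x :: real)"
  by simp

text \<open>The network that approximates the potential has parameters bounded by \<open>M\<close> and so belongs to every
  class with \<open>a \<ge> M\<close>; a larger \<open>a\<close> affects only the deviation term. The bound therefore serves both
  the choice \<open>a = M\<close> and the choice \<open>a = ln n\<close>.\<close>
lemma sup_risk_le_KB:
  fixes n :: nat
  assumes M: "M > 0" and a: "M \<le> a" and n: "n \<ge> 1"
  shows "sup_risk n (chi2_KB_class M (cbox 0 1) :: ((real^'d) measure \<times> (real^'d) measure) set) (chi2_estimator (relu_nets n a) n)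
    \<le> ennreal ((76 + 128 * M\<^sup>2 + (32 * a + 16 * a\<^sup>2) * wedge_const TYPE('d)) / sqrt (real n))"
  unfolding sup_risk_def
proof (rule SUP_least)
  fix p :: "(real^'d) measure \<times> (real^'d) measure" assume p: "p \<in> chi2_KB_class M (cbox 0 1)"
  obtain \<mu> \<nu> where pe: "p = (\<mu>, \<nu>)" by fastforce
  obtain f where pr: "(\<mu>, \<nu>) \<in> chi2_pairs (cbox 0 1)" and f: "f \<in> chi2_potentials \<mu> \<nu>" and KB: "KB_coeff f (cbox 0 1) \<le> ennreal M"
    using p unfolding chi2_KB_class_def pe by auto
  have \<nu>: "prob_space \<nu>" "sets \<nu> = sets (restrict_space borel (cbox 0 1))"
    using pr unfolding chi2_pairs_def borel_prob_measures_def by auto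
  note ap = relu_approximation[OF M KB \<nu> n]
  obtain g where g: "g \<in> relu_nets n M" "(\<integral>x. (f x - g x)\<^sup>2 \<partial>\<nu>) \<le> (76 + 128 * M\<^sup>2) / n" using ap(3) by blast
  have a0: "0 \<le> a" using M a by simp
  have sn: "sqrt (real n) \<le> real n"
  proof -
    have "sqrt (real n) * 1 \<le> sqrt (real n) * sqrt (real n)" using n by (intro mult_left_mono) auto
    then show ?thesis by simp
  qed
  have "(76 + 128 * M\<^sup>2) / n \<le> (76 + 128 * M\<^sup>2) / sqrt n" using sn n by (intro divide_left_mono) auto
  also have "\<dots> \<le> 4 * ((76 + 128 * M\<^sup>2) / sqrt n)" by (rule le_four_times) simp
  finally have ge: "(\<integral>x. (f x - g x)\<^sup>2 \<partial>\<nu>) \<le> 4 * ((76 + 128 * M\<^sup>2) / sqrt n)" using g(2) by (rule order_trans[rotated])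
  have "chi2_risk n (chi2_estimator (relu_nets n a) n) (\<mu>, \<nu>)
    \<le> ennreal ((76 + 128 * M\<^sup>2) / sqrt n + (8 * (4 * a) + (4 * a)\<^sup>2) * wedge_const TYPE('d) / sqrt n)"
    by (rule chi2_risk_le[OF pr f ap(2) n ridge_mixture_nets[OF a0 n] _ ge]) (use g(1) nets_mono(1)[OF a, of n] in auto)
  also have "(76 + 128 * M\<^sup>2) / sqrt n + (8 * (4 * a) + (4 * a)\<^sup>2) * wedge_const TYPE('d) / sqrt n
     = (76 + 128 * M\<^sup>2 + (32 * a + 16 * a\<^sup>2) * wedge_const TYPE('d)) / sqrt (real n)"
    by (simp add: add_divide_distrib power_mult_distrib)
  finally show "chi2_risk n (chi2_estimator (relu_nets n a) n) p
    \<le> ennreal ((76 + 128 * M\<^sup>2 + (32 * a + 16 * a\<^sup>2) * wedge_const TYPE('d)) / sqrt (real n))" unfolding pe .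
qed

text \<open>As for the ReLU class. For \<open>n = 1\<close> the sigmoids are constant, and the zero network together with
  the bound \<open>M\<close> on the divergence takes the place of the approximation.\<close>
lemma sup_risk_le_B:
  fixes n :: nat
  assumes M: "M > 0" and a: "M \<le> a" and n: "n \<ge> 1"
  shows "sup_risk n (chi2_B_class M (cbox 0 1) :: ((real^'d) measure \<times> (real^'d) measure) set) (chi2_estimator (sigmoid_nets n a) n)
    \<le> ennreal ((18 + M + 48 * M\<^sup>2 + 108 * M\<^sup>2 / ln 2 + (32 * a + 16 * a\<^sup>2) * wedge_const TYPE('d)) / sqrt (real n))"
  unfolding sup_risk_def
proof (rule SUP_least)
  fix p :: "(real^'d) measure \<times> (real^'d) measure" assume p: "p \<in> chi2_B_class M (cbox 0 1)"
  obtain \<mu> \<nu> where pe: "p = (\<mu>, \<nu>)" by fastforce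
  obtain f where pr: "(\<mu>, \<nu>) \<in> chi2_pairs (cbox 0 1)" and f: "f \<in> chi2_potentials \<mu> \<nu>" and B: "B_coeff f (cbox 0 1) \<le> ennreal M"
    and ch: "chi2_div \<mu> \<nu> \<le> ennreal M"
    using p unfolding chi2_B_class_def pe by auto
  have \<nu>: "prob_space \<nu>" "sets \<nu> = sets (restrict_space borel (cbox 0 1))"
    using pr unfolding chi2_pairs_def borel_prob_measures_def by auto
  have a0: "0 \<le> a" using M a by simp
  define E where "E = 18 + M + 48 * M\<^sup>2 + 108 * M\<^sup>2 / ln 2"
  have l2: "ln (2::real) > 0" by simp
  have fb: "\<bar>f x\<bar> \<le> 2 * (M + 1)" if "x \<in> cbox 0 1" for x
    using sigmoid_approximation(2)[OF M B \<nu>, of 2 x] that by simp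
  have "\<exists>g\<in>sigmoid_nets n a. (\<integral>x. (f x - g x)\<^sup>2 \<partial>\<nu>) \<le> 4 * (E / sqrt n)"
  proof (cases "n \<ge> 2")
    case True
    obtain g where g: "g \<in> sigmoid_nets n M" "(\<integral>x. (f x - g x)\<^sup>2 \<partial>\<nu>) \<le> (18 + 48 * M\<^sup>2) / n + 108 * M\<^sup>2 / (sqrt n * ln n)"
      using sigmoid_approximation(3)[OF M B \<nu> True] by blast
    have sn: "sqrt (real n) \<le> real n"
    proof -
      have "sqrt (real n) * 1 \<le> sqrt (real n) * sqrt (real n)" using n by (intro mult_left_mono) auto
      then show ?thesis by simp
    qed
    have "(18 + 48 * M\<^sup>2) / n \<le> (18 + 48 * M\<^sup>2) / sqrt n" using sn n by (intro divide_left_mono) auto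
    moreover have "108 * M\<^sup>2 / (sqrt n * ln n) \<le> 108 * M\<^sup>2 / (sqrt n * ln 2)"
      using True l2 by (intro divide_left_mono mult_left_mono mult_pos_pos) auto
    ultimately have "(18 + 48 * M\<^sup>2) / n + 108 * M\<^sup>2 / (sqrt n * ln n) \<le> (18 + 48 * M\<^sup>2) / sqrt n + 108 * M\<^sup>2 / (sqrt n * ln 2)" by (rule add_mono)
    also have "\<dots> = (18 + 48 * M\<^sup>2 + 108 * M\<^sup>2 / ln 2) / sqrt n" by (simp add: add_divide_distrib mult.commute)
    also have "\<dots> \<le> E / sqrt n" unfolding E_def using M by (intro divide_right_mono) auto
    also have "\<dots> \<le> 4 * (E / sqrt n)"
      by (rule le_four_times) (use M l2 in \<open>simp add: E_def\<close>)
    finally have "(\<integral>x. (f x - g x)\<^sup>2 \<partial>\<nu>) \<le> 4 * (E / sqrt n)" using g(2) by (rule order_trans[rotated])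
    then show ?thesis using g(1) nets_mono(2)[OF a, of n] by auto
  next
    case False
    then have n1: "n = 1" using n by simp
    have "1 / 4 * (\<integral>x. (f x)\<^sup>2 \<partial>\<nu>) = enn2real (chi2_div \<mu> \<nu>)"
      using chi2_variational(2)[OF pr f fb, of "\<lambda>_. 0" 0] by simp
    also have "\<dots> \<le> M" using ch M by (intro enn2real_leI) auto
    also have "\<dots> \<le> E" unfolding E_def using M l2 by simp
    finally have "(\<integral>x. (f x)\<^sup>2 \<partial>\<nu>) \<le> 4 * E" by simp
    then show ?thesis using zero_in_nets(2)[OF a0 n] by (intro bexI[of _ "\<lambda>_. 0"]) (simp_all add: n1)
  qed
  then obtain g where g: "g \<in> sigmoid_nets n a" "(\<integral>x. (f x - g x)\<^sup>2 \<partial>\<nu>) \<le> 4 * (E / sqrt n)" by blast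
  have "chi2_risk n (chi2_estimator (sigmoid_nets n a) n) (\<mu>, \<nu>)
    \<le> ennreal (E / sqrt n + (8 * (4 * a) + (4 * a)\<^sup>2) * wedge_const TYPE('d) / sqrt n)"
    by (rule chi2_risk_le[OF pr f fb n ridge_mixture_nets[OF a0 n] g]) auto
  also have "E / sqrt n + (8 * (4 * a) + (4 * a)\<^sup>2) * wedge_const TYPE('d) / sqrt n
     = (E + (32 * a + 16 * a\<^sup>2) * wedge_const TYPE('d)) / sqrt (real n)"
    by (simp add: add_divide_distrib power_mult_distrib)
  finally show "chi2_risk n (chi2_estimator (sigmoid_nets n a) n) p
    \<le> ennreal ((18 + M + 48 * M\<^sup>2 + 108 * M\<^sup>2 / ln 2 + (32 * a + 16 * a\<^sup>2) * wedge_const TYPE('d)) / sqrt (real n))"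
    unfolding pe E_def .
qed

text \<open>As soon as \<open>ln n\<close> exceeds \<open>M\<close>, the risk bound applies with \<open>a = ln n\<close>, and it is quadratic in \<open>a\<close>.\<close>
lemma adaptive_risk_rate:
  fixes R :: "nat \<Rightarrow> real \<Rightarrow> ennreal" and M E W :: real
  assumes R: "\<And>n a. M \<le> a \<Longrightarrow> n \<ge> 1 \<Longrightarrow> R n a \<le> ennreal ((E + (32 * a + 16 * a\<^sup>2) * W) / sqrt (real n))"
    and E: "E \<ge> 0" and W: "W \<ge> 0"
  shows "\<exists>(p::nat) K. \<forall>\<^sub>F n in sequentially. R n (ln (real n)) \<le> ennreal (K * ln (real n) ^ p / sqrt (real n))"
proof (rule exI[of _ 2], rule exI[of _ "E + 48 * W"])
  have "filterlim (\<lambda>n. ln (real n)) at_top sequentially" by real_asymp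
  then have "\<forall>\<^sub>F n in sequentially. max M 1 \<le> ln (real n)" unfolding filterlim_at_top by (rule spec)
  then show "\<forall>\<^sub>F n in sequentially. R n (ln (real n)) \<le> ennreal ((E + 48 * W) * ln (real n) ^ 2 / sqrt (real n))"
    using eventually_ge_at_top[of 1]
  proof eventually_elim
    case (elim n)
    define a where "a = ln (real n)"
    have a: "M \<le> a" "1 \<le> a" using elim by (auto simp: a_def)
    have a2: "1 \<le> a\<^sup>2" "a \<le> a\<^sup>2" using a(2) one_le_power[of a 2] self_le_power[of a 2] by auto
    have "E * 1 \<le> E * a\<^sup>2" using E a2 by (intro mult_left_mono) auto
    moreover have "(32 * a + 16 * a\<^sup>2) * W \<le> (32 * a\<^sup>2 + 16 * a\<^sup>2) * W" using W a2 by (intro mult_right_mono add_mono) auto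
    ultimately have "E + (32 * a + 16 * a\<^sup>2) * W \<le> (E + 48 * W) * a\<^sup>2" by (simp add: algebra_simps)
    then have "(E + (32 * a + 16 * a\<^sup>2) * W) / sqrt (real n) \<le> (E + 48 * W) * a\<^sup>2 / sqrt (real n)" by (intro divide_right_mono) auto
    then show ?case using order_trans[OF R[OF a(1) elim(2)] ennreal_leI] unfolding a_def by blast
  qed
qed

theorem corollary24:
  fixes X :: "(real^'d) set" and M :: real
  assumes X: "X = cbox 0 1"
    and M: "M > 0"
  shows "\<exists>c C. 0 < c \<and> c \<le> C \<and>
    (\<forall>(Q, G) \<in> {(chi2_KB_class M X, relu_nets), (chi2_B_class M X, sigmoid_nets)}.
       (\<forall>n\<ge>1. chi2_estimator (G n M) n \<in> estimators n X \<and>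
          sup_risk n Q (chi2_estimator (G n M) n) \<le> ennreal (C / sqrt (real n))) \<and>
       (\<forall>\<^sub>F n in sequentially.
          ennreal (c / sqrt (real n)) \<le> (\<Sqinter>D\<in>estimators n X. sup_risk n Q D)) \<and>
       (\<forall>n\<ge>1. chi2_estimator (G n (ln (real n))) n \<in> estimators n X) \<and>
       (\<exists>(p::nat) K. \<forall>\<^sub>F n in sequentially.
          sup_risk n Q (chi2_estimator (G n (ln (real n))) n)
            \<le> ennreal (K * ln (real n) ^ p / sqrt (real n))))"
proof -
  define W where "W = wedge_const TYPE('d)"
  have W: "W > 0" unfolding W_def by (rule wedge_const_pos)
  \<comment> \<open>for all \<open>\<delta>\<close> up to \<open>2 * d0\<close> the density is at least \<open>1/2\<close> and both coefficients are at most \<open>M\<close>\<close>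
  define d0 where "d0 = min (1 / 8) (M / (8 * pi\<^sup>2))"
  have d0: "0 < d0" "d0 \<le> 1 / 8" using M by (auto simp: d0_def)
  have dM: "4 * \<delta> * pi ^ 2 \<le> M" "\<delta> \<le> 1 / 4" if "\<delta> \<le> 2 * d0" for \<delta>
  proof -
    have "d0 \<le> M / (8 * pi\<^sup>2)" by (simp add: d0_def)
    then have "d0 * (8 * pi\<^sup>2) \<le> M" by (subst (asm) pos_le_divide_eq) auto
    moreover have "4 * \<delta> * pi\<^sup>2 \<le> 4 * (2 * d0) * pi\<^sup>2" using that by (intro mult_right_mono mult_left_mono) auto
    moreover have "4 * (2 * d0) * pi\<^sup>2 = d0 * (8 * pi\<^sup>2)" by simp
    ultimately show "4 * \<delta> * pi ^ 2 \<le> M" by linarith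
    show "\<delta> \<le> 1 / 4" using that d0 by linarith
  qed
  define c where "c = d0\<^sup>2 / (2 * exp 1)"
  have c: "0 < c" unfolding c_def using d0 by simp
  define E where "E = 76 + M + 128 * M\<^sup>2 + 108 * M\<^sup>2 / ln 2"
  have l2: "ln (2::real) > 0" by simp
  have E: "E \<ge> 76" unfolding E_def using M l2 by (simp add: add_nonneg_nonneg)
  have rKB: "sup_risk n (chi2_KB_class M X) (chi2_estimator (relu_nets n a) n) \<le> ennreal ((E + (32 * a + 16 * a\<^sup>2) * W) / sqrt (real n))"
    if "M \<le> a" "n \<ge> 1" for a n
    using sup_risk_le_KB[OF M that, where 'd='d] unfolding X W_def[symmetric]
  proof (rule order_trans, intro ennreal_leI divide_right_mono add_mono)
    show "76 + 128 * M\<^sup>2 \<le> E" unfolding E_def using M l2 by simp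
  qed auto
  have rB: "sup_risk n (chi2_B_class M X) (chi2_estimator (sigmoid_nets n a) n) \<le> ennreal ((E + (32 * a + 16 * a\<^sup>2) * W) / sqrt (real n))"
    if "M \<le> a" "n \<ge> 1" for a n
    using sup_risk_le_B[OF M that, where 'd='d] unfolding X W_def[symmetric]
  proof (rule order_trans, intro ennreal_leI divide_right_mono add_mono)
    show "18 + M + 48 * M\<^sup>2 + 108 * M\<^sup>2 / ln 2 \<le> E" unfolding E_def by simp
  qed auto
  define C where "C = c + E + (32 * M + 16 * M\<^sup>2) * W"
  have C: "c \<le> C" unfolding C_def using E W M by (simp add: add_nonneg_nonneg)
  have up: "ennreal ((E + (32 * M + 16 * M\<^sup>2) * W) / sqrt (real n)) \<le> ennreal (C / sqrt (real n))" for n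
    unfolding C_def using c by (intro ennreal_leI divide_right_mono) auto
  have low: "\<forall>\<^sub>F n in sequentially. ennreal (c / sqrt (real n)) \<le> (\<Sqinter>D\<in>estimators n X. sup_risk n Q D)"
    if "\<And>\<delta>. 0 < \<delta> \<Longrightarrow> \<delta> \<le> 2 * d0 \<Longrightarrow> (tilted_law \<delta>, corner_law) \<in> Q" for Q :: "((real^'d) measure \<times> (real^'d) measure) set"
    using eventually_ge_at_top[of 1]
    by eventually_elim (use minimax_lower_bound[OF that d0] in \<open>simp add: c_def X\<close>)
  have lowKB: "\<forall>\<^sub>F n in sequentially. ennreal (c / sqrt (real n)) \<le> (\<Sqinter>D\<in>estimators n X. sup_risk n (chi2_KB_class M X) D)"
    by (rule low) (use tilted_law_in_classes(1) dM in \<open>auto simp: X\<close>)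
  have lowB: "\<forall>\<^sub>F n in sequentially. ennreal (c / sqrt (real n)) \<le> (\<Sqinter>D\<in>estimators n X. sup_risk n (chi2_B_class M X) D)"
    by (rule low) (use tilted_law_in_classes(2) dM in \<open>auto simp: X\<close>)
  have est: "chi2_estimator (relu_nets n a) n \<in> estimators n X" "chi2_estimator (sigmoid_nets n a) n \<in> estimators n X"
    if "a \<ge> 0" "n \<ge> 1" for n a
    unfolding X using chi2_estimator_nets_measurable[OF that] by auto
  have adKB: "\<exists>(p::nat) K. \<forall>\<^sub>F n in sequentially.
          sup_risk n (chi2_KB_class M X) (chi2_estimator (relu_nets n (ln (real n))) n) \<le> ennreal (K * ln (real n) ^ p / sqrt (real n))"
    using E W by (intro adaptive_risk_rate[OF rKB]) auto
  have adB: "\<exists>(p::nat) K. \<forall>\<^sub>F n in sequentially.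
          sup_risk n (chi2_B_class M X) (chi2_estimator (sigmoid_nets n (ln (real n))) n) \<le> ennreal (K * ln (real n) ^ p / sqrt (real n))"
    using E W by (intro adaptive_risk_rate[OF rB]) auto
  show ?thesis
  proof (rule exI[of _ c], rule exI[of _ C], intro conjI ballI, goal_cases)
    case (3 QG)
    then consider "QG = (chi2_KB_class M X, relu_nets)" | "QG = (chi2_B_class M X, sigmoid_nets)" by auto
    then show ?case
    proof cases
      case 1
      show ?thesis
        unfolding 1 prod.case
        using est(1) M order_trans[OF rKB[OF order_refl] up] lowKB adKB by auto
    next
      case 2
      show ?thesis
        unfolding 2 prod.case
        using est(2) M order_trans[OF rB[OF order_refl] up] lowB adB by auto
    qed
  qed (use c C in auto)
qed

end
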